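(* Let $n \geq 5$ and let $L$ be a principal ideal domain without $2$-torsion. Then there is an isomorphism of $L$-modules $$H^1(\mathrm{Aut}\,F_n, V_L) \cong L^{\oplus 2},$$ where $V_L = V \otimes_{\mathbf{Z}} L$ and $V = \mathrm{IA}_n^{\mathrm{ab}} \cong H^* \otimes_{\mathbf{Z}} \Lambda^2 H$ is the abelianization of the IA-automorphism group of $F_n$.
   Context: $F_n$ is the free group of rank $n$ with basis $x_1,\dots,x_n$; $\mathrm{Aut}\,F_n$ is its automorphism group, acting on $F_n$ from the right, written $x^{\sigma}$, so $x^{\sigma\tau} = (x^{\sigma})^{\tau}$. $H$ is the abelianization of $F_n$, with basis $e_1,\dots,e_n$ induced from $x_1,\dots,x_n$, and $H^* = \mathrm{Hom}_{\mathbf{Z}}(H,\mathbf{Z})$ with dual basis $e_1^*,\dots,e_n^*$. $H$ is a left $\mathrm{Aut}\,F_n$-module via $\sigma\cdot [x] := [x^{\sigma^{-1}}]$ for $x \in F_n$, where $[x]$ is the class of $x$ in $H$; $H^*$ carries the dual action, and $H^*\otimes_{\mathbf{Z}}\Lambda^2 H$ the induced diagonal action. $\mathrm{IA}_n$ is the kernel of the natural homomorphism $\mathrm{Aut}\,F_n \to \mathrm{Aut}\,H = \mathrm{GL}(n,\mathbf{Z})$. $V := \mathrm{IA}_n^{\mathrm{ab}}$ is identified, as a $\mathrm{GL}(n,\mathbf{Z})$-module (known result), with $H^*\otimes_{\mathbf{Z}}\Lambda^2 H$ via the homomorphism induced by the first Johnson homomorphism $\tau_1:\mathrm{IA}_n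 \to \mathrm{Hom}_{\mathbf{Z}}(H,\Lambda^2 H) = H^*\otimes_{\mathbf{Z}}\Lambda^2 H$, $\sigma \mapsto ([x] \mapsto x^{-1}x^{\sigma})$. Here $x^{-1}x^\sigma$ lies in the commutator subgroup $[F_n,F_n]$, and its class in $[F_n,F_n]/[F_n,[F_n,F_n]] \cong \Lambda^2 H$ is taken, the class of $[x,y]=xyx^{-1}y^{-1}$ corresponding to $[x]\wedge[y]$. For a commutative ring $L$, $V_L := V\otimes_{\mathbf{Z}} L$, where $L$ is regarded as a trivial $\mathrm{Aut}\,F_n$-module. "Without $2$-torsion" means that $2a=0$ with $a \in L$ implies $a=0$. *)

theory Defs
  imports "HOL-Algebra.Algebra"
begin

section \<open>Free groups\<close>

text \<open>
  A letter is a generator together with a sign: \<open>(x, True)\<close> stands for \<open>x\<close> and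
  \<open>(x, False)\<close> for its inverse. The elements of the free group are the reduced words.
\<close>

type_synonym 'g word = "('g \<times> bool) list"

definition inv_letter :: "'g \<times> bool \<Rightarrow> 'g \<times> bool"
  where "inv_letter l = (fst l, \<not> snd l)"

definition reduced :: "'g word \<Rightarrow> bool"
  where "reduced w \<longleftrightarrow> (\<forall>i. Suc i < length w \<longrightarrow> w ! Suc i \<noteq> inv_letter (w ! i))"

fun cons_letter :: "'g \<times> bool \<Rightarrow> 'g word \<Rightarrow> 'g word" where
  "cons_letter l [] = [l]"
| "cons_letter l (m # w) = (if m = inv_letter l then w else l # m # w)"

definition free_group :: "'g set \<Rightarrow> 'g word monoid"
  where "free_group S =
    \<lparr>carrier = {w. reduced w \<and> set w \<subseteq> S \<times> UNIV},
     monoid.mult = foldr cons_letter,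
     one = []\<rparr>"


section \<open>Automorphisms, abelianization and the IA-automorphism group\<close>

text \<open>
  Automorphisms act from the right: the product of \<open>\<sigma>\<close> and \<open>\<tau>\<close> applies \<open>\<sigma>\<close> first,
  whereas the product in \<^const>\<open>AutoGroup\<close> is composition of functions.
\<close>

definition aut_group :: "('a, 'b) monoid_scheme \<Rightarrow> ('a \<Rightarrow> 'a) monoid"
  where "aut_group G =
    \<lparr>carrier = auto G,
     monoid.mult = (\<lambda>\<sigma> \<tau>. \<tau> \<otimes>\<^bsub>AutoGroup G\<^esub> \<sigma>),
     one = \<one>\<^bsub>AutoGroup G\<^esub>\<rparr>"

definition abelianization :: "('a, 'b) monoid_scheme \<Rightarrow> 'a set monoid"
  where "abelianization G = G Mod (derived G (carrier G))"

definition aut_abelianization :: "('a, 'b) monoid_scheme \<Rightarrow> ('a \<Rightarrow> 'a) \<Rightarrow> 'a set \<Rightarrow> 'a set"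
  where "aut_abelianization G \<sigma> = (\<lambda>C\<in>carrier (abelianization G). \<sigma> ` C)"

abbreviation free_group_n :: "nat \<Rightarrow> nat word monoid"
  where "free_group_n n \<equiv> free_group {..<n}"

abbreviation Aut_F :: "nat \<Rightarrow> (nat word \<Rightarrow> nat word) monoid"
  where "Aut_F n \<equiv> aut_group (free_group_n n)"

definition IA :: "nat \<Rightarrow> (nat word \<Rightarrow> nat word) monoid"
  where "IA n = (Aut_F n)
    \<lparr>carrier := kernel (Aut_F n) (aut_group (abelianization (free_group_n n)))
        (aut_abelianization (free_group_n n))\<rparr>"

definition IA_ab :: "nat \<Rightarrow> (nat word \<Rightarrow> nat word) set monoid"
  where "IA_ab n = abelianization (IA n)"

text \<open>
  The left action of \<open>Aut F\<^sub>n\<close> on \<open>IA\<^sub>n\<^sup>a\<^sup>b\<close> is induced by conjugation, \<open>\<sigma> \<cdot> [\<phi>] = [\<sigma> \<phi> \<sigma>\<^sup>-\<^sup>1]\<close>.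
  With products as above, the first Johnson homomorphism carries it to the diagonal action on
  \<open>H\<^sup>* \<otimes> \<Lambda>\<^sup>2 H\<close>, where \<open>\<sigma>\<close> acts on \<open>H\<close> by \<open>\<sigma> \<cdot> [x] = [\<sigma>\<^sup>-\<^sup>1 x]\<close>.
\<close>

definition IA_ab_action ::
    "nat \<Rightarrow> (nat word \<Rightarrow> nat word) \<Rightarrow> (nat word \<Rightarrow> nat word) set \<Rightarrow> (nat word \<Rightarrow> nat word) set"
  where "IA_ab_action n \<sigma> C = (\<lambda>\<phi>. \<sigma> \<otimes>\<^bsub>Aut_F n\<^esub> \<phi> \<otimes>\<^bsub>Aut_F n\<^esub> inv\<^bsub>Aut_F n\<^esub> \<sigma>) ` C"


section \<open>Extension of scalars\<close>

text \<open>
  For an abelian group \<open>A\<close>, written multiplicatively, and a commutative ring \<open>L\<close>, the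
  \<open>L\<close>-module \<open>A \<otimes>\<^sub>\<int> L\<close> is the free abelian group on \<open>A \<times> L\<close> modulo the bilinearity relations.
  In this and all later module records, the ring multiplication and unit are junk fields.
\<close>

definition tensor_relations ::
    "('a, 'b) monoid_scheme \<Rightarrow> ('l, 'm) ring_scheme \<Rightarrow> ('a \<times> 'l \<Rightarrow>\<^sub>0 int) set"
  where "tensor_relations A L =
    generate (free_Abelian_group (carrier A \<times> carrier L))
      ({frag_of (x \<otimes>\<^bsub>A\<^esub> y, a) - frag_of (x, a) - frag_of (y, a) | x y a.
          x \<in> carrier A \<and> y \<in> carrier A \<and> a \<in> carrier L} \<union>
       {frag_of (x, a \<oplus>\<^bsub>L\<^esub> b) - frag_of (x, a) - frag_of (x, b) | x a b.
          x \<in> carrier A \<and> a \<in> carrier L \<and> b \<in> carrier L})"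

definition tensor_group ::
    "('a, 'b) monoid_scheme \<Rightarrow> ('l, 'm) ring_scheme \<Rightarrow> ('a \<times> 'l \<Rightarrow>\<^sub>0 int) set monoid"
  where "tensor_group A L =
    free_Abelian_group (carrier A \<times> carrier L) Mod tensor_relations A L"

text \<open>
  The map on \<open>A \<otimes> L\<close> induced by a map \<open>f\<close> of \<open>A \<times> L\<close> whose linear extension preserves the
  relations: the linear extension sends a coset into, but not necessarily onto, a coset.
\<close>

definition tensor_map ::
    "('a, 'b) monoid_scheme \<Rightarrow> ('l, 'm) ring_scheme \<Rightarrow> ('a \<times> 'l \<Rightarrow> 'a \<times> 'l)
      \<Rightarrow> ('a \<times> 'l \<Rightarrow>\<^sub>0 int) set \<Rightarrow> ('a \<times> 'l \<Rightarrow>\<^sub>0 int) set"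
  where "tensor_map A L f C =
    tensor_relations A L
      <#>\<^bsub>free_Abelian_group (carrier A \<times> carrier L)\<^esub> (frag_extend (frag_of \<circ> f) ` C)"

definition tensor ::
    "('a, 'b) monoid_scheme \<Rightarrow> ('l, 'm) ring_scheme \<Rightarrow> ('l, ('a \<times> 'l \<Rightarrow>\<^sub>0 int) set) module"
  where "tensor A L =
    \<lparr>carrier = carrier (tensor_group A L),
     monoid.mult = undefined,
     one = undefined,
     ring.zero = \<one>\<^bsub>tensor_group A L\<^esub>,
     ring.add = monoid.mult (tensor_group A L),
     smult = (\<lambda>c. tensor_map A L (\<lambda>(x, a). (x, c \<otimes>\<^bsub>L\<^esub> a)))\<rparr>"

definition tensor_action ::
    "('a, 'b) monoid_scheme \<Rightarrow> ('l, 'm) ring_scheme \<Rightarrow> ('s \<Rightarrow> 'a \<Rightarrow> 'a)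
      \<Rightarrow> 's \<Rightarrow> ('a \<times> 'l \<Rightarrow>\<^sub>0 int) set \<Rightarrow> ('a \<times> 'l \<Rightarrow>\<^sub>0 int) set"
  where "tensor_action A L act \<sigma> = tensor_map A L (\<lambda>(x, a). (act \<sigma> x, a))"


section \<open>Modules\<close>

definition quotient_module :: "('l, 'a) module \<Rightarrow> 'a set \<Rightarrow> ('l, 'a set) module"
  where "quotient_module M N =
    \<lparr>carrier = a_rcosets\<^bsub>M\<^esub> N,
     monoid.mult = undefined,
     one = undefined,
     ring.zero = N,
     ring.add = set_add M,
     smult = (\<lambda>c C. N <+>\<^bsub>M\<^esub> ((\<lambda>x. c \<odot>\<^bsub>M\<^esub> x) ` C))\<rparr>"

definition square_module :: "('l, 'm) ring_scheme \<Rightarrow> ('l, 'l \<times> 'l) module"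
  where "square_module L =
    \<lparr>carrier = carrier L \<times> carrier L,
     monoid.mult = undefined,
     one = undefined,
     ring.zero = (\<zero>\<^bsub>L\<^esub>, \<zero>\<^bsub>L\<^esub>),
     ring.add = (\<lambda>(a, b) (c, d). (a \<oplus>\<^bsub>L\<^esub> c, b \<oplus>\<^bsub>L\<^esub> d)),
     smult = (\<lambda>r (a, b). (r \<otimes>\<^bsub>L\<^esub> a, r \<otimes>\<^bsub>L\<^esub> b))\<rparr>"

definition module_iso ::
    "('l, 'm) ring_scheme \<Rightarrow> ('l, 'a) module \<Rightarrow> ('l, 'b) module \<Rightarrow> ('a \<Rightarrow> 'b) set"
  where "module_iso L M N =
    {h. bij_betw h (carrier M) (carrier N) \<and>
        (\<forall>x\<in>carrier M. \<forall>y\<in>carrier M. h (x \<oplus>\<^bsub>M\<^esub> y) = h x \<oplus>\<^bsub>N\<^esub> h y) \<and>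
        (\<forall>c\<in>carrier L. \<forall>x\<in>carrier M. h (c \<odot>\<^bsub>M\<^esub> x) = c \<odot>\<^bsub>N\<^esub> h x)}"


section \<open>First cohomology\<close>

text \<open>
  The first cohomology of a group \<open>G\<close> acting linearly from the left on a module \<open>M\<close>:
  inhomogeneous 1-cocycles (crossed homomorphisms) modulo 1-coboundaries (principal
  crossed homomorphisms).
\<close>

definition cocycles ::
    "('s, 'b) monoid_scheme \<Rightarrow> ('l, 'a) module \<Rightarrow> ('s \<Rightarrow> 'a \<Rightarrow> 'a) \<Rightarrow> ('s \<Rightarrow> 'a) set"
  where "cocycles G M act =
    {f \<in> carrier G \<rightarrow>\<^sub>E carrier M.
       \<forall>\<sigma>\<in>carrier G. \<forall>\<tau>\<in>carrier G. f (\<sigma> \<otimes>\<^bsub>G\<^esub> \<tau>) = f \<sigma> \<oplus>\<^bsub>M\<^esub> act \<sigma> (f \<tau>)}"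

definition coboundaries ::
    "('s, 'b) monoid_scheme \<Rightarrow> ('l, 'a) module \<Rightarrow> ('s \<Rightarrow> 'a \<Rightarrow> 'a) \<Rightarrow> ('s \<Rightarrow> 'a) set"
  where "coboundaries G M act =
    (\<lambda>m. \<lambda>\<sigma>\<in>carrier G. act \<sigma> m \<ominus>\<^bsub>M\<^esub> m) ` carrier M"

definition cocycle_module ::
    "('s, 'b) monoid_scheme \<Rightarrow> ('l, 'a) module \<Rightarrow> ('s \<Rightarrow> 'a \<Rightarrow> 'a) \<Rightarrow> ('l, 's \<Rightarrow> 'a) module"
  where "cocycle_module G M act =
    \<lparr>carrier = cocycles G M act,
     monoid.mult = undefined,
     one = undefined,
     ring.zero = (\<lambda>\<sigma>\<in>carrier G. \<zero>\<^bsub>M\<^esub>),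
     ring.add = (\<lambda>f g. \<lambda>\<sigma>\<in>carrier G. f \<sigma> \<oplus>\<^bsub>M\<^esub> g \<sigma>),
     smult = (\<lambda>c f. \<lambda>\<sigma>\<in>carrier G. c \<odot>\<^bsub>M\<^esub> f \<sigma>)\<rparr>"

definition H1 ::
    "('s, 'b) monoid_scheme \<Rightarrow> ('l, 'a) module \<Rightarrow> ('s \<Rightarrow> 'a \<Rightarrow> 'a) \<Rightarrow> ('l, ('s \<Rightarrow> 'a) set) module"
  where "H1 G M act = quotient_module (cocycle_module G M act) (coboundaries G M act)"

end

theory Submission
  imports Defs
begin

text \<open>
  By Nielsen reduction, \<open>Aut F\<^sub>n\<close> is generated by transvections and signed permutations, and
  reducing integer matrices by the Euclidean algorithm shows that \<open>IA\<^sub>n\<close> is generated, modulo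
  commutators, by Magnus's automorphisms; the Johnson coordinates then identify a basis of
  \<open>IA\<^sub>n\<^sup>a\<^sup>b\<close>. A cocycle \<open>F\<close> restricts to an equivariant homomorphism on \<open>IA\<^sub>n\<close>, and since all Magnus
  automorphisms are built from conjugates of \<open>K : x\<^sub>0 \<mapsto> x\<^sub>1\<^sup>-\<^sup>1 x\<^sub>0 x\<^sub>1\<close>, this restriction is determined by
  \<open>F K\<close>. The signed permutations that fix or invert \<open>K\<close> leave only two free coordinates of \<open>F K\<close>.

  If both vanish, \<open>F\<close> is zero on \<open>IA\<^sub>n\<close>. The automorphism \<open>\<iota>\<close> inverting every generator is central
  modulo \<open>IA\<^sub>n\<close> and acts by \<open>-1\<close>, so \<open>2 F(g) = F(\<iota>) - g F(\<iota>)\<close>; evaluating this on transvections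
  shows that \<open>F(\<iota>)\<close> is divisible by two, so \<open>F\<close> is principal because there is no 2-torsion. Hence
  \<open>H\<^sup>1\<close> is a submodule of \<open>L\<^sup>2\<close>. The crossed homomorphisms \<open>g \<mapsto> E [\<iota>, g]\<close>, for \<open>E\<close> the identity and
  the contraction followed by the embedding of \<open>H\<close>, show that it has rank two, and over a principal
  ideal domain such a submodule is free of rank two.
\<close>

text \<open>The delicate point is that \<open>Ia n\<close> is no larger than \<open>Nn n\<close>; it
  is proved without a presentation of GL(n, Z). Nielsen reduction writes an automorphism as a word
  in generators, but a word does not show whether a basis vector is fixed. Basis vectors are
  therefore peeled off one at a time. At stage k, \<open>Dd k n\<close> holds the elements of
  \<open>Pk k n\<close> whose k-th row the Euclidean algorithm reduces in a controlled way. That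
  this set is stable under right multiplication by the generators of \<open>Pk k n\<close> is a
  confluence statement about the algorithm: two competing subtractions must lead to a common element
  modulo \<open>Nn n\<close>, and the Steinberg relations close these diagrams. So
  \<open>Dd k n\<close> is all of \<open>Pk k n\<close>. An element that already fixes the k-th
  vector admits no Euclidean step, hence lies in the expected stabilizer.

  The image of H^1 in L^2 is not computed. The explicit cocycles evaluate on K to -2 E(K), because
  \<iota> negates K modulo commutators, so they need not span L^2. They only show that both ideals
  governing a triangular basis of the image are nonzero.\<close>

lemma inv_letter_inv_letter [simp]: "inv_letter (inv_letter l) = l"
  by (simp add: inv_letter_def)

lemma inv_letter_neq [simp]: "inv_letter l \<noteq> l" "l \<noteq> inv_letter l"
  by (simp_all add: inv_letter_def prod_eq_iff)

lemma inv_letter_eq_iff [simp]: "inv_letter l = inv_letter m \<longleftrightarrow> l = m"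
  by (metis inv_letter_inv_letter)

lemma fst_inv_letter [simp]: "fst (inv_letter l) = fst l"
  by (simp add: inv_letter_def)

lemma reduced_Nil [simp]: "reduced []"
  and reduced_single [simp]: "reduced [l]"
  by (simp_all add: reduced_def)

lemma all_nat_split: "(\<forall>i. P i) \<longleftrightarrow> P 0 \<and> (\<forall>i. P (Suc i))"
  by (metis not0_implies_Suc)

lemma reduced_Cons2 [simp]: "reduced (l # m # w) \<longleftrightarrow> m \<noteq> inv_letter l \<and> reduced (m # w)"
  unfolding reduced_def
  by (subst all_nat_split) auto

lemma reduced_append:
  "reduced (u @ v) \<longleftrightarrow> reduced u \<and> reduced v \<and> (u \<noteq> [] \<longrightarrow> v \<noteq> [] \<longrightarrow> hd v \<noteq> inv_letter (last u))"
proof (induction u rule: induct_list012)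
  case (2 x)
  then show ?case by (cases v) auto
qed auto

lemma reduced_ConsD: "reduced (l # w) \<Longrightarrow> reduced w"
  by (cases w) auto

section \<open>The group law on reduced words\<close>

definition inv_word :: "'g word \<Rightarrow> 'g word"
  where "inv_word w = rev (map inv_letter w)"

lemma inv_word_Nil [simp]: "inv_word [] = []"
  and inv_word_Cons [simp]: "inv_word (l # w) = inv_word w @ [inv_letter l]"
  and inv_word_append [simp]: "inv_word (u @ v) = inv_word v @ inv_word u"
  and length_inv_word [simp]: "length (inv_word w) = length w"
  and inv_word_eq_Nil [simp]: "inv_word w = [] \<longleftrightarrow> w = []"
  by (simp_all add: inv_word_def)

lemma inv_word_inv_word [simp]: "inv_word (inv_word w) = w"
  by (simp add: inv_word_def rev_map o_def)

lemma reduced_inv_word [simp]: "reduced (inv_word w) \<longleftrightarrow> reduced w"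
proof -
  have "reduced w \<Longrightarrow> reduced (inv_word w)" for w :: "'a word"
  proof (induction w rule: induct_list012)
    case (3 x y zs)
    then show ?case
      by (auto simp: reduced_append)
  qed auto
  then show ?thesis
    by (metis inv_word_inv_word)
qed

lemma reduced_cons_letter: "reduced w \<Longrightarrow> reduced (cons_letter l w)"
  by (cases w) (auto dest: reduced_ConsD)

lemma reduced_foldr_cons_letter: "reduced v \<Longrightarrow> reduced (foldr cons_letter u v)"
  by (induction u) (auto intro: reduced_cons_letter)

lemma cons_letter_inv_letter: "reduced w \<Longrightarrow> cons_letter l (cons_letter (inv_letter l) w) = w"
proof (cases w)
  case (Cons m w')
  assume "reduced w"
  then show ?thesis
    using Cons by (cases w') auto
qed auto

lemma cons_letter_reduced: "reduced (l # w) \<Longrightarrow> cons_letter l w = l # w"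
  by (cases w) auto

lemma foldr_cons_letter_Nil: "reduced u \<Longrightarrow> foldr cons_letter u [] = u"
proof (induction u)
  case (Cons l u)
  then show ?case
    using reduced_ConsD[of l u] cons_letter_reduced[of l u] by simp
qed simp

text \<open>The heart of associativity. If \<open>l\<close> cancels the head of \<open>z\<close>,
  the same cancellation takes place in front of the reduced word on the right-hand side.\<close>

lemma foldr_cons_letter_cons:
  assumes "reduced w" and "reduced z"
  shows "foldr cons_letter (cons_letter l z) w = cons_letter l (foldr cons_letter z w)"
proof (cases z)
  case (Cons m z')
  show ?thesis
  proof (cases "m = inv_letter l")
    case True
    then show ?thesis
      using Cons cons_letter_inv_letter[of "foldr cons_letter z' w" l] assms
      by (simp add: reduced_foldr_cons_letter)
  qed (use Cons in auto)
qed auto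

lemma foldr_cons_letter_assoc:
  assumes "reduced v" "reduced w"
  shows "foldr cons_letter (foldr cons_letter u v) w = foldr cons_letter u (foldr cons_letter v w)"
  by (induction u) (auto simp: foldr_cons_letter_cons assms reduced_foldr_cons_letter)

lemma foldr_cons_letter_inv_word: "reduced w \<Longrightarrow> foldr cons_letter (inv_word u) (foldr cons_letter u w) = w"
proof (induction u arbitrary: w)
  case (Cons l u)
  then show ?case
    using cons_letter_inv_letter[of "foldr cons_letter u w" "inv_letter l"]
    by (simp add: reduced_foldr_cons_letter)
qed auto

section \<open>The free group on countably many generators\<close>

text \<open>One type serves every rank: F_n becomes the set of elements supported in
  \<open>{..<n}\<close>, and its automorphisms are extended by the identity on the other generators.
  Additive notation gives access to the simplification rules of \<open>group_add\<close>, which do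
  not assume commutativity.\<close>

typedef fgrp = "{w :: nat word. reduced w}"
  by (rule exI[of _ "[]"]) simp

setup_lifting type_definition_fgrp

instantiation fgrp :: group_add
begin

lift_definition zero_fgrp :: fgrp is "[]" by simp
lift_definition plus_fgrp :: "fgrp \<Rightarrow> fgrp \<Rightarrow> fgrp" is "foldr cons_letter"
  by (simp add: reduced_foldr_cons_letter)
lift_definition uminus_fgrp :: "fgrp \<Rightarrow> fgrp" is inv_word by simp
definition minus_fgrp :: "fgrp \<Rightarrow> fgrp \<Rightarrow> fgrp" where "minus_fgrp a b = a + - b"

instance
proof
  fix a b c :: fgrp
  show "a + b + c = a + (b + c)"
    by transfer (simp add: foldr_cons_letter_assoc)
  show "0 + a = a"
    by transfer simp
  show "a + 0 = a"
    by transfer (simp add: foldr_cons_letter_Nil)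
  show "- a + a = 0"
  proof transfer
    fix a :: "nat word"
    assume "reduced a"
    then show "foldr cons_letter (inv_word a) a = []"
      using foldr_cons_letter_inv_word[of "[]" a] by (simp add: foldr_cons_letter_Nil)
  qed
  show "a + - b = a - b"
    by (simp add: minus_fgrp_def)
qed

end

lift_definition gn :: "nat \<Rightarrow> fgrp" is "\<lambda>i. [(i, True)]" by simp

definition sgn_if :: "bool \<Rightarrow> 'a::uminus \<Rightarrow> 'a"
  where "sgn_if b x = (if b then x else - x)"

text \<open>The homomorphism extending \<open>f\<close>, given by the universal property. Since it
  reads off the reduced representative, additivity has to be proved; the case that matters is a new
  first letter that cancels.\<close>

definition lft :: "(nat \<Rightarrow> 'a::group_add) \<Rightarrow> fgrp \<Rightarrow> 'a"
  where "lft f w = sum_list (map (\<lambda>(i, b). sgn_if b (f i)) (Rep_fgrp w))"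

text \<open>Evaluates words that need not be reduced, so inductions on lists may pass through words
  with cancellations.\<close>

definition evalw :: "nat word \<Rightarrow> fgrp"
  where "evalw ls = sum_list (map (\<lambda>(i, b). sgn_if b (gn i)) ls)"

lemma evalw_Nil [simp]: "evalw [] = 0"
  and evalw_Cons [simp]: "evalw ((i, b) # w) = sgn_if b (gn i) + evalw w"
  and evalw_append [simp]: "evalw (u @ v) = evalw u + evalw v"
  by (simp_all add: evalw_def)

lemma Rep_fgrp_sgn_if: "Rep_fgrp (sgn_if b (gn i)) = [(i, b)]"
  by (simp add: sgn_if_def gn.rep_eq uminus_fgrp.rep_eq inv_word_def inv_letter_def)

lemma Rep_fgrp_plus_letter: "Rep_fgrp (sgn_if b (gn i) + w) = cons_letter (i, b) (Rep_fgrp w)"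
  by (simp add: plus_fgrp.rep_eq Rep_fgrp_sgn_if)

lemma reduced_Rep_fgrp [simp]: "reduced (Rep_fgrp w)"
  using Rep_fgrp by simp

lemma Rep_fgrp_evalw: "Rep_fgrp (evalw w) = foldr cons_letter w []"
  by (induction w) (auto simp: Rep_fgrp_plus_letter zero_fgrp.rep_eq)

lemma evalw_Rep_fgrp [simp]: "evalw (Rep_fgrp w) = w"
  by (metis Rep_fgrp_evalw Rep_fgrp_inject foldr_cons_letter_Nil reduced_Rep_fgrp)

lemma fgrp_induct [case_names zero plus]:
  assumes "P 0" and "\<And>i b w. P w \<Longrightarrow> P (sgn_if b (gn i) + w)"
  shows "P w"
proof -
  have "P (evalw l)" for l
    by (induction l) (auto simp: assms)
  then show ?thesis
    by (metis evalw_Rep_fgrp)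
qed

lemma sgn_if_cancel: "sgn_if b x + (sgn_if (\<not> b) x + y) = (y :: 'a::group_add)"
  by (simp add: sgn_if_def add.assoc[symmetric])

lemma lft_zero [simp]: "lft f 0 = 0"
  by (simp add: lft_def zero_fgrp.rep_eq)

lemma lft_letter: "lft f (sgn_if b (gn i) + w) = sgn_if b (f i) + lft f w"
proof (cases "Rep_fgrp w")
  case Nil
  then show ?thesis by (simp add: lft_def Rep_fgrp_plus_letter)
next
  case (Cons m u)
  then show ?thesis
    by (cases m) (auto simp: lft_def Rep_fgrp_plus_letter inv_letter_def sgn_if_cancel)
qed

lemma lft_plus [simp]: "lft f (u + v) = lft f u + lft f v"
  by (induction u rule: fgrp_induct) (auto simp: lft_letter add.assoc)

lemma lft_gn [simp]: "lft f (gn i) = f i"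
  by (simp add: lft_def gn.rep_eq sgn_if_def)

lemma hom_zero:
  fixes h :: "'a::group_add \<Rightarrow> 'b::group_add"
  assumes "\<And>x y. h (x + y) = h x + h y"
  shows "h 0 = 0"
  by (metis add.right_neutral add_left_cancel assms)

lemma hom_uminus:
  fixes h :: "'a::group_add \<Rightarrow> 'b::group_add"
  assumes "\<And>x y. h (x + y) = h x + h y"
  shows "h (- x) = - h x"
  by (metis add_eq_0_iff assms hom_zero left_minus)

lemma lft_uminus [simp]: "lft f (- u) = - lft f u"
  by (rule hom_uminus) simp

lemma lft_diff [simp]: "lft f (u - v) = lft f u - lft f v"
  by (metis diff_conv_add_uminus lft_plus lft_uminus)

lemma fgrp_hom_eqI:
  fixes g h :: "fgrp \<Rightarrow> 'b::group_add"
  assumes g: "\<And>x y. g (x + y) = g x + g y" and h: "\<And>x y. h (x + y) = h x + h y"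
    and eq: "\<And>i. i \<in> fst ` set (Rep_fgrp w) \<Longrightarrow> g (gn i) = h (gn i)"
  shows "g w = h w"
proof -
  note z = hom_zero[of g, OF g] hom_zero[of h, OF h] hom_uminus[of g, OF g] hom_uminus[of h, OF h]
  have "g (evalw l) = h (evalw l)" if "\<And>i. i \<in> fst ` set l \<Longrightarrow> g (gn i) = h (gn i)" for l
    using that by (induction l) (auto simp: g h z sgn_if_def)
  from this[of "Rep_fgrp w"] show ?thesis
    using eq by simp
qed

section \<open>Generators occurring in an element\<close>

definition supp :: "fgrp \<Rightarrow> nat set"
  where "supp w = fst ` set (Rep_fgrp w)"

lemma finite_supp [simp]: "finite (supp w)"
  by (simp add: supp_def)

lemmas group_normalize = add.assoc minus_add diff_conv_add_uminus

lemma supp_zero [simp]: "supp 0 = {}"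
  by (simp add: supp_def zero_fgrp.rep_eq)

lemma supp_gn [simp]: "supp (gn i) = {i}"
  by (simp add: supp_def gn.rep_eq)

lemma supp_uminus [simp]: "supp (- w) = supp w"
  by (simp add: supp_def uminus_fgrp.rep_eq inv_word_def image_image)

lemma set_cons_letter: "set (cons_letter l w) \<subseteq> insert l (set w)"
  by (cases w) auto

lemma set_foldr_cons_letter: "set (foldr cons_letter u v) \<subseteq> set u \<union> set v"
proof (induction u)
  case (Cons l u)
  then show ?case
    using set_cons_letter[of l "foldr cons_letter u v"] by auto
qed auto

lemma supp_plus: "supp (u + v) \<subseteq> supp u \<union> supp v"
  unfolding supp_def plus_fgrp.rep_eq using set_foldr_cons_letter[of "Rep_fgrp u" "Rep_fgrp v"] by auto

lemma supp_plus_subset [simp]: "supp u \<subseteq> A \<Longrightarrow> supp v \<subseteq> A \<Longrightarrow> supp (u + v) \<subseteq> A"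
  using supp_plus[of u v] by auto

lemma supp_diff_subset [simp]: "supp u \<subseteq> A \<Longrightarrow> supp v \<subseteq> A \<Longrightarrow> supp (u - v) \<subseteq> A"
  unfolding diff_conv_add_uminus by (rule supp_plus_subset) auto

lemma notin_supp_plus [simp]: "i \<notin> supp u \<Longrightarrow> i \<notin> supp v \<Longrightarrow> i \<notin> supp (u + v)"
  and notin_supp_diff [simp]: "i \<notin> supp u \<Longrightarrow> i \<notin> supp v \<Longrightarrow> i \<notin> supp (u - v)"
  using supp_plus supp_diff_subset[of u "- {i}" v] by blast+

lemma supp_sgn_if [simp]: "supp (sgn_if b w) = supp w"
  by (simp add: sgn_if_def)

lemma supp_evalw: "supp (evalw l) \<subseteq> fst ` set l"
  unfolding supp_def Rep_fgrp_evalw using set_foldr_cons_letter[of l "[]"] by auto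

lemma supp_closed_induct [consumes 1, case_names zero plus]:
  assumes "supp w \<subseteq> A" "P 0" "\<And>i b w. P w \<Longrightarrow> i \<in> A \<Longrightarrow> supp w \<subseteq> A \<Longrightarrow> P (sgn_if b (gn i) + w)"
  shows "P w"
proof -
  have "P (evalw l) \<and> supp (evalw l) \<subseteq> A" if "fst ` set l \<subseteq> A" for l
    using that
  proof (induction l)
    case (Cons m l)
    then show ?case
      using assms(3)[of "evalw l" "fst m" "snd m"] supp_plus_subset[of "sgn_if (snd m) (gn (fst m))" A "evalw l"]
      by (cases m) simp
  qed (simp add: assms)
  from this[of "Rep_fgrp w"] show ?thesis
    using assms(1) by (simp add: supp_def)
qed

section \<open>Automorphisms\<close>

typedef faut = "{f :: fgrp \<Rightarrow> fgrp. bij f \<and> (\<forall>x y. f (x + y) = f x + f y)}"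
  morphisms app Abs_faut
  by (rule exI[of _ id]) simp

lemma bij_app: "bij (app s)" and app_plus [simp]: "app s (x + y) = app s x + app s y"
  using app[of s] by auto

lemma app_zero [simp]: "app s 0 = 0"
  by (rule hom_zero) simp

lemma app_uminus [simp]: "app s (- x) = - app s x"
  by (rule hom_uminus) simp

lemma app_diff [simp]: "app s (x - y) = app s x - app s y"
  by (metis app_plus app_uminus diff_conv_add_uminus)

lemma app_sgn_if [simp]: "app s (sgn_if b x) = sgn_if b (app s x)"
  by (simp add: sgn_if_def)

text \<open>As in \<^const>\<open>aut_group\<close>, the sum \<open>s + t\<close> applies \<open>s\<close> first.\<close>
instantiation faut :: group_add
begin

definition zero_faut :: faut where "zero_faut = Abs_faut id"
definition plus_faut :: "faut \<Rightarrow> faut \<Rightarrow> faut" where "plus_faut s t = Abs_faut (app t \<circ> app s)"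
definition uminus_faut :: "faut \<Rightarrow> faut" where "uminus_faut s = Abs_faut (inv_into UNIV (app s))"
definition minus_faut :: "faut \<Rightarrow> faut \<Rightarrow> faut" where "minus_faut s t = s + - t"

lemma app_zero_faut: "app 0 = id"
  by (simp add: zero_faut_def Abs_faut_inverse)

lemma app_plus_faut: "app (s + t) = app t \<circ> app s"
  unfolding plus_faut_def by (rule Abs_faut_inverse) (auto intro: bij_comp bij_app)

lemma app_uminus_faut: "app (- s) = inv_into UNIV (app s)"
  unfolding uminus_faut_def
proof (rule Abs_faut_inverse, safe)
  show "bij (inv_into UNIV (app s))" by (simp add: bij_app bij_imp_bij_inv)
  fix x y
  have "app s (inv_into UNIV (app s) x + inv_into UNIV (app s) y) = x + y"
    by (simp add: bij_app bij_is_surj surj_f_inv_f)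
  then show "inv_into UNIV (app s) (x + y) = inv_into UNIV (app s) x + inv_into UNIV (app s) y"
    by (metis bij_app bij_inv_eq_iff)
qed

instance
proof
  fix a b c :: faut
  show "a + b + c = a + (b + c)"
    by (simp add: app_inject[symmetric] app_plus_faut o_assoc)
  show "0 + a = a" "a + 0 = a"
    by (simp_all add: app_inject[symmetric] app_plus_faut app_zero_faut)
  show "- a + a = 0"
    using surj_iff[of "app a"] bij_app[of a] bij_is_surj[of "app a"]
    by (simp add: app_inject[symmetric] app_plus_faut app_zero_faut app_uminus_faut)
  show "a + - b = a - b"
    by (simp add: minus_faut_def)
qed

end

lemma app_id [simp]: "app 0 x = x"
  by (simp add: app_zero_faut)

lemma app_add [simp]: "app (s + t) x = app t (app s x)"
  by (simp add: app_plus_faut)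

lemma app_neg_app [simp]: "app (- s) (app s x) = x" "app s (app (- s) x) = x"
  by (simp_all flip: app_add)

lemma app_minus [simp]: "app (s - t) x = app (- t) (app s x)"
  by (metis app_add diff_conv_add_uminus)

lemma faut_eqI:
  assumes "\<And>i. app s (gn i) = app t (gn i)"
  shows "s = t"
proof -
  have "app s w = app t w" for w
    by (rule fgrp_hom_eqI) (auto simp: assms)
  then show ?thesis
    by (simp add: app_inject[symmetric] fun_eq_iff)
qed

lemma app_cong:
  assumes "\<And>i. i \<in> supp w \<Longrightarrow> app s (gn i) = app t (gn i)"
  shows "app s w = app t w"
  by (rule fgrp_hom_eqI) (auto simp: assms supp_def)

lemma app_fix: "(\<And>i. i \<in> supp w \<Longrightarrow> app s (gn i) = gn i) \<Longrightarrow> app s w = w"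
  using app_cong[of w s 0] by simp

lemma app_uminus_eq: "app s x = y \<Longrightarrow> app (- s) y = x"
  by auto

text \<open>Meaningful only if \<open>lft f\<close> is bijective; \<open>app_mk\<close> certifies
  this by a candidate inverse that is tested on generators.\<close>

definition mk :: "(nat \<Rightarrow> fgrp) \<Rightarrow> faut"
  where "mk f = Abs_faut (lft f)"

lemma app_mk:
  assumes "\<And>i. lft g (f i) = gn i" "\<And>i. lft f (g i) = gn i"
  shows "app (mk f) = lft f"
proof -
  have *: "lft g (lft f w) = w" "lft f (lft g w) = w" for w
    using fgrp_hom_eqI[of "\<lambda>w. lft g (lft f w)" "\<lambda>w. w" w]
      fgrp_hom_eqI[of "\<lambda>w. lft f (lft g w)" "\<lambda>w. w" w] by (auto simp: assms)
  then have "bij (lft f)"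
    by (intro o_bij[of "lft g"]) auto
  then show ?thesis
    unfolding mk_def by (intro Abs_faut_inverse) auto
qed

lemma app_mk_gn:
  assumes "\<And>i. lft g (f i) = gn i" "\<And>i. lft f (g i) = gn i"
  shows "app (mk f) (gn i) = f i"
  using app_mk[of g f] assms by simp

lemma lft_fix: "(\<And>i. i \<in> supp w \<Longrightarrow> f i = gn i) \<Longrightarrow> lft f w = w"
  using fgrp_hom_eqI[of "lft f" "\<lambda>w. w" w] by (auto simp: supp_def)

text \<open>A common form for the elementary automorphisms: transvections are
  \<open>Q i 0 (gn j)\<close>, and Magnus's two families are \<open>Q i (- gn l) (gn l)\<close> and
  \<open>Q i 0 (comm (gn a) (gn b))\<close>. As long as x_i occurs in neither factor, the two sides
  compose independently (\<open>Q_plus\<close>).\<close>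

definition Q :: "nat \<Rightarrow> fgrp \<Rightarrow> fgrp \<Rightarrow> faut"
  where "Q i a b = mk (gn(i := a + gn i + b))"

lemma app_Q:
  assumes "i \<notin> supp a" "i \<notin> supp b"
  shows "app (Q i a b) (gn m) = (if m = i then a + gn i + b else gn m)"
proof -
  have *: "lft (gn(i := x)) a = a" "lft (gn(i := x)) b = b" for x
    using assms by (auto intro!: lft_fix)
  have "app (mk (gn(i := a + gn i + b))) (gn m) = (gn(i := a + gn i + b)) m"
    by (rule app_mk_gn[of "gn(i := - a + gn i + - b)"])
      (auto simp: * simp del: add_uminus_conv_diff simp add: add.assoc minus_add)
  then show ?thesis
    unfolding Q_def by simp
qed

lemma app_Q_fix: "i \<notin> supp a \<Longrightarrow> i \<notin> supp b \<Longrightarrow> i \<notin> supp w \<Longrightarrow> app (Q i a b) w = w"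
  by (rule app_fix) (auto simp: app_Q)

lemma Q_plus:
  assumes "i \<notin> supp a" "i \<notin> supp b" "i \<notin> supp c" "i \<notin> supp d"
  shows "Q i a b + Q i c d = Q i (a + c) (d + b)"
proof (rule faut_eqI)
  have "i \<notin> supp (a + c)" "i \<notin> supp (d + b)"
    using assms supp_plus by blast+
  then show "app (Q i a b + Q i c d) (gn m) = app (Q i (a + c) (d + b)) (gn m)" for m
    using assms by (auto simp: app_Q app_Q_fix add.assoc)
qed

lemma Q_zero [simp]: "Q i 0 0 = 0"
  by (rule faut_eqI) (simp add: app_Q)

lemma Q_uminus:
  assumes "i \<notin> supp a" "i \<notin> supp b"
  shows "- Q i a b = Q i (- a) (- b)"
proof -
  have "Q i a b + Q i (- a) (- b) = 0"
    using assms by (simp add: Q_plus)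
  then show ?thesis
    by (simp add: minus_unique)
qed

section \<open>Exponent sums and commutators\<close>

text \<open>The coefficient of e_j in the class of an element in H.\<close>

definition mu :: "nat \<Rightarrow> fgrp \<Rightarrow> int"
  where "mu j = lft (\<lambda>i. if i = j then 1 else 0)"

lemma mu_simps [simp]: "mu j 0 = 0" "mu j (u + v) = mu j u + mu j v" "mu j (- u) = - mu j u"
    "mu j (u - v) = mu j u - mu j v" "mu j (gn i) = (if i = j then 1 else 0)"
    "mu j (sgn_if b u) = sgn_if b (mu j u)"
  by (simp_all add: mu_def sgn_if_def)

lemma mu_app:
  assumes "supp w \<subseteq> A" "finite A"
  shows "mu j (app s w) = (\<Sum>a\<in>A. mu a w * mu j (app s (gn a)))"
  using assms(1)
proof (induction rule: supp_closed_induct)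
  case zero
  then show ?case by simp
next
  case (plus i b w)
  have "(\<Sum>a\<in>A. mu a (gn i) * mu j (app s (gn a))) = (\<Sum>a\<in>A. if a = i then mu j (app s (gn a)) else 0)"
    by (intro sum.cong) auto
  also have "\<dots> = mu j (app s (gn i))"
    using plus assms by simp
  finally have "(\<Sum>a\<in>A. mu a (gn i) * mu j (app s (gn a))) = mu j (app s (gn i))" .
  then show ?case
    using plus by (simp add: distrib_right sum.distrib sgn_if_def sum_negf)
qed

lemma mu_app_eq_0: "(\<And>j. mu j w = 0) \<Longrightarrow> mu j (app s w) = 0"
  by (subst mu_app[of w "supp w"]) auto

definition comm :: "'a::group_add \<Rightarrow> 'a \<Rightarrow> 'a"
  where "comm u v = u + v - u - v"

lemma mu_comm [simp]: "mu j (comm u v) = 0"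
  by (simp add: comm_def)

lemma supp_comm [simp]: "supp u \<subseteq> A \<Longrightarrow> supp v \<subseteq> A \<Longrightarrow> supp (comm u v) \<subseteq> A"
  unfolding comm_def by (intro supp_diff_subset supp_plus_subset)

text \<open>The commutator subgroup of the free group on \<open>A\<close>. The support is recorded
  because the commutators will multiply a generator x_i that must not occur in them.\<close>

inductive_set Dv :: "nat set \<Rightarrow> fgrp set" for A where
  comm: "supp u \<subseteq> A \<Longrightarrow> supp v \<subseteq> A \<Longrightarrow> comm u v \<in> Dv A"
| plus: "u \<in> Dv A \<Longrightarrow> v \<in> Dv A \<Longrightarrow> u + v \<in> Dv A"
| uminus: "u \<in> Dv A \<Longrightarrow> - u \<in> Dv A"

lemma mu_evalw_nonneg: "(i, False) \<notin> set l \<Longrightarrow> 0 \<le> mu i (evalw l)"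
  by (induction l) (auto simp: sgn_if_def)

lemma mu_evalw_nonpos: "(i, True) \<notin> set l \<Longrightarrow> mu i (evalw l) \<le> 0"
  by (induction l) (auto simp: sgn_if_def)

text \<open>The first letter of a word with vanishing exponent sums recurs inverted, and moving it there
  changes the element by a commutator and shortens the word.\<close>
lemma evalw_in_Dv:
  assumes "fst ` set l \<subseteq> A" "\<And>j. mu j (evalw l) = 0"
  shows "evalw l \<in> Dv A"
  using assms
proof (induction l rule: length_induct)
  case (1 l)
  show ?case
  proof (cases l)
    case Nil
    then show ?thesis
      using Dv.comm[of 0 A 0] by (simp add: comm_def)
  next
    case (Cons m l')
    obtain i b where m: "m = (i, b)" by (cases m)
    have "(i, \<not> b) \<in> set l'"
    proof (rule ccontr)
      assume *: "(i, \<not> b) \<notin> set l'"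
      have "mu i (evalw l) = sgn_if b 1 + mu i (evalw l')"
        by (simp add: Cons m)
      moreover have "mu i (evalw l) = 0"
        using "1.prems" by blast
      ultimately show False
        using * mu_evalw_nonneg[of i l'] mu_evalw_nonpos[of i l'] by (cases b) (auto simp: sgn_if_def)
    qed
    then obtain u v where l': "l' = u @ (i, \<not> b) # v"
      by (meson split_list)
    let ?x = "sgn_if b (gn i)"
    have x: "sgn_if (\<not> b) (gn i) = - ?x"
      by (simp add: sgn_if_def)
    have e: "evalw l = comm ?x (evalw u) + evalw (u @ v)"
      by (simp add: Cons m l' x comm_def add.assoc diff_conv_add_uminus del: add_uminus_conv_diff)
    have "mu j (evalw (u @ v)) = 0" for j
      using "1.prems"(2)[of j] unfolding e by simp
    moreover have "fst ` set (u @ v) \<subseteq> A" "length (u @ v) < length l"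
      using "1.prems"(1) by (auto simp: Cons l')
    ultimately have "evalw (u @ v) \<in> Dv A"
      using "1.IH" by blast
    moreover have "comm ?x (evalw u) \<in> Dv A"
      using "1.prems"(1) supp_evalw[of u] by (intro Dv.comm) (auto simp: Cons m l')
    ultimately show ?thesis
      unfolding e by (rule Dv.plus[rotated])
  qed
qed

lemma in_Dv: "supp w \<subseteq> A \<Longrightarrow> (\<And>j. mu j w = 0) \<Longrightarrow> w \<in> Dv A"
  using evalw_in_Dv[of "Rep_fgrp w" A] by (simp add: supp_def)

section \<open>The automorphism group and the Torelli subgroup\<close>

text \<open>Aut F_n, extended by the identity on the remaining generators. Imposing the support
  condition on the inverse as well makes closure under inversion immediate.\<close>

definition An :: "nat \<Rightarrow> faut set"
  where "An n = {s. (\<forall>i\<ge>n. app s (gn i) = gn i) \<and>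
    (\<forall>i<n. supp (app s (gn i)) \<subseteq> {..<n} \<and> supp (app (- s) (gn i)) \<subseteq> {..<n})}"

lemma supp_app_subset:
  assumes "supp w \<subseteq> A" "\<And>i. i \<in> A \<Longrightarrow> supp (app s (gn i)) \<subseteq> B"
  shows "supp (app s w) \<subseteq> B"
  using assms(1)
proof (induction rule: supp_closed_induct)
  case (plus i b w)
  then show ?case
    using assms(2)[of i] by simp
qed auto

lemma An_app_fix: "s \<in> An n \<Longrightarrow> i \<ge> n \<Longrightarrow> app s (gn i) = gn i"
  by (simp add: An_def)

lemma An_supp: "s \<in> An n \<Longrightarrow> supp w \<subseteq> {..<n} \<Longrightarrow> supp (app s w) \<subseteq> {..<n}"
  by (rule supp_app_subset) (auto simp: An_def)

lemma An_zero [simp]: "0 \<in> An n"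
  by (simp add: An_def)

lemma An_uminus: "s \<in> An n \<Longrightarrow> - s \<in> An n"
  by (auto simp: An_def intro: app_uminus_eq)

lemma An_plus: "s \<in> An n \<Longrightarrow> t \<in> An n \<Longrightarrow> s + t \<in> An n"
  unfolding An_def mem_Collect_eq
proof (intro conjI allI impI)
  fix i
  assume a: "(\<forall>i\<ge>n. app s (gn i) = gn i) \<and> (\<forall>i<n. supp (app s (gn i)) \<subseteq> {..<n} \<and> supp (app (- s) (gn i)) \<subseteq> {..<n})"
    "(\<forall>i\<ge>n. app t (gn i) = gn i) \<and> (\<forall>i<n. supp (app t (gn i)) \<subseteq> {..<n} \<and> supp (app (- t) (gn i)) \<subseteq> {..<n})"
  then have "s \<in> An n" "t \<in> An n"
    unfolding An_def by simp_all
  then have st: "s \<in> An n" "t \<in> An n" "- s \<in> An n" "- t \<in> An n"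
    by (simp_all add: An_uminus)
  show "app (s + t) (gn i) = gn i" if "n \<le> i"
    using a that by simp
  show "supp (app (s + t) (gn i)) \<subseteq> {..<n}" "supp (app (- (s + t)) (gn i)) \<subseteq> {..<n}" if "i < n"
    using st that by (simp_all add: minus_add An_supp del: add_uminus_conv_diff)
qed

lemma An_diff: "s \<in> An n \<Longrightarrow> t \<in> An n \<Longrightarrow> s - t \<in> An n"
  by (metis An_plus An_uminus diff_conv_add_uminus)

lemma An_sgn_if: "s \<in> An n \<Longrightarrow> sgn_if b s \<in> An n"
  by (simp add: sgn_if_def An_uminus)

definition Ia :: "nat \<Rightarrow> faut set"
  where "Ia n = {s \<in> An n. \<forall>j w. mu j (app s w) = mu j w}"

lemma Ia_An: "s \<in> Ia n \<Longrightarrow> s \<in> An n"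
  by (simp add: Ia_def)

lemma Ia_zero [simp]: "0 \<in> Ia n"
  by (simp add: Ia_def)

lemma Ia_plus: "s \<in> Ia n \<Longrightarrow> t \<in> Ia n \<Longrightarrow> s + t \<in> Ia n"
  by (simp add: Ia_def An_plus)

lemma Ia_uminus: "s \<in> Ia n \<Longrightarrow> - s \<in> Ia n"
  by (simp add: Ia_def An_uminus) (metis app_neg_app(2))

lemma Ia_diff: "s \<in> Ia n \<Longrightarrow> t \<in> Ia n \<Longrightarrow> s - t \<in> Ia n"
  by (metis Ia_plus Ia_uminus diff_conv_add_uminus)

lemma Ia_comm: "s \<in> Ia n \<Longrightarrow> t \<in> Ia n \<Longrightarrow> comm s t \<in> Ia n"
  unfolding comm_def by (intro Ia_diff Ia_plus)

lemma in_IaI: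
  assumes "s \<in> An n" "\<And>i j. i < n \<Longrightarrow> mu j (app s (gn i)) = mu j (gn i)"
  shows "s \<in> Ia n"
proof -
  have "mu j (app s w) = mu j w" for j w
  proof (induction w rule: fgrp_induct)
    case (plus i b w)
    then show ?case
      using assms(2)[of i j] An_app_fix[OF assms(1), of i] by (cases "i < n") auto
  qed simp
  then show ?thesis
    using assms(1) by (simp add: Ia_def)
qed

lemma Ia_conj:
  assumes "s \<in> Ia n" "g \<in> An n"
  shows "- g + s + g \<in> Ia n"
proof (rule in_IaI)
  show "- g + s + g \<in> An n"
    using assms by (intro An_plus An_uminus) (simp_all add: Ia_An)
  fix i j
  let ?v = "app (- g) (gn i)"
  have "mu j (app s ?v - ?v) = 0" for j
    using assms by (simp add: Ia_def)
  then have "mu j (app g (app s ?v - ?v)) = 0"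
    by (rule mu_app_eq_0)
  then show "mu j (app (- g + s + g) (gn i)) = mu j (gn i)"
    by (simp del: mu_simps(5))
qed

lemma Q_in_An:
  assumes "i < n" "supp a \<subseteq> {..<n} - {i}" "supp b \<subseteq> {..<n} - {i}"
  shows "Q i a b \<in> An n"
proof -
  have *: "supp (app (Q i a b) (gn m)) \<subseteq> {..<n}" if "m < n" "supp a \<subseteq> {..<n} - {i}" "supp b \<subseteq> {..<n} - {i}" for m a b
  proof -
    have "supp (a + gn i + b) \<subseteq> {..<n}"
      using that assms(1) by (intro supp_plus_subset) auto
    moreover have "i \<notin> supp a" "i \<notin> supp b"
      using that by auto
    ultimately show ?thesis
      using that by (auto simp: app_Q)
  qed
  have i: "i \<notin> supp a" "i \<notin> supp b"
    using assms by auto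
  show ?thesis
    unfolding An_def mem_Collect_eq Q_uminus[OF i]
    using i assms *[of _ a b] *[of _ "- a" "- b"] by (auto simp: app_Q simp del: subset_Diff_insert)
qed

lemma Q_in_Ia:
  assumes "i < n" "supp a \<subseteq> {..<n} - {i}" "supp b \<subseteq> {..<n} - {i}" "\<And>j. mu j a + mu j b = 0"
  shows "Q i a b \<in> Ia n"
proof (rule in_IaI)
  fix m j
  have "i \<notin> supp a" "i \<notin> supp b"
    using assms by auto
  then show "mu j (app (Q i a b) (gn m)) = mu j (gn m)"
    using assms(4)[of j] by (auto simp: app_Q)
qed (simp add: assms Q_in_An)

text \<open>Magnus's generators together with all commutators of \<open>Ia n\<close>. Admitting the
  commutators makes normality in \<open>Ia n\<close> immediate (\<open>Nn_conj_Ia\<close>) and costs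
  nothing for statements about the abelianization.\<close>

inductive_set Nn :: "nat \<Rightarrow> faut set" for n where
  comm: "s \<in> Ia n \<Longrightarrow> t \<in> Ia n \<Longrightarrow> comm s t \<in> Nn n"
| K: "i < n \<Longrightarrow> l < n \<Longrightarrow> i \<noteq> l \<Longrightarrow> Q i (- gn l) (gn l) \<in> Nn n"
| Kc: "i < n \<Longrightarrow> a < n \<Longrightarrow> b < n \<Longrightarrow> i \<noteq> a \<Longrightarrow> i \<noteq> b \<Longrightarrow> Q i 0 (comm (gn a) (gn b)) \<in> Nn n"
| plus: "s \<in> Nn n \<Longrightarrow> t \<in> Nn n \<Longrightarrow> s + t \<in> Nn n"
| uminus: "s \<in> Nn n \<Longrightarrow> - s \<in> Nn n"

lemma Nn_zero [simp]: "0 \<in> Nn n"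
  using Nn.comm[of 0 n 0] by (simp add: comm_def)

lemma Nn_diff: "s \<in> Nn n \<Longrightarrow> t \<in> Nn n \<Longrightarrow> s - t \<in> Nn n"
  by (metis Nn.plus Nn.uminus diff_conv_add_uminus)

lemma Nn_Ia: "s \<in> Nn n \<Longrightarrow> s \<in> Ia n"
proof (induction rule: Nn.induct)
  case (K i l)
  then show ?case by (intro Q_in_Ia) auto
next
  case (Kc i a b)
  then show ?case
    using supp_comm[of "gn a" "{..<n} - {i}" "gn b"] by (intro Q_in_Ia) auto
qed (auto intro: Ia_comm Ia_plus Ia_uminus)

lemma Nn_An: "s \<in> Nn n \<Longrightarrow> s \<in> An n"
  by (simp add: Nn_Ia Ia_An)

lemma Nn_conj_Ia: "s \<in> Ia n \<Longrightarrow> t \<in> Nn n \<Longrightarrow> s + t - s \<in> Nn n"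
  using Nn.plus[OF Nn.comm[of s n t]] by (fastforce simp: comm_def add.assoc Nn_Ia)

section \<open>Magnus elements that move a single generator\<close>

context
  fixes n i :: nat and B
  assumes i: "i < n" and B: "B \<subseteq> {..<n} - {i}"
begin

lemma Q_conj_gen_in_Nn: "supp u \<subseteq> B \<Longrightarrow> Q i (- u) u \<in> Nn n"
proof (induction rule: supp_closed_induct)
  case (plus l b u)
  have iu: "i \<notin> supp u"
    using plus B by auto
  have il: "i \<noteq> l" "l < n"
    using plus B by auto
  have l: "Q i (- gn l) (gn l) \<in> Nn n"
    using plus B by (intro Nn.K) (auto simp: i)
  moreover have "- Q i (- gn l) (gn l) = Q i (gn l) (- gn l)"
    using il by (simp add: Q_uminus)
  ultimately have l: "Q i (- sgn_if b (gn l)) (sgn_if b (gn l)) \<in> Nn n"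
    using Nn.uminus[OF l] by (auto simp: sgn_if_def)
  have "Q i (- u) u + Q i (- sgn_if b (gn l)) (sgn_if b (gn l)) =
      Q i (- (sgn_if b (gn l) + u)) (sgn_if b (gn l) + u)"
    using iu il by (subst Q_plus) (auto simp: minus_add simp del: add_uminus_conv_diff)
  then show ?case
    using Nn.plus[OF plus(1) l] by simp
qed simp

text \<open>The admissible right factors for x_i. The aim is \<open>Dv_Cn\<close>: every product of
  commutators in the letters of \<open>B\<close> is one of them.\<close>

definition Cn :: "fgrp set"
  where "Cn = {c. supp c \<subseteq> B \<and> (\<forall>j. mu j c = 0) \<and> Q i 0 c \<in> Nn n}"

lemma Cn_plus:
  assumes "c \<in> Cn" "d \<in> Cn"
  shows "c + d \<in> Cn"
proof -
  have "i \<notin> supp c" "i \<notin> supp d"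
    using assms B by (auto simp: Cn_def)
  then have "Q i 0 (c + d) = Q i 0 d + Q i 0 c"
    by (simp add: Q_plus)
  then show ?thesis
    using assms by (simp add: Cn_def Nn.plus)
qed

lemma Cn_uminus:
  assumes "c \<in> Cn"
  shows "- c \<in> Cn"
proof -
  have "i \<notin> supp c"
    using assms B by (auto simp: Cn_def)
  then have "Q i 0 (- c) = - Q i 0 c"
    by (simp add: Q_uminus)
  then show ?thesis
    using assms by (auto simp: Cn_def intro: Nn.uminus)
qed

text \<open>Conjugating the factor \<open>c\<close> by \<open>u\<close> is the same as conjugating
  \<open>Q i 0 c\<close> by \<open>Q i u (- u)\<close>, an element of \<open>Ia n\<close>, and
  \<open>Nn n\<close> is stable under that.\<close>

lemma Cn_conj:
  assumes "c \<in> Cn" "supp u \<subseteq> B"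
  shows "u + c - u \<in> Cn"
proof -
  have i': "i \<notin> supp c" "i \<notin> supp u"
    using assms B by (auto simp: Cn_def)
  have s: "Q i u (- u) \<in> Ia n"
    using i B assms by (intro Q_in_Ia) auto
  have "i \<notin> supp (c - u)"
    using assms(1) i' supp_diff_subset[of c "- {i}" u] by auto
  then have "Q i u (- u) + Q i 0 c - Q i u (- u) = Q i 0 (u + c - u)"
    using i' by (simp add: Q_plus Q_uminus diff_conv_add_uminus add.assoc del: add_uminus_conv_diff)
  then have "Q i 0 (u + c - u) \<in> Nn n"
    using Nn_conj_Ia[OF s] assms(1) by (metis (mono_tags, lifting) Cn_def mem_Collect_eq)
  then show ?thesis
    using assms by (simp add: Cn_def)
qed

lemma comm_plus_left: "comm (x + u) v = (x + comm u v - x) + comm x v" for x :: "'a::group_add"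
  by (simp add: comm_def diff_conv_add_uminus add.assoc minus_add del: add_uminus_conv_diff)

lemma comm_plus_right: "comm u (y + v) = comm u y + (y + comm u v - y)" for u :: "'a::group_add"
  by (simp add: comm_def diff_conv_add_uminus add.assoc minus_add del: add_uminus_conv_diff)

lemma comm_uminus_left: "comm (- x) v = - x + (- comm x v) - (- x)" for x :: "'a::group_add"
  by (simp add: comm_def diff_conv_add_uminus add.assoc minus_add del: add_uminus_conv_diff)

lemma comm_uminus_right: "comm u (- v) = - v + (- comm u v) - (- v)" for u :: "'a::group_add"
  by (simp add: comm_def diff_conv_add_uminus add.assoc minus_add del: add_uminus_conv_diff)

lemma Cn_comm_gn: "a \<in> B \<Longrightarrow> b \<in> B \<Longrightarrow> comm (gn a) (gn b) \<in> Cn"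
  using i Nn.Kc[of i n a b] B by (auto simp: Cn_def)

lemma Cn_comm_right:
  assumes "a \<in> B" "supp v \<subseteq> B"
  shows "comm (gn a) v \<in> Cn"
  using assms(2)
proof (induction rule: supp_closed_induct)
  case zero
  then show ?case by (simp add: comm_def Cn_def)
next
  case (plus b e v)
  have "comm (gn a) (sgn_if e (gn b)) \<in> Cn"
    unfolding sgn_if_def comm_uminus_right using Cn_comm_gn[of a b] plus assms
    by (cases e) (auto simp only: if_True if_False comm_uminus_right intro!: Cn_conj Cn_uminus, auto)
  then show ?case
    unfolding comm_plus_right using plus by (intro Cn_plus Cn_conj) auto
qed

lemma Cn_comm:
  assumes "supp u \<subseteq> B" "supp v \<subseteq> B"
  shows "comm u v \<in> Cn"
  using assms(1)
proof (induction rule: supp_closed_induct)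
  case zero
  then show ?case by (simp add: comm_def Cn_def)
next
  case (plus b e u)
  have "comm (sgn_if e (gn b)) v \<in> Cn"
    unfolding sgn_if_def comm_uminus_left using Cn_comm_right[of b v] plus assms
    by (cases e) (auto simp only: if_True if_False comm_uminus_left intro!: Cn_conj Cn_uminus, auto)
  then show ?case
    unfolding comm_plus_left using plus by (intro Cn_plus Cn_conj) auto
qed

lemma Dv_Cn: "c \<in> Dv B \<Longrightarrow> c \<in> Cn"
  by (induction rule: Dv.induct) (auto intro: Cn_comm Cn_plus Cn_uminus)

text \<open>The automorphism factors into conjugation of x_i by \<open>a\<close> and right
  multiplication by \<open>b + a\<close>. The first is a product of the generators \<open>K\<close>;
  the second factor has vanishing exponent sums, hence is a product of commutators.\<close>

lemma QN_aux:
  assumes "supp a \<subseteq> B" "supp b \<subseteq> B" "\<And>j. mu j a + mu j b = 0"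
  shows "Q i a b \<in> Nn n"
proof -
  have i': "i \<notin> supp a" "i \<notin> supp b"
    using assms B by auto
  have s: "supp (b + a) \<subseteq> B"
    using assms by (intro supp_plus_subset)
  have "b + a \<in> Dv B"
    using assms(3) s by (intro in_Dv) (auto simp: add.commute)
  then have "Q i 0 (b + a) \<in> Nn n"
    using Dv_Cn by (auto simp: Cn_def)
  moreover have "Q i a (- a) \<in> Nn n"
    using Q_conj_gen_in_Nn[of "- a"] assms by simp
  moreover have "Q i a (- a) + Q i 0 (b + a) = Q i a b"
    using i' s B by (subst Q_plus) (auto simp: add.assoc)
  ultimately show ?thesis
    using Nn.plus by metis
qed

end

lemma QN:
  assumes "i < n" "supp a \<subseteq> {..<n} - {i}" "supp b \<subseteq> {..<n} - {i}" "\<And>j. mu j a + mu j b = 0"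
  shows "Q i a b \<in> Nn n"
  using QN_aux[OF assms(1) order_refl assms(2-4)] .

section \<open>Nielsen automorphisms\<close>

text \<open>Conjugation as a right action, so iterated conjugations follow the order of the sum. The
  left action on \<open>IA_ab n\<close> is \<open>cj\<close> by the inverse.\<close>

definition cj :: "'a::group_add \<Rightarrow> 'a \<Rightarrow> 'a"
  where "cj x s = - s + x + s"

lemma cj_simps [simp]: "cj 0 s = 0" "cj x 0 = x"
  by (simp_all add: cj_def)

lemma cj_plus: "cj (x + y) s = cj x s + cj y s"
  by (simp add: cj_def group_normalize del: add_uminus_conv_diff)

lemma cj_uminus: "cj (- x) s = - cj x s"
  by (simp add: cj_def group_normalize del: add_uminus_conv_diff)

lemma cj_diff: "cj (x - y) s = cj x s - cj y s"
  by (simp only: diff_conv_add_uminus cj_plus cj_uminus)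

lemma cj_cj: "cj (cj x s) u = cj x (s + u)"
  by (simp add: cj_def group_normalize del: add_uminus_conv_diff)

lemma cj_comm: "cj (comm x y) s = comm (cj x s) (cj y s)"
  by (simp add: comm_def cj_diff cj_plus)

text \<open>Allows a conjugation identity to be verified on generators without computing an inverse
  automorphism.\<close>

lemma cj_eqI: "x + s = s + y \<Longrightarrow> cj x s = y"
  by (simp add: cj_def add.assoc)

definition t :: "nat \<Rightarrow> nat \<Rightarrow> faut"
  where "t i j = Q i 0 (gn j)"

lemma app_t: "i \<noteq> j \<Longrightarrow> app (t i j) (gn m) = (if m = i then gn i + gn j else gn m)"
  by (simp add: t_def app_Q)

lemma app_neg_t: "i \<noteq> j \<Longrightarrow> app (- t i j) (gn m) = (if m = i then gn i - gn j else gn m)"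
  by (simp add: t_def app_Q Q_uminus)

lemma t_An: "i < n \<Longrightarrow> j < n \<Longrightarrow> i \<noteq> j \<Longrightarrow> t i j \<in> An n"
  unfolding t_def by (rule Q_in_An) auto

section \<open>Stability of the Magnus subgroup under transvections\<close>

definition QI :: "nat \<Rightarrow> nat \<Rightarrow> fgrp \<Rightarrow> fgrp \<Rightarrow> bool"
  where "QI n i a b \<longleftrightarrow> i < n \<and> supp a \<subseteq> {..<n} - {i} \<and> supp b \<subseteq> {..<n} - {i} \<and> (\<forall>j. mu j a + mu j b = 0)"

lemma QI_Nn: "QI n i a b \<Longrightarrow> Q i a b \<in> Nn n"
  unfolding QI_def by (intro QN) auto

text \<open>Since x_p differs from x_i, conjugation just substitutes into the two factors; since x_q
  differs from x_i, the results are still free of x_i.\<close>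

lemma cj_Q_t_disjoint:
  assumes "QI n i a b" "p < n" "q < n" "p \<noteq> q" "i \<noteq> p" "i \<noteq> q"
  shows "cj (Q i a b) (t p q) \<in> Nn n"
proof -
  let ?B = "{..<n} - {i}"
  have s: "supp (app (t p q) (gn m)) \<subseteq> ?B" if "m \<in> ?B" for m
    using that assms by (simp add: app_t)
  have ab: "supp (app (t p q) a) \<subseteq> ?B" "supp (app (t p q) b) \<subseteq> ?B"
    using assms(1) s unfolding QI_def by (meson supp_app_subset)+
  have i: "i \<notin> supp a" "i \<notin> supp b" "i \<notin> supp (app (t p q) a)" "i \<notin> supp (app (t p q) b)"
    using ab assms(1) unfolding QI_def by blast+
  have "mu j (app (t p q) (a + b)) = 0" for j
    using assms(1) by (intro mu_app_eq_0) (simp add: QI_def)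
  then have "QI n i (app (t p q) a) (app (t p q) b)"
    using ab assms(1) by (simp add: QI_def)
  moreover have "cj (Q i a b) (t p q) = Q i (app (t p q) a) (app (t p q) b)"
    using assms i by (intro cj_eqI faut_eqI) (auto simp: app_Q app_t)
  ultimately show ?thesis
    using QI_Nn by metis
qed

lemma cj_Q_t_same:
  assumes "QI n p a b" "q < n" "p \<noteq> q"
  shows "cj (Q p a b) (t p q) \<in> Nn n"
proof -
  have p: "p \<notin> supp a" "p \<notin> supp b"
    using assms(1) unfolding QI_def by blast+
  have "QI n p a (gn q + b - gn q)"
    using assms by (simp add: QI_def)
  moreover have "cj (Q p a b) (t p q) = Q p a (gn q + b - gn q)"
    unfolding t_def using assms p by (intro cj_eqI) (simp add: Q_plus)
  ultimately show ?thesis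
    using QI_Nn by metis
qed

text \<open>The only conjugates of the Magnus generators by a transvection \<open>t p q\<close> that are not
  immediate are those moving \<open>x\<^sub>q\<close>.\<close>
lemma cj_K_t_move:
  assumes "p < n" "q < n" "l < n" "p \<noteq> q" "l \<noteq> q"
  shows "cj (Q q (- gn l) (gn l)) (t p q) \<in> Nn n"
proof (cases "l = p")
  case True
  have "cj (Q q (- gn p) (gn p)) (t p q) = Q q (- gn p) (gn p) + Q p (- gn q) (gn q)"
    using assms by (intro cj_eqI faut_eqI)
      (auto simp: app_Q app_t group_normalize simp del: add_uminus_conv_diff)
  then show ?thesis
    using assms True by (auto intro!: Nn.plus Nn.K)
next
  case False
  have "cj (Q q (- gn l) (gn l)) (t p q) = Q q (- gn l) (gn l) + Q p 0 (comm (gn q) (- gn l))"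
    using assms False by (intro cj_eqI faut_eqI)
      (auto simp: app_Q app_t comm_def group_normalize simp del: add_uminus_conv_diff)
  moreover have "QI n p 0 (comm (gn q) (- gn l))"
    using assms False by (auto simp: QI_def)
  ultimately show ?thesis
    using assms by (simp add: Nn.plus Nn.K QI_Nn)
qed

text \<open>The factorization was found by a computer search.\<close>
lemma cj_Kc_t_move_eq:
  assumes "p \<noteq> q" "l \<noteq> q" "l \<noteq> p"
  shows "cj (Q q 0 (comm (gn p) (gn l))) (t p q) =
    Q p (gn q) (- gn q) + Q q (- gn l + gn p) (gn l - gn p) + Q p (gn l) (gn q - gn l - gn q)
      + Q q (- gn p) (gn p) + Q p (- gn q) (gn q)"
  using assms by (intro cj_eqI faut_eqI)
    (auto simp: app_Q app_t comm_def group_normalize simp del: add_uminus_conv_diff)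

lemma cj_Kc_t_move1:
  assumes "p < n" "q < n" "l < n" "p \<noteq> q" "l \<noteq> q"
  shows "cj (Q q 0 (comm (gn p) (gn l))) (t p q) \<in> Nn n"
proof (cases "l = p")
  case True
  then show ?thesis by (simp add: comm_def)
next
  case False
  then show ?thesis
    unfolding cj_Kc_t_move_eq[OF assms(4,5) False]
    using assms by (intro Nn.plus QI_Nn) (simp_all add: QI_def)
qed

lemma cj_Kc_t_move:
  assumes "p < n" "q < n" "a < n" "b < n" "p \<noteq> q" "a \<noteq> q" "b \<noteq> q"
  shows "cj (Q q 0 (comm (gn a) (gn b))) (t p q) \<in> Nn n"
proof -
  consider "a = p" | "b = p" | "a \<noteq> p" "b \<noteq> p" by blast
  then show ?thesis
  proof cases
    case 1
    then show ?thesis using assms cj_Kc_t_move1 by simp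
  next
    case 2
    have "comm (gn a) (gn p) = - comm (gn p) (gn a)"
      by (simp add: comm_def group_normalize del: add_uminus_conv_diff)
    then have "Q q 0 (comm (gn a) (gn b)) = - Q q 0 (comm (gn p) (gn a))"
      using assms by (simp add: 2 Q_uminus comm_def)
    then show ?thesis
      using assms cj_Kc_t_move1[of p n q a] by (simp add: cj_uminus Nn.uminus)
  next
    case 3
    let ?c = "comm (gn a) (gn b)"
    have "cj (Q q 0 ?c) (t p q) = Q q 0 ?c + Q p 0 (gn q - ?c - gn q)"
      using assms 3 by (intro cj_eqI faut_eqI)
        (auto simp: app_Q app_t comm_def group_normalize simp del: add_uminus_conv_diff)
    moreover have "QI n p 0 (gn q - ?c - gn q)"
      using assms 3 by (simp add: QI_def)
    ultimately show ?thesis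
      using assms by (simp add: Nn.plus Nn.Kc QI_Nn)
  qed
qed

lemma cj_Ia: "s \<in> Ia n \<Longrightarrow> g \<in> An n \<Longrightarrow> cj s g \<in> Ia n"
  unfolding cj_def by (rule Ia_conj)

lemma QI_K: "i < n \<Longrightarrow> l < n \<Longrightarrow> i \<noteq> l \<Longrightarrow> QI n i (- gn l) (gn l)"
  by (simp add: QI_def)

lemma QI_Kc: "i < n \<Longrightarrow> a < n \<Longrightarrow> b < n \<Longrightarrow> i \<noteq> a \<Longrightarrow> i \<noteq> b \<Longrightarrow> QI n i 0 (comm (gn a) (gn b))"
  by (simp add: QI_def)

lemma cj_Nn_t:
  assumes "x \<in> Nn n" "p < n" "q < n" "p \<noteq> q"
  shows "cj x (t p q) \<in> Nn n"
  using assms(1)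
proof induction
  case (comm s u)
  then show ?case
    using assms by (auto simp: cj_comm intro!: Nn.comm cj_Ia t_An)
next
  case (K i l)
  then show ?case
    using cj_Q_t_disjoint[OF QI_K[of i n l] assms(2-4)] cj_Q_t_same[OF QI_K[of i n l]]
      cj_K_t_move[OF assms(2,3), of l] assms by blast
next
  case (Kc i a b)
  then show ?case
    using cj_Q_t_disjoint[OF QI_Kc[of i n a b] assms(2-4)] cj_Q_t_same[OF QI_Kc[of i n a b]]
      cj_Kc_t_move[OF assms(2,3), of a b] assms by blast
qed (auto simp: cj_plus cj_uminus intro: Nn.plus Nn.uminus)

section \<open>Signed permutations of the generators from index k on\<close>

definition W :: "nat \<Rightarrow> nat \<Rightarrow> faut set"
  where "W k n = {w. \<exists>\<pi> \<epsilon>. \<pi> permutes {k..<n} \<and> (\<forall>m. m \<notin> {k..<n} \<longrightarrow> \<epsilon> m) \<and>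
    (\<forall>m. app w (gn m) = sgn_if (\<epsilon> m) (gn (\<pi> m)))}"

text \<open>Here \<open>\<epsilon> m\<close> is true when x_m is not inverted.\<close>

definition spm :: "(nat \<Rightarrow> nat) \<Rightarrow> (nat \<Rightarrow> bool) \<Rightarrow> faut"
  where "spm \<pi> \<epsilon> = mk (\<lambda>m. sgn_if (\<epsilon> m) (gn (\<pi> m)))"

lemma sgn_if_sgn_if [simp]: "sgn_if a (sgn_if b x) = sgn_if (a = b) (x :: 'a::group_add)"
  by (simp add: sgn_if_def)

lemma lft_sgn_if [simp]: "lft f (sgn_if b x) = sgn_if b (lft f x)"
  by (simp add: sgn_if_def)

lemma sgn_if_True [simp]: "sgn_if True x = x"
  by (simp add: sgn_if_def)

lemma app_spm:
  assumes "bij \<pi>"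
  shows "app (spm \<pi> \<epsilon>) (gn m) = sgn_if (\<epsilon> m) (gn (\<pi> m))"
  unfolding spm_def
  by (rule app_mk_gn[of "\<lambda>m. sgn_if (\<epsilon> (inv_into UNIV \<pi> m)) (gn (inv_into UNIV \<pi> m))"])
    (use assms in \<open>simp_all add: bij_is_surj surj_f_inv_f bij_is_inj\<close>)

lemma spm_W: "\<pi> permutes {k..<n} \<Longrightarrow> (\<And>m. m \<notin> {k..<n} \<Longrightarrow> \<epsilon> m) \<Longrightarrow> spm \<pi> \<epsilon> \<in> W k n"
  unfolding W_def using app_spm[OF permutes_bij] by blast

lemma WE:
  assumes "w \<in> W k n"
  obtains \<pi> \<epsilon> where "\<pi> permutes {k..<n}" "\<And>m. m \<notin> {k..<n} \<Longrightarrow> \<epsilon> m" "w = spm \<pi> \<epsilon>"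
    "\<And>m. app w (gn m) = sgn_if (\<epsilon> m) (gn (\<pi> m))"
proof -
  obtain \<pi> \<epsilon> where *: "\<pi> permutes {k..<n}" "\<And>m. m \<notin> {k..<n} \<Longrightarrow> \<epsilon> m"
    "\<And>m. app w (gn m) = sgn_if (\<epsilon> m) (gn (\<pi> m))"
    using assms unfolding W_def by blast
  moreover have "w = spm \<pi> \<epsilon>"
    using * by (intro faut_eqI) (simp add: app_spm permutes_bij)
  ultimately show ?thesis using that by blast
qed

lemma W_zero [simp]: "0 \<in> W k n"
  unfolding W_def by (auto intro!: exI[of _ id] exI[of _ "\<lambda>_. True"] permutes_id)

lemma W_plus:
  assumes "w \<in> W k n" "w' \<in> W k n"
  shows "w + w' \<in> W k n"
proof -
  obtain \<pi> \<epsilon> where 1: "\<pi> permutes {k..<n}" "\<And>m. m \<notin> {k..<n} \<Longrightarrow> \<epsilon> m"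
    "\<And>m. app w (gn m) = sgn_if (\<epsilon> m) (gn (\<pi> m))"
    using WE[OF assms(1)] by metis
  obtain \<pi>' \<epsilon>' where 2: "\<pi>' permutes {k..<n}" "\<And>m. m \<notin> {k..<n} \<Longrightarrow> \<epsilon>' m"
    "\<And>m. app w' (gn m) = sgn_if (\<epsilon>' m) (gn (\<pi>' m))"
    using WE[OF assms(2)] by metis
  show ?thesis
    unfolding W_def mem_Collect_eq
  proof (rule exI[of _ "\<pi>' \<circ> \<pi>"], rule exI[of _ "\<lambda>m. \<epsilon> m = \<epsilon>' (\<pi> m)"], intro conjI allI impI)
    show "\<pi>' \<circ> \<pi> permutes {k..<n}"
      using 1 2 by (simp add: permutes_compose)
    show "app (w + w') (gn m) = sgn_if (\<epsilon> m = \<epsilon>' (\<pi> m)) (gn ((\<pi>' \<circ> \<pi>) m))" for m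
      by (simp add: 1 2)
    show "\<epsilon> m = \<epsilon>' (\<pi> m)" if "m \<notin> {k..<n}" for m
      using that 1 2 permutes_not_in[OF 1(1)] by metis
  qed
qed

lemma W_uminus:
  assumes "w \<in> W k n"
  shows "- w \<in> W k n"
proof -
  obtain \<pi> \<epsilon> where 1: "\<pi> permutes {k..<n}" "\<And>m. m \<notin> {k..<n} \<Longrightarrow> \<epsilon> m"
    "\<And>m. app w (gn m) = sgn_if (\<epsilon> m) (gn (\<pi> m))"
    using WE[OF assms(1)] by metis
  let ?p = "inv_into UNIV \<pi>"
  show ?thesis
    unfolding W_def mem_Collect_eq
  proof (rule exI[of _ ?p], rule exI[of _ "\<lambda>m. \<epsilon> (?p m)"], intro conjI allI impI)
    show "?p permutes {k..<n}"
      using 1 by (simp add: permutes_inv)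
    show "app (- w) (gn m) = sgn_if (\<epsilon> (?p m)) (gn (?p m))" for m
      using 1 by (intro app_uminus_eq) (simp add: permutes_inverses)
    show "\<epsilon> (?p m)" if "m \<notin> {k..<n}" for m
      using that 1 permutes_not_in[OF permutes_inv[OF 1(1)]] by metis
  qed
qed

lemma W_An:
  assumes "w \<in> W k n"
  shows "w \<in> An n"
proof -
  have *: "supp (app w (gn i)) \<subseteq> {..<n}" if "w \<in> W k n" "i < n" for w i
  proof -
    obtain \<pi> \<epsilon> where 1: "\<pi> permutes {k..<n}" "\<And>m. app w (gn m) = sgn_if (\<epsilon> m) (gn (\<pi> m))"
      using WE[OF \<open>w \<in> W k n\<close>] by metis
    have "\<pi> i < n"
      using 1 that by (metis atLeastLessThan_iff permutes_in_image permutes_not_in)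
    then show ?thesis by (simp add: 1)
  qed
  obtain \<pi> \<epsilon> where 1: "\<pi> permutes {k..<n}" "\<And>m. m \<notin> {k..<n} \<Longrightarrow> \<epsilon> m"
    "\<And>m. app w (gn m) = sgn_if (\<epsilon> m) (gn (\<pi> m))"
    using WE[OF assms] by metis
  have "app w (gn i) = gn i" if "i \<ge> n" for i
    using that 1 permutes_not_in[OF 1(1), of i] by (simp add: sgn_if_def)
  then show ?thesis
    using * assms W_uminus[OF assms] by (simp add: An_def)
qed

lemma W_mono: "k \<le> k' \<Longrightarrow> W k' n \<subseteq> W k n"
proof
  fix w assume k: "k \<le> k'" and w: "w \<in> W k' n"
  obtain \<pi> \<epsilon> where "\<pi> permutes {k'..<n}" "\<And>m. m \<notin> {k'..<n} \<Longrightarrow> \<epsilon> m" "w = spm \<pi> \<epsilon>"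
    using WE[OF w] by metis
  moreover have "{k'..<n} \<subseteq> {k..<n}"
    using k by auto
  ultimately show "w \<in> W k n"
    using spm_W[of \<pi> k n \<epsilon>] permutes_subset by blast
qed

text \<open>If \<open>w\<close> inverts x_i, rewriting the equation for the inverse generator
  reverses the product, so the two factors change sides and sign.\<close>

lemma cj_Q_W:
  assumes "bij \<pi>" "i \<notin> supp a" "i \<notin> supp b" "w = spm \<pi> \<epsilon>"
  shows "cj (Q i a b) w = (if \<epsilon> i then Q (\<pi> i) (app w a) (app w b) else Q (\<pi> i) (- app w b) (- app w a))"
proof -
  have w: "app w (gn m) = sgn_if (\<epsilon> m) (gn (\<pi> m))" for m
    using assms app_spm by simp
  have *: "\<pi> i \<notin> supp (app w c)" if "i \<notin> supp c" for c
  proof -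
    have "supp (app w c) \<subseteq> - {\<pi> i}"
    proof (rule supp_app_subset)
      show "supp c \<subseteq> - {i}" using that by blast
      show "supp (app w (gn m)) \<subseteq> - {\<pi> i}" if "m \<in> - {i}" for m
        using that bij_is_inj[OF assms(1)] by (auto simp: w dest: injD)
    qed
    then show ?thesis by blast
  qed
  show ?thesis
  proof (intro cj_eqI faut_eqI)
    fix m
    have "\<pi> m = \<pi> i \<longleftrightarrow> m = i"
      using bij_is_inj[OF assms(1)] by (auto dest: injD)
    then show "app (Q i a b + w) (gn m) = app (w + (if \<epsilon> i then Q (\<pi> i) (app w a) (app w b) else Q (\<pi> i) (- app w b) (- app w a))) (gn m)"
      using assms(1-3) * by (cases "m = i")
        (auto simp: app_Q w sgn_if_def group_normalize simp del: add_uminus_conv_diff)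
  qed
qed

lemma cj_QI_W:
  assumes "QI n i a b" "w \<in> W k n"
  shows "cj (Q i a b) w \<in> Nn n"
proof -
  obtain \<pi> \<epsilon> where 1: "\<pi> permutes {k..<n}" "w = spm \<pi> \<epsilon>"
    "\<And>m. app w (gn m) = sgn_if (\<epsilon> m) (gn (\<pi> m))"
    using WE[OF assms(2)] by metis
  have \<pi>: "\<pi> m < n" if "m < n" for m
    using 1 that by (metis atLeastLessThan_iff permutes_in_image permutes_not_in)
  have i: "i \<notin> supp a" "i \<notin> supp b" "i < n"
    using assms(1) unfolding QI_def by blast+
  have s: "supp (app w (gn m)) \<subseteq> {..<n} - {\<pi> i}" if "m \<in> {..<n} - {i}" for m
    using that \<pi>[of m] permutes_inj[OF 1(1)] by (auto simp: 1(3) dest: injD)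
  have ab: "supp (app w a) \<subseteq> {..<n} - {\<pi> i}" "supp (app w b) \<subseteq> {..<n} - {\<pi> i}"
    using assms(1) s unfolding QI_def by (meson supp_app_subset)+
  have m: "mu j (app w (a + b)) = 0" for j
    using assms(1) by (intro mu_app_eq_0) (simp add: QI_def)
  have m: "mu j (app w a) + mu j (app w b) = 0" "mu j (- app w b) + mu j (- app w a) = 0" for j
    using m[of j] by simp_all
  have "QI n (\<pi> i) (app w a) (app w b)" "QI n (\<pi> i) (- app w b) (- app w a)"
    using ab \<pi> i m unfolding QI_def by (auto simp only: supp_uminus)
  then show ?thesis
    unfolding cj_Q_W[OF permutes_bij[OF 1(1)] i(1,2) 1(2)] using QI_Nn by simp
qed

lemma cj_Nn_W:
  assumes "x \<in> Nn n" "w \<in> W k n"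
  shows "cj x w \<in> Nn n"
  using assms(1)
proof induction
  case (comm s u)
  then show ?case
    using assms by (auto simp: cj_comm intro!: Nn.comm cj_Ia W_An)
qed (auto simp: cj_plus cj_uminus intro: Nn.plus Nn.uminus cj_QI_W[OF QI_K assms(2)] cj_QI_W[OF QI_Kc assms(2)])

text \<open>Modulo commutators its elements fix e_0, ..., e_(k-1). It interpolates between
  \<open>An n\<close> for k = 0 and \<open>Nn n\<close> for k = n.\<close>

inductive_set Pk :: "nat \<Rightarrow> nat \<Rightarrow> faut set" for k n where
  N: "x \<in> Nn n \<Longrightarrow> x \<in> Pk k n"
| t: "k \<le> i \<Longrightarrow> i < n \<Longrightarrow> j < n \<Longrightarrow> i \<noteq> j \<Longrightarrow> t i j \<in> Pk k n"
| W: "w \<in> W k n \<Longrightarrow> w \<in> Pk k n"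
| plus: "s \<in> Pk k n \<Longrightarrow> u \<in> Pk k n \<Longrightarrow> s + u \<in> Pk k n"
| uminus: "s \<in> Pk k n \<Longrightarrow> - s \<in> Pk k n"

lemma Pk_An: "s \<in> Pk k n \<Longrightarrow> s \<in> An n"
  by (induction rule: Pk.induct) (auto intro: Nn_An t_An W_An An_plus An_uminus)

lemma Pk_diff: "s \<in> Pk k n \<Longrightarrow> u \<in> Pk k n \<Longrightarrow> s - u \<in> Pk k n"
  by (metis Pk.plus Pk.uminus diff_conv_add_uminus)

definition flip :: "nat \<Rightarrow> faut"
  where "flip q = spm id (\<lambda>m. m \<noteq> q)"

lemma app_flip: "app (flip q) (gn m) = (if m = q then - gn m else gn m)"
  by (simp add: flip_def app_spm sgn_if_def)

lemma flip_W: "k \<le> q \<Longrightarrow> q < n \<Longrightarrow> flip q \<in> W k n"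
  unfolding flip_def by (rule spm_W) (auto simp: permutes_id)

lemma neg_t_flip: "p \<noteq> q \<Longrightarrow> - t p q = cj (t p q) (flip q)"
  by (rule sym, intro cj_eqI faut_eqI) (auto simp: app_flip app_neg_t app_t)

text \<open>That \<open>t p q\<close> conjugates \<open>Nn n\<close> into itself does not give the
  same for its inverse. But the inverse is the conjugate of \<open>t p q\<close> by a flip, and
  signed permutations form a group that is already under control.\<close>

lemma cj_Nn_neg_t:
  assumes "x \<in> Nn n" "p < n" "q < n" "p \<noteq> q"
  shows "cj x (- t p q) \<in> Nn n"
proof -
  have "cj x (- t p q) = cj (cj (cj x (- flip q)) (t p q)) (flip q)"
    unfolding cj_cj neg_t_flip[OF assms(4)] by (simp only: cj_def add.assoc)
  then show ?thesis
    using cj_Nn_W[OF cj_Nn_t[OF cj_Nn_W[OF assms(1) W_uminus[OF flip_W[of 0 q n]]] assms(2-4)]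
        flip_W[of 0 q n]] assms by simp
qed

lemma cj_Nn_Pk:
  assumes "g \<in> Pk k n" "x \<in> Nn n"
  shows "cj x g \<in> Nn n \<and> cj x (- g) \<in> Nn n"
  using assms
proof (induction arbitrary: x rule: Pk.induct)
  case (N y)
  then show ?case
    by (auto simp: cj_def intro: Nn.plus Nn.uminus Nn_diff)
next
  case (t i j)
  then show ?case by (simp add: cj_Nn_t cj_Nn_neg_t)
next
  case (W w)
  then show ?case by (auto intro: cj_Nn_W W_uminus)
next
  case (plus s u)
  then show ?case
    by (simp add: cj_cj[symmetric] minus_add del: add_uminus_conv_diff)
qed auto

section \<open>Nielsen reduction\<close>

definition len :: "fgrp \<Rightarrow> nat"
  where "len w = length (Rep_fgrp w)"

lemma len_uminus [simp]: "len (- w) = len w"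
  by (simp add: len_def uminus_fgrp.rep_eq)

lemma len_eq_0 [simp]: "len w = 0 \<longleftrightarrow> w = 0"
  by (simp add: len_def zero_fgrp.rep_eq[symmetric] Rep_fgrp_inject)

lemma evalw_inv_word [simp]: "evalw (inv_word l) = - evalw l"
proof (induction l)
  case (Cons m l)
  then show ?case
    by (cases m) (auto simp: inv_letter_def sgn_if_def minus_add simp del: add_uminus_conv_diff)
qed simp

lemma Rep_evalw_reduced: "reduced l \<Longrightarrow> Rep_fgrp (evalw l) = l"
  by (simp add: Rep_fgrp_evalw foldr_cons_letter_Nil)

lemma cancel_words:
  assumes "reduced u" "reduced v"
  shows "\<exists>x p y. u = x @ inv_word p \<and> v = p @ y \<and> reduced (x @ y)"
  using assms
proof (induction v arbitrary: u)
  case Nil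
  then show ?case by (intro exI[of _ u] exI[of _ "[]"]) auto
next
  case (Cons l v)
  show ?case
  proof (cases "u \<noteq> [] \<and> last u = inv_letter l")
    case True
    then have u: "u = butlast u @ [inv_letter l]"
      by (metis append_butlast_last_id)
    then have "reduced (butlast u)"
      using Cons.prems(1) by (metis reduced_append)
    then obtain x p y where "butlast u = x @ inv_word p" "v = p @ y" "reduced (x @ y)"
      using Cons.IH[of "butlast u"] Cons.prems(2) reduced_ConsD by blast
    then show ?thesis
      using u by (intro exI[of _ x] exI[of _ "l # p"] exI[of _ y]) auto
  next
    case False
    then have "reduced (u @ l # v)"
      using Cons.prems by (auto simp: reduced_append)
    then show ?thesis
      by (intro exI[of _ u] exI[of _ "[]"] exI[of _ "l # v"]) auto
  qed
qed

text \<open>The number of letters at the end of \<open>u\<close> that cancel against the beginning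
  of \<open>v\<close>: each cancellation shortens the product by two.\<close>

definition canc :: "fgrp \<Rightarrow> fgrp \<Rightarrow> nat"
  where "canc u v = (len u + len v - len (u + v)) div 2"

lemma cancel_fgrp:
  obtains x p y where "Rep_fgrp u = x @ inv_word p" "Rep_fgrp v = p @ y"
    "Rep_fgrp (u + v) = x @ y" "length p = canc u v" "reduced (x @ y)"
proof -
  obtain x p y where *: "Rep_fgrp u = x @ inv_word p" "Rep_fgrp v = p @ y" "reduced (x @ y)"
    using cancel_words[of "Rep_fgrp u" "Rep_fgrp v"] by auto
  have "u + v = evalw (x @ inv_word p) + evalw (p @ y)"
    by (simp flip: *(1,2))
  also have "\<dots> = evalw (x @ y)"
    by (simp add: group_normalize del: add_uminus_conv_diff)
  finally have uv: "Rep_fgrp (u + v) = x @ y"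
    using * Rep_evalw_reduced by metis
  then have "length p = canc u v"
    by (simp add: canc_def len_def *)
  then show ?thesis
    using that * uv by blast
qed

lemma len_plus: "len (u + v) + 2 * canc u v = len u + len v"
  by (rule cancel_fgrp[of u v]) (auto simp: len_def)

text \<open>Outer letters of such a word are mutually inverse and can be stripped in pairs. A single
  letter left in the middle would be its own inverse, and two would not be reduced.\<close>

lemma eq_inv_word_Nil: "reduced z \<Longrightarrow> z = inv_word z \<Longrightarrow> z = []"
proof (induction z rule: length_induct)
  case (1 z)
  show ?case
  proof (cases z)
    case (Cons l z')
    show ?thesis
    proof (cases z' rule: rev_cases)
      case Nil
      then show ?thesis using Cons "1.prems"(2) by simp
    next
      case (snoc m k)
      have "l # m @ [k] = inv_word (l # m @ [k])"
        using "1.prems"(2) unfolding Cons snoc .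
      also have "\<dots> = inv_letter k # inv_word m @ [inv_letter l]"
        by simp
      finally have "l = inv_letter k \<and> m = inv_word m \<and> k = inv_letter l"
        unfolding list.inject append1_eq_conv .
      then have m: "m = inv_word m" and k: "k = inv_letter l"
        by blast+
      have "reduced m"
        using "1.prems"(1) unfolding Cons snoc by (metis append_Cons reduced_ConsD reduced_append)
      moreover have "length m < length z"
        by (simp add: Cons snoc)
      ultimately have "m = []"
        using "1.IH" m by blast
      then show ?thesis
        using "1.prems"(1) k by (simp add: Cons snoc)
    qed
  qed simp
qed

lemma not_reduced_inv: "reduced (x @ inv_word x) \<Longrightarrow> x = []"
proof (cases x rule: rev_cases)
  case (snoc y l)
  assume "reduced (x @ inv_word x)"
  then show ?thesis
    by (simp add: snoc reduced_append)
qed simp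

text \<open>Were half of \<open>u\<close> to cancel in \<open>u + u\<close>, writing
  \<open>u\<close> as \<open>x @ inv_word p\<close> and as \<open>p @ y\<close> would give
  \<open>p = x @ z\<close> with \<open>z\<close> its own inverse. So \<open>z\<close> is empty and
  \<open>u\<close> is the word \<open>x\<close> followed by its inverse, which is reduced only if it
  is empty.\<close>

lemma canc_self:
  assumes "u \<noteq> 0"
  shows "2 * canc u u < len u"
proof (rule ccontr)
  assume *: "\<not> ?thesis"
  obtain x p y where 1: "Rep_fgrp u = x @ inv_word p" "Rep_fgrp u = p @ y" "length p = canc u u"
    using cancel_fgrp[of u u] by metis
  have "len u = length x + length p" "len u = length p + length y"
    unfolding len_def using arg_cong[OF 1(1), of length] arg_cong[OF 1(2), of length] by simp_all
  then have l: "length x = length y" "length x \<le> length p"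
    using * 1(3) by linarith+
  obtain z where z: "p = x @ z"
    using 1 l by (metis append_eq_append_conv_if append_take_drop_id)
  have "inv_word z @ inv_word x = z @ y"
    using 1 by (simp add: z)
  then have "inv_word z = z" "inv_word x = y"
    using append_eq_append_conv[of "inv_word z" z "inv_word x" y] by auto
  moreover have "reduced z"
    using 1 reduced_Rep_fgrp[of u] by (metis reduced_append z)
  ultimately have "z = []"
    using eq_inv_word_Nil[of z] by simp
  then have "Rep_fgrp u = x @ inv_word x"
    using 1 z by simp
  then have "x = []"
    using not_reduced_inv reduced_Rep_fgrp[of u] by metis
  then have "Rep_fgrp u = []"
    using \<open>Rep_fgrp u = x @ inv_word x\<close> by simp
  then have "u = 0"
    by (metis len_def len_eq_0 list.size(3))
  then show False
    using assms by simp
qed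

subsection \<open>Tie-breaking code of the initial half\<close>

text \<open>Letters are read as digits. In base 2n this orders words of a fixed length
  lexicographically, as an arithmetic substitute for a well-ordering of the letters.\<close>

fun code :: "nat \<Rightarrow> nat word \<Rightarrow> nat" where
  "code B [] = 0"
| "code B ((i, b) # w) = (2 * i + (if b then 1 else 0)) * B ^ length w + code B w"

lemma code_append: "code B (u @ v) = code B u * B ^ length v + code B v"
proof (induction u)
  case (Cons m u)
  then show ?case by (cases m) (simp add: algebra_simps power_add)
qed simp

lemma code_less: "fst ` set w \<subseteq> {..<n} \<Longrightarrow> code (2 * n) w < (2 * n) ^ length w"
proof (induction w)
  case (Cons m w)
  obtain i b where m: "m = (i, b)" by (cases m)
  have "i < n" using Cons by (auto simp: m)
  then have "2 * i + (if b then 1 else 0) + 1 \<le> 2 * n" by auto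
  then have "(2 * i + (if b then 1 else 0) + 1) * (2 * n) ^ length w \<le> (2 * n) * (2 * n) ^ length w"
    by (rule mult_right_mono) simp
  moreover have "code (2 * n) w < (2 * n) ^ length w"
    using Cons by simp
  ultimately show ?case
    by (simp add: m algebra_simps)
qed simp

lemma digit_eq:
  fixes a b c d P :: nat
  assumes "a * P + c = b * P + d" "c < P" "d < P"
  shows "a = b" "c = d"
proof -
  have "(a * P + c) div P = a" "(b * P + d) div P = b"
    using assms(2,3) by simp_all
  then show "a = b" using assms(1) by metis
  then show "c = d" using assms(1) by simp
qed

lemma code_inj:
  assumes "length u = length v" "fst ` set u \<subseteq> {..<n}" "fst ` set v \<subseteq> {..<n}" "code (2 * n) u = code (2 * n) v"
  shows "u = v"
  using assms
proof (induction rule: list_induct2)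
  case (Cons a u b v)
  obtain i e j f where ab: "a = (i, e)" "b = (j, f)"
    by (meson surj_pair)
  let ?a = "2 * i + (if e then 1 else 0 :: nat)" and ?b = "2 * j + (if f then 1 else 0 :: nat)"
  let ?P = "(2 * n) ^ length u"
  have lt: "code (2 * n) u < ?P" "code (2 * n) v < ?P"
    using Cons code_less[of u n] code_less[of v n] by auto
  have eq: "?a * ?P + code (2 * n) u = ?b * ?P + code (2 * n) v"
    using Cons.prems Cons.hyps by (simp add: ab)
  have "?a = ?b" "code (2 * n) u = code (2 * n) v"
    using digit_eq[OF eq lt] .
  moreover from this(1) have "i = j \<and> e = f"
    by (cases e; cases f; simp; presburger)
  ultimately show ?case
    using Cons by (simp add: ab)
qed simp

text \<open>Nielsen's tie-breaker among words of equal length compares the initial halves of an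
  element and of its inverse; \<open>m2\<close> adds the two codes.\<close>

definition hcode :: "nat \<Rightarrow> fgrp \<Rightarrow> nat"
  where "hcode B u = code B (take ((len u + 1) div 2) (Rep_fgrp u))"

definition m2 :: "nat \<Rightarrow> fgrp \<Rightarrow> nat"
  where "m2 B u = hcode B u + hcode B (- u)"

lemma m2_uminus [simp]: "m2 B (- u) = m2 B u"
  by (simp add: m2_def)

text \<open>Replacing the last block changes at most the second half of \<open>u\<close>, so the
  first summand of \<open>m2\<close> is untouched. In the inverse the block comes first and fits
  into the initial half, where its smaller code decides.\<close>

lemma m2_less:
  assumes u: "Rep_fgrp u = x @ inv_word p" and u': "Rep_fgrp u' = x @ inv_word q"
    and l: "length p = length q" "length p \<le> length x" and c: "code (2 * n) q < code (2 * n) p"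
    and s: "supp u \<subseteq> {..<n}" "supp u' \<subseteq> {..<n}"
  shows "m2 (2 * n) u' < m2 (2 * n) u"
proof -
  let ?k = "(length x + length q + 1) div 2"
  have k: "(len u + 1) div 2 = ?k" "(len u' + 1) div 2 = ?k"
    using u u' l by (auto simp: len_def)
  have 1: "hcode (2 * n) u = hcode (2 * n) u'"
    unfolding hcode_def k using u u' l by simp
  have neg: "Rep_fgrp (- u) = p @ inv_word x" "Rep_fgrp (- u') = q @ inv_word x"
    by (simp_all add: uminus_fgrp.rep_eq u u')
  let ?z = "take (?k - length q) (inv_word x)"
  have h: "hcode (2 * n) (- u) = code (2 * n) (p @ ?z)" "hcode (2 * n) (- u') = code (2 * n) (q @ ?z)"
    unfolding hcode_def len_uminus k neg using l by simp_all
  have "code (2 * n) q * (2 * n) ^ length ?z + code (2 * n) ?z < (code (2 * n) q + 1) * (2 * n) ^ length ?z"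
  proof -
    have "set ?z \<subseteq> set (inv_word x)" by (rule set_take_subset)
    moreover have "fst ` set (inv_word x) = fst ` set x"
      by (simp add: inv_word_def image_image)
    moreover have "fst ` set x \<subseteq> {..<n}"
      using s u by (auto simp: supp_def)
    ultimately have "fst ` set ?z \<subseteq> {..<n}" by blast
    then show ?thesis
      using code_less[of ?z n] by simp
  qed
  also have "\<dots> \<le> code (2 * n) p * (2 * n) ^ length ?z"
    using c by (intro mult_right_mono) auto
  finally have "hcode (2 * n) (- u') < hcode (2 * n) (- u)"
    unfolding h code_append by (rule order_less_le_trans) (rule le_add1)
  then show ?thesis
    using 1 by (simp add: m2_def)
qed

text \<open>Left and right multiplication of x_i by a letter differ by a conjugation of x_i, which
  lies in \<open>Nn n\<close>.\<close>

lemma Q_letter_Pk: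
  assumes "i < n" "j < n" "i \<noteq> j"
  shows "Q i 0 (sgn_if f (gn j)) \<in> Pk 0 n" "Q i (sgn_if f (gn j)) 0 \<in> Pk 0 n"
proof -
  show 1: "Q i 0 (sgn_if f (gn j)) \<in> Pk 0 n" for f
    using Pk.t[of 0 i n j] Pk.uminus[OF Pk.t[of 0 i n j]] assms
    by (auto simp: t_def sgn_if_def Q_uminus)
  let ?x = "sgn_if f (gn j)"
  have "QI n i ?x (- ?x)"
    using assms by (simp add: QI_def)
  then have "Q i ?x (- ?x) + Q i 0 ?x \<in> Pk 0 n"
    by (intro Pk.plus Pk.N QI_Nn 1)
  moreover have "Q i ?x (- ?x) + Q i 0 ?x = Q i ?x 0"
    using assms by (simp add: Q_plus)
  ultimately show "Q i ?x 0 \<in> Pk 0 n" by simp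
qed

definition letter_val :: "faut \<Rightarrow> nat \<times> bool \<Rightarrow> fgrp"
  where "letter_val \<psi> a = sgn_if (snd a) (app \<psi> (gn (fst a)))"

lemma letter_val_inv_letter: "letter_val \<psi> (inv_letter a) = - letter_val \<psi> a"
  by (simp add: letter_val_def inv_letter_def sgn_if_def)

text \<open>For a positive letter this is right multiplication of the generator. Right
  multiplication of an inverse letter is left multiplication of the generator by the inverse
  factor.\<close>

lemma Nielsen_move:
  assumes "\<psi> \<in> An n" "fst a < n" "fst b < n" "fst a \<noteq> fst b"
  obtains s where "s \<in> Pk 0 n" "\<And>m. m \<noteq> fst a \<Longrightarrow> app (s + \<psi>) (gn m) = app \<psi> (gn m)"
    "letter_val (s + \<psi>) a = letter_val \<psi> a + letter_val \<psi> b"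
proof (cases "snd a")
  case True
  show ?thesis
  proof (rule that[of "Q (fst a) 0 (sgn_if (snd b) (gn (fst b)))"])
    show "letter_val (Q (fst a) 0 (sgn_if (snd b) (gn (fst b))) + \<psi>) a = letter_val \<psi> a + letter_val \<psi> b"
      using True assms by (simp add: letter_val_def app_Q)
  qed (use assms in \<open>auto simp: app_Q intro!: Q_letter_Pk\<close>)
next
  case False
  show ?thesis
  proof (rule that[of "Q (fst a) (sgn_if (\<not> snd b) (gn (fst b))) 0"])
    show "letter_val (Q (fst a) (sgn_if (\<not> snd b) (gn (fst b))) 0 + \<psi>) a = letter_val \<psi> a + letter_val \<psi> b"
      using False assms by (auto simp: letter_val_def app_Q sgn_if_def group_normalize simp del: add_uminus_conv_diff)
  qed (use assms in \<open>auto simp: app_Q intro!: Q_letter_Pk\<close>)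
qed

definition M1 :: "nat \<Rightarrow> faut \<Rightarrow> nat"
  where "M1 n \<psi> = (\<Sum>i<n. len (app \<psi> (gn i)))"

definition M2 :: "nat \<Rightarrow> faut \<Rightarrow> nat"
  where "M2 n \<psi> = (\<Sum>i<n. m2 (2 * n) (app \<psi> (gn i)))"

lemma sum_change_one:
  fixes f g :: "nat \<Rightarrow> nat"
  assumes "i < n" "\<And>m. m \<noteq> i \<Longrightarrow> f m = g m"
  shows "(\<Sum>m<n. f m) + g i = (\<Sum>m<n. g m) + f i"
proof -
  have "(\<Sum>m\<in>{..<n} - {i}. f m) = (\<Sum>m\<in>{..<n} - {i}. g m)"
    using assms by (intro sum.cong) auto
  then show ?thesis
    using assms(1) by (simp add: sum.remove[of "{..<n}" i])
qed

text \<open>Lexicographic minimality of total length and tie-breaker within a coset of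
  \<open>Pk 0 n\<close>.\<close>

locale nielsen_reduced =
  fixes n :: nat and \<psi> :: faut
  assumes psi: "\<psi> \<in> An n"
    and minimal: "\<And>s. s \<in> Pk 0 n \<Longrightarrow> M1 n (s + \<psi>) > M1 n \<psi> \<or> M1 n (s + \<psi>) = M1 n \<psi> \<and> M2 n (s + \<psi>) \<ge> M2 n \<psi>"
begin

abbreviation "U \<equiv> letter_val \<psi>"

lemma U_neq_0: "U a \<noteq> 0"
proof
  assume "U a = 0"
  then have "app \<psi> (gn (fst a)) = app \<psi> 0"
    by (auto simp: letter_val_def sgn_if_def split: if_splits)
  then have "gn (fst a) = 0"
    by (metis app_neg_app(1))
  then show False
    by (metis insert_not_empty supp_gn supp_zero)
qed

lemma U_supp: "fst a < n \<Longrightarrow> supp (U a) \<subseteq> {..<n}"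
  using An_supp[OF psi, of "gn (fst a)"] by (simp add: letter_val_def)

lemma min_move:
  assumes "fst a < n" "fst b < n" "fst a \<noteq> fst b"
  shows "len (U a) < len (U a + U b) \<or> len (U a) = len (U a + U b) \<and> m2 (2 * n) (U a) \<le> m2 (2 * n) (U a + U b)"
proof -
  obtain s where s: "s \<in> Pk 0 n" "\<And>m. m \<noteq> fst a \<Longrightarrow> app (s + \<psi>) (gn m) = app \<psi> (gn m)"
    "letter_val (s + \<psi>) a = U a + U b"
    using Nielsen_move[OF psi assms] by metis
  have l: "len (app (s + \<psi>) (gn (fst a))) = len (U a + U b)" "len (app \<psi> (gn (fst a))) = len (U a)"
    "m2 (2 * n) (app (s + \<psi>) (gn (fst a))) = m2 (2 * n) (U a + U b)"
    "m2 (2 * n) (app \<psi> (gn (fst a))) = m2 (2 * n) (U a)"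
    unfolding s(3)[symmetric] by (simp_all add: letter_val_def sgn_if_def)
  have "M1 n (s + \<psi>) + len (U a) = M1 n \<psi> + len (U a + U b)"
    "M2 n (s + \<psi>) + m2 (2 * n) (U a) = M2 n \<psi> + m2 (2 * n) (U a + U b)"
    unfolding M1_def M2_def l[symmetric] using assms s by (auto intro!: sum_change_one simp del: app_add)
  then show ?thesis
    using minimal[OF s(1)] by linarith
qed

text \<open>If more than half of the second factor cancelled, the Nielsen move replacing
  \<open>U a\<close> by \<open>U a + U b\<close> would shorten the tuple. For equal generators there
  is no such move, and \<open>canc_self\<close> takes over.\<close>

lemma canc_le1:
  assumes "fst a < n" "fst b < n" "b \<noteq> inv_letter a"
  shows "2 * canc (U a) (U b) \<le> len (U b)"
proof (cases "fst a = fst b")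
  case True
  then have "a = b"
    using assms by (cases a; cases b) (auto simp: inv_letter_def)
  then show ?thesis
    using canc_self[OF U_neq_0[of b]] by simp
next
  case False
  then show ?thesis
    using min_move[OF assms(1,2)] len_plus[of "U a" "U b"] by linarith
qed

lemma canc_uminus: "canc (- v) (- u) = canc u v"
proof -
  have "len (- v + - u) = len (u + v)"
    by (metis len_uminus minus_add)
  then show ?thesis
    by (simp add: canc_def add.commute del: add_uminus_conv_diff)
qed

lemma canc_le2:
  assumes "fst a < n" "fst b < n" "b \<noteq> inv_letter a"
  shows "2 * canc (U a) (U b) \<le> len (U a)"
  using canc_le1[of "inv_letter b" "inv_letter a"] assms
  by (auto simp: letter_val_inv_letter canc_uminus)

text \<open>The neighbours can never consume the middle factor completely. Otherwise both
  cancellations are exactly one half, the middle factor is \<open>p @ inv_word q\<close>, and a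
  length-preserving move exchanges \<open>p\<close> and \<open>q\<close> at the end of one
  neighbour. One of the two directions lowers the tie-breaker.\<close>

lemma canc_N2:
  assumes "fst a < n" "fst b < n" "fst d < n" "b \<noteq> inv_letter a" "d \<noteq> inv_letter b"
  shows "canc (U a) (U b) + canc (U b) (U d) < len (U b)"
proof (rule ccontr)
  assume "\<not> ?thesis"
  then have half: "2 * canc (U a) (U b) = len (U b)" "2 * canc (U b) (U d) = len (U b)"
    using canc_le1[OF assms(1,2,4)] canc_le2[OF assms(2,3,5)] by linarith+
  have "fst a \<noteq> fst b" "fst b \<noteq> fst d"
  proof -
    have "a \<noteq> b" "b \<noteq> d"
      using half canc_self[OF U_neq_0[of b]] by auto
    then show "fst a \<noteq> fst b" "fst b \<noteq> fst d"
      using assms by (cases a; cases b; cases d; auto simp: inv_letter_def)+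
  qed
  obtain x p y where 1: "Rep_fgrp (U a) = x @ inv_word p" "Rep_fgrp (U b) = p @ y"
    "Rep_fgrp (U a + U b) = x @ y" "length p = canc (U a) (U b)"
    using cancel_fgrp[of "U a" "U b"] by metis
  obtain y' q z where 2: "Rep_fgrp (U b) = y' @ inv_word q" "Rep_fgrp (U d) = q @ z"
    "Rep_fgrp (U b + U d) = y' @ z" "length q = canc (U b) (U d)"
    using cancel_fgrp[of "U b" "U d"] by metis
  have lpq: "length p = length q"
    using 1 2 half by simp
  have "length y' = length p"
    using arg_cong[OF 2(1), of length] half 1 2 by (simp add: len_def)
  then have yy: "y' = p" "y = inv_word q"
    using 1(2) 2(1) by (metis append_eq_append_conv)+
  have supps: "supp (U a) \<subseteq> {..<n}" "supp (U b) \<subseteq> {..<n}" "supp (U d) \<subseteq> {..<n}"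
    using assms U_supp by simp_all
  have "p \<noteq> q"
  proof
    assume "p = q"
    then have "p = []"
      using 2(1) yy not_reduced_inv[of p] reduced_Rep_fgrp[of "U b"] by simp
    then have "len (U b) = 0"
      using half 1 by simp
    then show False
      using U_neq_0 by simp
  qed
  moreover have "fst ` set p \<subseteq> {..<n}" "fst ` set q \<subseteq> {..<n}"
    using 1(2) 2(2) supps by (auto simp: supp_def)
  ultimately have "code (2 * n) p \<noteq> code (2 * n) q"
    using code_inj lpq by blast
  then consider (less) "code (2 * n) q < code (2 * n) p" | (greater) "code (2 * n) p < code (2 * n) q"
    by linarith
  then show False
  proof cases
    case less
    have "length p \<le> length x"
      using canc_le2[OF assms(1,2,4)] 1 arg_cong[OF 1(1), of length] by (simp add: len_def)
    then have "m2 (2 * n) (U a + U b) < m2 (2 * n) (U a)"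
      using 1 yy lpq less supps by (intro m2_less[of _ x p _ q]) simp_all
    moreover have "len (U a + U b) = len (U a)"
      using len_plus[of "U a" "U b"] half by linarith
    ultimately show False
      using min_move[OF assms(1,2) \<open>fst a \<noteq> fst b\<close>] by linarith
  next
    case greater
    let ?a = "inv_letter d" and ?b = "inv_letter b"
    have "length q \<le> length z"
      using canc_le1[OF assms(2,3,5)] 2 arg_cong[OF 2(2), of length] by (simp add: len_def)
    moreover have "Rep_fgrp (U ?a) = inv_word z @ inv_word q"
      by (simp add: letter_val_inv_letter uminus_fgrp.rep_eq 2)
    moreover have e: "U ?a + U ?b = - (U b + U d)"
      by (simp add: letter_val_inv_letter minus_add del: add_uminus_conv_diff)
    moreover have "Rep_fgrp (- (U b + U d)) = inv_word z @ inv_word p"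
      unfolding uminus_fgrp.rep_eq 2 yy by simp
    ultimately have "m2 (2 * n) (U ?a + U ?b) < m2 (2 * n) (U ?a)"
      using lpq greater supps by (intro m2_less[of _ "inv_word z" q _ p]) (simp_all add: letter_val_inv_letter)
    moreover have "len (U ?a + U ?b) = len (U ?a)"
      using len_plus[of "U b" "U d"] half unfolding e by (simp add: letter_val_inv_letter)
    ultimately show False
      using min_move[of ?a ?b] assms \<open>fst b \<noteq> fst d\<close> by auto
  qed
qed

text \<open>Here \<open>s\<close> is the surviving end of the image of the last letter, long enough
  that the next factor cannot consume it. Hence every letter of \<open>l\<close> leaves at least one
  letter in the image.\<close>

lemma growth:
  assumes "reduced l" "l \<noteq> []" "fst ` set l \<subseteq> {..<n}"
  shows "\<exists>w r s. Rep_fgrp (app \<psi> (evalw l)) = w @ s \<and> Rep_fgrp (U (last l)) = r @ s \<and> s \<noteq> [] \<and>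
    length l \<le> length w + 1 \<and>
    (\<forall>d. fst d < n \<longrightarrow> d \<noteq> inv_letter (last l) \<longrightarrow> canc (U (last l)) (U d) < length s)"
  using assms
proof (induction l rule: rev_induct)
  case (snoc b l)
  have b: "fst b < n" using snoc by auto
  show ?case
  proof (cases "l = []")
    case True
    have "Rep_fgrp (U b) \<noteq> []"
      by (metis U_neq_0 len_def len_eq_0 list.size(3))
    moreover have "canc (U b) (U d) < length (Rep_fgrp (U b))" if "fst d < n" "d \<noteq> inv_letter b" for d
      using canc_le2[OF b that] U_neq_0[of b] by (simp add: len_def[symmetric] del: len_eq_0) (use len_eq_0 in fastforce)
    ultimately show ?thesis
      using True by (intro exI[of _ "[]"] exI[of _ "Rep_fgrp (U b)"]) (cases b, auto simp: letter_val_def)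
  next
    case False
    let ?a = "last l"
    have a: "fst ?a < n"
      using snoc.prems(3) last_in_set[OF False] by (fastforce simp del: last_in_set)
    have ab: "b \<noteq> inv_letter ?a"
      using snoc.prems False by (simp add: reduced_append)
    obtain w r s where IH: "Rep_fgrp (app \<psi> (evalw l)) = w @ s" "Rep_fgrp (U ?a) = r @ s" "s \<noteq> []"
      "length l \<le> length w + 1" "\<forall>d. fst d < n \<longrightarrow> d \<noteq> inv_letter ?a \<longrightarrow> canc (U ?a) (U d) < length s"
      using snoc.IH False snoc.prems unfolding reduced_append set_append image_Un Un_subset_iff by blast
    have "canc (U ?a) (U b) < length s"
      using IH(5) ab b by blast
    note IH = IH(1-4) this
    obtain x p y where 1: "Rep_fgrp (U ?a) = x @ inv_word p" "Rep_fgrp (U b) = p @ y"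
      "length p = canc (U ?a) (U b)" "reduced (x @ y)"
      using cancel_fgrp[of "U ?a" "U b"] by metis
    have "length r \<le> length x"
      using arg_cong[OF 1(1), of length] IH 1 by simp
    then obtain s' where s': "x = r @ s'" "s = s' @ inv_word p"
      using IH(2) 1(1) by (metis append_eq_append_conv_if append_take_drop_id append_eq_conv_conj append.assoc)
    have "s' \<noteq> []"
      using IH(5) 1(3) s' by auto
    have "app \<psi> (evalw l) = evalw (w @ s)" "U b = evalw (p @ y)"
      using IH(1) 1(2) evalw_Rep_fgrp by metis+
    then have "app \<psi> (evalw l) + U b = evalw (w @ s' @ y)"
      by (simp add: s' group_normalize del: add_uminus_conv_diff)
    then have e: "app \<psi> (evalw (l @ [b])) = evalw ((w @ s') @ y)"
      by (cases b) (simp add: letter_val_def)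
    have "reduced (w @ s')"
      using reduced_Rep_fgrp[of "app \<psi> (evalw l)"] unfolding IH(1) s' by (metis append.assoc reduced_append)
    moreover have "reduced (s' @ y)"
      using 1(4) unfolding s' by (metis append.assoc reduced_append)
    ultimately have "reduced ((w @ s') @ y)"
      using \<open>s' \<noteq> []\<close> by (auto simp: reduced_append)
    then have R: "Rep_fgrp (app \<psi> (evalw (l @ [b]))) = (w @ s') @ y"
      unfolding e by (rule Rep_evalw_reduced)
    have ly: "length y + length p = len (U b)"
      using 1(2) by (simp add: len_def)
    have "2 * length p \<le> len (U b)"
      using canc_le1[OF a b ab] 1 by simp
    moreover have "len (U b) \<noteq> 0"
      using U_neq_0 by simp
    ultimately have "length y \<noteq> 0"
      using ly by linarith
    then have "y \<noteq> []"
      by simp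
    moreover have "canc (U b) (U d) < length y" if "fst d < n" "d \<noteq> inv_letter b" for d
      using canc_N2[OF a b that(1) ab that(2)] ly 1(3) by linarith
    moreover have "length (l @ [b]) \<le> length (w @ s') + 1"
      using IH(4) \<open>s' \<noteq> []\<close> by (cases s') auto
    ultimately show ?thesis
      using R 1(2) by (intro exI[of _ "w @ s'"] exI[of _ p] exI[of _ y]) simp
  qed
qed simp

text \<open>A generator x_j is the image of a reduced word, and by \<open>growth\<close> that word
  cannot be longer than one letter.\<close>

lemma inverse_W: "- \<psi> \<in> W 0 n"
proof -
  have "\<exists>i b. app (- \<psi>) (gn j) = sgn_if b (gn i) \<and> (j < n \<longrightarrow> i < n) \<and> (n \<le> j \<longrightarrow> i = j \<and> b)" for j
  proof (cases "j < n")
    case True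
    let ?v = "app (- \<psi>) (gn j)"
    have v: "fst ` set (Rep_fgrp ?v) \<subseteq> {..<n}"
      using An_supp[OF An_uminus[OF psi], of "gn j"] True unfolding supp_def[symmetric] by simp
    have e: "app \<psi> (evalw (Rep_fgrp ?v)) = gn j"
      by simp
    have "Rep_fgrp ?v \<noteq> []"
    proof
      assume "Rep_fgrp ?v = []"
      then have "gn j = 0" using e by simp
      then show False by (metis insert_not_empty supp_gn supp_zero)
    qed
    from growth[OF reduced_Rep_fgrp this v] obtain w r s where
      g: "Rep_fgrp (gn j) = w @ s" "s \<noteq> []" "length (Rep_fgrp ?v) \<le> length w + 1"
      unfolding e by blast
    have "length (w @ s) = 1"
      unfolding g(1)[symmetric] by (simp add: gn.rep_eq)
    then have "length (Rep_fgrp ?v) = 1"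
      using g \<open>Rep_fgrp ?v \<noteq> []\<close> by (cases s; cases "Rep_fgrp ?v") auto
    then obtain m where m: "Rep_fgrp ?v = [m]"
      by (cases "Rep_fgrp ?v") auto
    then have "?v = sgn_if (snd m) (gn (fst m))"
      using evalw_Rep_fgrp[of ?v] by (cases m) simp
    moreover have "fst m < n"
      using v m by simp
    ultimately show ?thesis using True by auto
  next
    case False
    then show ?thesis
      using An_app_fix[OF An_uminus[OF psi], of j] by (intro exI[of _ j] exI[of _ True]) auto
  qed
  then obtain \<pi> \<epsilon> where *: "\<And>j. app (- \<psi>) (gn j) = sgn_if (\<epsilon> j) (gn (\<pi> j))"
    "\<And>j. j < n \<Longrightarrow> \<pi> j < n" "\<And>j. n \<le> j \<Longrightarrow> \<pi> j = j \<and> \<epsilon> j"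
    by metis
  have "inj \<pi>"
  proof (rule injI)
    fix i j assume "\<pi> i = \<pi> j"
    then have "app (- \<psi>) (gn i) = app (- \<psi>) (gn j) \<or> app (- \<psi>) (gn i) = app (- \<psi>) (- gn j)"
      by (auto simp: * sgn_if_def)
    then have "gn i = gn j \<or> gn i = - gn j"
      by (metis app_neg_app(2))
    then have "supp (gn i) = supp (gn j)"
      by (elim disjE) (simp_all only: supp_uminus)
    then show "i = j" by simp
  qed
  have "\<pi> permutes {..<n}"
  proof (rule bij_imp_permutes)
    show "bij_betw \<pi> {..<n} {..<n}"
      using \<open>inj \<pi>\<close> *(2) by (intro bij_betw_imageI endo_inj_surj) (auto intro: inj_on_subset)
  qed (use * in auto)
  then show ?thesis
    unfolding W_def using * by (auto intro!: exI[of _ \<pi>] exI[of _ \<epsilon>] simp: atLeast0LessThan)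
qed

end

text \<open>Every coset contains a lexicographically minimal element, and \<open>inverse_W\<close>
  makes it the inverse of a signed permutation.\<close>

theorem An_eq_Pk: "An n = Pk 0 n"
proof
  show "Pk 0 n \<subseteq> An n" using Pk_An by blast
  show "An n \<subseteq> Pk 0 n"
  proof
    fix \<phi> assume phi: "\<phi> \<in> An n"
    let ?r = "measures [\<lambda>s. M1 n (s + \<phi>), \<lambda>s. M2 n (s + \<phi>)]"
    have "0 \<in> Pk 0 n" by (simp add: Pk.N)
    then obtain s where s: "s \<in> Pk 0 n" "\<And>s'. (s', s) \<in> ?r \<Longrightarrow> s' \<notin> Pk 0 n"
      using wfE_min[OF wf_measures] by metis
    have "nielsen_reduced n (s + \<phi>)"
    proof
      show "s + \<phi> \<in> An n"
        using s phi by (intro An_plus) (simp_all add: Pk_An)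
      fix s' assume "s' \<in> Pk 0 n"
      then have "s' + s \<in> Pk 0 n" using s by (intro Pk.plus)
      then have "(s' + s, s) \<notin> ?r" using s(2) by blast
      then show "M1 n (s + \<phi>) < M1 n (s' + (s + \<phi>)) \<or>
          M1 n (s' + (s + \<phi>)) = M1 n (s + \<phi>) \<and> M2 n (s + \<phi>) \<le> M2 n (s' + (s + \<phi>))"
        by (auto simp: add.assoc)
    qed
    then have "- (s + \<phi>) \<in> W 0 n"
      by (rule nielsen_reduced.inverse_W)
    then have "- s - - (s + \<phi>) \<in> Pk 0 n"
      using Pk_diff[OF Pk.uminus[OF s(1)] Pk.W] by blast
    moreover have "- s - - (s + \<phi>) = \<phi>"
      by (simp add: group_normalize del: add_uminus_conv_diff)
    ultimately show "\<phi> \<in> Pk 0 n" by simp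
  qed
qed

section \<open>Relations modulo the Magnus subgroup\<close>

lemma cj_Nn: "x \<in> Nn n \<Longrightarrow> g \<in> An n \<Longrightarrow> cj x g \<in> Nn n"
  using cj_Nn_Pk An_eq_Pk by blast

text \<open>Equality in the quotient of \<open>An n\<close> by the normal subgroup
  \<open>Nn n\<close>. This quotient turns out to be the image in GL(n, Z), but only after
  \<open>Ia_eq_Nn\<close>.\<close>

definition eqN :: "nat \<Rightarrow> faut \<Rightarrow> faut \<Rightarrow> bool"
  where "eqN n x y \<longleftrightarrow> x - y \<in> Nn n"

lemma eqN_refl [simp]: "eqN n x x"
  by (simp add: eqN_def)

lemma eqN_sym: "eqN n x y \<Longrightarrow> eqN n y x"
  unfolding eqN_def using Nn.uminus[of "x - y" n] by simp

lemma eqN_trans [trans]: "eqN n x y \<Longrightarrow> eqN n y z \<Longrightarrow> eqN n x z"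
  unfolding eqN_def using Nn.plus[of "x - y" n "y - z"] by (simp add: group_normalize del: add_uminus_conv_diff)

lemma eqN_plus: "eqN n x y \<Longrightarrow> eqN n u v \<Longrightarrow> x \<in> An n \<Longrightarrow> eqN n (x + u) (y + v)"
proof -
  assume a: "eqN n x y" "eqN n u v" "x \<in> An n"
  have "cj (u - v) (- x) + (x - y) \<in> Nn n"
    using a by (intro Nn.plus cj_Nn An_uminus) (auto simp: eqN_def)
  then show "eqN n (x + u) (y + v)"
    by (simp add: eqN_def cj_def group_normalize del: add_uminus_conv_diff)
qed

lemma eqN_plus_left: "eqN n u v \<Longrightarrow> x \<in> An n \<Longrightarrow> eqN n (x + u) (x + v)"
  by (rule eqN_plus) simp_all

lemma eqN_plus_right: "eqN n x y \<Longrightarrow> eqN n (x + u) (y + u)"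
  by (simp add: eqN_def group_normalize del: add_uminus_conv_diff)

lemma eqN_uminus: "eqN n x y \<Longrightarrow> x \<in> An n \<Longrightarrow> eqN n (- x) (- y)"
proof -
  assume a: "eqN n x y" "x \<in> An n"
  have "cj (y - x) x \<in> Nn n"
    using a eqN_sym by (intro cj_Nn) (auto simp: eqN_def)
  then show "eqN n (- x) (- y)"
    by (simp add: eqN_def cj_def group_normalize del: add_uminus_conv_diff)
qed

lemma eqN_cj: "eqN n x y \<Longrightarrow> g \<in> An n \<Longrightarrow> eqN n (cj x g) (cj y g)"
  unfolding eqN_def using cj_Nn[of "x - y" n g] by (simp add: cj_diff)

lemma eqN_sgn_if: "eqN n x y \<Longrightarrow> x \<in> An n \<Longrightarrow> eqN n (sgn_if b x) (sgn_if b y)"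
  by (simp add: sgn_if_def eqN_uminus)

lemma cj_sgn_if: "cj (sgn_if b x) g = sgn_if b (cj x g)"
  by (simp add: sgn_if_def cj_uminus)

lemma cj_An: "x \<in> An n \<Longrightarrow> g \<in> An n \<Longrightarrow> cj x g \<in> An n"
  unfolding cj_def by (intro An_plus An_uminus)

definition te :: "bool \<Rightarrow> nat \<Rightarrow> nat \<Rightarrow> faut"
  where "te e i j = sgn_if e (t i j)"

lemma neg_te: "- te e i j = te (\<not> e) i j"
  by (simp add: te_def sgn_if_def)

lemma te_An: "i < n \<Longrightarrow> j < n \<Longrightarrow> i \<noteq> j \<Longrightarrow> te e i j \<in> An n"
  by (simp add: te_def An_sgn_if t_An)

lemma cj_back: "cj (cj x g) (- g) = x" "cj (cj x (- g)) g = x"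
  by (simp_all add: cj_cj)

section \<open>Steinberg relations modulo the Magnus subgroup\<close>

context
  fixes n p q :: nat
  assumes pq: "p < n" "q < n" "p \<noteq> q"
begin

text \<open>Transvections with a common source commute only after a commutator correction at that
  generator; in the remaining case they commute exactly.\<close>

lemma rel1_pos:
  assumes "i < n" "j < n" "i \<noteq> j" "i \<noteq> q" "j \<noteq> p"
  shows "eqN n (cj (t i j) (t p q)) (t i j)"
proof (cases "i = p")
  case True
  have "cj (t p j) (t p q) = Q p 0 (gn q + gn j - gn q)"
    unfolding t_def using assms pq by (intro cj_eqI) (simp add: Q_plus)
  moreover have "Q p 0 (gn q + gn j - gn q) - t p j = Q p 0 (- gn j + gn q + gn j - gn q)"
    unfolding t_def diff_conv_add_uminus[of _ "Q p 0 (gn j)"] using assms pq True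
    by (simp add: Q_uminus Q_plus group_normalize del: add_uminus_conv_diff)
  moreover have "Q p 0 (- gn j + gn q + gn j - gn q) \<in> Nn n"
    using assms pq True by (intro QI_Nn) (simp add: QI_def)
  ultimately show ?thesis
    by (simp add: eqN_def True)
next
  case False
  have "cj (t i j) (t p q) = t i j"
    using assms pq False by (intro cj_eqI faut_eqI) (auto simp: app_t)
  then show ?thesis by simp
qed

lemma rel2_pos:
  assumes "i < n" "i \<noteq> p" "i \<noteq> q"
  shows "eqN n (cj (t i p) (t p q)) (t i p + t i q)"
proof -
  have "cj (t i p) (t p q) = t i q + t i p"
    using assms pq by (intro cj_eqI faut_eqI) (auto simp: app_t add.assoc)
  moreover have "t i q + t i p = Q i 0 (gn p + gn q)" "t i p + t i q = Q i 0 (gn q + gn p)"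
    unfolding t_def using assms pq by (simp_all add: Q_plus)
  moreover have "Q i 0 (gn p + gn q) - Q i 0 (gn q + gn p) = Q i 0 (- gn p - gn q + (gn p + gn q))"
    unfolding diff_conv_add_uminus[of "Q i 0 (gn p + gn q)"] using assms pq
    by (simp add: Q_uminus Q_plus group_normalize del: add_uminus_conv_diff)
  moreover have "Q i 0 (- gn p - gn q + (gn p + gn q)) \<in> Nn n"
    using assms pq by (intro QI_Nn) (simp add: QI_def)
  ultimately show ?thesis
    by (simp add: eqN_def)
qed

lemma rel3_pos:
  assumes "j < n" "j \<noteq> p" "j \<noteq> q"
  shows "eqN n (cj (t q j) (t p q)) (t q j - t p j)"
proof -
  have "cj (t q j) (t p q) = t q j + Q p 0 (gn q - gn j - gn q)"
    using assms pq by (intro cj_eqI faut_eqI)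
      (auto simp: app_t app_Q group_normalize simp del: add_uminus_conv_diff)
  moreover have "eqN n (Q p 0 (gn q - gn j - gn q)) (- t p j)"
  proof -
    have "Q p 0 (gn q - gn j - gn q) - - t p j = Q p 0 (gn j + (gn q - gn j - gn q))"
      unfolding t_def using assms pq by (simp add: Q_plus)
    moreover have "Q p 0 (gn j + (gn q - gn j - gn q)) \<in> Nn n"
      using assms pq by (intro QI_Nn) (simp add: QI_def)
    ultimately show ?thesis by (simp add: eqN_def)
  qed
  ultimately show ?thesis
    using eqN_plus[OF eqN_refl[of n "t q j"], of _ "- t p j"] assms pq by (simp add: t_An)
qed

lemma eqN_cj_neg:
  assumes "eqN n (cj x (t p q)) y"
  shows "eqN n x (cj y (- t p q))"
  using eqN_cj[OF assms, of "- t p q"] pq by (simp add: cj_back An_uminus t_An)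

lemma rel1:
  assumes "i < n" "j < n" "i \<noteq> j" "i \<noteq> q" "j \<noteq> p"
  shows "eqN n (cj (t i j) (te e p q)) (t i j)"
proof (cases e)
  case True
  then show ?thesis using rel1_pos assms by (simp add: te_def)
next
  case False
  have "eqN n (t i j) (cj (t i j) (- t p q))"
    using rel1_pos[OF assms] by (rule eqN_cj_neg)
  then show ?thesis
    using False by (simp add: te_def sgn_if_def eqN_sym)
qed

lemma rel2:
  assumes "i < n" "i \<noteq> p" "i \<noteq> q"
  shows "eqN n (cj (t i p) (te e p q)) (t i p + te e i q)"
proof (cases e)
  case True
  then show ?thesis using rel2_pos assms by (simp add: te_def)
next
  case False
  have "eqN n (t i p) (cj (t i p) (- t p q) + cj (t i q) (- t p q))"
    using eqN_cj_neg[OF rel2_pos[OF assms]] by (simp add: cj_plus)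
  also have "eqN n \<dots> (cj (t i p) (- t p q) + t i q)"
    using rel1[of i q False] assms pq
    by (intro eqN_plus) (auto simp: te_def sgn_if_def intro!: cj_An t_An An_uminus)
  finally have "eqN n (t i p + - t i q) (cj (t i p) (- t p q) + t i q + - t i q)"
    using assms pq by (intro eqN_plus) (auto intro: t_An)
  then show ?thesis
    using False by (simp add: te_def sgn_if_def add.assoc eqN_sym)
qed

lemma rel3:
  assumes "j < n" "j \<noteq> p" "j \<noteq> q"
  shows "eqN n (cj (t q j) (te e p q)) (t q j + te (\<not> e) p j)"
proof (cases e)
  case True
  then show ?thesis using rel3_pos assms by (simp add: te_def sgn_if_def)
next
  case False
  have "eqN n (t q j) (cj (t q j) (- t p q) + - cj (t p j) (- t p q))"
    using eqN_cj_neg[OF rel3_pos[OF assms]] by (simp add: cj_diff)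
  also have "eqN n \<dots> (cj (t q j) (- t p q) + - t p j)"
    using rel1[of p j False] assms pq
    by (intro eqN_plus eqN_uminus) (auto simp: te_def sgn_if_def intro!: cj_An t_An An_uminus)
  finally have "eqN n (t q j + t p j) (cj (t q j) (- t p q) + - t p j + t p j)"
    using assms pq by (intro eqN_plus) (auto intro: t_An)
  then show ?thesis
    using False by (simp add: te_def sgn_if_def add.assoc eqN_sym del: add_uminus_conv_diff)
qed

end

lemma comm_te:
  assumes "i < n" "j < n" "i \<noteq> j" "p < n" "q < n" "p \<noteq> q" "i \<noteq> q" "j \<noteq> p"
  shows "eqN n (te d i j + te e p q) (te e p q + te d i j)"
proof -
  have "eqN n (cj (te d i j) (te e p q)) (te d i j)"
    unfolding te_def[of d] cj_sgn_if using assms by (intro eqN_sgn_if rel1 cj_An te_An t_An)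
  then have "eqN n (te e p q + cj (te d i j) (te e p q)) (te e p q + te d i j)"
    using assms by (intro eqN_plus te_An) auto
  then show ?thesis
    by (simp add: cj_def add.assoc[symmetric])
qed

text \<open>Exchanging two subtractions that share the index \<open>b\<close> costs one further
  subtraction from \<open>a\<close> to \<open>d\<close>. It comes last here and first in
  \<open>relA\<close>; the confluence diagrams need both forms.\<close>

lemma relC:
  assumes "a < n" "b < n" "d < n" "a \<noteq> b" "b \<noteq> d" "a \<noteq> d"
  shows "eqN n (- t b d - t a b) (- t a b - t b d - t a d)"
proof -
  have "eqN n (cj (t b d) (te False a b)) (t b d + te True a d)"
    using rel3[of a n b d False] assms by simp
  then have "eqN n (- cj (t b d) (te False a b)) (- (t b d + te True a d))"
    using assms by (intro eqN_uminus cj_An t_An te_An)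
  then have "eqN n (te False a b + - cj (t b d) (te False a b)) (te False a b + - (t b d + te True a d))"
    using assms by (intro eqN_plus te_An) auto
  then have *: "eqN n (- t b d - t a b) (- t a b + (- t a d + - t b d))"
    by (simp add: cj_def te_def sgn_if_def group_normalize del: add_uminus_conv_diff)
  have "eqN n (- t a d + - t b d) (- t b d + - t a d)"
    using comm_te[of a n d b d False False] assms by (simp add: te_def sgn_if_def)
  then have "eqN n (- t a b + (- t a d + - t b d)) (- t a b + (- t b d + - t a d))"
    using assms by (intro eqN_plus_left An_uminus t_An)
  from eqN_trans[OF * this] show ?thesis
    by (simp add: group_normalize del: add_uminus_conv_diff)
qed

lemma relA:
  assumes "a < n" "b < n" "d < n" "a \<noteq> b" "b \<noteq> d" "a \<noteq> d"
  shows "eqN n (- t b d - t a b) (- t a d - t a b - t b d)"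
proof -
  have 1: "eqN n (- t b d + - t a d) (- t a d + - t b d)" "eqN n (- t a b + - t a d) (- t a d + - t a b)"
    using comm_te[of b n d a d False False] comm_te[of a n b a d False False] assms
    by (simp_all add: te_def sgn_if_def)
  note relC[OF assms]
  also have "- t a b - t b d - t a d = - t a b + (- t b d + - t a d)"
    by (simp add: group_normalize del: add_uminus_conv_diff)
  also have "eqN n \<dots> (- t a b + (- t a d + - t b d))"
    using 1(1) assms by (intro eqN_plus_left An_uminus t_An)
  also have "- t a b + (- t a d + - t b d) = (- t a b + - t a d) + - t b d"
    by (simp add: add.assoc del: add_uminus_conv_diff)
  also have "eqN n \<dots> ((- t a d + - t a b) + - t b d)"
    using 1(2) by (rule eqN_plus_right)
  finally show ?thesis
    by (simp add: group_normalize del: add_uminus_conv_diff)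
qed

text \<open>Three alternating transvections give a quarter turn in the plane of the two indices,
  that is, a signed transposition.\<close>

lemma rho:
  assumes "k \<le> i" "k \<le> j" "i < n" "j < n" "i \<noteq> j"
  shows "\<exists>w\<in>W k n. eqN n (t j i - t i j + t j i) w"
proof -
  let ?w = "spm (Transposition.transpose i j) (\<lambda>m. m \<noteq> i)"
  have w: "app ?w (gn m) = sgn_if (m \<noteq> i) (gn (Transposition.transpose i j m))" for m
    by (rule app_spm) simp
  have "t j i - t i j + t j i = ?w + Q i (gn j) (- gn j)"
    unfolding diff_conv_add_uminus using assms
    by (intro faut_eqI)
      (auto simp: app_t app_neg_t app_Q w sgn_if_def transpose_def group_normalize simp del: add_uminus_conv_diff)
  moreover have "Q i (gn j) (- gn j) \<in> Nn n"
    using assms by (intro QI_Nn) (simp add: QI_def)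
  moreover have W: "?w \<in> W k n"
    using assms by (intro spm_W permutes_swap_id) auto
  moreover have "eqN n (?w + Q i (gn j) (- gn j)) (?w + 0)"
    using calculation W by (intro eqN_plus W_An[of _ k]) (auto simp: eqN_def)
  ultimately show ?thesis by auto
qed

lemma rel4:
  assumes "\<pi> permutes {k..<n}" "w = spm \<pi> \<epsilon>" "w \<in> W k n" "i < n" "j < n" "i \<noteq> j"
  shows "eqN n (cj (t i j) w) (te (\<epsilon> i = \<epsilon> j) (\<pi> i) (\<pi> j))"
proof -
  have w: "app w (gn m) = sgn_if (\<epsilon> m) (gn (\<pi> m))" for m
    using assms app_spm permutes_bij by blast
  have \<pi>: "\<pi> m < n" if "m < n" for m
    using assms that by (metis atLeastLessThan_iff permutes_in_image permutes_not_in)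
  have ne: "\<pi> i \<noteq> \<pi> j"
    using permutes_inj[OF assms(1)] assms by (auto dest: injD)
  have c: "cj (t i j) w = (if \<epsilon> i then Q (\<pi> i) 0 (app w (gn j)) else Q (\<pi> i) (- app w (gn j)) 0)"
    unfolding t_def using assms by (subst cj_Q_W[OF permutes_bij[OF assms(1)] _ _ assms(2)]) auto
  show ?thesis
  proof (cases "\<epsilon> i")
    case True
    then show ?thesis
      using ne c by (auto simp: te_def t_def w sgn_if_def Q_uminus)
  next
    case False
    let ?x = "- app w (gn j)"
    have x: "?x = sgn_if (\<not> \<epsilon> j) (gn (\<pi> j))"
      by (simp add: w sgn_if_def)
    have te: "te (\<not> \<epsilon> j) (\<pi> i) (\<pi> j) = Q (\<pi> i) 0 ?x"
      unfolding x using ne by (simp add: te_def t_def sgn_if_def Q_uminus)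
    have "Q (\<pi> i) ?x 0 - Q (\<pi> i) 0 ?x = Q (\<pi> i) ?x (- ?x)"
      unfolding diff_conv_add_uminus[of "Q (\<pi> i) ?x 0"] using ne unfolding x by (simp add: Q_uminus Q_plus)
    moreover have "Q (\<pi> i) ?x (- ?x) \<in> Nn n"
      unfolding x using ne \<pi> assms by (intro QI_Nn) (simp add: QI_def)
    ultimately show ?thesis
      using False te c by (simp add: eqN_def)
  qed
qed

lemma mu_te:
  assumes "i \<noteq> j"
  shows "mu l (app (te e i j) w) = mu l w + (if l = j then sgn_if e (mu i w) else 0)"
proof (induction w rule: fgrp_induct)
  case (plus m b w)
  have "app (te e i j) (gn m) = (if m = i then gn i + sgn_if e (gn j) else gn m)"
    using assms by (simp add: te_def sgn_if_def app_t app_neg_t)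
  then show ?case
    using plus by (auto simp: sgn_if_def)
qed (auto simp: sgn_if_def)

lemma mu_W:
  assumes "\<pi> permutes {k..<n}" "w = spm \<pi> \<epsilon>"
  shows "mu (\<pi> l) (app w x) = sgn_if (\<epsilon> l) (mu l x)"
proof (induction x rule: fgrp_induct)
  case (plus m b x)
  have "app w (gn m) = sgn_if (\<epsilon> m) (gn (\<pi> m))"
    using assms app_spm permutes_bij by blast
  moreover have "\<pi> m = \<pi> l \<longleftrightarrow> m = l"
    using permutes_inj[OF assms(1)] by (auto dest: injD)
  ultimately show ?case
    using plus by (auto simp: sgn_if_def)
qed (auto simp: sgn_if_def)

text \<open>The action on H fixes the span of e_0, ..., e_(k-1) pointwise.\<close>

definition lowfix :: "nat \<Rightarrow> faut \<Rightarrow> bool"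
  where "lowfix k g \<longleftrightarrow> (\<forall>c. (\<forall>a\<ge>k. mu a c = 0) \<longrightarrow> (\<forall>l. mu l (app g c) = mu l c))"

lemma lowfix_plus: "lowfix k g \<Longrightarrow> lowfix k h \<Longrightarrow> lowfix k (g + h)"
  by (simp add: lowfix_def)

lemma lowfix_uminus:
  assumes "lowfix k g"
  shows "lowfix k (- g)"
  unfolding lowfix_def
proof (intro allI impI)
  fix c l
  assume "\<forall>a\<ge>k. mu a c = 0"
  then have "mu a (app g c - c) = 0" for a
    using assms by (simp add: lowfix_def)
  then have "mu l (app (- g) (app g c - c)) = 0"
    by (rule mu_app_eq_0)
  then show "mu l (app (- g) c) = mu l c"
    by simp
qed

lemma lowfix_Pk: "g \<in> Pk k n \<Longrightarrow> lowfix k g"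
proof (induction rule: Pk.induct)
  case (N x)
  then show ?case
    using Nn_Ia by (fastforce simp: lowfix_def Ia_def)
next
  case (t i j)
  then have "mu l (app (t i j) w) = mu l w + (if l = j then mu i w else 0)" for l w
    using mu_te[of i j l True w] by (simp add: te_def)
  then show ?case
    using t by (simp add: lowfix_def)
next
  case (W w)
  then obtain \<pi> \<epsilon> where 1: "\<pi> permutes {k..<n}" "\<And>m. m \<notin> {k..<n} \<Longrightarrow> \<epsilon> m" "w = spm \<pi> \<epsilon>"
    using WE by metis
  show ?case
    unfolding lowfix_def
  proof (intro allI impI)
    fix c l
    assume c: "\<forall>a\<ge>k. mu a c = 0"
    obtain l' where l: "l = \<pi> l'"
      using permutes_surj[OF 1(1)] by (metis surjD)
    have e: "mu l (app w c) = sgn_if (\<epsilon> l') (mu l' c)"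
      unfolding l by (rule mu_W[OF 1(1,3)])
    show "mu l (app w c) = mu l c"
    proof (cases "l' < k")
      case True
      then have "l = l'" "\<epsilon> l'"
        using l permutes_not_in[OF 1(1), of l'] 1(2)[of l'] by auto
      then show ?thesis using e by simp
    next
      case False
      then have "k \<le> l"
        using l permutes_in_image[OF 1(1), of l'] permutes_not_in[OF 1(1), of l'] by fastforce
      then show ?thesis
        using e c False by (simp add: sgn_if_def)
    qed
  qed
qed (auto intro: lowfix_plus lowfix_uminus)

section \<open>Stabilizers in the general linear group\<close>

text \<open>The expected stabilizer of e_k modulo e_0, ..., e_(k-1) inside \<open>Pk k n\<close>.
  The generators \<open>te e k j\<close> with j < k change e_k only by a lower basis vector.\<close>

inductive_set Pr :: "nat \<Rightarrow> nat \<Rightarrow> faut set" for k n where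
  N: "x \<in> Nn n \<Longrightarrow> x \<in> Pr k n"
| t: "k < i \<Longrightarrow> i < n \<Longrightarrow> j < n \<Longrightarrow> i \<noteq> j \<Longrightarrow> te e i j \<in> Pr k n"
| tk: "j < k \<Longrightarrow> te e k j \<in> Pr k n"
| W: "w \<in> W (Suc k) n \<Longrightarrow> w \<in> Pr k n"
| plus: "s \<in> Pr k n \<Longrightarrow> u \<in> Pr k n \<Longrightarrow> s + u \<in> Pr k n"

lemma Pr_uminus: "s \<in> Pr k n \<Longrightarrow> - s \<in> Pr k n"
proof (induction rule: Pr.induct)
  case (plus s u)
  then show ?case
    using Pr.plus[of "- u" k n "- s"] by (simp add: minus_add del: add_uminus_conv_diff)
next
  case (t i j e)
  then show ?case by (simp add: neg_te Pr.t)
next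
  case (tk j e)
  then show ?case by (simp add: neg_te Pr.tk)
qed (auto intro: Pr.N Nn.uminus Pr.W W_uminus)

lemma te_Pk: "k \<le> i \<Longrightarrow> i < n \<Longrightarrow> j < n \<Longrightarrow> i \<noteq> j \<Longrightarrow> te e i j \<in> Pk k n"
  by (simp add: te_def sgn_if_def Pk.t Pk.uminus)

lemma Pr_Pk: "s \<in> Pr k n \<Longrightarrow> k < n \<Longrightarrow> s \<in> Pk k n"
proof (induction rule: Pr.induct)
  case (W w)
  then show ?case using W_mono[of k "Suc k" n] by (auto intro: Pk.W)
qed (auto intro: Pk.N Pk.plus te_Pk)

text \<open>The k-th row of the matrix of \<open>g\<close> on H; the Euclidean algorithm works on
  its entries from index k on.\<close>

definition vc :: "nat \<Rightarrow> faut \<Rightarrow> nat \<Rightarrow> int"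
  where "vc k g l = mu l (app g (gn k))"

lemma vc_te: "i \<noteq> j \<Longrightarrow> vc k (g + te e i j) l = vc k g l + (if l = j then sgn_if e (vc k g i) else 0)"
  by (simp add: vc_def mu_te)

lemma vc_W: "\<pi> permutes {k..<n} \<Longrightarrow> w = spm \<pi> \<epsilon> \<Longrightarrow> vc k (g + w) (\<pi> l) = sgn_if (\<epsilon> l) (vc k g l)"
  by (simp add: vc_def mu_W)

lemma Pr_keep:
  assumes "p \<in> Pr k n" "\<And>a. a > k \<Longrightarrow> mu a c = 0" "a \<ge> k"
  shows "mu a (app p c) = mu a c"
  using assms
proof (induction arbitrary: c a rule: Pr.induct)
  case (N x)
  then show ?case using Nn_Ia by (fastforce simp: Ia_def)
next
  case (W w)
  have "(\<forall>l. l \<ge> Suc k \<longrightarrow> mu l c = 0)"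
    using W by simp
  then show ?case
    using lowfix_Pk[OF Pk.W[OF W(1)]] by (simp add: lowfix_def)
next
  case (plus s u)
  have "mu a (app s c) = 0" if "a > k" for a
    using plus.IH(1)[of c a] plus.prems(1)[of a] plus.prems(1) that by simp
  then have "mu a (app u (app s c)) = mu a (app s c)"
    using plus by blast
  then show ?case
    using plus by simp
qed (auto simp: mu_te sgn_if_def)

text \<open>An element of \<open>Pr k n\<close> moves e_k only by lower vectors, which
  \<open>g\<close> fixes. So the relevant part of the row depends only on the coset.\<close>

lemma vc_Pr_plus:
  assumes "p \<in> Pr k n" "g \<in> Pk k n" "l \<ge> k"
  shows "vc k (p + g) l = vc k g l"
proof -
  have "mu a (app p (gn k) - gn k) = 0" if "a \<ge> k" for a
    using Pr_keep[OF assms(1), of "gn k" a] that by simp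
  then have "mu l (app g (app p (gn k) - gn k)) = mu l (app p (gn k) - gn k)"
    "mu l (app p (gn k) - gn k) = 0"
    using lowfix_Pk[OF assms(2)] assms(3) unfolding lowfix_def by blast+
  then show ?thesis
    by (simp add: vc_def)
qed

text \<open>A Euclidean step: with the chosen sign, entry i is used to diminish the absolute value
  of entry j. The equality forces entry i to be no larger than entry j in absolute value.\<close>

definition good :: "nat \<Rightarrow> nat \<Rightarrow> faut \<Rightarrow> nat \<Rightarrow> nat \<Rightarrow> bool \<Rightarrow> bool"
  where "good k n g i j e \<longleftrightarrow> k \<le> i \<and> i < n \<and> k \<le> j \<and> j < n \<and> i \<noteq> j \<and> vc k g i \<noteq> 0 \<and>
    \<bar>vc k g j + sgn_if e (vc k g i)\<bar> = \<bar>vc k g j\<bar> - \<bar>vc k g i\<bar>"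

text \<open>The elements whose image of the \<open>k\<close>-th basis vector can be reduced back to that vector by Euclidean
  steps, while staying in one coset of the expected stabilizer \<^const>\<open>Pr\<close>.\<close>
inductive_set Dd :: "nat \<Rightarrow> nat \<Rightarrow> faut set" for k n where
  base: "p \<in> Pr k n \<Longrightarrow> p \<in> Dd k n"
| W: "g \<in> Dd k n \<Longrightarrow> w \<in> W k n \<Longrightarrow> g + w \<in> Dd k n"
| red: "g + te e i j \<in> Dd k n \<Longrightarrow> good k n g i j e \<Longrightarrow> g \<in> Dd k n"

lemma Pr_eqN: "eqN n x y \<Longrightarrow> y \<in> Pr k n \<Longrightarrow> x \<in> Pr k n"
  using Pr.plus[of "x - y" k n y] by (auto simp: eqN_def intro: Pr.N)

lemma Pr_zero [simp]: "0 \<in> Pr k n"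
  by (simp add: Pr.N)

lemma Pr_sgn_if: "s \<in> Pr k n \<Longrightarrow> sgn_if b s \<in> Pr k n"
  by (simp add: sgn_if_def Pr_uminus)

lemma perm_ge: "\<pi> permutes {k..<n} \<Longrightarrow> k \<le> m \<Longrightarrow> k \<le> \<pi> m"
  by (metis atLeastLessThan_iff permutes_in_image permutes_not_in)

lemma perm_lt: "\<pi> permutes {k..<n} \<Longrightarrow> m < n \<Longrightarrow> \<pi> m < n"
  by (metis atLeastLessThan_iff permutes_in_image permutes_not_in)

section \<open>Euclidean reduction of one row\<close>

locale stage =
  fixes n k :: nat
  assumes kn: "k < n"
begin

abbreviation "D \<equiv> Dd k n"
abbreviation "v \<equiv> vc k"

lemma D_Pk: "g \<in> D \<Longrightarrow> g \<in> Pk k n"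
proof (induction rule: Dd.induct)
  case (base p)
  then show ?case using kn by (rule Pr_Pk)
next
  case (red g e i j)
  have "g + te e i j - te e i j \<in> Pk k n"
    using red by (intro Pk_diff te_Pk) (auto simp: good_def)
  then show ?case by simp
qed (auto intro: Pk.plus Pk.W)

lemma D_An: "g \<in> D \<Longrightarrow> g \<in> An n"
  using D_Pk Pk_An by blast

text \<open>Euclidean steps act on the right and depend only on the row, which left multiplication
  by \<open>Pr k n\<close> leaves alone.\<close>

lemma D_P:
  assumes "p \<in> Pr k n"
  shows "g \<in> D \<Longrightarrow> p + g \<in> D"
proof (induction rule: Dd.induct)
  case (base p')
  then show ?case using assms by (intro Dd.base Pr.plus)
next
  case (W g w)
  then show ?case using Dd.W[of "p + g" k n w] by (simp add: add.assoc)
next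
  case (red g e i j)
  have "g \<in> Pk k n"
    using Dd.red[OF red(1,2)] by (rule D_Pk)
  then have "good k n (p + g) i j e"
    using red(2) vc_Pr_plus[OF assms] by (simp add: good_def)
  then show ?case
    using red Dd.red[of "p + g"] by (simp add: add.assoc)
qed

lemma D_eqN: "eqN n x y \<Longrightarrow> g \<in> An n \<Longrightarrow> g + x \<in> D \<Longrightarrow> g + y \<in> D"
proof -
  assume a: "eqN n x y" "g \<in> An n" "g + x \<in> D"
  have "cj (y - x) (- g) \<in> Nn n"
    using a eqN_sym by (intro cj_Nn An_uminus) (auto simp: eqN_def)
  then have "cj (y - x) (- g) + (g + x) \<in> D"
    by (rule D_P[OF Pr.N a(3)])
  then show "g + y \<in> D"
    by (simp add: cj_def group_normalize del: add_uminus_conv_diff)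
qed

text \<open>Such a transvection does not alter the row from index k on, so conjugating it by
  \<open>g\<close> should give an element of the stabilizer. The proof follows the reduction of
  \<open>g\<close>, moving the transvection through each step by a Steinberg relation.\<close>

lemma zero_source:
  assumes "g \<in> D" "k \<le> i" "i < n" "j < n" "i \<noteq> j" "j < k \<or> v g i = 0"
  shows "cj (t i j) (- g) \<in> Pr k n"
  using assms
proof (induction arbitrary: i j rule: Dd.induct)
  case (base p)
  have "v p k = 1"
    using Pr_keep[OF base(1), of "gn k" k] by (simp add: vc_def)
  have "t i j \<in> Pr k n"
  proof (cases "i = k")
    case True
    then have "j < k" using \<open>v p k = 1\<close> base by auto
    then show ?thesis using Pr.tk[of j k True n] True by (simp add: te_def)
  next
    case False
    then show ?thesis using base Pr.t[of k i n j True] by (simp add: te_def)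
  qed
  then have "p + t i j + - p \<in> Pr k n"
    using base by (intro Pr.plus Pr_uminus)
  then show ?case by (simp add: cj_def)
next
  case (W g w)
  have gA: "g \<in> An n" using W D_An by blast
  obtain \<pi> \<epsilon> where 1: "\<pi> permutes {k..<n}" "\<And>m. m \<notin> {k..<n} \<Longrightarrow> \<epsilon> m" "w = spm \<pi> \<epsilon>"
    using WE[OF W(2)] by metis
  obtain i' j' where ij: "i = \<pi> i'" "j = \<pi> j'"
    using permutes_surj[OF 1(1)] by (metis surjD)
  have i': "k \<le> i'" "i' < n" "j' < n" "i' \<noteq> j'"
    using W.prems ij permutes_not_in[OF 1(1)] permutes_in_image[OF 1(1)] perm_lt[OF 1(1)]
      by (metis atLeastLessThan_iff leI)+
  have c: "j' < k \<or> v g i' = 0"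
  proof (cases "j < k")
    case True
    then have "j' = j"
      using ij permutes_in_image[OF 1(1), of j'] permutes_not_in[OF 1(1), of j'] by fastforce
    then show ?thesis using True by simp
  next
    case False
    then have "v (g + w) (\<pi> i') = 0" using W.prems ij by blast
    then show ?thesis by (simp add: vc_W[OF 1(1,3)] sgn_if_def split: if_splits)
  qed
  have "eqN n (cj (t i' j') w) (te (\<epsilon> i' = \<epsilon> j') i j)"
    using rel4[OF 1(1,3) W(2) i'(2-4)] ij by simp
  then have "eqN n (cj (cj (t i' j') w) (- w)) (cj (te (\<epsilon> i' = \<epsilon> j') i j) (- w))"
    using W by (intro eqN_cj An_uminus W_An)
  then have "eqN n (t i' j') (sgn_if (\<epsilon> i' = \<epsilon> j') (cj (t i j) (- w)))"
    by (simp add: cj_back te_def cj_sgn_if)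
  then have "eqN n (sgn_if (\<epsilon> i' = \<epsilon> j') (t i' j')) (sgn_if (\<epsilon> i' = \<epsilon> j') (sgn_if (\<epsilon> i' = \<epsilon> j') (cj (t i j) (- w))))"
    using i' by (intro eqN_sgn_if t_An)
  then have "eqN n (sgn_if (\<epsilon> i' = \<epsilon> j') (t i' j')) (cj (t i j) (- w))"
    by simp
  note eqN_sym[OF this]
  then have "eqN n (cj (cj (t i j) (- w)) (- g)) (cj (sgn_if (\<epsilon> i' = \<epsilon> j') (t i' j')) (- g))"
    using gA by (intro eqN_cj An_uminus)
  moreover have "cj (sgn_if (\<epsilon> i' = \<epsilon> j') (t i' j')) (- g) \<in> Pr k n"
    unfolding cj_sgn_if using W i' c by (intro Pr_sgn_if W.IH)
  ultimately show ?case
    using Pr_eqN by (simp add: cj_cj minus_add del: add_uminus_conv_diff)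
next
  case (red g e p q)
  let ?s = "te e p q"
  have g: "k \<le> p" "p < n" "k \<le> q" "q < n" "p \<noteq> q" "v g p \<noteq> 0"
    "\<bar>v g q + sgn_if e (v g p)\<bar> = \<bar>v g q\<bar> - \<bar>v g p\<bar>"
    using red(2) by (auto simp: good_def)
  have gA: "g \<in> An n" "?s \<in> An n"
    using Dd.red[OF red(1,2)] D_An g te_An by auto
  have e: "cj (t i j) (- g) = cj (cj (t i j) ?s) (- (g + ?s))"
    by (simp add: cj_cj minus_add del: add_uminus_conv_diff)
  have tA: "t i j \<in> An n" using red.prems by (intro t_An)
  have *: "cj (t i j) (- g) \<in> Pr k n"
    if "eqN n (cj (t i j) ?s) x" "cj x (- (g + ?s)) \<in> Pr k n" for x
    unfolding e using that gA by (intro Pr_eqN[OF eqN_cj[OF that(1)]] An_uminus An_plus)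
  have vs: "v (g + ?s) l = v g l + (if l = q then sgn_if e (v g p) else 0)" for l
    using g by (intro vc_te)
  consider "i \<noteq> q" "j \<noteq> p" | "i \<noteq> q" "j = p" | "i = q" by blast
  then show ?case
  proof cases
    case 1
    show ?thesis
    proof (rule *)
      show "eqN n (cj (t i j) ?s) (t i j)" using 1 g red.prems by (intro rel1)
      show "cj (t i j) (- (g + ?s)) \<in> Pr k n"
        using 1 red.prems by (intro red.IH) (auto simp: vs)
    qed
  next
    case 2
    have vi: "v g i = 0" using 2 red.prems g by auto
    show ?thesis
    proof (rule *)
      show "eqN n (cj (t i j) ?s) (t i p + te e i q)"
        unfolding 2(2) using 2 g red.prems by (intro rel2) auto
      show "cj (t i p + te e i q) (- (g + ?s)) \<in> Pr k n"
        unfolding cj_plus te_def[of _ i] cj_sgn_if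
        using 2 red.prems vi g by (intro Pr.plus Pr_sgn_if red.IH) (auto simp: vs)
    qed
  next
    case 3
    \<comment> \<open>The entry diminished by a Euclidean step is at least as large in absolute
      value as the nonzero source entry, so only a lower target index remains.\<close>
    have "v g q \<noteq> 0" using g by auto
    then have j: "j < k" using red.prems 3 by auto
    show ?thesis
    proof (rule *)
      show "eqN n (cj (t i j) ?s) (t q j + te (\<not> e) p j)"
        unfolding 3 using j g red.prems by (intro rel3) auto
      show "cj (t q j + te (\<not> e) p j) (- (g + ?s)) \<in> Pr k n"
        unfolding cj_plus te_def[of _ p j] cj_sgn_if
        using j red.prems g by (intro Pr.plus Pr_sgn_if red.IH) auto
    qed
  qed
qed

lemma D_zero_source:
  assumes "g \<in> D" "k \<le> i" "i < n" "j < n" "i \<noteq> j" "j < k \<or> v g i = 0"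
  shows "g + te e i j \<in> D"
proof -
  have "cj (te e i j) (- g) + g \<in> D"
    unfolding te_def cj_sgn_if using assms by (intro D_P Pr_sgn_if zero_source)
  then show ?thesis
    by (simp add: cj_def group_normalize del: add_uminus_conv_diff)
qed

lemma good_W:
  assumes w: "\<pi> permutes {k..<n}" "w = spm \<pi> \<epsilon>" "w \<in> W k n" and g: "good k n g i j e"
  shows "good k n (g + w) (\<pi> i) (\<pi> j) (e = (\<epsilon> i = \<epsilon> j))"
    and "eqN n (te e i j + w) (w + te (e = (\<epsilon> i = \<epsilon> j)) (\<pi> i) (\<pi> j))"
proof -
  have ij: "k \<le> i" "i < n" "k \<le> j" "j < n" "i \<noteq> j"
    using g by (auto simp: good_def)
  have "\<pi> i \<noteq> \<pi> j"
    using permutes_inj[OF w(1)] ij by (auto dest: injD)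
  have "\<bar>sgn_if (\<epsilon> j) (v g j) + sgn_if (e = (\<epsilon> i = \<epsilon> j)) (sgn_if (\<epsilon> i) (v g i))\<bar> =
      \<bar>sgn_if (\<epsilon> j) (v g j)\<bar> - \<bar>sgn_if (\<epsilon> i) (v g i)\<bar>" "sgn_if (\<epsilon> i) (v g i) \<noteq> 0"
    using g by (cases "\<epsilon> i"; cases "\<epsilon> j"; cases e; simp add: good_def sgn_if_def; linarith)+
  then show "good k n (g + w) (\<pi> i) (\<pi> j) (e = (\<epsilon> i = \<epsilon> j))"
    unfolding good_def vc_W[OF w(1,2)] using \<open>\<pi> i \<noteq> \<pi> j\<close> ij perm_ge[OF w(1)] perm_lt[OF w(1)] by blast
  have "eqN n (cj (te e i j) w) (sgn_if e (te (\<epsilon> i = \<epsilon> j) (\<pi> i) (\<pi> j)))"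
    unfolding te_def[of e] cj_sgn_if using ij w W_An by (intro eqN_sgn_if rel4 cj_An t_An) auto
  then have "eqN n (w + cj (te e i j) w) (w + sgn_if e (te (\<epsilon> i = \<epsilon> j) (\<pi> i) (\<pi> j)))"
    using w W_An by (intro eqN_plus_left) auto
  then show "eqN n (te e i j + w) (w + te (e = (\<epsilon> i = \<epsilon> j)) (\<pi> i) (\<pi> j))"
    by (simp add: cj_def te_def add.assoc[symmetric])
qed

text \<open>An inversion principle: a trailing signed permutation can be carried through a Euclidean
  step, which turns it into another Euclidean step.\<close>

lemma D_cases:
  assumes "g \<in> D"
  shows "(\<exists>p\<in>Pr k n. \<exists>w\<in>W k n. g = p + w) \<or> (\<exists>i j e. good k n g i j e \<and> g + te e i j \<in> D)"
  using assms
proof (induction rule: Dd.induct)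
  case (base p)
  then show ?case by (metis W_zero add.right_neutral)
next
  case (W g w)
  from W.IH show ?case
  proof (elim disjE bexE exE conjE)
    fix p w' assume "p \<in> Pr k n" "w' \<in> W k n" "g = p + w'"
    then show ?thesis
      using W_plus[OF _ W(2), of w'] by (metis add.assoc)
  next
    fix i j e assume *: "good k n g i j e" "g + te e i j \<in> D"
    obtain \<pi> \<epsilon> where 1: "\<pi> permutes {k..<n}" "w = spm \<pi> \<epsilon>"
      using WE[OF W(2)] by metis
    note gw = good_W[OF 1 W(2) *(1)]
    have "g + (te e i j + w) \<in> D"
      using Dd.W[OF *(2) W(2)] by (simp add: add.assoc)
    then have "g + (w + te (e = (\<epsilon> i = \<epsilon> j)) (\<pi> i) (\<pi> j)) \<in> D"
      by (rule D_eqN[OF gw(2) D_An[OF W(1)]])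
    then show ?thesis
      using gw(1) by (auto simp: add.assoc)
  qed
qed blast

text \<open>With nonnegative entries every Euclidean step is a subtraction, so no signs enter the
  confluence diagrams.\<close>

definition nn :: "faut \<Rightarrow> bool"
  where "nn g \<longleftrightarrow> (\<forall>l\<in>{k..<n}. v g l \<ge> 0)"

definition norm :: "faut \<Rightarrow> nat"
  where "norm g = nat (\<Sum>l\<in>{k..<n}. \<bar>v g l\<bar>)"

lemma vc_sub: "i \<noteq> j \<Longrightarrow> v (g - t i j) l = v g l - (if l = j then v g i else 0)"
  using vc_te[of i j k g False l] by (simp add: te_def sgn_if_def)

lemma nn_step:
  assumes "nn g" "i \<in> {k..<n}" "j \<in> {k..<n}" "i \<noteq> j" "v g i \<le> v g j"
  shows "nn (g - t i j)" "norm (g - t i j) \<le> norm g" "0 < v g i \<Longrightarrow> norm (g - t i j) < norm g"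
proof -
  show *: "nn (g - t i j)"
    using assms by (auto simp: nn_def vc_sub)
  have le: "\<bar>v (g - t i j) l\<bar> \<le> \<bar>v g l\<bar>" if "l \<in> {k..<n}" for l
    using assms * that by (auto simp: nn_def vc_sub)
  then show "norm (g - t i j) \<le> norm g"
    unfolding norm_def by (intro nat_mono sum_mono)
  assume "0 < v g i"
  then have "(\<Sum>l\<in>{k..<n}. \<bar>v (g - t i j) l\<bar>) < (\<Sum>l\<in>{k..<n}. \<bar>v g l\<bar>)"
    using assms by (intro sum_strict_mono_ex1 ballI le) (auto simp: vc_sub nn_def intro!: bexI[of _ j])
  moreover have "0 \<le> (\<Sum>l\<in>{k..<n}. \<bar>v (g - t i j) l\<bar>)"
    by (intro sum_nonneg) simp
  ultimately show "norm (g - t i j) < norm g"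
    unfolding norm_def by (subst nat_mono_iff) linarith+
qed

lemma te_False: "g + te False i j = g - t i j"
  by (simp add: te_def sgn_if_def)

lemma good_nn:
  assumes "nn g" "good k n g i j e"
  shows "\<not> e \<and> 0 < v g i \<and> v g i \<le> v g j \<and> i \<in> {k..<n} \<and> j \<in> {k..<n} \<and> i \<noteq> j"
proof -
  have "v g i \<ge> 0" "v g j \<ge> 0"
    using assms by (auto simp: nn_def good_def)
  then show ?thesis
    using assms(2) by (auto simp: good_def sgn_if_def split: if_splits)
qed

text \<open>A zero entry offers no Euclidean step, so that case rests on
  \<open>D_zero_source\<close> rather than on the rule \<open>red\<close>.\<close>

lemma D_back:
  assumes "nn g" "i \<in> {k..<n}" "j \<in> {k..<n}" "i \<noteq> j" "v g i \<le> v g j" "g - t i j \<in> D"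
  shows "g \<in> D"
proof (cases "v g i = 0")
  case True
  have "(g - t i j) + te True i j \<in> D"
    using True assms by (intro D_zero_source) (auto simp: vc_sub)
  then show ?thesis by (simp add: te_def)
next
  case False
  then have "v g i > 0" using assms by (auto simp: nn_def order_less_le)
  then have "good k n g i j False"
    using assms by (auto simp: good_def sgn_if_def)
  then show ?thesis
    using assms Dd.red by (metis te_False)
qed

lemma D_back':
  assumes "eqN n x (- t i' j' - t i j)" "g + x \<in> D" "g \<in> An n"
    "nn (g - t i' j')" "i \<in> {k..<n}" "j \<in> {k..<n}" "i \<noteq> j" "v (g - t i' j') i \<le> v (g - t i' j') j"
  shows "g - t i' j' \<in> D"
proof (rule D_back[OF assms(4-8)])
  have "g + (- t i' j' - t i j) \<in> D"
    using D_eqN[OF assms(1,3,2)] .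
  then show "g - t i' j' - t i j \<in> D"
    by (simp add: group_normalize del: add_uminus_conv_diff)
qed

text \<open>Some legal subtraction from \<open>a\<close> to \<open>b\<close> keeps \<open>g\<close>
  in \<open>D\<close>; the claim is that any other legal subtraction does too. The cases are the
  ways in which the index pairs overlap. In each the two results are joined by further subtractions,
  covered by induction on the norm, and by a relation modulo \<open>Nn n\<close>.\<close>

lemma confluence:
  assumes "g \<in> D" "nn g" "i \<in> {k..<n}" "j \<in> {k..<n}" "i \<noteq> j" "v g i \<le> v g j"
  shows "g - t i j \<in> D"
  using assms
proof (induction "norm g" arbitrary: g i j rule: less_induct)
  case less
  show ?case
  proof (cases "v g i = 0")
    case True
    then show ?thesis
      using D_zero_source[OF less.prems(1), of i j False] less.prems by (simp add: te_False)
  next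
    case False
    then have vi: "0 < v g i" using less.prems by (auto simp: nn_def order_less_le)
    have gA: "g \<in> An n" using less.prems D_An by blast
    have ij: "i < n" "j < n" using less.prems by auto
    have red: "h - t a b \<in> D"
      if "h \<in> D" "nn h" "norm h < norm g" "a \<in> {k..<n}" "b \<in> {k..<n}" "a \<noteq> b" "v h a \<le> v h b" for h a b
      using less.hyps that by blast
    let ?x = "g - t i j"
    have x: "nn ?x" "norm ?x < norm g"
      using nn_step less.prems vi by blast+
    have vx: "v ?x l = v g l - (if l = j then v g i else 0)" for l
      by (rule vc_sub) (rule less.prems)
    have vj: "v g j > 0" using vi less.prems by auto
    \<comment> \<open>The row of such an element has a single nonzero entry from index k on, whereas
      entries i and j are both positive.\<close>
    have "\<not> (\<exists>p\<in>Pr k n. \<exists>w\<in>W k n. g = p + w)"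
    proof (safe)
      fix p w assume *: "p \<in> Pr k n" "w \<in> W k n" "g = p + w"
      obtain \<pi> \<epsilon> where 1: "\<And>m. app w (gn m) = sgn_if (\<epsilon> m) (gn (\<pi> m))"
        using WE[OF *(2)] by metis
      have "v (p + w) l = (if \<pi> k = l then sgn_if (\<epsilon> k) 1 else 0)" if "l \<ge> k" for l
        unfolding vc_Pr_plus[OF *(1) Pk.W[OF *(2)] that] by (simp add: vc_def 1 sgn_if_def)
      then have "\<pi> k = i" "\<pi> k = j"
        using vi vj less.prems *(3) by (auto split: if_splits)
      then show False using less.prems by simp
    qed
    then obtain a b e where "good k n g a b e" "g + te e a b \<in> D"
      using D_cases[OF less.prems(1)] by blast
    then have ab: "0 < v g a" "v g a \<le> v g b" "a \<in> {k..<n}" "b \<in> {k..<n}" "a \<noteq> b"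
      and yD: "g - t a b \<in> D"
      using good_nn[OF less.prems(2)] te_False by (metis (full_types))+
    let ?y = "g - t a b"
    have y: "nn ?y" "norm ?y < norm g"
      using nn_step less.prems ab by blast+
    have vy: "v ?y l = v g l - (if l = b then v g a else 0)" for l
      by (rule vc_sub) (rule ab)
    have abn: "a < n" "b < n" using ab by auto
    have red2: "g - t a b - t c d \<in> D" "nn (g - t a b - t c d)" "norm (g - t a b - t c d) < norm g"
        "\<And>l. v (g - t a b - t c d) l = v ?y l - (if l = d then v ?y c else 0)"
      if "c \<in> {k..<n}" "d \<in> {k..<n}" "c \<noteq> d" "v ?y c \<le> v ?y d" for c d
      using red[OF yD y that] nn_step(1,2)[OF y(1) that] y(2) vc_sub[OF that(3), of ?y] by simp_all
    have tA: "t c d \<in> An n" if "c \<in> {k..<n}" "d \<in> {k..<n}" "c \<noteq> d" for c d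
      using that by (intro t_An) auto
    note ijr = less.prems(3-5)
    consider (same) "a = i" "b = j" | (commuting) "b \<noteq> j" "b \<noteq> i" "a \<noteq> j"
      | (target) "b = j" "a \<noteq> i" | (left) "b = i" "a \<noteq> j" | (right) "a = j" "b \<noteq> i" | (opposite) "a = j" "b = i"
      using ab ijr by blast
    then show ?thesis
    proof cases
      case same
      then show ?thesis using yD by simp
    next
      case commuting
      have D1: "g - t a b - t i j \<in> D"
        using red2[OF ijr] commuting vy less.prems by simp
      show ?thesis
      proof (rule D_back'[of "- t a b - t i j" i j a b])
        show "eqN n (- t a b - t i j) (- t i j - t a b)"
          using comm_te[of a n b i j False False] ab ijr commuting by (simp add: te_def sgn_if_def)
        show "g + (- t a b - t i j) \<in> D"
          using D1 by (simp add: add_diff_eq)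
      qed (use gA x ab ijr vx less.prems(6) commuting in auto)
    next
      \<comment> \<open>Both subtractions act on entry j. The join passes through subtracting the
        smaller of the two sources from the larger one.\<close>
      case target
      note tg = target
      show ?thesis
      proof (cases "v g a \<le> v g i")
        case True
        have "a \<noteq> i" "v ?y a \<le> v ?y i"
          using ab ijr less.prems(6) tg True by (auto simp: vc_sub)
        note 1 = red2[OF ab(3) ijr(1) this]
        have D1: "g - t a b - t a i - t i j \<in> D"
          using ijr ab tg less.prems(6) by (intro red[OF 1(1-3)]) (auto simp: vc_sub)
        show ?thesis
        proof (rule D_back'[of "- t a b - t a i - t i j" i j a i])
          show "eqN n (- t a b - t a i - t i j) (- t i j - t a i)"
            unfolding tg(1) by (rule eqN_sym[OF relA]) (use ab ijr tg in auto)
          show "g + (- t a b - t a i - t i j) \<in> D"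
            using D1 by (simp add: add_diff_eq)
        qed (use gA x ab ijr vx less.prems(6) tg True in auto)
      next
        case False
        have "i \<noteq> a" "v ?y i \<le> v ?y a"
          using ab ijr less.prems(6) tg False by (auto simp: vc_sub)
        note 1 = red2[OF ijr(1) ab(3) this]
        let ?z = "g - t i j - t i a"
        have z: "nn ?z" "\<And>l. v ?z l = v ?x l - (if l = a then v ?x i else 0)"
          using nn_step(1)[OF x(1), of i a] vc_sub[of i a ?x] ab ijr tg False by (auto simp: vx)
        have "?z - t a j \<in> D"
          using D_eqN[OF relA[of i n a j], of g] 1(1) gA ab ijr tg by (simp add: add_diff_eq)
        then have "?z \<in> D"
          using D_back[OF z(1), of a j] z(2) vx ab ijr tg less.prems False by auto
        then show ?thesis
          using D_back[OF x(1), of i a] vx ab ijr tg False by auto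
      qed
    next
      \<comment> \<open>Entry j is diminished in two portions: by what remains of entry i after the
        other subtraction, and then by entry a.\<close>
      case left
      have "i \<noteq> j" "v ?y i \<le> v ?y j"
        using ab ijr less.prems(6) left by (auto simp: vc_sub)
      note 1 = red2[OF ijr(1,2) this]
      have D1: "g - t a b - t i j - t a j \<in> D"
        using ijr ab left less.prems(6) by (intro red[OF 1(1-3)]) (auto simp: vc_sub)
      show ?thesis
      proof (rule D_back'[of "- t a b - t i j - t a j" i j a b])
        show "eqN n (- t a b - t i j - t a j) (- t i j - t a b)"
          unfolding left(1) by (rule eqN_sym[OF relC]) (use ab ijr left in auto)
        show "g + (- t a b - t i j - t a j) \<in> D"
          using D1 by (simp add: add_diff_eq)
      qed (use gA x ab ijr vx less.prems(6) left in auto)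
    next
      \<comment> \<open>The known subtraction uses entry j before entry i was taken from it, so
        entry b has lost too much. Adding entry i back to b repairs this, and the repaired element
        is in \<open>D\<close> because the addition can be undone by a legal subtraction.\<close>
      case right
      have "i \<noteq> j" "v ?y i \<le> v ?y j"
        using ab ijr less.prems(6) right by (auto simp: vc_sub)
      note 1 = red2[OF ijr(1,2) this]
      let ?z = "g - t a b - t i j + t i b"
      have vz: "v ?z l = v (g - t a b - t i j) l + (if l = b then v (g - t a b - t i j) i else 0)" for l
        using vc_te[of i b k "g - t a b - t i j" True l] right by (simp add: te_def)
      have "nn ?z"
        using 1(2) ijr unfolding nn_def by (auto simp: vz)
      moreover have "?z - t i b \<in> D"
        using 1(1) by simp
      moreover have "v ?z i \<le> v ?z b"
        unfolding vz 1(4) vy using right ab ijr by auto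
      ultimately have zD: "?z \<in> D"
        using right ab ijr by (intro D_back[of ?z i b]) blast+
      have "eqN n (- t i j - t j b - t i b) (- t j b - t i j)"
        by (rule eqN_sym[OF relC]) (use ab ijr right in auto)
      then have "eqN n (- t i j - t j b - t i b + t i b) (- t j b - t i j + t i b)"
        by (rule eqN_plus_right)
      then have "eqN n (- t i j - t j b) (- t j b - t i j + t i b)"
        by simp
      then have rel: "eqN n (- t j b - t i j + t i b) (- t i j - t j b)"
        by (rule eqN_sym)
      have D1: "g - t j b - t i j + t i b \<in> D"
        using zD right by simp
      show ?thesis
      proof (rule D_back'[of "- t j b - t i j + t i b" i j j b])
        show "eqN n (- t j b - t i j + t i b) (- t i j - t j b)"
          by (rule rel)
        show "g + (- t j b - t i j + t i b) \<in> D"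
          using D1 by (simp add: group_normalize del: add_uminus_conv_diff)
      qed (use gA vi x ab ijr vx less.prems(6) right in auto)
    next
      \<comment> \<open>The two entries are equal, and the two subtractions differ by the quarter
        turn of \<open>rho\<close> and a transvection whose source entry is zero.\<close>
      case opposite
      then have eq: "v g i = v g j" using ab less.prems by simp
      obtain w where w: "w \<in> W k n" "eqN n (t j i - t i j + t j i) w"
        using rho[of k i j n] ijr by auto
      have "g - t j i + w \<in> D"
        using yD opposite w by (auto intro: Dd.W)
      then have 1: "g - t j i + (t j i - t i j + t j i) \<in> D"
        using D_eqN[OF eqN_sym[OF w(2)]] yD opposite D_An by auto
      have e: "g - t j i + (t j i - t i j + t j i) = g - t i j + t j i"
        by (simp add: group_normalize del: add_uminus_conv_diff)
      have "v (g - t i j + t j i) j = 0"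
        using vc_te[of j i k "g - t i j" True j] eq vx ijr by (simp add: te_def)
      then have "g - t i j + t j i + te False j i \<in> D"
        using 1 ijr unfolding e by (intro D_zero_source) auto
      then show ?thesis
        by (simp add: te_False)
    qed
  qed
qed

text \<open>An addition is the reverse of a legal subtraction. The remaining case is a subtraction
  that makes an entry negative.\<close>

lemma D_te_nn:
  assumes "g \<in> D" "nn g" "i \<in> {k..<n}" "j \<in> {k..<n}" "i \<noteq> j"
  shows "g + te e i j \<in> D"
proof (cases e)
  case True
  let ?h = "g + te True i j"
  have vh: "v ?h l = v g l + (if l = j then v g i else 0)" for l
    using assms by (simp add: vc_te)
  have "?h \<in> D"
  proof (rule D_back[of ?h i j])
    show "nn ?h" using assms by (auto simp: nn_def vh)
    show "v ?h i \<le> v ?h j" using assms by (auto simp: nn_def vh)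
    show "?h - t i j \<in> D" using assms by (simp add: te_def)
  qed (use assms in auto)
  then show ?thesis using True by simp
next
  case False
  show ?thesis
  proof (cases "v g i \<le> v g j")
    case True
    then show ?thesis using confluence[OF assms True] False by (simp add: te_False)
  next
    case gt: False
    have y: "g - t j i \<in> D"
      using assms gt by (intro confluence) auto
    obtain w where w: "w \<in> W k n" "eqN n (t j i - t i j + t j i) w"
      using rho[of k i j n] assms by auto
    have "g - t j i + w \<in> D"
      using y w by (auto intro: Dd.W)
    then have 1: "g - t j i + (t j i - t i j + t j i) \<in> D"
      using D_eqN[OF eqN_sym[OF w(2)]] y D_An by auto
    let ?x = "g - t i j"
    have e: "g - t j i + (t j i - t i j + t j i) = ?x + te True j i"
      by (simp add: te_def group_normalize del: add_uminus_conv_diff)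
    \<comment> \<open>Entry j of \<open>?x\<close> is negative, so adding it to entry i is a
      Euclidean step. It leads to a quarter turn of \<open>g - t j i\<close>, which is known to be
      in \<open>D\<close>.\<close>
    have "good k n ?x j i True"
      using assms gt by (auto simp: good_def vc_sub nn_def)
    then have "?x \<in> D"
      using 1 unfolding e by (rule Dd.red[rotated])
    then show ?thesis using False by (simp add: te_False)
  qed
qed

lemma make_nn:
  obtains w where "w \<in> W k n" "nn (g + w)"
proof -
  let ?\<epsilon> = "\<lambda>m. m \<notin> {k..<n} \<or> v g m \<ge> 0"
  have "spm id ?\<epsilon> \<in> W k n"
    by (rule spm_W) (auto simp: permutes_id)
  moreover have "nn (g + spm id ?\<epsilon>)"
    using vc_W[of id k n "spm id ?\<epsilon>" ?\<epsilon> g] by (auto simp: nn_def permutes_id sgn_if_def)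
  ultimately show ?thesis using that by blast
qed

text \<open>A signed permutation makes the row nonnegative, and the transvection is carried through
  it.\<close>

lemma D_te:
  assumes "g \<in> D" "i \<in> {k..<n}" "j \<in> {k..<n}" "i \<noteq> j"
  shows "g + te e i j \<in> D"
proof -
  obtain w where w: "w \<in> W k n" "nn (g + w)" by (rule make_nn)
  obtain \<pi> \<epsilon> where 1: "\<pi> permutes {k..<n}" "w = spm \<pi> \<epsilon>"
    using WE[OF w(1)] by metis
  have gA: "g \<in> An n" "w \<in> An n" using assms D_An w W_An by auto
  have ij: "\<pi> i \<in> {k..<n}" "\<pi> j \<in> {k..<n}" "\<pi> i \<noteq> \<pi> j"
    using assms permutes_in_image[OF 1(1)] permutes_inj[OF 1(1)] by (auto dest: injD)
  let ?e = "e = (\<epsilon> i = \<epsilon> j)"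
  have "g + w + te ?e (\<pi> i) (\<pi> j) \<in> D"
    using assms w ij by (intro D_te_nn) (auto intro: Dd.W)
  then have D: "(g + w) + te ?e (\<pi> i) (\<pi> j) \<in> D" .
  have "eqN n (cj (te e i j) w) (sgn_if e (te (\<epsilon> i = \<epsilon> j) (\<pi> i) (\<pi> j)))"
    unfolding te_def[of e] cj_sgn_if using assms 1 w W_An by (intro eqN_sgn_if rel4 cj_An t_An) auto
  then have "eqN n (te ?e (\<pi> i) (\<pi> j)) (cj (te e i j) w)"
    unfolding te_def sgn_if_sgn_if by (rule eqN_sym)
  then have "(g + w) + cj (te e i j) w \<in> D"
    by (rule D_eqN[OF _ An_plus[OF gA] D])
  then have "(g + w) + cj (te e i j) w + - w \<in> D"
    by (rule Dd.W[OF _ W_uminus[OF w(1)]])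
  then show ?thesis
    by (simp add: cj_def group_normalize del: add_uminus_conv_diff)
qed

lemma D_Pk_plus: "h \<in> Pk k n \<Longrightarrow> g \<in> D \<Longrightarrow> g + h \<in> D \<and> g - h \<in> D"
proof (induction arbitrary: g rule: Pk.induct)
  case (N x)
  have "cj x (- g) + g \<in> D" "cj (- x) (- g) + g \<in> D"
    using N D_An by (auto intro!: D_P Pr.N cj_Nn An_uminus Nn.uminus)
  then show ?case
    by (simp add: cj_def group_normalize del: add_uminus_conv_diff)
next
  case (t i j)
  have "g + te e i j \<in> D" for e
  proof (cases "j < k")
    case True
    then show ?thesis using t by (intro D_zero_source) auto
  next
    case False
    then show ?thesis using t by (intro D_te) auto
  qed
  from this[of True] this[of False] show ?case
    by (simp add: te_def sgn_if_def)
next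
  case (W w)
  then show ?case
    using Dd.W[OF W(2) W_uminus[OF W(1)]] by (auto intro: Dd.W)
next
  case (plus s u)
  have "g + s + u \<in> D" "g - u - s \<in> D"
    using plus by blast+
  then show ?case
    by (simp add: group_normalize del: add_uminus_conv_diff)
qed simp

lemma Pk_D: "h \<in> Pk k n \<Longrightarrow> h \<in> D"
  using D_Pk_plus[of h 0] by (simp add: Dd.base)

end

section \<open>Peeling off one basis vector\<close>

lemma Q_Pk:
  assumes "k \<le> i" "i < n" "supp u \<subseteq> {..<n} - {i}"
  shows "Q i 0 u \<in> Pk k n"
  using assms(3)
proof (induction rule: supp_closed_induct)
  case zero
  then show ?case by (simp add: Pk.N)
next
  case (plus l b u)
  then have l: "l < n" "l \<noteq> i" "i \<notin> supp u" by auto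
  have "Q i 0 (sgn_if b (gn l)) = te b i l"
    using l by (auto simp: te_def sgn_if_def t_def Q_uminus)
  then have "Q i 0 u + Q i 0 (sgn_if b (gn l)) \<in> Pk k n"
    using plus l assms te_Pk by (intro Pk.plus) auto
  then show ?case
    using l by (simp add: Q_plus)
qed

text \<open>Generators of \<open>Pk (Suc k) n\<close> do not move the letters of \<open>u\<close>.
  Only a transvection with target k feels the conjugation, and its correction again has a source
  above k.\<close>

lemma cj_Pk_Q:
  assumes "x \<in> Pk (Suc k) n" "k < n" "supp u \<subseteq> {..<k}"
  shows "cj x (Q k 0 u) \<in> Pk (Suc k) n"
  using assms(1)
proof induction
  case (N x)
  have "supp u \<subseteq> {..<n} - {k}" using assms by auto
  then show ?case
    using N assms by (intro Pk.N cj_Nn Q_in_An) auto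
next
  case (t i l)
  have ku: "k \<notin> supp u" "i \<notin> supp u" using assms t by auto
  show ?case
  proof (cases "l = k")
    case True
    have "cj (t i l) (Q k 0 u) = Q i 0 u + t i k"
      unfolding t_def Q_plus using ku t True
      by (intro cj_eqI faut_eqI) (auto simp: app_Q app_Q_fix add.assoc group_normalize simp del: add_uminus_conv_diff)
    moreover have "supp u \<subseteq> {..<n} - {i}" using assms ku by auto
    ultimately show ?thesis
      using t True assms by (auto intro!: Pk.plus Q_Pk Pk.t)
  next
    case False
    have "cj (t i l) (Q k 0 u) = t i l"
      unfolding t_def using ku t False by (intro cj_eqI faut_eqI) (auto simp: app_Q app_Q_fix)
    then show ?thesis using t by (simp add: Pk.t)
  qed
next
  case (W w)
  then obtain \<pi> \<epsilon> where 1: "\<pi> permutes {Suc k..<n}" "\<And>m. m \<notin> {Suc k..<n} \<Longrightarrow> \<epsilon> m" "w = spm \<pi> \<epsilon>"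
    "\<And>m. app w (gn m) = sgn_if (\<epsilon> m) (gn (\<pi> m))"
    using WE by metis
  have wm: "app w (gn m) = gn m" if "m \<le> k" for m
    using that 1 permutes_not_in[OF 1(1), of m] by (simp add: sgn_if_def)
  have "app w u = u"
  proof (rule app_fix)
    fix i assume "i \<in> supp u"
    then show "app w (gn i) = gn i" using assms by (intro wm) auto
  qed
  note wu = this wm[OF order_refl]
  have ku: "k \<notin> supp u" using assms by auto
  have "cj w (Q k 0 u) = w"
  proof (intro cj_eqI faut_eqI)
    fix m
    have "\<pi> m = k \<longleftrightarrow> m = k"
      using permutes_not_in[OF 1(1), of k] permutes_inj[OF 1(1)] by (metis atLeastLessThan_iff injD not_less_eq_eq order_refl)
    then show "app (w + Q k 0 u) (gn m) = app (Q k 0 u + w) (gn m)"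
      using ku wu by (cases "m = k") (auto simp: app_Q 1(4))
  qed
  then show ?case using W by (simp add: Pk.W)
qed (auto simp: cj_plus cj_uminus intro: Pk.plus Pk.uminus)

text \<open>A semidirect decomposition: all multiplications of x_k by lower letters can be collected
  on the right, since they normalize the other factor.\<close>

lemma Pr_decompose:
  assumes "p \<in> Pr k n" "k < n"
  shows "\<exists>x\<in>Pk (Suc k) n. \<exists>u. supp u \<subseteq> {..<k} \<and> p = x + Q k 0 u"
  using assms(1)
proof induction
  case (N x)
  then show ?case by (intro bexI[of _ x] exI[of _ 0]) (auto intro: Pk.N)
next
  case (t i j e)
  then show ?case by (intro bexI[of _ "te e i j"] exI[of _ 0]) (auto intro: te_Pk)
next
  case (tk j e)
  then show ?case
    by (intro bexI[of _ 0] exI[of _ "sgn_if e (gn j)"]) (auto intro: Pk.N simp: te_def t_def sgn_if_def Q_uminus)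
next
  case (W w)
  then show ?case by (intro bexI[of _ w] exI[of _ 0]) (auto intro: Pk.W)
next
  case (plus s s')
  obtain x u x' u' where *: "x \<in> Pk (Suc k) n" "supp u \<subseteq> {..<k}" "s = x + Q k 0 u"
    "x' \<in> Pk (Suc k) n" "supp u' \<subseteq> {..<k}" "s' = x' + Q k 0 u'"
    using plus.IH by blast
  have k: "k \<notin> supp u" "k \<notin> supp u'" using * by auto
  have "cj x' (Q k 0 (- u)) \<in> Pk (Suc k) n"
    using * assms by (intro cj_Pk_Q) auto
  moreover have "s + s' = (x + cj x' (Q k 0 (- u))) + Q k 0 (u' + u)"
  proof -
    have "Q k 0 (- u) = - Q k 0 u" "Q k 0 (u' + u) = Q k 0 u + Q k 0 u'"
      using k by (simp_all add: Q_uminus Q_plus)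
    then show ?thesis
      by (simp add: * cj_def group_normalize del: add_uminus_conv_diff)
  qed
  ultimately show ?case
    using * by (intro bexI[of _ "x + cj x' (Q k 0 (- u))"] exI[of _ "u' + u"]) (auto intro: Pk.plus)
qed

text \<open>In the induction step the row of \<open>g\<close> is a unit vector, so no Euclidean step
  applies and \<open>D_cases\<close> gives \<open>g = p + w\<close>. The unit vector also forces
  \<open>w\<close> to fix x_k. Finally, the lower factor \<open>u\<close> split off from
  \<open>p\<close> has trivial class in H, so multiplying x_k by it is an element of
  \<open>Nn n\<close>.\<close>

lemma fix_basis_Pk:
  assumes "g \<in> An n" "k \<le> n" "\<And>j a. j < k \<Longrightarrow> mu a (app g (gn j)) = mu a (gn j)"
  shows "g \<in> Pk k n"
  using assms(2,3)
proof (induction k)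
  case 0
  then show ?case using assms(1) An_eq_Pk by simp
next
  case (Suc k)
  interpret stage n k
    using Suc by unfold_locales simp
  have g: "g \<in> Pk k n"
    using Suc by simp
  have "lowfix (Suc k) g"
    unfolding lowfix_def
  proof (intro allI impI)
    fix c l
    assume c: "\<forall>a\<ge>Suc k. mu a c = 0"
    have "mu l (app g c) = (\<Sum>a\<in>supp c. mu a c * mu l (app g (gn a)))"
      by (rule mu_app) auto
    also have "\<dots> = (\<Sum>a\<in>supp c. mu a c * mu l (app 0 (gn a)))"
      using c Suc.prems(2) by (intro sum.cong refl) (metis app_id less_Suc_eq_le mult_zero_left not_less_eq_eq)
    also have "\<dots> = mu l (app 0 c)"
      by (rule mu_app[symmetric]) auto
    finally show "mu l (app g c) = mu l c" by simp
  qed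
  have vg: "vc k g l = (if k = l then 1 else 0)" for l
    using Suc.prems(2)[of k l] by (simp add: vc_def)
  have "g \<in> D" using g by (rule Pk_D)
  from D_cases[OF this] obtain p w where pw: "p \<in> Pr k n" "w \<in> W k n" "g = p + w"
  proof (elim disjE bexE exE conjE)
    fix i j e assume "good k n g i j e"
    then have False by (auto simp: good_def vg split: if_splits)
    then show ?thesis by blast
  qed blast
  obtain \<pi> \<epsilon> where 1: "\<pi> permutes {k..<n}" "\<And>m. m \<notin> {k..<n} \<Longrightarrow> \<epsilon> m" "w = spm \<pi> \<epsilon>"
    "\<And>m. app w (gn m) = sgn_if (\<epsilon> m) (gn (\<pi> m))"
    using WE[OF pw(2)] by metis
  have "vc k g (\<pi> k) = vc k w (\<pi> k)"
    unfolding pw(3) by (rule vc_Pr_plus[OF pw(1) Pk.W[OF pw(2)] perm_ge[OF 1(1) order_refl]])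
  then have "sgn_if (\<epsilon> k) 1 = (if k = \<pi> k then 1 else 0 :: int)"
    by (simp add: vg) (simp add: vc_def 1(4))
  then have fixk: "\<pi> k = k" "\<epsilon> k"
    by (auto simp: sgn_if_def split: if_splits)
  have "w \<in> W (Suc k) n"
    unfolding 1(3)
  proof (rule spm_W)
    have "\<pi> permutes {k..<n} - {k}"
      using permutes_superset[OF 1(1), of "{k..<n} - {k}"] fixk by auto
    moreover have "{k..<n} - {k} = {Suc k..<n}" by auto
    ultimately show "\<pi> permutes {Suc k..<n}" by simp
    show "\<epsilon> m" if "m \<notin> {Suc k..<n}" for m
      using that 1(2)[of m] fixk by (cases "m = k") auto
  qed
  then have w: "w \<in> Pk (Suc k) n" by (rule Pk.W)
  obtain x u where x: "x \<in> Pk (Suc k) n" "supp u \<subseteq> {..<k}" "p = x + Q k 0 u"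
    using Pr_decompose[OF pw(1) kn] by blast
  have "Q k 0 u = - x + g + - w"
    by (simp add: pw(3) x(3) group_normalize del: add_uminus_conv_diff)
  then have "lowfix (Suc k) (Q k 0 u)"
    using \<open>lowfix (Suc k) g\<close> lowfix_Pk[OF x(1)] lowfix_Pk[OF w]
    by (metis lowfix_plus lowfix_uminus)
  then have "mu l (app (Q k 0 u) (gn k)) = mu l (gn k)" for l
    by (auto simp: lowfix_def)
  moreover have "k \<notin> supp u" using x by auto
  ultimately have "mu l u = 0" for l
    by (simp add: app_Q)
  moreover have "supp u \<subseteq> {..<n} - {k}" using x kn by auto
  ultimately have "Q k 0 u \<in> Nn n"
    using kn by (intro QN) auto
  then show ?case
    unfolding pw(3) x(3) by (rule Pk.plus[OF Pk.plus[OF x(1) Pk.N] w])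
qed

text \<open>At k = n neither transvections nor nontrivial signed permutations are left among the
  generators of \<open>Pk n n\<close>.\<close>

theorem Ia_eq_Nn: "Ia n = Nn n"
proof
  show "Nn n \<subseteq> Ia n" using Nn_Ia by blast
  have "Pk n n \<subseteq> Nn n"
  proof
    fix g assume "g \<in> Pk n n"
    then show "g \<in> Nn n"
    proof induction
      case (W w)
      then obtain \<pi> \<epsilon> where "\<pi> permutes {n..<n}" "\<And>m. m \<notin> {n..<n} \<Longrightarrow> \<epsilon> m"
        "\<And>m. app w (gn m) = sgn_if (\<epsilon> m) (gn (\<pi> m))"
        using WE by metis
      then have "w = 0"
        by (intro faut_eqI) (simp add: sgn_if_def)
      then show ?case by simp
    qed (auto intro: Nn.plus Nn.uminus)
  qed
  then show "Ia n \<subseteq> Nn n"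
    using fix_basis_Pk[of _ n n] by (auto simp: Ia_def)
qed

section \<open>Second order exponent sums\<close>

text \<open>The integral Heisenberg group of unitriangular matrices of size three. A homomorphism
  into it captures one quadratic Magnus coefficient without power series.\<close>

datatype heis = Heis (ha: int) (hb: int) (hc: int)

instantiation heis :: group_add
begin

definition zero_heis :: heis where "zero_heis = Heis 0 0 0"
definition plus_heis :: "heis \<Rightarrow> heis \<Rightarrow> heis"
  where "plus_heis x y = Heis (ha x + ha y) (hb x + hb y) (hc x + hc y + ha x * hb y)"
definition uminus_heis :: "heis \<Rightarrow> heis"
  where "uminus_heis x = Heis (- ha x) (- hb x) (- hc x + ha x * hb x)"
definition minus_heis :: "heis \<Rightarrow> heis \<Rightarrow> heis" where "minus_heis x y = x + - y"

instance
  by standard (auto simp: zero_heis_def plus_heis_def uminus_heis_def minus_heis_def algebra_simps intro: heis.expand)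

end

definition heis_hom :: "nat \<Rightarrow> nat \<Rightarrow> fgrp \<Rightarrow> heis"
  where "heis_hom j k = lft (\<lambda>i. Heis (if i = j then 1 else 0) (if i = k then 1 else 0) 0)"

lemma heis_sel [simp]:
  "ha (x + y) = ha x + ha y" "hb (x + y) = hb x + hb y" "hc (x + y) = hc x + hc y + ha x * hb y"
  "ha (- x) = - ha x" "hb (- x) = - hb x" "hc (- x) = - hc x + ha x * hb x"
  "ha 0 = 0" "hb 0 = 0" "hc 0 = 0"
  by (simp_all add: zero_heis_def plus_heis_def uminus_heis_def)

lemma ha_heis_hom: "ha (heis_hom j k w) = mu j w" and hb_heis_hom: "hb (heis_hom j k w) = mu k w"
  unfolding heis_hom_def mu_def by (rule fgrp_hom_eqI; simp)+

text \<open>The coefficient of \<open>X\<^sub>j X\<^sub>k\<close> in the Magnus expansion; on the commutator subgroup it is the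
  coefficient of \<open>e\<^sub>j \<and> e\<^sub>k\<close>.\<close>
definition mu2 :: "nat \<Rightarrow> nat \<Rightarrow> fgrp \<Rightarrow> int"
  where "mu2 j k w = hc (heis_hom j k w)"

lemma mu2_simps [simp]: "mu2 j k 0 = 0" "mu2 j k (u + v) = mu2 j k u + mu2 j k v + mu j u * mu k v"
    "mu2 j k (- u) = - mu2 j k u + mu j u * mu k u" "mu2 j k (gn i) = 0"
  by (simp_all add: mu2_def ha_heis_hom[symmetric, of j _ k] hb_heis_hom[symmetric, of k _ j])
    (simp_all add: heis_hom_def)

lemma mu2_diff [simp]: "mu2 j k (u - v) = mu2 j k u - mu2 j k v + mu j v * mu k v - mu j u * mu k v"
  unfolding diff_conv_add_uminus by (simp del: add_uminus_conv_diff)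

lemma mu2_comm: "mu2 j k (comm u v) = mu j u * mu k v - mu j v * mu k u"
  by (simp add: comm_def algebra_simps)

definition D0 :: "fgrp set"
  where "D0 = {c. \<forall>j. mu j c = 0}"

text \<open>The action on Lambda^2 H by the matrix of \<open>g\<close>. Membership in
  \<open>D0\<close> is carried along because \<open>mu2\<close> is additive only where exponent sums
  vanish.\<close>

lemma mu2_app:
  assumes "c \<in> Dv {..<n}"
  shows "mu2 j k (app g c) = (\<Sum>a<n. \<Sum>b<n. mu2 a b c * mu j (app g (gn a)) * mu k (app g (gn b))) \<and> c \<in> D0"
  using assms
proof induction
  case (comm u v)
  let ?S = "\<lambda>j u. \<Sum>a<n. mu a u * mu j (app g (gn a))"
  have e: "mu j (app g u) = ?S j u" "mu j (app g v) = ?S j v" for j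
    using comm by (intro mu_app; simp)+
  have p: "?S j u * ?S k v = (\<Sum>a<n. \<Sum>b<n. (mu a u * mu b v) * mu j (app g (gn a)) * mu k (app g (gn b)))" for u v
    unfolding sum_product by (intro sum.cong refl) (simp add: algebra_simps)
  have "app g (comm u v) = comm (app g u) (app g v)"
    by (simp add: comm_def)
  then have "mu2 j k (app g (comm u v)) = ?S j u * ?S k v - ?S j v * ?S k u"
    by (simp add: mu2_comm e)
  also have "\<dots> = (\<Sum>a<n. \<Sum>b<n. mu2 a b (comm u v) * mu j (app g (gn a)) * mu k (app g (gn b)))"
    unfolding p mu2_comm sum_subtractf[symmetric] by (intro sum.cong refl) (simp add: algebra_simps)
  finally show ?case by (simp add: D0_def)
next
  case (plus u v)
  then have "mu j (app g u) = 0"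
    by (intro mu_app_eq_0) (simp add: D0_def)
  then show ?case
    using plus by (simp add: D0_def sum.distrib distrib_right)
next
  case (uminus u)
  then have "mu j (app g u) = 0"
    by (intro mu_app_eq_0) (simp add: D0_def)
  then show ?case
    using uminus by (simp add: D0_def sum_negf)
qed

text \<open>The shuffle relation of Magnus coefficients; for j = k it says that the coefficient is a
  binomial one. On the commutator subgroup the right-hand side vanishes.\<close>

lemma mu2_alternating: "mu2 j k w + mu2 k j w = (if j = k then mu j w * mu j w - mu j w else mu j w * mu k w)"
proof (induction w rule: fgrp_induct)
  case (plus i b w)
  then show ?case
    by (cases b; cases "j = k"; simp add: sgn_if_def algebra_simps)
qed simp

lemma mu2_alternating_D0: "(\<And>j. mu j w = 0) \<Longrightarrow> mu2 k j w = - mu2 j k w"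
  using mu2_alternating[of j k w] by (simp split: if_splits)

section \<open>The Johnson homomorphism\<close>

text \<open>The coordinate of the first Johnson homomorphism at the dual vector of e_i and at e_j
  \<and> e_k.\<close>

definition chi :: "nat \<Rightarrow> nat \<Rightarrow> nat \<Rightarrow> faut \<Rightarrow> int"
  where "chi i j k s = mu2 j k (- gn i + app s (gn i))"

lemma Ia_mu: "s \<in> Ia n \<Longrightarrow> mu j (app s w) = mu j w"
  by (simp add: Ia_def)

lemma chi_alt: "s \<in> Ia n \<Longrightarrow> chi i k j s = - chi i j k s"
  unfolding chi_def by (rule mu2_alternating_D0) (simp add: Ia_mu)

lemma chi_diag: "s \<in> Ia n \<Longrightarrow> chi i j j s = 0"
  using chi_alt[of s n i j j] by simp

text \<open>The displacement of a product is the product of the displacements up to a conjugation.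
  On elements with vanishing exponent sums, \<open>mu2\<close> is additive and does not see the
  conjugation.\<close>

lemma mu2_displacement:
  assumes "s \<in> Ia n" "supp w \<subseteq> {..<n}"
  shows "mu2 j k (- w + app s w) = (\<Sum>a<n. mu a w * chi a j k s)"
  using assms(2)
proof (induction rule: supp_closed_induct)
  case zero
  then show ?case by simp
next
  case (plus i b w)
  let ?x = "sgn_if b (gn i)"
  have i: "mu2 j k (- ?x + app s ?x) = (\<Sum>a<n. mu a ?x * chi a j k s)"
  proof -
    have "(\<Sum>a<n. mu a ?x * chi a j k s) = (\<Sum>a<n. if a = i then sgn_if b (chi i j k s) else 0)"
      by (intro sum.cong refl) (auto simp: sgn_if_def)
    also have "\<dots> = sgn_if b (chi i j k s)"
      using plus by simp
    finally show ?thesis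
      using assms(1) by (cases b) (simp_all add: chi_def sgn_if_def Ia_mu algebra_simps)
  qed
  define c d where "c = - ?x + app s ?x" and "d = - w + app s w"
  have "mu j c = 0" for j
    using assms(1) by (simp add: c_def Ia_mu del: app_sgn_if)
  moreover have "- (?x + w) + app s (?x + w) = (- w + c + w) + d"
    by (simp add: c_def d_def group_normalize del: add_uminus_conv_diff app_sgn_if)
  ultimately have "mu2 j k (- (?x + w) + app s (?x + w)) = mu2 j k c + mu2 j k d"
    by (simp del: app_plus)
  then have "mu2 j k (- (?x + w) + app s (?x + w)) = mu2 j k (- ?x + app s ?x) + mu2 j k (- w + app s w)"
    by (simp only: c_def d_def)
  then show ?case
    using i plus by (simp add: distrib_right sum.distrib)
qed

text \<open>The displacement of \<open>s + u\<close> splits at \<open>app s (gn i)\<close>, which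
  has the same class in H as x_i, so \<open>u\<close> displaces both alike.\<close>

lemma chi_plus:
  assumes "s \<in> Ia n" "u \<in> Ia n" "i < n"
  shows "chi i j k (s + u) = chi i j k s + chi i j k u"
proof -
  let ?x = "gn i"
  have "supp (app s ?x) \<subseteq> {..<n}"
    using assms by (intro An_supp Ia_An) auto
  then have "mu2 j k (- app s ?x + app u (app s ?x)) = (\<Sum>a<n. mu a (app s ?x) * chi a j k u)"
    using assms by (intro mu2_displacement)
  also have "\<dots> = (\<Sum>a<n. if a = i then chi i j k u else 0)"
    using assms by (intro sum.cong refl) (auto simp: Ia_mu)
  also have "\<dots> = chi i j k u"
    using assms by simp
  finally have 1: "mu2 j k (- app s ?x + app u (app s ?x)) = chi i j k u" .
  have "- ?x + app (s + u) ?x = (- ?x + app s ?x) + (- app s ?x + app u (app s ?x))"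
    by (simp add: group_normalize del: add_uminus_conv_diff)
  then have "chi i j k (s + u) = mu2 j k ((- ?x + app s ?x) + (- app s ?x + app u (app s ?x)))"
    unfolding chi_def by simp
  also have "\<dots> = chi i j k s + mu2 j k (- app s ?x + app u (app s ?x))"
    unfolding chi_def using assms by (subst mu2_simps(2)) (simp add: Ia_mu)
  finally show ?thesis unfolding 1 .
qed

lemma chi_zero [simp]: "chi i j k 0 = 0"
  by (simp add: chi_def)

lemma chi_uminus:
  assumes "s \<in> Ia n" "i < n"
  shows "chi i j k (- s) = - chi i j k s"
  using chi_plus[OF assms(1) Ia_uminus[OF assms(1)] assms(2), of j k] by simp

lemma chi_comm:
  assumes "s \<in> Ia n" "u \<in> Ia n" "i < n"
  shows "chi i j k (comm s u) = 0"
  unfolding comm_def diff_conv_add_uminus using assms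
  by (simp add: chi_plus[of _ n] chi_uminus[of _ n] Ia_plus Ia_uminus del: add_uminus_conv_diff)

section \<open>Equivariance of the Johnson coordinates\<close>

abbreviation mat :: "faut \<Rightarrow> nat \<Rightarrow> nat \<Rightarrow> int"
  where "mat g a j \<equiv> mu j (app g (gn a))"

text \<open>The displacement of x_i under the conjugate is the image under \<open>g\<close> of the
  displacement of \<open>app (- g) (gn i)\<close>. So the dual index transforms by the inverse
  matrix and the other two by the matrix itself.\<close>

lemma chi_cj:
  assumes "s \<in> Ia n" "g \<in> An n" "i < n"
  shows "chi i j k (cj s g) = (\<Sum>a<n. \<Sum>b<n. (\<Sum>l<n. mat (- g) i l * chi l a b s) * mat g a j * mat g b k)"
proof -
  let ?y = "app (- g) (gn i)"
  have y: "supp ?y \<subseteq> {..<n}"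
    using assms by (intro An_supp An_uminus) auto
  then have "supp (- ?y + app s ?y) \<subseteq> {..<n}"
    using An_supp[OF Ia_An[OF assms(1)]] by simp
  then have Dv: "- ?y + app s ?y \<in> Dv {..<n}"
    using assms by (intro in_Dv) (auto simp: Ia_mu)
  have e: "- gn i + app (cj s g) (gn i) = app g (- ?y + app s ?y)"
    by (simp add: cj_def del: add_uminus_conv_diff uminus_add_conv_diff)
  have "chi i j k (cj s g) = (\<Sum>a<n. \<Sum>b<n. mu2 a b (- ?y + app s ?y) * mat g a j * mat g b k)"
    unfolding chi_def e using mu2_app[OF Dv, of j k g] by blast
  then show ?thesis
    by (simp only: mu2_displacement[OF assms(1) y])
qed

lemma mat_inverse:
  assumes "g \<in> An n" "a < n"
  shows "(\<Sum>l<n. mat (- g) a l * mat g l j) = (if a = j then 1 else 0)"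
proof -
  have "mu j (app g (app (- g) (gn a))) = (\<Sum>l<n. mat (- g) a l * mat g l j)"
    using assms by (intro mu_app An_supp An_uminus) auto
  then show ?thesis by simp
qed

lemma sum_delta_mult:
  fixes f :: "nat \<Rightarrow> int"
  assumes "a < n"
  shows "(\<Sum>l<n. (if a = l then 1 else 0) * f l) = f a" "(\<Sum>l<n. (if l = a then 1 else 0) * f l) = f a"
    "(\<Sum>l<n. f l * (if a = l then 1 else 0)) = f a" "(\<Sum>l<n. f l * (if l = a then 1 else 0)) = f a"
proof -
  have "(\<Sum>l<n. (if a = l then 1 else 0) * f l) = (\<Sum>l<n. if a = l then f l else 0)"
    "(\<Sum>l<n. f l * (if a = l then 1 else 0)) = (\<Sum>l<n. if a = l then f l else 0)"
    by (intro sum.cong; simp)+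
  then show "(\<Sum>l<n. (if a = l then 1 else 0) * f l) = f a" "(\<Sum>l<n. (if l = a then 1 else 0) * f l) = f a"
    "(\<Sum>l<n. f l * (if a = l then 1 else 0)) = f a" "(\<Sum>l<n. f l * (if l = a then 1 else 0)) = f a"
    using assms by (simp_all add: eq_commute)
qed

lemma sum_rotate: "(\<Sum>i\<in>A. \<Sum>b\<in>B. \<Sum>l\<in>C. f i b l) = (\<Sum>b\<in>B. \<Sum>l\<in>C. \<Sum>i\<in>A. f i b l)"
proof -
  have "(\<Sum>i\<in>A. \<Sum>b\<in>B. \<Sum>l\<in>C. f i b l) = (\<Sum>b\<in>B. \<Sum>i\<in>A. \<Sum>l\<in>C. f i b l)"
    by (rule sum.swap)
  also have "\<dots> = (\<Sum>b\<in>B. \<Sum>l\<in>C. \<Sum>i\<in>A. f i b l)"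
    by (intro sum.cong refl sum.swap)
  finally show ?thesis .
qed

text \<open>The coefficient of e_k in the contraction of the dual factor with the first wedge
  factor.\<close>

definition ctr :: "nat \<Rightarrow> nat \<Rightarrow> faut \<Rightarrow> int"
  where "ctr n k s = (\<Sum>a<n. chi a a k s)"

lemma ctr_cj:
  assumes "s \<in> Ia n" "g \<in> An n"
  shows "ctr n k (cj s g) = (\<Sum>b<n. ctr n b s * mat g b k)"
proof -
  have "ctr n k (cj s g) = (\<Sum>i<n. \<Sum>a<n. \<Sum>b<n. \<Sum>l<n. mat (- g) i l * chi l a b s * mat g a i * mat g b k)"
    unfolding ctr_def using assms by (intro sum.cong refl) (simp add: chi_cj sum_distrib_right)
  also have "\<dots> = (\<Sum>a<n. \<Sum>i<n. \<Sum>b<n. \<Sum>l<n. mat (- g) i l * chi l a b s * mat g a i * mat g b k)"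
    by (rule sum.swap)
  also have "\<dots> = (\<Sum>a<n. \<Sum>b<n. \<Sum>l<n. \<Sum>i<n. mat (- g) i l * chi l a b s * mat g a i * mat g b k)"
    by (intro sum.cong refl sum_rotate)
  also have "\<dots> = (\<Sum>a<n. \<Sum>b<n. \<Sum>l<n. (if a = l then 1 else 0) * (chi l a b s * mat g b k))"
  proof (intro sum.cong refl)
    fix a b l assume "a \<in> {..<n}"
    then have "(\<Sum>i<n. mat g a i * mat (- g) i l) = (if a = l then 1 else 0)"
      using mat_inverse[OF An_uminus[OF assms(2)], of a l] by simp
    moreover have "(\<Sum>i<n. mat (- g) i l * chi l a b s * mat g a i * mat g b k) =
        (\<Sum>i<n. mat g a i * mat (- g) i l) * (chi l a b s * mat g b k)"
      unfolding sum_distrib_right by (intro sum.cong refl) (simp only: mult.assoc mult.left_commute mult.commute)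
    ultimately show "(\<Sum>i<n. mat (- g) i l * chi l a b s * mat g a i * mat g b k) = (if a = l then 1 else 0) * (chi l a b s * mat g b k)"
      by (simp only:)
  qed
  also have "\<dots> = (\<Sum>a<n. \<Sum>b<n. chi a a b s * mat g b k)"
    by (intro sum.cong refl sum_delta_mult) simp
  also have "\<dots> = (\<Sum>b<n. \<Sum>a<n. chi a a b s * mat g b k)"
    by (rule sum.swap)
  also have "\<dots> = (\<Sum>b<n. ctr n b s * mat g b k)"
    by (simp add: ctr_def sum_distrib_right)
  finally show ?thesis .
qed

text \<open>The coordinates of the image of c in H under the embedding that wedges c with the
  identity element: the sum over i of the dual vector of e_i tensored with e_i \<and> c.\<close>

definition tfam :: "(nat \<Rightarrow> int) \<Rightarrow> nat \<Rightarrow> nat \<Rightarrow> nat \<Rightarrow> int"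
  where "tfam c i j k = (if i = j then 1 else 0) * c k - (if i = k then 1 else 0) * c j"

text \<open>The identity element is invariant, so conjugation only transforms
  \<open>c\<close>.\<close>

lemma tfam_cj:
  assumes "u \<in> Ia n" "g \<in> An n" "i < n"
    and c: "\<And>i j k. i < n \<Longrightarrow> j < n \<Longrightarrow> k < n \<Longrightarrow> chi i j k u = tfam c i j k"
  shows "chi i j k (cj u g) = tfam (\<lambda>k. \<Sum>b<n. c b * mat g b k) i j k"
proof -
  let ?h = "mat (- g)" and ?g = "mat g"
  have in1: "(\<Sum>l<n. ?h i l * chi l a b u) = ?h i a * c b - ?h i b * c a" if "a < n" "b < n" for a b
  proof -
    have "(\<Sum>l<n. ?h i l * chi l a b u) = (\<Sum>l<n. (?h i l * c b) * (if l = a then 1 else 0) - (?h i l * c a) * (if l = b then 1 else 0))"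
      using that by (intro sum.cong refl) (simp add: c tfam_def algebra_simps)
    also have "\<dots> = ?h i a * c b - ?h i b * c a"
      unfolding sum_subtractf using that by (simp only: sum_delta_mult)
    finally show ?thesis .
  qed
  have "chi i j k (cj u g) = (\<Sum>a<n. \<Sum>b<n. (?h i a * c b - ?h i b * c a) * ?g a j * ?g b k)"
    unfolding chi_cj[OF assms(1-3)] by (intro sum.cong refl) (simp add: in1)
  also have "\<dots> = (\<Sum>a<n. \<Sum>b<n. (?h i a * ?g a j) * (c b * ?g b k)) - (\<Sum>a<n. \<Sum>b<n. (c a * ?g a j) * (?h i b * ?g b k))"
    unfolding sum_subtractf[symmetric] by (intro sum.cong refl) (simp add: algebra_simps)
  also have "\<dots> = (\<Sum>a<n. ?h i a * ?g a j) * (\<Sum>b<n. c b * ?g b k) - (\<Sum>a<n. c a * ?g a j) * (\<Sum>b<n. ?h i b * ?g b k)"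
    unfolding sum_product ..
  also have "\<dots> = tfam (\<lambda>k. \<Sum>b<n. c b * mat g b k) i j k"
    unfolding mat_inverse[OF assms(2,3)] by (simp add: tfam_def)
  finally show ?thesis .
qed

lemma chi_cj_W:
  assumes "s \<in> Ia n" "\<pi> permutes {0..<n}" "w = spm \<pi> \<epsilon>" "w \<in> W 0 n" "i < n" "j < n" "k < n"
  shows "chi (\<pi> i) (\<pi> j) (\<pi> k) (cj s w) = sgn_if (\<epsilon> i) (sgn_if (\<epsilon> j) (sgn_if (\<epsilon> k) (chi i j k s)))"
proof -
  have w: "app w (gn m) = sgn_if (\<epsilon> m) (gn (\<pi> m))" for m
    using assms app_spm permutes_bij by blast
  have inj: "\<pi> a = \<pi> b \<longleftrightarrow> a = b" for a b
    using permutes_inj[OF assms(2)] by (auto dest: injD)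
  have \<pi>: "\<pi> m < n" if "m < n" for m
    using perm_lt[OF assms(2) that] .
  have "app (- w) (gn (\<pi> i)) = sgn_if (\<epsilon> i) (gn i)"
    by (intro app_uminus_eq) (simp add: w)
  then have h: "mat (- w) (\<pi> i) l = sgn_if (\<epsilon> i) 1 * (if i = l then 1 else 0)" for l
    by (simp add: sgn_if_def)
  have g: "mat w a (\<pi> j) = (if a = j then 1 else 0) * sgn_if (\<epsilon> j) 1" for a j
    by (simp add: w inj sgn_if_def)
  have 1: "(\<Sum>l<n. mat (- w) (\<pi> i) l * chi l a b s) = sgn_if (\<epsilon> i) 1 * chi i a b s" for a b
    unfolding h using sum_delta_mult(1)[OF \<open>i < n\<close>, of "\<lambda>l. chi l a b s"]
    by (simp add: mult.assoc sum_distrib_left[symmetric])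
  have "chi (\<pi> i) (\<pi> j) (\<pi> k) (cj s w) =
      (\<Sum>a<n. \<Sum>b<n. sgn_if (\<epsilon> i) 1 * chi i a b s * mat w a (\<pi> j) * mat w b (\<pi> k))"
    using chi_cj[OF assms(1) W_An[OF assms(4)] \<pi>[OF \<open>i < n\<close>], of "\<pi> j" "\<pi> k"] unfolding 1 .
  also have "\<dots> = (\<Sum>a<n. (if a = j then 1 else 0) * (\<Sum>b<n. (if b = k then 1 else 0) *
      (sgn_if (\<epsilon> i) 1 * sgn_if (\<epsilon> j) 1 * sgn_if (\<epsilon> k) 1 * chi i a b s)))"
    unfolding g sum_distrib_left by (intro sum.cong refl) (simp add: algebra_simps)
  also have "\<dots> = sgn_if (\<epsilon> i) 1 * sgn_if (\<epsilon> j) 1 * sgn_if (\<epsilon> k) 1 * chi i j k s"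
    using assms by (simp only: sum_delta_mult)
  finally show ?thesis by (simp add: sgn_if_def)
qed

lemma chi_cj_t:
  assumes "s \<in> Ia n" "k < n" "q < n" "k \<noteq> q" "i < n" "i \<noteq> k" "j < n" "j \<noteq> q"
  shows "chi i j q (cj s (t k q)) = chi i j q s + chi i j k s"
proof -
  have h: "mat (- t k q) i l = (if i = l then 1 else 0)" for l
    using assms by (simp add: app_neg_t)
  have g: "mat (t k q) a j = (if a = j then 1 else 0)"
    "mat (t k q) a q = (if a = q then 1 else 0) + (if a = k then 1 else 0)" for a
    using assms by (auto simp: app_t)
  have "chi i j q (cj s (t k q)) = (\<Sum>a<n. \<Sum>b<n. chi i a b s * (if a = j then 1 else 0) *
      ((if b = q then 1 else 0) + (if b = k then 1 else 0)))"
    using chi_cj[OF assms(1) t_An[OF assms(2-4)] assms(5), of j q] unfolding h g sum_delta_mult[OF assms(5)] .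
  also have "\<dots> = (\<Sum>a<n. (if a = j then 1 else 0) * (\<Sum>b<n. chi i a b s * (if b = q then 1 else 0) + chi i a b s * (if b = k then 1 else 0)))"
    unfolding sum_distrib_left by (intro sum.cong refl) (simp add: algebra_simps)
  also have "\<dots> = chi i j q s + chi i j k s"
    unfolding sum.distrib using assms by (simp only: sum_delta_mult)
  finally show ?thesis .
qed

lemma chi_Q:
  assumes "i \<notin> supp a" "i \<notin> supp b"
  shows "chi i' j k (Q i a b) = (if i' = i then mu2 j k (- gn i + a + gn i + b) else 0)"
  using assms by (simp add: chi_def app_Q add.assoc del: mu2_simps(2,3))

section \<open>The dual basis of Magnus generators\<close>

definition basis :: "nat \<Rightarrow> (nat \<times> nat \<times> nat) set"
  where "basis n = {(i, j, k). i < n \<and> j < k \<and> k < n}"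

lemma finite_basis [simp]: "finite (basis n)"
  by (rule finite_subset[of _ "{..<n} \<times> {..<n} \<times> {..<n}"]) (auto simp: basis_def)

definition chib :: "nat \<times> nat \<times> nat \<Rightarrow> faut \<Rightarrow> int"
  where "chib b = (case b of (i, j, k) \<Rightarrow> chi i j k)"

text \<open>When i is the second wedge index the inverse of Magnus's generator is taken; this sign
  makes the Johnson coordinates exactly dual.\<close>

definition Kb :: "nat \<times> nat \<times> nat \<Rightarrow> faut"
  where "Kb b = (case b of (i, j, k) \<Rightarrow>
    if i = j then Q i (- gn k) (gn k) else if i = k then Q i (gn j) (- gn j) else Q i 0 (comm (gn j) (gn k)))"

lemma Kb_Ia: "b \<in> basis n \<Longrightarrow> Kb b \<in> Ia n"
  by (cases b) (simp add: Kb_def basis_def Q_in_Ia)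

lemma chi_Kb:
  assumes "a \<noteq> b"
  shows "chi i j k (Kb (i', a, b)) =
    (if i = i' then (if a = j \<and> b = k then 1 else 0) - (if b = j \<and> a = k then 1 else 0) else 0)"
proof -
  consider "i' = a" | "i' = b" | "i' \<noteq> a" "i' \<noteq> b" by blast
  then show ?thesis
    using assms by cases (auto simp: Kb_def chi_Q comm_def)
qed

lemma chib_Kb: "b \<in> basis n \<Longrightarrow> b' \<in> basis n \<Longrightarrow> chib b (Kb b') = (if b = b' then 1 else 0)"
  by (cases b; cases b') (auto simp: basis_def chib_def chi_Kb)

text \<open>Since \<^term>\<open>Ia n = Nn n\<close>, properties of the Torelli subgroup can be checked on the dual basis.\<close>
lemma Ia_induct [consumes 1, case_names comm Kb plus uminus]:
  assumes "s \<in> Ia n"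
    and comm: "\<And>s u. s \<in> Ia n \<Longrightarrow> u \<in> Ia n \<Longrightarrow> P (comm s u)"
    and Kb: "\<And>b. b \<in> basis n \<Longrightarrow> P (Kb b)"
    and plus: "\<And>s u. s \<in> Ia n \<Longrightarrow> u \<in> Ia n \<Longrightarrow> P s \<Longrightarrow> P u \<Longrightarrow> P (s + u)"
    and uminus: "\<And>s. s \<in> Ia n \<Longrightarrow> P s \<Longrightarrow> P (- s)"
  shows "P s"
proof -
  have "s \<in> Nn n" using assms(1) Ia_eq_Nn by simp
  then show ?thesis
  proof induction
    case (K i l)
    show ?case
    proof (cases "i < l")
      case True
      then show ?thesis using Kb[of "(i, i, l)"] K by (simp add: Kb_def basis_def)
    next
      case False
      have b: "(i, l, i) \<in> basis n" using False K by (simp add: basis_def)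
      have "- Kb (i, l, i) = Q i (- gn l) (gn l)"
        using K by (simp add: Kb_def Q_uminus)
      then show ?thesis using uminus[OF Kb_Ia[OF b] Kb[OF b]] by simp
    qed
  next
    case (Kc i a b)
    consider "a < b" | "b < a" | "a = b" by linarith
    then show ?case
    proof cases
      case 1
      then show ?thesis using Kb[of "(i, a, b)"] Kc by (simp add: Kb_def basis_def)
    next
      case 2
      have b: "(i, b, a) \<in> basis n" using 2 Kc by (simp add: basis_def)
      have "- comm (gn b) (gn a) = comm (gn a) (gn b)"
        by (simp add: comm_def group_normalize del: add_uminus_conv_diff)
      then have "- Kb (i, b, a) = Q i 0 (comm (gn a) (gn b))"
        using Kc 2 by (simp add: Kb_def Q_uminus comm_def)
      then show ?thesis using uminus[OF Kb_Ia[OF b] Kb[OF b]] by simp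
    next
      case 3
      then show ?thesis using comm[of 0 0] by (simp add: comm_def)
    qed
  qed (auto intro: comm plus uminus simp: Nn_Ia)
qed

lemma chib_plus: "s \<in> Ia n \<Longrightarrow> u \<in> Ia n \<Longrightarrow> b \<in> basis n \<Longrightarrow> chib b (s + u) = chib b s + chib b u"
  by (auto simp: chib_def basis_def chi_plus)

lemma chib_uminus: "s \<in> Ia n \<Longrightarrow> b \<in> basis n \<Longrightarrow> chib b (- s) = - chib b s"
  by (auto simp: chib_def basis_def chi_uminus)

lemma chib_multiple:
  assumes "s \<in> Ia n"
  shows "\<exists>u\<in>Ia n. \<forall>b\<in>basis n. chib b u = m * chib b s"
proof -
  have nat: "\<exists>u\<in>Ia n. \<forall>b\<in>basis n. chib b u = int m * chib b s" for m
  proof (induction m)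
    case 0
    then show ?case by (intro bexI[of _ 0]) (auto simp: chib_def)
  next
    case (Suc m)
    then obtain u where "u \<in> Ia n" "\<forall>b\<in>basis n. chib b u = int m * chib b s" by blast
    then show ?case
      using assms by (intro bexI[of _ "u + s"]) (auto simp: chib_plus Ia_plus algebra_simps)
  qed
  show ?thesis
  proof (cases "m \<ge> 0")
    case True
    then show ?thesis using nat[of "nat m"] by simp
  next
    case False
    then obtain u where "u \<in> Ia n" "\<forall>b\<in>basis n. chib b u = - m * chib b s"
      using nat[of "nat (- m)"] by auto
    then show ?thesis
      by (intro bexI[of _ "- u"]) (auto simp: chib_uminus Ia_uminus)
  qed
qed

text \<open>Prescribed coordinates are realized, which later lets an endomorphism of the
  abelianization be defined by its coordinates alone.\<close>

lemma chib_surj: "\<exists>s\<in>Ia n. \<forall>b\<in>basis n. chib b s = c b"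
proof -
  have "\<exists>s\<in>Ia n. \<forall>b\<in>basis n. chib b s = (if b \<in> B then c b else 0)" if "B \<subseteq> basis n" for B
    using finite_subset[OF that finite_basis] that
  proof (induction B rule: finite_induct)
    case empty
    then show ?case by (intro bexI[of _ 0]) (auto simp: chib_def)
  next
    case (insert x B)
    then obtain s where s: "s \<in> Ia n" "\<forall>b\<in>basis n. chib b s = (if b \<in> B then c b else 0)"
      by auto
    obtain u where u: "u \<in> Ia n" "\<forall>b\<in>basis n. chib b u = c x * chib b (Kb x)"
      using chib_multiple[OF Kb_Ia[of x n], of "c x"] insert.prems by auto
    then show ?case
      using s insert by (intro bexI[of _ "s + u"]) (auto simp: chib_plus Ia_plus chib_Kb)
  qed
  from this[of "basis n"] show ?thesis by auto
qed

lemma chi_from_chib: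
  assumes "s \<in> Ia n" "\<And>b. b \<in> basis n \<Longrightarrow> chib b s = (case b of (i, j, k) \<Rightarrow> f i j k)"
    and "\<And>i j k. f i k j = - f i j k" "i < n" "j < n" "k < n"
  shows "chi i j k s = (f i j k :: int)"
proof -
  have lt: "chi i j k s = f i j k" if "j < k" "k < n" for j k
    using assms(2)[of "(i, j, k)"] that assms(4) by (simp add: chib_def basis_def)
  consider "j < k" | "k < j" | "j = k" by linarith
  then show ?thesis
  proof cases
    case 2
    then show ?thesis
      using lt[OF 2 assms(5)] chi_alt[OF assms(1), of i k j] assms(3)[of i k j] by linarith
  next
    case 3
    then show ?thesis
      using chi_diag[OF assms(1), of i k] assms(3)[of i k k] by simp
  qed (use lt assms(6) in blast)
qed

section \<open>Transport to the group records\<close>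

inductive_set Der :: "'a::group_add set \<Rightarrow> 'a set" for S where
  comm: "x \<in> S \<Longrightarrow> y \<in> S \<Longrightarrow> comm x y \<in> Der S"
| plus: "x \<in> Der S \<Longrightarrow> y \<in> Der S \<Longrightarrow> x + y \<in> Der S"
| uminus: "x \<in> Der S \<Longrightarrow> - x \<in> Der S"

text \<open>Identifies a subset of a \<open>group_add\<close> type with a group record, so that all
  computations can stay on the additive side.\<close>

locale transport =
  fixes S :: "'a::group_add set" and G (structure) and \<phi> :: "'a \<Rightarrow> 'b"
  assumes zero: "0 \<in> S" and plus: "x \<in> S \<Longrightarrow> y \<in> S \<Longrightarrow> x + y \<in> S" and uminus: "x \<in> S \<Longrightarrow> - x \<in> S"
    and bij: "bij_betw \<phi> S (carrier G)"
    and mult: "x \<in> S \<Longrightarrow> y \<in> S \<Longrightarrow> \<phi> (x + y) = \<phi> x \<otimes> \<phi> y"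
    and one: "\<phi> 0 = \<one>"
begin

lemma closed: "x \<in> S \<Longrightarrow> \<phi> x \<in> carrier G"
  using bij by (auto simp: bij_betw_def)

lemma ex: "y \<in> carrier G \<Longrightarrow> \<exists>x\<in>S. y = \<phi> x"
  using bij by (auto simp: bij_betw_def)

lemma inj: "x \<in> S \<Longrightarrow> y \<in> S \<Longrightarrow> \<phi> x = \<phi> y \<longleftrightarrow> x = y"
  using bij by (auto simp: bij_betw_def inj_on_def)

lemma group: "group G"
proof (rule groupI)
  show "x \<otimes> y \<in> carrier G" if "x \<in> carrier G" "y \<in> carrier G" for x y
  proof -
    obtain a b where "a \<in> S" "b \<in> S" "x = \<phi> a" "y = \<phi> b" using ex \<open>x \<in> _\<close> \<open>y \<in> _\<close> by metis
    then show ?thesis by (simp add: mult[symmetric] closed plus)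
  qed
  show "\<one> \<in> carrier G" using closed[OF zero] one by simp
  show "x \<otimes> y \<otimes> z = x \<otimes> (y \<otimes> z)" if xyz: "x \<in> carrier G" "y \<in> carrier G" "z \<in> carrier G" for x y z
  proof -
    obtain a b c where "a \<in> S" "b \<in> S" "c \<in> S" "x = \<phi> a" "y = \<phi> b" "z = \<phi> c" using ex xyz by metis
    then show ?thesis by (simp add: mult[symmetric] plus add.assoc)
  qed
  show "\<one> \<otimes> x = x" if "x \<in> carrier G" for x
  proof -
    obtain a where "a \<in> S" "x = \<phi> a" using ex \<open>x \<in> _\<close> by metis
    then show ?thesis by (simp add: one[symmetric] mult[symmetric] zero)
  qed
  show "\<exists>y\<in>carrier G. y \<otimes> x = \<one>" if "x \<in> carrier G" for x
  proof -
    obtain a where "a \<in> S" "x = \<phi> a" using ex \<open>x \<in> _\<close> by metis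
    then show ?thesis
      by (intro bexI[of _ "\<phi> (- a)"]) (simp_all add: one[symmetric] mult[symmetric] uminus closed)
  qed
qed

lemma hom_inv: "x \<in> S \<Longrightarrow> inv \<phi> x = \<phi> (- x)"
  by (rule group.inv_equality[OF group]) (simp_all add: mult[symmetric] one[symmetric] uminus closed)

lemma hom_one: "\<phi> 0 = \<one>"
  by (rule one)

lemma hom_comm: "x \<in> S \<Longrightarrow> y \<in> S \<Longrightarrow> \<phi> (comm x y) = \<phi> x \<otimes> \<phi> y \<otimes> inv \<phi> x \<otimes> inv \<phi> y"
  by (simp add: comm_def diff_conv_add_uminus mult plus uminus hom_inv del: add_uminus_conv_diff)

lemma Der_S: "x \<in> Der S \<Longrightarrow> x \<in> S"
proof (induction rule: Der.induct)
  case (comm x y)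
  then show ?case
    unfolding comm_def diff_conv_add_uminus by (intro plus uminus)
qed (auto intro: plus uminus)

lemma derived: "derived G (carrier G) = \<phi> ` Der S"
proof
  have "\<phi> x \<in> derived G (carrier G)" if "x \<in> Der S" for x
    using that
  proof induction
    case (comm x y)
    then show ?case
      unfolding derived_def using closed hom_comm by (intro generate.incl) blast
  next
    case (plus x y)
    then show ?case
      unfolding derived_def by (simp add: mult Der_S generate.eng)
  next
    case (uminus x)
    then show ?case
      unfolding derived_def using group.generate_m_inv_closed[OF group group.derived_set_in_carrier[OF group order_refl]]
      by (simp add: hom_inv[symmetric] Der_S)
  qed
  then show "\<phi> ` Der S \<subseteq> derived G (carrier G)" by blast
  have "y \<in> \<phi> ` Der S" if "y \<in> generate G (derived_set G (carrier G))" for y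
    using that
  proof induction
    case one
    have "\<phi> (comm 0 0) = \<one>" by (simp add: comm_def hom_one)
    then show ?case using Der.comm[OF zero zero] by (metis image_eqI)
  next
    case (incl h)
    then obtain x y where "x \<in> carrier G" "y \<in> carrier G" "h = x \<otimes> y \<otimes> inv x \<otimes> inv y" by blast
    moreover then obtain a b where "a \<in> S" "b \<in> S" "x = \<phi> a" "y = \<phi> b" using ex by metis
    ultimately show ?case by (metis Der.comm hom_comm image_eqI)
  next
    case (inv h)
    then obtain x y where "x \<in> carrier G" "y \<in> carrier G" "h = x \<otimes> y \<otimes> inv x \<otimes> inv y" by blast
    moreover then obtain a b where ab: "a \<in> S" "b \<in> S" "x = \<phi> a" "y = \<phi> b" using ex by metis
    ultimately have "h = \<phi> (comm a b)" by (simp add: hom_comm)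
    then have "inv h = \<phi> (- comm a b)"
      using Der_S[OF Der.comm[OF ab(1,2)]] by (simp add: hom_inv)
    then show ?case using Der.uminus[OF Der.comm[OF ab(1,2)]] by simp
  next
    case (eng h1 h2)
    then show ?case by (auto simp: mult[symmetric] Der_S intro: Der.plus)
  qed
  then show "derived G (carrier G) \<subseteq> \<phi> ` Der S"
    unfolding derived_def by blast
qed

end

section \<open>The records of F_n, Aut F_n and IA_n\<close>

definition Fn :: "nat \<Rightarrow> fgrp set"
  where "Fn n = {w. supp w \<subseteq> {..<n}}"

lemma Rep_Fn: "w \<in> Fn n \<longleftrightarrow> Rep_fgrp w \<in> carrier (free_group_n n)"
  by (auto simp: Fn_def supp_def free_group_def)

lemma Rep_Abs: "x \<in> carrier (free_group_n n) \<Longrightarrow> Rep_fgrp (Abs_fgrp x) = x"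
  by (auto simp: free_group_def Abs_fgrp_inverse)

interpretation free: transport "Fn n" "free_group_n n" Rep_fgrp for n
proof
  show "bij_betw Rep_fgrp (Fn n) (carrier (free_group_n n))"
    by (rule bij_betwI[of _ _ _ Abs_fgrp]) (auto simp: Rep_Fn Rep_Abs Rep_fgrp_inverse)
qed (auto simp: Fn_def free_group_def plus_fgrp.rep_eq zero_fgrp.rep_eq)

lemma Der_Fn: "Der (Fn n) = {w \<in> Fn n. \<forall>j. mu j w = 0}"
proof
  have "w \<in> Fn n \<and> (\<forall>j. mu j w = 0)" if "w \<in> Der (Fn n)" for w
    using that by induction (auto simp: Fn_def)
  then show "Der (Fn n) \<subseteq> {w \<in> Fn n. \<forall>j. mu j w = 0}" by blast
  have "w \<in> Der (Fn n)" if "w \<in> Dv {..<n}" for w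
    using that by induction (auto simp: Fn_def intro: Der.intros)
  then show "{w \<in> Fn n. \<forall>j. mu j w = 0} \<subseteq> Der (Fn n)"
    using in_Dv by (fastforce simp: Fn_def)
qed

definition Phi :: "nat \<Rightarrow> faut \<Rightarrow> nat word \<Rightarrow> nat word"
  where "Phi n g = (\<lambda>w\<in>carrier (free_group_n n). Rep_fgrp (app g (Abs_fgrp w)))"

lemma app_Fn: "g \<in> An n \<Longrightarrow> w \<in> Fn n \<Longrightarrow> app g w \<in> Fn n"
  by (simp add: Fn_def An_supp)

lemma Phi_Rep: "w \<in> Fn n \<Longrightarrow> Phi n g (Rep_fgrp w) = Rep_fgrp (app g w)"
  by (simp add: Phi_def Rep_Fn Rep_fgrp_inverse)

lemma Phi_auto:
  assumes "g \<in> An n"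
  shows "Phi n g \<in> auto (free_group_n n)"
  unfolding auto_def Bij_def
proof (intro IntI CollectI)
  let ?F = "free_group_n n"
  show "Phi n g \<in> hom ?F ?F"
  proof (rule homI)
    fix x y assume "x \<in> carrier ?F" "y \<in> carrier ?F"
    then obtain u v where uv: "u \<in> Fn n" "v \<in> Fn n" "x = Rep_fgrp u" "y = Rep_fgrp v"
      using free.ex by metis
    show "Phi n g x \<in> carrier ?F"
      using uv assms by (simp add: Phi_Rep app_Fn free.closed)
    have "Phi n g (x \<otimes>\<^bsub>?F\<^esub> y) = Rep_fgrp (app g (u + v))"
      using uv by (simp only: free.mult[symmetric] Phi_Rep free.plus)
    then show "Phi n g (x \<otimes>\<^bsub>?F\<^esub> y) = Phi n g x \<otimes>\<^bsub>?F\<^esub> Phi n g y"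
      using uv assms by (simp add: Phi_Rep app_Fn free.mult)
  qed
  show "Phi n g \<in> extensional (carrier ?F)"
    by (simp add: Phi_def)
  show "bij_betw (Phi n g) (carrier ?F) (carrier ?F)"
  proof (rule bij_betwI[of _ _ _ "Phi n (- g)"])
    have "Phi n h \<in> carrier ?F \<rightarrow> carrier ?F" if "h \<in> An n" for h
      using that free.ex by (fastforce simp: Phi_Rep app_Fn free.closed)
    then show "Phi n g \<in> carrier ?F \<rightarrow> carrier ?F" "Phi n (- g) \<in> carrier ?F \<rightarrow> carrier ?F"
      using assms An_uminus by blast+
    have "Phi n (- h) (Phi n h x) = x" if "x \<in> carrier ?F" "h \<in> An n" for x h
    proof -
      obtain u where "u \<in> Fn n" "x = Rep_fgrp u" using free.ex \<open>x \<in> _\<close> by metis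
      then show ?thesis using that by (simp add: Phi_Rep app_Fn)
    qed
    from this[OF _ assms] this[OF _ An_uminus[OF assms]]
    show "Phi n (- g) (Phi n g x) = x" "Phi n g (Phi n (- g) x) = x" if "x \<in> carrier ?F" for x
      using that by simp_all
  qed
qed

lemma lft_eq_on_Fn:
  assumes "\<And>u v. u \<in> Fn n \<Longrightarrow> v \<in> Fn n \<Longrightarrow> \<sigma> (u + v) = \<sigma> u + \<sigma> v"
    and f: "\<And>i. i < n \<Longrightarrow> f i = \<sigma> (gn i)" and "w \<in> Fn n"
  shows "lft f w = (\<sigma> w :: fgrp)"
proof -
  have "\<sigma> 0 + \<sigma> 0 = \<sigma> 0"
    using assms(1)[of 0 0] free.zero[of n] by simp
  then have "- \<sigma> 0 + (\<sigma> 0 + \<sigma> 0) = - \<sigma> 0 + \<sigma> 0" by simp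
  then have 0: "\<sigma> 0 = 0" by simp
  have neg: "\<sigma> (- u) = - \<sigma> u" if "u \<in> Fn n" for u
    using assms(1)[of u "- u"] that free.uminus[OF that] 0 by (simp add: minus_unique)
  have "supp w \<subseteq> {..<n}" using assms(3) by (simp add: Fn_def)
  then show ?thesis
  proof (induction rule: supp_closed_induct)
    case (plus i b w)
    have "gn i \<in> Fn n" "sgn_if b (gn i) \<in> Fn n" "w \<in> Fn n" using plus by (auto simp: Fn_def)
    then show ?case
      using plus f[of i] neg by (auto simp: assms(1) sgn_if_def)
  qed (simp add: 0)
qed

text \<open>The given automorphism of the record and its inverse are both extended by the identity
  beyond rank n; each certifies that the other is bijective.\<close>

lemma Phi_surj:
  assumes "\<sigma> \<in> auto (free_group_n n)"
  shows "\<exists>g\<in>An n. Phi n g = \<sigma>"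
proof -
  let ?F = "free_group_n n"
  let ?\<tau> = "inv_into (carrier ?F) \<sigma>"
  have h: "\<sigma> \<in> hom ?F ?F" and e: "\<sigma> \<in> extensional (carrier ?F)" and b: "bij_betw \<sigma> (carrier ?F) (carrier ?F)"
    using assms by (auto simp: auto_def Bij_def)
  have b': "bij_betw ?\<tau> (carrier ?F) (carrier ?F)"
    using b by (rule bij_betw_inv_into)
  have h': "?\<tau> (x \<otimes>\<^bsub>?F\<^esub> y) = ?\<tau> x \<otimes>\<^bsub>?F\<^esub> ?\<tau> y" if "x \<in> carrier ?F" "y \<in> carrier ?F" for x y
    using that h assms free.group[of n] by (intro Bij_inv_into_lemma[where S = "carrier ?F"])
      (auto simp: hom_def auto_def intro!: monoid.m_closed group.is_monoid)
  define s where "s u = Abs_fgrp (\<sigma> (Rep_fgrp u))" for u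
  define s' where "s' u = Abs_fgrp (?\<tau> (Rep_fgrp u))" for u
  have Rs: "Rep_fgrp (s u) = \<sigma> (Rep_fgrp u)" "Rep_fgrp (s' u) = ?\<tau> (Rep_fgrp u)" if "u \<in> Fn n" for u
    unfolding s_def s'_def using that b b' by (auto intro!: Rep_Abs simp: Rep_Fn bij_betw_def)
  have sF: "s u \<in> Fn n" "s' u \<in> Fn n" if "u \<in> Fn n" for u
    using that b b' by (auto simp: Rep_Fn Rs bij_betw_def)
  have ss: "s' (s u) = u" "s (s' u) = u" if u: "u \<in> Fn n" for u
  proof -
    have "Rep_fgrp u \<in> carrier ?F" using u by (simp only: Rep_Fn)
    then have "Rep_fgrp (s' (s u)) = Rep_fgrp u" "Rep_fgrp (s (s' u)) = Rep_fgrp u"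
      unfolding Rs(2)[OF sF(1)[OF u]] Rs(1)[OF sF(2)[OF u]] Rs[OF u]
      using bij_betw_inv_into_left[OF b] bij_betw_inv_into_right[OF b] by simp_all
    then show "s' (s u) = u" "s (s' u) = u" by (simp_all only: Rep_fgrp_inject)
  qed
  have sp: "s (u + v) = s u + s v" "s' (u + v) = s' u + s' v" if uv: "u \<in> Fn n" "v \<in> Fn n" for u v
  proof -
    have c: "Rep_fgrp u \<in> carrier ?F" "Rep_fgrp v \<in> carrier ?F" using uv by (simp_all only: Rep_Fn)
    have "Rep_fgrp (s (u + v)) = Rep_fgrp (s u + s v)" "Rep_fgrp (s' (u + v)) = Rep_fgrp (s' u + s' v)"
      unfolding Rs[OF free.plus[OF uv]] free.mult[OF uv] free.mult[OF sF(1)[OF uv(1)] sF(1)[OF uv(2)]]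
        free.mult[OF sF(2)[OF uv(1)] sF(2)[OF uv(2)]] Rs[OF uv(1)] Rs[OF uv(2)]
      by (rule hom_mult[OF h c], rule h'[OF c])
    then show "s (u + v) = s u + s v" "s' (u + v) = s' u + s' v" by (simp_all only: Rep_fgrp_inject)
  qed
  let ?f = "\<lambda>i. if i < n then s (gn i) else gn i" and ?g = "\<lambda>i. if i < n then s' (gn i) else gn i"
  have lf: "lft ?f w = s w" "lft ?g w = s' w" if "w \<in> Fn n" for w
    using lft_eq_on_Fn[of n s ?f w] lft_eq_on_Fn[of n s' ?g w] that sp by simp_all
  have gF: "gn i \<in> Fn n" if "i < n" for i
    using that by (simp add: Fn_def)
  have "app (mk ?f) = lft ?f"
    by (rule app_mk[of ?g]) (auto simp: lf sF gF ss)
  moreover have "app (mk ?g) = lft ?g"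
    by (rule app_mk[of ?f]) (auto simp: lf sF gF ss)
  moreover have "- mk ?f = mk ?g"
    by (rule faut_eqI, rule app_uminus_eq) (auto simp: calculation lf sF gF ss)
  ultimately have "mk ?f \<in> An n"
    using sF gF by (auto simp: An_def Fn_def)
  moreover have "Phi n (mk ?f) = \<sigma>"
  proof (rule extensionalityI[OF _ e])
    show "Phi n (mk ?f) \<in> extensional (carrier ?F)" by (simp add: Phi_def)
    fix x assume "x \<in> carrier ?F"
    then obtain u where "u \<in> Fn n" "x = Rep_fgrp u" using free.ex by metis
    then show "Phi n (mk ?f) x = \<sigma> x"
      using \<open>app (mk ?f) = lft ?f\<close> by (simp add: Phi_Rep lf Rs)
  qed
  ultimately show ?thesis by blast
qed

interpretation aut: transport "An n" "Aut_F n" "Phi n" for n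
proof
  show "bij_betw (Phi n) (An n) (carrier (Aut_F n))"
    unfolding bij_betw_def
  proof
    show "inj_on (Phi n) (An n)"
    proof (rule inj_onI)
      fix g h assume gh: "g \<in> An n" "h \<in> An n" "Phi n g = Phi n h"
      show "g = h"
      proof (rule faut_eqI)
        fix i
        show "app g (gn i) = app h (gn i)"
        proof (cases "i < n")
          case True
          then have "gn i \<in> Fn n" by (simp add: Fn_def)
          then have "Rep_fgrp (app g (gn i)) = Rep_fgrp (app h (gn i))"
            using gh(3) by (metis Phi_Rep)
          then show ?thesis by (simp add: Rep_fgrp_inject)
        qed (use gh in \<open>simp add: An_app_fix\<close>)
      qed
    qed
    show "Phi n ` An n = carrier (Aut_F n)"
      using Phi_auto Phi_surj by (fastforce simp: aut_group_def)
  qed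
  show "Phi n 0 = \<one>\<^bsub>Aut_F n\<^esub>"
    by (auto simp: Phi_def aut_group_def AutoGroup_def BijGroup_def Rep_Abs fun_eq_iff restrict_def)
  show "Phi n (g + h) = Phi n g \<otimes>\<^bsub>Aut_F n\<^esub> Phi n h" if "g \<in> An n" "h \<in> An n" for g h
  proof -
    have "Phi n g \<in> Bij (carrier (free_group_n n))" "Phi n h \<in> Bij (carrier (free_group_n n))"
      using that Phi_auto by (auto simp: auto_def)
    then have e: "Phi n g \<otimes>\<^bsub>Aut_F n\<^esub> Phi n h = compose (carrier (free_group_n n)) (Phi n h) (Phi n g)"
      by (simp add: aut_group_def AutoGroup_def BijGroup_def)
    show ?thesis
      unfolding e
    proof (rule extensionalityI)
      fix x assume x: "x \<in> carrier (free_group_n n)"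
      then obtain u where "u \<in> Fn n" "x = Rep_fgrp u" using free.ex by metis
      then show "Phi n (g + h) x = compose (carrier (free_group_n n)) (Phi n h) (Phi n g) x"
        using that x by (simp add: Phi_Rep compose_eq app_Fn)
    qed (auto simp: Phi_def)
  qed
qed (auto intro: An_plus An_uminus)

text \<open>The cosets of the commutator subgroup are the level sets of the exponent sums.\<close>

lemma coset_F:
  assumes "x \<in> Fn n"
  shows "derived (free_group_n n) (carrier (free_group_n n)) #>\<^bsub>free_group_n n\<^esub> Rep_fgrp x =
    Rep_fgrp ` {w \<in> Fn n. \<forall>j. mu j w = mu j x}"
proof -
  have "{w \<in> Fn n. \<forall>j. mu j w = mu j x} = (\<lambda>d. d + x) ` {w \<in> Fn n. \<forall>j. mu j w = 0}"
  proof (intro equalityI subsetI)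
    fix w assume "w \<in> {w \<in> Fn n. \<forall>j. mu j w = mu j x}"
    then have "w = (w - x) + x" "w - x \<in> {w \<in> Fn n. \<forall>j. mu j w = 0}"
      using assms by (auto simp: Fn_def)
    then show "w \<in> (\<lambda>d. d + x) ` {w \<in> Fn n. \<forall>j. mu j w = 0}" by blast
  qed (use assms free.plus in auto)
  moreover have "derived (free_group_n n) (carrier (free_group_n n)) #>\<^bsub>free_group_n n\<^esub> Rep_fgrp x =
      (\<lambda>d. Rep_fgrp (d + x)) ` {w \<in> Fn n. \<forall>j. mu j w = 0}"
    unfolding free.derived Der_Fn r_coset_def using assms by (auto simp: free.mult[symmetric])
  ultimately show ?thesis by (simp add: image_image)
qed

text \<open>Acting trivially on the abelianization means preserving each level set of the exponent
  sums, which need only be tested on the generators.\<close>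

lemma carrier_IA: "carrier (IA n) = Phi n ` Ia n"
proof -
  let ?F = "free_group_n n" and ?cl = "\<lambda>x. Rep_fgrp ` {w \<in> Fn n. \<forall>j. mu j w = mu j x}"
  have ab: "carrier (abelianization ?F) = ?cl ` Fn n"
  proof -
    have "carrier ?F = Rep_fgrp ` Fn n" using free.bij by (auto simp: bij_betw_def)
    then have "carrier (abelianization ?F) = (\<lambda>w. derived ?F (carrier ?F) #>\<^bsub>?F\<^esub> Rep_fgrp w) ` Fn n"
      unfolding abelianization_def carrier_FactGroup by (metis image_image)
    also have "\<dots> = ?cl ` Fn n"
      by (intro image_cong refl coset_F)
    finally show ?thesis .
  qed
  have inj_Rep: "inj Rep_fgrp"
    by (simp add: inj_def Rep_fgrp_inject)
  have iff: "aut_abelianization ?F (Phi n g) = \<one>\<^bsub>aut_group (abelianization ?F)\<^esub> \<longleftrightarrow> g \<in> Ia n" if g: "g \<in> An n" for g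
  proof -
    have im: "Phi n g ` ?cl x = Rep_fgrp ` app g ` {w \<in> Fn n. \<forall>j. mu j w = mu j x}" for x
      by (auto simp: image_image Phi_Rep intro!: image_cong)
    have "aut_abelianization ?F (Phi n g) = \<one>\<^bsub>aut_group (abelianization ?F)\<^esub> \<longleftrightarrow>
        (\<forall>x\<in>Fn n. Phi n g ` ?cl x = ?cl x)"
    proof -
      have "\<one>\<^bsub>aut_group (abelianization ?F)\<^esub> = (\<lambda>C\<in>carrier (abelianization ?F). C)"
        by (simp add: aut_group_def AutoGroup_def BijGroup_def)
      then have "aut_abelianization ?F (Phi n g) = \<one>\<^bsub>aut_group (abelianization ?F)\<^esub> \<longleftrightarrow>
          (\<forall>C\<in>carrier (abelianization ?F). Phi n g ` C = C)"
        unfolding aut_abelianization_def by (metis (no_types, lifting) restrict_apply' restrict_ext)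
      then show ?thesis
        unfolding ab by blast
    qed
    also have "\<dots> \<longleftrightarrow> (\<forall>x\<in>Fn n. app g ` {w \<in> Fn n. \<forall>j. mu j w = mu j x} = {w \<in> Fn n. \<forall>j. mu j w = mu j x})"
      unfolding im inj_image_eq_iff[OF inj_Rep] ..
    also have "\<dots> \<longleftrightarrow> g \<in> Ia n"
    proof
      assume *: "\<forall>x\<in>Fn n. app g ` {w \<in> Fn n. \<forall>j. mu j w = mu j x} = {w \<in> Fn n. \<forall>j. mu j w = mu j x}"
      show "g \<in> Ia n"
      proof (rule in_IaI[OF g])
        fix i j assume "i < n"
        then have "gn i \<in> Fn n" by (simp add: Fn_def)
        then have "app g (gn i) \<in> {w \<in> Fn n. \<forall>j. mu j w = mu j (gn i)}"
          using * by blast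
        then show "mu j (app g (gn i)) = mu j (gn i)" by blast
      qed
    next
      assume I: "g \<in> Ia n"
      show "\<forall>x\<in>Fn n. app g ` {w \<in> Fn n. \<forall>j. mu j w = mu j x} = {w \<in> Fn n. \<forall>j. mu j w = mu j x}"
      proof (intro ballI equalityI subsetI)
        fix x w assume "w \<in> {w \<in> Fn n. \<forall>j. mu j w = mu j x}"
        then have "app (- g) w \<in> {w \<in> Fn n. \<forall>j. mu j w = mu j x}"
          using Ia_mu[OF Ia_uminus[OF I]] app_Fn[OF An_uminus[OF g]] by simp
        then have "app g (app (- g) w) \<in> app g ` {w \<in> Fn n. \<forall>j. mu j w = mu j x}" by blast
        then show "w \<in> app g ` {w \<in> Fn n. \<forall>j. mu j w = mu j x}" by simp
      qed (use I g in \<open>auto simp: Ia_mu app_Fn\<close>)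
    qed
    finally show ?thesis .
  qed
  have "carrier (Aut_F n) = Phi n ` An n"
    using aut.bij[of n] by (auto simp: bij_betw_def)
  then show ?thesis
    unfolding IA_def kernel_def using iff Ia_An by auto
qed

interpretation ia: transport "Ia n" "IA n" "Phi n" for n
proof
  show "bij_betw (Phi n) (Ia n) (carrier (IA n))"
    unfolding carrier_IA by (rule inj_on_imp_bij_betw) (auto intro!: inj_onI simp: aut.inj Ia_An)
qed (auto simp: IA_def aut.mult Ia_An aut.one intro: Ia_plus Ia_uminus)

lemma Der_Ia_chi: "s \<in> Der (Ia n) \<Longrightarrow> i < n \<Longrightarrow> chi i j k s = 0"
proof (induction rule: Der.induct)
  case (plus x y)
  then show ?case using ia.Der_S by (simp add: chi_plus[of _ n])
next
  case (uminus x)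
  then show ?case using ia.Der_S by (simp add: chi_uminus[of _ n])
qed (simp add: chi_comm)

section \<open>The abelianization of IA_n and its coordinates\<close>

definition cls :: "nat \<Rightarrow> faut \<Rightarrow> (nat word \<Rightarrow> nat word) set"
  where "cls n s = derived (IA n) (carrier (IA n)) #>\<^bsub>IA n\<^esub> Phi n s"

lemma normal_IA: "derived (IA n) (carrier (IA n)) \<lhd> IA n"
  by (rule group.derived_self_is_normal[OF ia.group])

lemma carrier_IA_ab: "carrier (IA_ab n) = cls n ` Ia n"
  unfolding IA_ab_def abelianization_def carrier_FactGroup carrier_IA image_image cls_def ..

lemma cls_eq: "s \<in> Ia n \<Longrightarrow> cls n s = Phi n ` (\<lambda>d. d + s) ` Der (Ia n)"
  unfolding cls_def ia.derived r_coset_def by (auto simp: ia.mult[symmetric] ia.Der_S)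

lemma cls_plus: "s \<in> Ia n \<Longrightarrow> u \<in> Ia n \<Longrightarrow> cls n (s + u) = cls n s \<otimes>\<^bsub>IA_ab n\<^esub> cls n u"
  unfolding IA_ab_def abelianization_def cls_def
  using normal.rcos_sum[OF normal_IA ia.closed ia.closed] by (simp add: ia.mult)

lemma one_IA_ab: "\<one>\<^bsub>IA_ab n\<^esub> = derived (IA n) (carrier (IA n))"
  by (simp add: IA_ab_def abelianization_def)

lemma cls_Der:
  assumes "s \<in> Der (Ia n)"
  shows "cls n s = \<one>\<^bsub>IA_ab n\<^esub>"
  unfolding one_IA_ab cls_def using assms
  by (intro subgroup.rcos_const[OF normal_imp_subgroup[OF normal_IA] ia.group]) (simp add: ia.derived)

lemma group_IA_ab: "group (IA_ab n)"
  unfolding IA_ab_def abelianization_def by (rule normal.factorgroup_is_group[OF normal_IA])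

lemma cls_chi:
  assumes "s \<in> Ia n" "u \<in> Ia n" "cls n s = cls n u" "i < n"
  shows "chi i j k s = chi i j k u"
proof -
  have "0 \<in> Der (Ia n)"
    using Der.comm[of 0 "Ia n" 0] by (simp add: comm_def)
  then have "Phi n s \<in> cls n s"
    unfolding cls_eq[OF assms(1)] image_image by (intro image_eqI[of _ _ 0]) simp_all
  then obtain d where d: "d \<in> Der (Ia n)" "Phi n s = Phi n (d + u)"
    unfolding assms(3) cls_eq[OF assms(2)] by blast
  then have "s = d + u"
    using assms by (simp add: ia.inj ia.plus ia.Der_S)
  then show ?thesis
    using assms d by (simp add: chi_plus[of _ n] ia.Der_S Der_Ia_chi)
qed

text \<open>The chosen representative is immaterial, since the Johnson coordinates vanish on
  commutators (\<open>cls_chi\<close>).\<close>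

definition chiV :: "nat \<Rightarrow> nat \<Rightarrow> nat \<Rightarrow> nat \<Rightarrow> (nat word \<Rightarrow> nat word) set \<Rightarrow> int"
  where "chiV n i j k C = chi i j k (SOME s. s \<in> Ia n \<and> cls n s = C)"

lemma chiV_cls:
  assumes "s \<in> Ia n" "i < n"
  shows "chiV n i j k (cls n s) = chi i j k s"
proof -
  let ?s = "SOME u. u \<in> Ia n \<and> cls n u = cls n s"
  have "?s \<in> Ia n \<and> cls n ?s = cls n s"
    by (rule someI[of _ s]) (simp add: assms)
  then show ?thesis
    unfolding chiV_def using cls_chi assms by blast
qed

text \<open>In the additive picture the left action is conjugation by the inverse, and conjugation
  permutes the commutator subgroup, so a whole coset goes onto a coset.\<close>

lemma IA_ab_action_cls:
  assumes "s \<in> Ia n" "g \<in> An n"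
  shows "IA_ab_action n (Phi n g) (cls n s) = cls n (cj s (- g))"
proof -
  have conj: "Phi n g \<otimes>\<^bsub>Aut_F n\<^esub> Phi n x \<otimes>\<^bsub>Aut_F n\<^esub> inv\<^bsub>Aut_F n\<^esub> (Phi n g) = Phi n (cj x (- g))" if "x \<in> Ia n" for x
    using that assms by (simp add: aut.hom_inv aut.mult[symmetric] An_plus An_uminus Ia_An cj_def del: add_uminus_conv_diff)
  have cj_Der: "cj d h \<in> Der (Ia n)" if "d \<in> Der (Ia n)" "h \<in> An n" for d h
    using that(1)
  proof induction
    case (comm x y)
    then show ?case using that by (auto simp: cj_comm intro!: Der.comm cj_Ia)
  qed (auto simp: cj_plus cj_uminus intro: Der.plus Der.uminus)
  have "(\<lambda>x. cj x (- g)) ` (\<lambda>d. d + s) ` Der (Ia n) = (\<lambda>d. d + cj s (- g)) ` Der (Ia n)"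
  proof (intro equalityI subsetI)
    fix y assume "y \<in> (\<lambda>d. d + cj s (- g)) ` Der (Ia n)"
    then obtain d where d: "d \<in> Der (Ia n)" "y = d + cj s (- g)" by blast
    then have "y = cj (cj d g + s) (- g)" by (simp add: cj_plus cj_back)
    then show "y \<in> (\<lambda>x. cj x (- g)) ` (\<lambda>d. d + s) ` Der (Ia n)"
      using cj_Der[OF d(1) assms(2)] by blast
  qed (use cj_Der[OF _ An_uminus[OF assms(2)]] in \<open>auto simp: cj_plus\<close>)
  moreover have "IA_ab_action n (Phi n g) (cls n s) = Phi n ` (\<lambda>x. cj x (- g)) ` (\<lambda>d. d + s) ` Der (Ia n)"
    unfolding IA_ab_action_def cls_eq[OF assms(1)] using assms
    by (auto simp: image_image conj Ia_plus ia.Der_S intro!: image_cong)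
  moreover have "cj s (- g) \<in> Ia n"
    using assms by (intro cj_Ia An_uminus)
  ultimately show ?thesis
    by (simp add: cls_eq)
qed

section \<open>Extension of scalars\<close>

locale tensor_setup = V: group V + L: cring L
  for V :: "('a, 'b) monoid_scheme" and L :: "('l, 'm) ring_scheme"
begin

abbreviation "S \<equiv> carrier V \<times> carrier L"
abbreviation "FG \<equiv> free_Abelian_group S"
abbreviation "R \<equiv> tensor_relations V L"
abbreviation "A \<equiv> tensor V L"

lemma R_generators:
  shows "x \<in> carrier V \<Longrightarrow> y \<in> carrier V \<Longrightarrow> a \<in> carrier L \<Longrightarrow>
      frag_of (x \<otimes>\<^bsub>V\<^esub> y, a) - frag_of (x, a) - frag_of (y, a) \<in> R"
    and "x \<in> carrier V \<Longrightarrow> a \<in> carrier L \<Longrightarrow> b \<in> carrier L \<Longrightarrow>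
      frag_of (x, a \<oplus>\<^bsub>L\<^esub> b) - frag_of (x, a) - frag_of (x, b) \<in> R"
  unfolding tensor_relations_def by (rule generate.incl, blast)+

lemma generators_closed:
  "{frag_of (x \<otimes>\<^bsub>V\<^esub> y, a) - frag_of (x, a) - frag_of (y, a) | x y a.
      x \<in> carrier V \<and> y \<in> carrier V \<and> a \<in> carrier L} \<union>
    {frag_of (x, a \<oplus>\<^bsub>L\<^esub> b) - frag_of (x, a) - frag_of (x, b) | x a b.
      x \<in> carrier V \<and> a \<in> carrier L \<and> b \<in> carrier L} \<subseteq> carrier FG"
proof -
  have "Poly_Mapping.keys (u - v - w) \<subseteq> S"
    if "Poly_Mapping.keys u \<subseteq> S" "Poly_Mapping.keys v \<subseteq> S" "Poly_Mapping.keys w \<subseteq> S" for u v w :: "'a \<times> 'l \<Rightarrow>\<^sub>0 int"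
    using that keys_diff[of "u - v" w] keys_diff[of u v] by blast
  then show ?thesis
    by (auto simp del: mem_Sigma_iff simp: SigmaI)
qed

lemma R_subgroup: "subgroup R FG"
  unfolding tensor_relations_def using group.generate_is_subgroup[OF group_free_Abelian_group generators_closed] .

lemma R_normal: "R \<lhd> FG"
  using comm_group.subgroup_imp_normal[OF abelian_free_Abelian_group R_subgroup] .

lemma R_keys: "r \<in> R \<Longrightarrow> Poly_Mapping.keys r \<subseteq> S"
  using subgroup.mem_carrier[OF R_subgroup] by fastforce

lemma R_zero [simp]: "0 \<in> R"
  using subgroup.one_closed[OF R_subgroup] by simp

lemma R_plus: "r \<in> R \<Longrightarrow> r' \<in> R \<Longrightarrow> r + r' \<in> R"
  using subgroup.m_closed[OF R_subgroup] by simp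

lemma R_uminus: "r \<in> R \<Longrightarrow> - r \<in> R"
  using subgroup.m_inv_closed[OF R_subgroup, of r] R_keys by simp

lemma R_diff: "r \<in> R \<Longrightarrow> r' \<in> R \<Longrightarrow> r - r' \<in> R"
  using R_plus[of r "- r'"] R_uminus by simp

lemma R_induct [consumes 1, case_names zero left right plus uminus]:
  assumes "r \<in> R" and zero: "P 0"
    and left: "\<And>x y a. x \<in> carrier V \<Longrightarrow> y \<in> carrier V \<Longrightarrow> a \<in> carrier L \<Longrightarrow>
      P (frag_of (x \<otimes>\<^bsub>V\<^esub> y, a) - frag_of (x, a) - frag_of (y, a))"
    and right: "\<And>x a b. x \<in> carrier V \<Longrightarrow> a \<in> carrier L \<Longrightarrow> b \<in> carrier L \<Longrightarrow>
      P (frag_of (x, a \<oplus>\<^bsub>L\<^esub> b) - frag_of (x, a) - frag_of (x, b))"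
    and plus: "\<And>r r'. r \<in> R \<Longrightarrow> r' \<in> R \<Longrightarrow> P r \<Longrightarrow> P r' \<Longrightarrow> P (r + r')"
    and uminus: "\<And>r. r \<in> R \<Longrightarrow> P r \<Longrightarrow> P (- r)"
  shows "P r"
  using assms(1) unfolding tensor_relations_def
proof (induction rule: generate.induct)
  case one
  then show ?case using zero by simp
next
  case (incl h)
  then show ?case using left right by blast
next
  case (inv h)
  then have "h \<in> R" unfolding tensor_relations_def by (rule generate.incl)
  moreover have "P h" using inv left right by blast
  ultimately show ?case using uminus R_keys by simp
next
  case (eng h1 h2)
  then show ?case using plus by (simp add: tensor_relations_def)
qed

definition q :: "('a \<times> 'l \<Rightarrow>\<^sub>0 int) \<Rightarrow> ('a \<times> 'l \<Rightarrow>\<^sub>0 int) set"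
  where "q c = R #>\<^bsub>FG\<^esub> c"

lemma q_alt: "q c = {r + c | r. r \<in> R}"
  by (auto simp: q_def r_coset_def)

lemma q_eq: "q c = q d \<longleftrightarrow> c - d \<in> R"
proof
  assume "q c = q d"
  moreover have "c \<in> q c" unfolding q_alt by (rule CollectI, rule exI[of _ 0]) simp
  ultimately have "c \<in> q d" by simp
  then show "c - d \<in> R" unfolding q_alt by auto
next
  assume cd: "c - d \<in> R"
  have "r + c \<in> q d" if "r \<in> R" for r
    unfolding q_alt using that cd R_plus by (intro CollectI exI[of _ "r + (c - d)"]) auto
  moreover have "r + d \<in> q c" if "r \<in> R" for r
    unfolding q_alt using that cd R_diff by (intro CollectI exI[of _ "r - (c - d)"]) auto
  ultimately show "q c = q d" unfolding q_alt by blast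
qed

lemma carrier_A: "carrier A = q ` {c. Poly_Mapping.keys c \<subseteq> S}"
  unfolding tensor_def tensor_group_def q_def by (auto simp: carrier_FactGroup)

lemma q_closed: "Poly_Mapping.keys c \<subseteq> S \<Longrightarrow> q c \<in> carrier A"
  by (simp add: carrier_A)

lemma q_ex: "m \<in> carrier A \<Longrightarrow> \<exists>c. Poly_Mapping.keys c \<subseteq> S \<and> m = q c"
  by (auto simp: carrier_A)

lemma q_add:
  assumes "Poly_Mapping.keys c \<subseteq> S" "Poly_Mapping.keys d \<subseteq> S"
  shows "q c \<oplus>\<^bsub>A\<^esub> q d = q (c + d)"
  using normal.rcos_sum[OF R_normal, of c d] assms by (simp add: tensor_def tensor_group_def q_def)

lemma zero_A: "\<zero>\<^bsub>A\<^esub> = q 0"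
proof -
  have "q 0 = R" by (simp add: q_alt)
  then show ?thesis by (simp add: tensor_def tensor_group_def)
qed

lemma keys_plus [simp]: "Poly_Mapping.keys c \<subseteq> S \<Longrightarrow> Poly_Mapping.keys d \<subseteq> S \<Longrightarrow> Poly_Mapping.keys (c + d) \<subseteq> S"
  using keys_add[of c d] by blast

lemma keys_minus' [simp]: "Poly_Mapping.keys c \<subseteq> S \<Longrightarrow> Poly_Mapping.keys d \<subseteq> S \<Longrightarrow> Poly_Mapping.keys (c - d) \<subseteq> S"
  using keys_diff[of c d] by blast

lemma abelian_group_A: "abelian_group A"
proof (rule abelian_groupI)
  show "x \<oplus>\<^bsub>A\<^esub> y \<in> carrier A" if "x \<in> carrier A" "y \<in> carrier A" for x y
    using that by (auto simp: carrier_A q_add)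
  show "\<zero>\<^bsub>A\<^esub> \<in> carrier A" by (simp add: zero_A q_closed)
  show "x \<oplus>\<^bsub>A\<^esub> y \<oplus>\<^bsub>A\<^esub> z = x \<oplus>\<^bsub>A\<^esub> (y \<oplus>\<^bsub>A\<^esub> z)" if "x \<in> carrier A" "y \<in> carrier A" "z \<in> carrier A" for x y z
    using that by (auto simp: carrier_A q_add keys_plus add.assoc)
  show "x \<oplus>\<^bsub>A\<^esub> y = y \<oplus>\<^bsub>A\<^esub> x" if "x \<in> carrier A" "y \<in> carrier A" for x y
    using that by (auto simp: carrier_A q_add add.commute)
  show "\<zero>\<^bsub>A\<^esub> \<oplus>\<^bsub>A\<^esub> x = x" if "x \<in> carrier A" for x
    using that by (auto simp: carrier_A q_add zero_A)
  show "\<exists>y\<in>carrier A. y \<oplus>\<^bsub>A\<^esub> x = \<zero>\<^bsub>A\<^esub>" if x: "x \<in> carrier A" for x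
  proof -
    obtain c where c: "Poly_Mapping.keys c \<subseteq> S" "x = q c" using q_ex[OF x] by blast
    then show ?thesis
      by (intro bexI[of _ "q (- c)"]) (simp_all add: q_add zero_A q_closed keys_minus del: minus_frag_cmul)
  qed
qed

section \<open>Induced maps on the tensor product\<close>

definition mapf :: "('a \<Rightarrow> 'a) \<Rightarrow> ('l \<Rightarrow> 'l) \<Rightarrow> ('a \<times> 'l \<Rightarrow>\<^sub>0 int) \<Rightarrow> ('a \<times> 'l \<Rightarrow>\<^sub>0 int)"
  where "mapf h k = frag_extend (frag_of \<circ> (\<lambda>(x, a). (h x, k a)))"

lemma mapf_simps [simp]: "mapf h k 0 = 0" "mapf h k (c + d) = mapf h k c + mapf h k d" "mapf h k (- c) = - mapf h k c"
  "mapf h k (c - d) = mapf h k c - mapf h k d" "mapf h k (frag_of (x, a)) = frag_of (h x, k a)"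
  by (simp_all add: mapf_def frag_extend_add frag_extend_minus frag_extend_diff del: minus_frag_cmul)

lemma S_frag_induct [consumes 1, case_names zero one diff]:
  assumes "Poly_Mapping.keys c \<subseteq> S" "P 0"
    and "\<And>x a. x \<in> carrier V \<Longrightarrow> a \<in> carrier L \<Longrightarrow> P (frag_of (x, a))"
    and "\<And>c d. Poly_Mapping.keys c \<subseteq> S \<Longrightarrow> Poly_Mapping.keys d \<subseteq> S \<Longrightarrow> P c \<Longrightarrow> P d \<Longrightarrow> P (c - d)"
  shows "P c"
proof -
  have "Poly_Mapping.keys c \<subseteq> S \<and> P c"
    using assms(1)
    by (induction rule: frag_induction) (use assms(2-4) in auto)
  then show ?thesis by simp
qed

context
  fixes h k
  assumes h: "\<And>x. x \<in> carrier V \<Longrightarrow> h x \<in> carrier V"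
      "\<And>x y. x \<in> carrier V \<Longrightarrow> y \<in> carrier V \<Longrightarrow> h (x \<otimes>\<^bsub>V\<^esub> y) = h x \<otimes>\<^bsub>V\<^esub> h y"
    and k: "\<And>a. a \<in> carrier L \<Longrightarrow> k a \<in> carrier L"
      "\<And>a b. a \<in> carrier L \<Longrightarrow> b \<in> carrier L \<Longrightarrow> k (a \<oplus>\<^bsub>L\<^esub> b) = k a \<oplus>\<^bsub>L\<^esub> k b"
begin

lemma mapf_keys: "Poly_Mapping.keys c \<subseteq> S \<Longrightarrow> Poly_Mapping.keys (mapf h k c) \<subseteq> S"
  by (induction rule: S_frag_induct) (simp_all add: h k)

lemma mapf_R: "r \<in> R \<Longrightarrow> mapf h k r \<in> R"
  by (induction rule: R_induct) (auto simp: h k R_generators intro: R_plus R_uminus simp del: minus_frag_cmul)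

text \<open>The linear extension maps relations to relations, so multiplying the image by the
  relations gives the full coset of any one image element.\<close>

lemma tensor_map_q:
  assumes "Poly_Mapping.keys c \<subseteq> S"
  shows "tensor_map V L (\<lambda>(x, a). (h x, k a)) (q c) = q (mapf h k c)"
proof -
  have "tensor_map V L (\<lambda>(x, a). (h x, k a)) (q c) = {r + mapf h k (r' + c) | r r'. r \<in> R \<and> r' \<in> R}"
    unfolding tensor_map_def set_mult_def q_alt mapf_def[symmetric] by (auto simp del: mapf_simps; blast)
  also have "\<dots> = q (mapf h k c)"
  proof (intro equalityI subsetI)
    fix x assume "x \<in> {r + mapf h k (r' + c) | r r'. r \<in> R \<and> r' \<in> R}"
    then obtain r r' where "r \<in> R" "r' \<in> R" "x = (r + mapf h k r') + mapf h k c"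
      by (auto simp: add.assoc)
    then show "x \<in> q (mapf h k c)"
      unfolding q_alt using R_plus mapf_R by blast
  next
    fix x assume "x \<in> q (mapf h k c)"
    then obtain r where "r \<in> R" "x = r + mapf h k (0 + c)" unfolding q_alt by auto
    then show "x \<in> {r + mapf h k (r' + c) | r r'. r \<in> R \<and> r' \<in> R}" using R_zero by blast
  qed
  finally show ?thesis .
qed

end

lemma smult_q:
  assumes "Poly_Mapping.keys c \<subseteq> S" "r \<in> carrier L"
  shows "r \<odot>\<^bsub>A\<^esub> q c = q (mapf (\<lambda>x. x) (\<lambda>a. r \<otimes>\<^bsub>L\<^esub> a) c)"
  using tensor_map_q[of "\<lambda>x. x" "\<lambda>a. r \<otimes>\<^bsub>L\<^esub> a" c] assms by (simp add: tensor_def L.r_distr)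

lemma smult_keys: "r \<in> carrier L \<Longrightarrow> Poly_Mapping.keys c \<subseteq> S \<Longrightarrow> Poly_Mapping.keys (mapf (\<lambda>x. x) (\<lambda>a. r \<otimes>\<^bsub>L\<^esub> a) c) \<subseteq> S"
  by (rule mapf_keys) (auto simp: L.r_distr)

lemma module_A: "module L A"
proof (rule moduleI)
  show "cring L" by (rule L.is_cring)
  show "abelian_group A" by (rule abelian_group_A)
next
  fix r x assume "r \<in> carrier L" "x \<in> carrier A"
  then show "r \<odot>\<^bsub>A\<^esub> x \<in> carrier A"
    by (auto simp: carrier_A smult_q smult_keys)
next
  fix a b x assume ab: "a \<in> carrier L" "b \<in> carrier L" and "x \<in> carrier A"
  then obtain c where c: "Poly_Mapping.keys c \<subseteq> S" "x = q c" using q_ex by blast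
  let ?m = "\<lambda>r. mapf (\<lambda>x. x) (\<lambda>a. r \<otimes>\<^bsub>L\<^esub> a)"
  from c(1) have "?m (a \<oplus>\<^bsub>L\<^esub> b) c - (?m a c + ?m b c) \<in> R"
  proof (induction rule: S_frag_induct)
    case (one x e)
    then show ?case
      using R_generators(2)[of x "a \<otimes>\<^bsub>L\<^esub> e" "b \<otimes>\<^bsub>L\<^esub> e"] ab by (simp add: L.l_distr diff_diff_eq)
  next
    case (diff c d)
    then show ?case using R_diff[OF diff.IH] by (simp add: algebra_simps del: minus_frag_cmul)
  qed simp
  then show "(a \<oplus>\<^bsub>L\<^esub> b) \<odot>\<^bsub>A\<^esub> x = a \<odot>\<^bsub>A\<^esub> x \<oplus>\<^bsub>A\<^esub> b \<odot>\<^bsub>A\<^esub> x"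
    using ab c by (simp add: smult_q q_add smult_keys q_eq)
next
  fix a x y assume "a \<in> carrier L" "x \<in> carrier A" "y \<in> carrier A"
  then show "a \<odot>\<^bsub>A\<^esub> (x \<oplus>\<^bsub>A\<^esub> y) = a \<odot>\<^bsub>A\<^esub> x \<oplus>\<^bsub>A\<^esub> a \<odot>\<^bsub>A\<^esub> y"
    by (auto simp: carrier_A smult_q q_add keys_plus smult_keys)
next
  fix a b x assume ab: "a \<in> carrier L" "b \<in> carrier L" and "x \<in> carrier A"
  then obtain c where c: "Poly_Mapping.keys c \<subseteq> S" "x = q c" using q_ex by blast
  let ?m = "\<lambda>r. mapf (\<lambda>x. x) (\<lambda>a. r \<otimes>\<^bsub>L\<^esub> a)"
  from c(1) have "?m (a \<otimes>\<^bsub>L\<^esub> b) c = ?m a (?m b c)"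
    by (induction rule: S_frag_induct) (simp_all add: ab L.m_assoc)
  then show "(a \<otimes>\<^bsub>L\<^esub> b) \<odot>\<^bsub>A\<^esub> x = a \<odot>\<^bsub>A\<^esub> (b \<odot>\<^bsub>A\<^esub> x)"
    using ab c by (simp add: smult_q smult_keys)
next
  fix x assume "x \<in> carrier A"
  then obtain c where c: "Poly_Mapping.keys c \<subseteq> S" "x = q c" using q_ex by blast
  from c(1) have "mapf (\<lambda>x. x) (\<lambda>a. \<one>\<^bsub>L\<^esub> \<otimes>\<^bsub>L\<^esub> a) c = c"
    by (induction rule: S_frag_induct) simp_all
  then show "\<one>\<^bsub>L\<^esub> \<odot>\<^bsub>A\<^esub> x = x"
    using c by (simp add: smult_q)
qed

sublocale A: module L A
  by (rule module_A)

text \<open>The pure tensor of \<open>x\<close> and \<open>a\<close>.\<close>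

definition pt :: "'a \<Rightarrow> 'l \<Rightarrow> ('a \<times> 'l \<Rightarrow>\<^sub>0 int) set"
  where "pt x a = q (frag_of (x, a))"

lemma pt_closed: "x \<in> carrier V \<Longrightarrow> a \<in> carrier L \<Longrightarrow> pt x a \<in> carrier A"
  unfolding pt_def by (rule q_closed) simp

lemma uminus_q: "Poly_Mapping.keys c \<subseteq> S \<Longrightarrow> \<ominus>\<^bsub>A\<^esub> q c = q (- c)"
  by (rule A.minus_equality) (simp_all add: q_add zero_A q_closed keys_minus)

lemma diff_q: "Poly_Mapping.keys c \<subseteq> S \<Longrightarrow> Poly_Mapping.keys d \<subseteq> S \<Longrightarrow> q c \<ominus>\<^bsub>A\<^esub> q d = q (c - d)"
  by (simp add: a_minus_def uminus_q q_add)

lemma A_induct [consumes 1, case_names zero pt diff]: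
  assumes "m \<in> carrier A" "P \<zero>\<^bsub>A\<^esub>" "\<And>x a. x \<in> carrier V \<Longrightarrow> a \<in> carrier L \<Longrightarrow> P (pt x a)"
    and "\<And>m m'. m \<in> carrier A \<Longrightarrow> m' \<in> carrier A \<Longrightarrow> P m \<Longrightarrow> P m' \<Longrightarrow> P (m \<ominus>\<^bsub>A\<^esub> m')"
  shows "P m"
proof -
  obtain c where c: "Poly_Mapping.keys c \<subseteq> S" "m = q c" using q_ex[OF assms(1)] by blast
  from c(1) have "P (q c)"
  proof (induction rule: S_frag_induct)
    case zero
    then show ?case using assms(2) zero_A by simp
  next
    case (one x a)
    then show ?case using assms(3) by (simp add: pt_def)
  next
    case (diff c d)
    then show ?case using assms(4)[of "q c" "q d"] by (simp add: diff_q q_closed)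
  qed
  then show ?thesis using c by simp
qed

lemma pt_mult:
  assumes "x \<in> carrier V" "y \<in> carrier V" "a \<in> carrier L"
  shows "pt (x \<otimes>\<^bsub>V\<^esub> y) a = pt x a \<oplus>\<^bsub>A\<^esub> pt y a"
  unfolding pt_def using assms R_generators(1)[OF assms] by (simp add: q_add q_eq diff_diff_eq)

definition tm :: "('a \<Rightarrow> 'a) \<Rightarrow> ('a \<times> 'l \<Rightarrow>\<^sub>0 int) set \<Rightarrow> ('a \<times> 'l \<Rightarrow>\<^sub>0 int) set"
  where "tm h = tensor_map V L (\<lambda>(x, a). (h x, a))"

context
  fixes h
  assumes h: "\<And>x. x \<in> carrier V \<Longrightarrow> h x \<in> carrier V"
      "\<And>x y. x \<in> carrier V \<Longrightarrow> y \<in> carrier V \<Longrightarrow> h (x \<otimes>\<^bsub>V\<^esub> y) = h x \<otimes>\<^bsub>V\<^esub> h y"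
begin

lemma tm_q: "Poly_Mapping.keys c \<subseteq> S \<Longrightarrow> tm h (q c) = q (mapf h (\<lambda>a. a) c)"
  unfolding tm_def using tensor_map_q[of h "\<lambda>a. a"] h by simp

lemma tm_keys: "Poly_Mapping.keys c \<subseteq> S \<Longrightarrow> Poly_Mapping.keys (mapf h (\<lambda>a. a) c) \<subseteq> S"
  by (rule mapf_keys) (simp_all add: h)

lemma tm_closed: "m \<in> carrier A \<Longrightarrow> tm h m \<in> carrier A"
  by (auto simp: carrier_A tm_q tm_keys)

lemma tm_add: "m \<in> carrier A \<Longrightarrow> m' \<in> carrier A \<Longrightarrow> tm h (m \<oplus>\<^bsub>A\<^esub> m') = tm h m \<oplus>\<^bsub>A\<^esub> tm h m'"
  by (auto simp: carrier_A tm_q q_add keys_plus tm_keys)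

lemma tm_diff: "m \<in> carrier A \<Longrightarrow> m' \<in> carrier A \<Longrightarrow> tm h (m \<ominus>\<^bsub>A\<^esub> m') = tm h m \<ominus>\<^bsub>A\<^esub> tm h m'"
  by (auto simp: carrier_A tm_q diff_q keys_minus' tm_keys)

lemma tm_zero: "tm h \<zero>\<^bsub>A\<^esub> = \<zero>\<^bsub>A\<^esub>"
  by (simp add: zero_A tm_q)

lemma tm_pt: "x \<in> carrier V \<Longrightarrow> a \<in> carrier L \<Longrightarrow> tm h (pt x a) = pt (h x) a"
  by (simp add: pt_def tm_q)

lemma tm_smult: "r \<in> carrier L \<Longrightarrow> m \<in> carrier A \<Longrightarrow> tm h (r \<odot>\<^bsub>A\<^esub> m) = r \<odot>\<^bsub>A\<^esub> tm h m"
proof -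
  assume r: "r \<in> carrier L" and "m \<in> carrier A"
  then obtain c where c: "Poly_Mapping.keys c \<subseteq> S" "m = q c" using q_ex by blast
  from c(1) have "mapf h (\<lambda>a. a) (mapf (\<lambda>x. x) (\<lambda>a. r \<otimes>\<^bsub>L\<^esub> a) c) = mapf (\<lambda>x. x) (\<lambda>a. r \<otimes>\<^bsub>L\<^esub> a) (mapf h (\<lambda>a. a) c)"
    by (induction rule: S_frag_induct) simp_all
  then show ?thesis
    using c r by (simp add: smult_q tm_q smult_keys tm_keys)
qed

end

text \<open>The functional sending a pure tensor of x and a to \<open>\<chi> x\<close> times a. It
  is described through its lift to the free abelian group, where a homomorphism is determined by its
  values on generators.\<close>

definition fn :: "('a \<Rightarrow> int) \<Rightarrow> ('a \<times> 'l \<Rightarrow>\<^sub>0 int) set \<Rightarrow> 'l"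
  where "fn \<chi> m = (THE a. \<exists>h c. h \<in> hom FG (add_monoid L) \<and> (\<forall>x\<in>carrier V. \<forall>a\<in>carrier L. h (frag_of (x, a)) = add_pow L (\<chi> x) a) \<and>
    Poly_Mapping.keys c \<subseteq> S \<and> m = q c \<and> a = h c)"

context
  fixes \<chi> :: "'a \<Rightarrow> int"
  assumes chi: "\<And>x y. x \<in> carrier V \<Longrightarrow> y \<in> carrier V \<Longrightarrow> \<chi> (x \<otimes>\<^bsub>V\<^esub> y) = \<chi> x + \<chi> y"
begin

text \<open>The lift kills the relations because \<open>\<chi>\<close> and scalar multiples are
  additive. The later facts on \<open>fn\<close> use only the properties obtained here.\<close>

lemma fn_obtain:
  obtains h where "\<And>c d. Poly_Mapping.keys c \<subseteq> S \<Longrightarrow> Poly_Mapping.keys d \<subseteq> S \<Longrightarrow> h (c + d) = h c \<oplus>\<^bsub>L\<^esub> h d"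
    "\<And>c. Poly_Mapping.keys c \<subseteq> S \<Longrightarrow> h c \<in> carrier L"
    "\<And>x a. x \<in> carrier V \<Longrightarrow> a \<in> carrier L \<Longrightarrow> h (frag_of (x, a)) = add_pow L (\<chi> x) a"
    "\<And>c. Poly_Mapping.keys c \<subseteq> S \<Longrightarrow> fn \<chi> (q c) = h c"
proof -
  interpret FG: comm_group FG by (rule abelian_free_Abelian_group)
  have "(\<lambda>(x, a). add_pow L (\<chi> x) a) ` S \<subseteq> carrier (add_monoid L)"
    by (auto simp: add_pow_def intro!: L.add.int_pow_closed[simplified])
  then obtain h where h: "h \<in> hom FG (add_monoid L)" "\<And>z. z \<in> S \<Longrightarrow> h (frag_of z) = (\<lambda>(x, a). add_pow L (\<chi> x) a) z"
    using comm_group.free_Abelian_group_universal[OF L.a_comm_group] by blast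
  have hadd: "h (c + d) = h c \<oplus>\<^bsub>L\<^esub> h d" if "Poly_Mapping.keys c \<subseteq> S" "Poly_Mapping.keys d \<subseteq> S" for c d
    using hom_mult[OF h(1), of c d] that by simp
  have hc: "h c \<in> carrier L" if "Poly_Mapping.keys c \<subseteq> S" for c
    using hom_in_carrier[OF h(1), of c] that by simp
  have hf: "h (frag_of (x, a)) = add_pow L (\<chi> x) a" if "x \<in> carrier V" "a \<in> carrier L" for x a
    using h(2)[of "(x, a)"] that by simp
  have h0: "h 0 = \<zero>\<^bsub>L\<^esub>"
    using hadd[of 0 0] hc[of 0] L.add.l_cancel_one'[of "h 0" "h 0"] by simp
  have hneg: "h (- c) = \<ominus>\<^bsub>L\<^esub> h c" if "Poly_Mapping.keys c \<subseteq> S" for c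
    using hadd[of "- c" c] hc[of c] hc[of "- c"] that h0 L.minus_equality[of "h (- c)" "h c"] by simp
  have hdiff: "h (c - d) = h c \<ominus>\<^bsub>L\<^esub> h d" if "Poly_Mapping.keys c \<subseteq> S" "Poly_Mapping.keys d \<subseteq> S" for c d
    using hadd[of c "- d"] hneg[of d] that by (simp add: a_minus_def)
  have pw: "add_pow L (i + j) a = add_pow L (i) a \<oplus>\<^bsub>L\<^esub> add_pow L (j) a" if "a \<in> carrier L" for i j :: int and a
    using that L.add.int_pow_mult by simp
  have pc: "add_pow L (i) a \<in> carrier L" if "a \<in> carrier L" for i :: int and a
    using that L.add.int_pow_closed by simp
  have cancel: "(u \<oplus>\<^bsub>L\<^esub> v) \<ominus>\<^bsub>L\<^esub> u \<ominus>\<^bsub>L\<^esub> v = \<zero>\<^bsub>L\<^esub>" if "u \<in> carrier L" "v \<in> carrier L" for u v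
    using that by (simp add: a_minus_def L.a_comm[of u v] L.a_assoc L.r_neg)
  have hR: "h r = \<zero>\<^bsub>L\<^esub>" if "r \<in> R" for r
    using that
  proof (induction rule: R_induct)
    case (left x y a)
    then have "h (frag_of (x \<otimes>\<^bsub>V\<^esub> y, a) - frag_of (x, a) - frag_of (y, a)) =
        (add_pow L (\<chi> x) a \<oplus>\<^bsub>L\<^esub> add_pow L (\<chi> y) a) \<ominus>\<^bsub>L\<^esub> add_pow L (\<chi> x) a \<ominus>\<^bsub>L\<^esub> add_pow L (\<chi> y) a"
      by (simp add: hdiff keys_minus' hf chi pw)
    then show ?case using left by (simp only: cancel pc)
  next
    case (right x a b)
    then have "h (frag_of (x, a \<oplus>\<^bsub>L\<^esub> b) - frag_of (x, a) - frag_of (x, b)) =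
        (add_pow L (\<chi> x) a \<oplus>\<^bsub>L\<^esub> add_pow L (\<chi> x) b) \<ominus>\<^bsub>L\<^esub> add_pow L (\<chi> x) a \<ominus>\<^bsub>L\<^esub> add_pow L (\<chi> x) b"
      by (simp add: hdiff keys_minus' hf L.add.int_pow_distrib)
    then show ?case using right by (simp only: cancel pc)
  qed (simp_all add: h0 hadd hneg R_keys)
  have "fn \<chi> (q c) = h c" if c: "Poly_Mapping.keys c \<subseteq> S" for c
    unfolding fn_def
  proof (rule the_equality)
    show "\<exists>h' c'. h' \<in> hom FG (add_monoid L) \<and> (\<forall>x\<in>carrier V. \<forall>a\<in>carrier L. h' (frag_of (x, a)) = add_pow L (\<chi> x) a) \<and>
        Poly_Mapping.keys c' \<subseteq> S \<and> q c = q c' \<and> h c = h' c'"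
      using h(1) hf c by blast
    fix a assume "\<exists>h' c'. h' \<in> hom FG (add_monoid L) \<and> (\<forall>x\<in>carrier V. \<forall>a\<in>carrier L. h' (frag_of (x, a)) = add_pow L (\<chi> x) a) \<and>
        Poly_Mapping.keys c' \<subseteq> S \<and> q c = q c' \<and> a = h' c'"
    then obtain h' c' where h': "h' \<in> hom FG (add_monoid L)" "\<And>x a. x \<in> carrier V \<Longrightarrow> a \<in> carrier L \<Longrightarrow> h' (frag_of (x, a)) = add_pow L (\<chi> x) a"
      "Poly_Mapping.keys c' \<subseteq> S" "q c = q c'" "a = h' c'" by blast
    have "h' d = h d" if "Poly_Mapping.keys d \<subseteq> S" for d
      using that
    proof (induction rule: S_frag_induct)
      case zero
      have "h' 0 \<oplus>\<^bsub>L\<^esub> h' 0 = h' 0" "h' 0 \<in> carrier L"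
        using hom_mult[OF h'(1), of 0 0] hom_in_carrier[OF h'(1), of 0] by simp_all
      then have "h' 0 = \<zero>\<^bsub>L\<^esub>" using L.add.l_cancel_one'[of "h' 0" "h' 0"] by simp
      then show ?case using h0 by simp
    next
      case (one x a)
      then show ?case using h' hf by simp
    next
      case (diff c d)
      have "h' ((c - d) + d) = h' (c - d) \<oplus>\<^bsub>L\<^esub> h' d"
        using hom_mult[OF h'(1), of "c - d" d] diff keys_minus' by simp
      moreover have "h ((c - d) + d) = h (c - d) \<oplus>\<^bsub>L\<^esub> h d"
        using hadd[of "c - d" d] diff keys_minus' by simp
      moreover have "h' (c - d) \<in> carrier L"
        using hom_in_carrier[OF h'(1), of "c - d"] diff keys_minus' by simp
      ultimately show ?case
        using diff hc[of "c - d"] hc[of d] keys_minus'[of c d] by simp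
    qed
    moreover have "h c = h c'"
    proof -
      have "h c \<ominus>\<^bsub>L\<^esub> h c' = \<zero>\<^bsub>L\<^esub>"
        using hR[of "c - c'"] h'(4) q_eq hdiff[OF c h'(3)] by simp
      then show ?thesis using hc c h'(3) by simp
    qed
    ultimately show "a = h c" using h' by simp
  qed
  with hadd hc hf show ?thesis by (rule that)
qed

lemma fn_closed: "m \<in> carrier A \<Longrightarrow> fn \<chi> m \<in> carrier L"
  by (rule fn_obtain) (auto simp: carrier_A)

lemma fn_add: "m \<in> carrier A \<Longrightarrow> m' \<in> carrier A \<Longrightarrow> fn \<chi> (m \<oplus>\<^bsub>A\<^esub> m') = fn \<chi> m \<oplus>\<^bsub>L\<^esub> fn \<chi> m'"
  by (rule fn_obtain) (auto simp: carrier_A q_add keys_plus)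

lemma fn_pt: "x \<in> carrier V \<Longrightarrow> a \<in> carrier L \<Longrightarrow> fn \<chi> (pt x a) = add_pow L (\<chi> x) a"
  by (rule fn_obtain) (auto simp: pt_def)

lemma fn_zero: "fn \<chi> \<zero>\<^bsub>A\<^esub> = \<zero>\<^bsub>L\<^esub>"
  using fn_add[of "\<zero>\<^bsub>A\<^esub>" "\<zero>\<^bsub>A\<^esub>"] fn_closed[of "\<zero>\<^bsub>A\<^esub>"]
    L.add.l_cancel_one'[of "fn \<chi> \<zero>\<^bsub>A\<^esub>" "fn \<chi> \<zero>\<^bsub>A\<^esub>"] by simp

lemma fn_uminus: "m \<in> carrier A \<Longrightarrow> fn \<chi> (\<ominus>\<^bsub>A\<^esub> m) = \<ominus>\<^bsub>L\<^esub> fn \<chi> m"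
  using fn_add[of "\<ominus>\<^bsub>A\<^esub> m" m] fn_closed[of m] fn_closed[of "\<ominus>\<^bsub>A\<^esub> m"] fn_zero
    L.minus_equality[of "fn \<chi> (\<ominus>\<^bsub>A\<^esub> m)" "fn \<chi> m"] by (simp add: A.l_neg)

lemma fn_diff: "m \<in> carrier A \<Longrightarrow> m' \<in> carrier A \<Longrightarrow> fn \<chi> (m \<ominus>\<^bsub>A\<^esub> m') = fn \<chi> m \<ominus>\<^bsub>L\<^esub> fn \<chi> m'"
  by (simp add: a_minus_def fn_add fn_uminus)

lemma smult_pt: "x \<in> carrier V \<Longrightarrow> a \<in> carrier L \<Longrightarrow> r \<in> carrier L \<Longrightarrow> r \<odot>\<^bsub>A\<^esub> pt x a = pt x (r \<otimes>\<^bsub>L\<^esub> a)"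
  by (simp add: pt_def smult_q)

lemma fn_smult: "m \<in> carrier A \<Longrightarrow> r \<in> carrier L \<Longrightarrow> fn \<chi> (r \<odot>\<^bsub>A\<^esub> m) = r \<otimes>\<^bsub>L\<^esub> fn \<chi> m"
proof (induction rule: A_induct)
  case zero
  then show ?case by (simp add: fn_zero)
next
  case (pt x a)
  then show ?case by (simp add: smult_pt fn_pt L.add_pow_rdistr_int)
next
  case (diff m m')
  have e: "r \<odot>\<^bsub>A\<^esub> (m \<ominus>\<^bsub>A\<^esub> m') = r \<odot>\<^bsub>A\<^esub> m \<ominus>\<^bsub>A\<^esub> r \<odot>\<^bsub>A\<^esub> m'"
    using diff by (simp add: a_minus_def A.smult_r_distr A.smult_r_minus)
  have "fn \<chi> (r \<odot>\<^bsub>A\<^esub> (m \<ominus>\<^bsub>A\<^esub> m')) = r \<otimes>\<^bsub>L\<^esub> fn \<chi> m \<ominus>\<^bsub>L\<^esub> r \<otimes>\<^bsub>L\<^esub> fn \<chi> m'"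
    unfolding e using diff by (simp add: fn_diff)
  also have "\<dots> = r \<otimes>\<^bsub>L\<^esub> fn \<chi> (m \<ominus>\<^bsub>A\<^esub> m')"
    using diff fn_closed by (simp add: fn_diff) (simp add: a_minus_def L.r_distr L.r_minus)
  finally show ?case .
qed

end

end

context tensor_setup
begin

lemma pt_add: "x \<in> carrier V \<Longrightarrow> a \<in> carrier L \<Longrightarrow> b \<in> carrier L \<Longrightarrow> pt x (a \<oplus>\<^bsub>L\<^esub> b) = pt x a \<oplus>\<^bsub>A\<^esub> pt x b"
  unfolding pt_def using R_generators(2)[of x a b] by (simp add: q_add q_eq diff_diff_eq)

lemma pt_zero:
  assumes "x \<in> carrier V"
  shows "pt x \<zero>\<^bsub>L\<^esub> = \<zero>\<^bsub>A\<^esub>"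
  using pt_add[of x "\<zero>\<^bsub>L\<^esub>" "\<zero>\<^bsub>L\<^esub>"] pt_closed[of x "\<zero>\<^bsub>L\<^esub>"] assms
    A.add.l_cancel_one'[of "pt x \<zero>\<^bsub>L\<^esub>" "pt x \<zero>\<^bsub>L\<^esub>"] by simp

lemma pt_one:
  assumes "a \<in> carrier L"
  shows "pt \<one>\<^bsub>V\<^esub> a = \<zero>\<^bsub>A\<^esub>"
  using pt_mult[of "\<one>\<^bsub>V\<^esub>" "\<one>\<^bsub>V\<^esub>" a] pt_closed[of "\<one>\<^bsub>V\<^esub>" a] assms
    A.add.l_cancel_one'[of "pt \<one>\<^bsub>V\<^esub> a" "pt \<one>\<^bsub>V\<^esub> a"] by simp

lemma pt_uminus: "x \<in> carrier V \<Longrightarrow> a \<in> carrier L \<Longrightarrow> pt x (\<ominus>\<^bsub>L\<^esub> a) = \<ominus>\<^bsub>A\<^esub> pt x a"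
  using pt_add[of x "\<ominus>\<^bsub>L\<^esub> a" a] A.minus_equality[of "pt x (\<ominus>\<^bsub>L\<^esub> a)" "pt x a"]
  by (simp add: pt_closed L.l_neg pt_zero)

lemma pt_inv: "x \<in> carrier V \<Longrightarrow> a \<in> carrier L \<Longrightarrow> pt (inv\<^bsub>V\<^esub> x) a = \<ominus>\<^bsub>A\<^esub> pt x a"
  using pt_mult[of "inv\<^bsub>V\<^esub> x" x a] A.minus_equality[of "pt (inv\<^bsub>V\<^esub> x) a" "pt x a"]
  by (simp add: pt_closed pt_one)

end

text \<open>Generators with dual functionals make the tensor product free over L. Equality,
  divisibility by two and 2-torsion can then be tested on coordinates.\<close>

locale tensor_basis = tensor_setup V L
  for V :: "('a, 'b) monoid_scheme" and L :: "('l, 'm) ring_scheme" +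
  fixes B :: "'i set" and K :: "'i \<Rightarrow> 'a" and \<chi> :: "'i \<Rightarrow> 'a \<Rightarrow> int"
  assumes finite_B: "finite B" and K_closed: "b \<in> B \<Longrightarrow> K b \<in> carrier V"
    and chi_mult: "b \<in> B \<Longrightarrow> x \<in> carrier V \<Longrightarrow> y \<in> carrier V \<Longrightarrow> \<chi> b (x \<otimes>\<^bsub>V\<^esub> y) = \<chi> b x + \<chi> b y"
    and chi_K: "b \<in> B \<Longrightarrow> b' \<in> B \<Longrightarrow> \<chi> b (K b') = (if b = b' then 1 else 0)"
    and generate_K: "carrier V = generate V (K ` B)"
begin

lemma addpow_closed: "a \<in> carrier L \<Longrightarrow> add_pow L (i :: int) a \<in> carrier L"
  using L.add.int_pow_closed by simp

lemma addpow_0 [simp]: "add_pow L (0 :: int) a = \<zero>\<^bsub>L\<^esub>"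
  by (simp add: add_pow_def)

lemma addpow_neg: "a \<in> carrier L \<Longrightarrow> add_pow L (- i :: int) a = \<ominus>\<^bsub>L\<^esub> add_pow L i a"
  using L.add.int_pow_neg by simp

lemma fnb_closed: "b \<in> B \<Longrightarrow> m \<in> carrier A \<Longrightarrow> fn (\<chi> b) m \<in> carrier L"
  by (rule fn_closed) (simp_all add: chi_mult)

lemma fnb_add: "b \<in> B \<Longrightarrow> m \<in> carrier A \<Longrightarrow> m' \<in> carrier A \<Longrightarrow>
    fn (\<chi> b) (m \<oplus>\<^bsub>A\<^esub> m') = fn (\<chi> b) m \<oplus>\<^bsub>L\<^esub> fn (\<chi> b) m'"
  by (rule fn_add) (simp_all add: chi_mult)

lemma fnb_zero: "b \<in> B \<Longrightarrow> fn (\<chi> b) \<zero>\<^bsub>A\<^esub> = \<zero>\<^bsub>L\<^esub>"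
  by (rule fn_zero) (simp_all add: chi_mult)

lemma fnb_pt: "b \<in> B \<Longrightarrow> x \<in> carrier V \<Longrightarrow> a \<in> carrier L \<Longrightarrow> fn (\<chi> b) (pt x a) = add_pow L (\<chi> b x) a"
  by (rule fn_pt) (simp_all add: chi_mult)

lemma chi_one: "b \<in> B \<Longrightarrow> \<chi> b \<one>\<^bsub>V\<^esub> = 0"
  using chi_mult[of b "\<one>\<^bsub>V\<^esub>" "\<one>\<^bsub>V\<^esub>"] by simp

lemma chi_inv: "b \<in> B \<Longrightarrow> x \<in> carrier V \<Longrightarrow> \<chi> b (inv\<^bsub>V\<^esub> x) = - \<chi> b x"
  using chi_mult[of b "inv\<^bsub>V\<^esub> x" x] chi_one[of b] by simp

lemma pt_expansion:
  assumes "x \<in> carrier V" "a \<in> carrier L"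
  shows "pt x a = (\<Oplus>\<^bsub>A\<^esub>b\<in>B. pt (K b) (add_pow L (\<chi> b x) a))"
proof -
  have c: "pt (K b) (add_pow L i a) \<in> carrier A" if "b \<in> B" for b and i :: int
    using that K_closed assms addpow_closed pt_closed by simp
  have "x \<in> generate V (K ` B)" using assms generate_K by simp
  then show ?thesis
  proof induction
    case one
    have "(\<Oplus>\<^bsub>A\<^esub>b\<in>B. pt (K b) (add_pow L (\<chi> b \<one>\<^bsub>V\<^esub>) a)) = (\<Oplus>\<^bsub>A\<^esub>b\<in>B. \<zero>\<^bsub>A\<^esub>)"
      by (rule A.finsum_cong') (simp_all add: chi_one pt_zero K_closed)
    then show ?case using assms by (simp add: pt_one)
  next
    case (incl h)
    then obtain b' where b': "b' \<in> B" "h = K b'" by blast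
    have "(\<Oplus>\<^bsub>A\<^esub>b\<in>B. pt (K b) (add_pow L (\<chi> b h) a)) = (\<Oplus>\<^bsub>A\<^esub>b\<in>B. if b' = b then pt (K b) a else \<zero>\<^bsub>A\<^esub>)"
      using b' assms by (intro A.finsum_cong') (auto simp: chi_K pt_zero K_closed pt_closed)
    also have "\<dots> = pt (K b') a"
      using b' assms finite_B by (intro A.finsum_singleton) (auto simp: K_closed pt_closed)
    finally show ?case using b' by simp
  next
    case (inv h)
    then obtain b' where b': "b' \<in> B" "h = K b'" by blast
    have "(\<Oplus>\<^bsub>A\<^esub>b\<in>B. pt (K b) (add_pow L (\<chi> b (inv\<^bsub>V\<^esub> h)) a)) = (\<Oplus>\<^bsub>A\<^esub>b\<in>B. if b' = b then \<ominus>\<^bsub>A\<^esub> pt (K b) a else \<zero>\<^bsub>A\<^esub>)"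
    proof (rule A.finsum_cong'[OF refl])
      fix b assume "b \<in> B"
      then show "pt (K b) (add_pow L (\<chi> b (inv\<^bsub>V\<^esub> h)) a) = (if b' = b then \<ominus>\<^bsub>A\<^esub> pt (K b) a else \<zero>\<^bsub>A\<^esub>)"
        using b' assms by (auto simp: chi_inv chi_K K_closed pt_zero pt_uminus addpow_neg)
    qed (use b' assms in \<open>auto simp: K_closed pt_closed\<close>)
    also have "\<dots> = \<ominus>\<^bsub>A\<^esub> pt (K b') a"
      using b' assms finite_B by (intro A.finsum_singleton) (auto simp: K_closed pt_closed)
    finally show ?case using b' assms by (simp add: pt_inv K_closed)
  next
    case (eng h1 h2)
    have h: "h1 \<in> carrier V" "h2 \<in> carrier V"
      using eng generate_K by simp_all
    have "pt (h1 \<otimes>\<^bsub>V\<^esub> h2) a = (\<Oplus>\<^bsub>A\<^esub>b\<in>B. pt (K b) (add_pow L (\<chi> b h1) a)) \<oplus>\<^bsub>A\<^esub> (\<Oplus>\<^bsub>A\<^esub>b\<in>B. pt (K b) (add_pow L (\<chi> b h2) a))"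
      using h assms eng by (simp add: pt_mult)
    also have "\<dots> = (\<Oplus>\<^bsub>A\<^esub>b\<in>B. pt (K b) (add_pow L (\<chi> b h1) a) \<oplus>\<^bsub>A\<^esub> pt (K b) (add_pow L (\<chi> b h2) a))"
      using c by (intro A.finsum_addf[symmetric]) auto
    also have "\<dots> = (\<Oplus>\<^bsub>A\<^esub>b\<in>B. pt (K b) (add_pow L (\<chi> b (h1 \<otimes>\<^bsub>V\<^esub> h2)) a))"
      using c h assms by (intro A.finsum_cong') (auto simp: chi_mult L.add.int_pow_mult pt_add K_closed addpow_closed)
    finally show ?case .
  qed
qed

lemma fn_expansion:
  assumes "m \<in> carrier A"
  shows "m = (\<Oplus>\<^bsub>A\<^esub>b\<in>B. pt (K b) (fn (\<chi> b) m))"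
  using assms
proof (induction rule: A_induct)
  case zero
  have "(\<Oplus>\<^bsub>A\<^esub>b\<in>B. pt (K b) (fn (\<chi> b) \<zero>\<^bsub>A\<^esub>)) = (\<Oplus>\<^bsub>A\<^esub>b\<in>B. \<zero>\<^bsub>A\<^esub>)"
    by (rule A.finsum_cong') (simp_all add: fnb_zero pt_zero K_closed)
  then show ?case by simp
next
  case (pt x a)
  have "(\<Oplus>\<^bsub>A\<^esub>b\<in>B. pt (K b) (fn (\<chi> b) (pt x a))) = (\<Oplus>\<^bsub>A\<^esub>b\<in>B. pt (K b) (add_pow L (\<chi> b x) a))"
    using pt by (intro A.finsum_cong') (auto simp: fnb_pt K_closed pt_closed addpow_closed)
  then show ?case using pt_expansion[OF pt] by simp
next
  case (diff m m')
  note fc = fnb_closed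
  have p: "pt (K b) (fn (\<chi> b) m) \<in> carrier A" if "b \<in> B" "m \<in> carrier A" for b m
    using that K_closed fc pt_closed by simp
  let ?f = "\<lambda>m b. pt (K b) (fn (\<chi> b) m)"
  have "finsum A (?f (m \<ominus>\<^bsub>A\<^esub> m')) B \<oplus>\<^bsub>A\<^esub> finsum A (?f m') B = (\<Oplus>\<^bsub>A\<^esub>b\<in>B. ?f (m \<ominus>\<^bsub>A\<^esub> m') b \<oplus>\<^bsub>A\<^esub> ?f m' b)"
    using diff p by (intro A.finsum_addf[symmetric]) auto
  also have "\<dots> = finsum A (?f m) B"
  proof (rule A.finsum_cong'[OF refl])
    fix b assume b: "b \<in> B"
    have "(m \<ominus>\<^bsub>A\<^esub> m') \<oplus>\<^bsub>A\<^esub> m' = m"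
      using diff by (simp add: a_minus_def A.a_assoc A.l_neg)
    then have "fn (\<chi> b) m = fn (\<chi> b) (m \<ominus>\<^bsub>A\<^esub> m') \<oplus>\<^bsub>L\<^esub> fn (\<chi> b) m'"
      using fnb_add[OF b, of "m \<ominus>\<^bsub>A\<^esub> m'" m'] diff by simp
    then show "?f (m \<ominus>\<^bsub>A\<^esub> m') b \<oplus>\<^bsub>A\<^esub> ?f m' b = ?f m b"
      using b diff fc K_closed by (simp add: pt_add)
  qed (use diff p in auto)
  finally have e: "finsum A (?f (m \<ominus>\<^bsub>A\<^esub> m')) B \<oplus>\<^bsub>A\<^esub> m' = m"
    using diff by simp
  define s where "s = finsum A (?f (m \<ominus>\<^bsub>A\<^esub> m')) B"
  have s: "s \<in> carrier A"
    unfolding s_def using diff p by (intro A.finsum_closed) auto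
  have "m \<ominus>\<^bsub>A\<^esub> m' = (s \<oplus>\<^bsub>A\<^esub> m') \<ominus>\<^bsub>A\<^esub> m'"
    using e by (simp only: s_def)
  also have "\<dots> = s"
    using s diff by (simp add: a_minus_def A.a_assoc A.r_neg)
  finally show ?case
    unfolding s_def .
qed

lemma fn_inj:
  assumes "m \<in> carrier A" "m' \<in> carrier A" "\<And>b. b \<in> B \<Longrightarrow> fn (\<chi> b) m = fn (\<chi> b) m'"
  shows "m = m'"
proof -
  have "(\<Oplus>\<^bsub>A\<^esub>b\<in>B. pt (K b) (fn (\<chi> b) m)) = (\<Oplus>\<^bsub>A\<^esub>b\<in>B. pt (K b) (fn (\<chi> b) m'))"
    using assms fnb_closed by (intro A.finsum_cong') (auto simp: pt_closed K_closed)
  then show ?thesis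
    by (rule trans[OF fn_expansion[OF assms(1)] trans[OF _ fn_expansion[OF assms(2), symmetric]]])
qed

lemma half:
  assumes "m \<in> carrier A" "\<And>b. b \<in> B \<Longrightarrow> \<exists>d\<in>carrier L. fn (\<chi> b) m = d \<oplus>\<^bsub>L\<^esub> d"
  shows "\<exists>m'\<in>carrier A. m = m' \<oplus>\<^bsub>A\<^esub> m'"
proof -
  obtain d where d: "\<And>b. b \<in> B \<Longrightarrow> d b \<in> carrier L \<and> fn (\<chi> b) m = d b \<oplus>\<^bsub>L\<^esub> d b"
    using assms(2) by metis
  let ?m = "\<Oplus>\<^bsub>A\<^esub>b\<in>B. pt (K b) (d b)"
  have "m = (\<Oplus>\<^bsub>A\<^esub>b\<in>B. pt (K b) (fn (\<chi> b) m))"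
    by (rule fn_expansion[OF assms(1)])
  also have "\<dots> = (\<Oplus>\<^bsub>A\<^esub>b\<in>B. pt (K b) (d b) \<oplus>\<^bsub>A\<^esub> pt (K b) (d b))"
    using d by (intro A.finsum_cong') (auto simp: pt_add pt_closed K_closed)
  also have "\<dots> = ?m \<oplus>\<^bsub>A\<^esub> ?m"
    using d by (intro A.finsum_addf) (auto simp: pt_closed K_closed)
  finally show ?thesis
    using d by (intro bexI[of _ ?m]) (auto simp: pt_closed K_closed intro!: A.finsum_closed)
qed

lemma A_no_2_torsion:
  assumes L2: "\<And>a. a \<in> carrier L \<Longrightarrow> a \<oplus>\<^bsub>L\<^esub> a = \<zero>\<^bsub>L\<^esub> \<Longrightarrow> a = \<zero>\<^bsub>L\<^esub>"
    and m: "m \<in> carrier A" "m \<oplus>\<^bsub>A\<^esub> m = \<zero>\<^bsub>A\<^esub>"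
  shows "m = \<zero>\<^bsub>A\<^esub>"
proof (rule fn_inj[OF m(1)])
  fix b assume b: "b \<in> B"
  have "fn (\<chi> b) m \<oplus>\<^bsub>L\<^esub> fn (\<chi> b) m = \<zero>\<^bsub>L\<^esub>"
    using fnb_add[OF b m(1) m(1)] fnb_zero[OF b] m(2) by simp
  then have "fn (\<chi> b) m = \<zero>\<^bsub>L\<^esub>"
    using L2 fnb_closed[OF b m(1)] by blast
  then show "fn (\<chi> b) m = fn (\<chi> b) \<zero>\<^bsub>A\<^esub>"
    using fnb_zero[OF b] by simp
qed simp

end

section \<open>Quotients of modules\<close>

lemma abelian_group_square_module:
  assumes "cring L"
  shows "abelian_group (square_module L)"
proof -
  interpret cring L by (rule assms)
  show ?thesis
  proof (rule abelian_groupI)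
    show "\<exists>y\<in>carrier (square_module L). y \<oplus>\<^bsub>square_module L\<^esub> x = \<zero>\<^bsub>square_module L\<^esub>"
      if "x \<in> carrier (square_module L)" for x
      using that by (intro bexI[of _ "(\<ominus>\<^bsub>L\<^esub> fst x, \<ominus>\<^bsub>L\<^esub> snd x)"]) (auto simp: square_module_def l_neg)
  qed (auto simp: square_module_def a_ac)
qed

text \<open>The first isomorphism theorem. The additive part is that of groups; compatibility with
  scalars is checked on representatives.\<close>

lemma quotient_module_iso:
  fixes M :: "('l, 'a) module" and Q :: "('l, 'c) module"
  assumes M: "abelian_group M" and Q: "abelian_group Q"
    and \<Psi>: "\<Psi> ` carrier M = carrier Q"
    and add: "\<And>x y. x \<in> carrier M \<Longrightarrow> y \<in> carrier M \<Longrightarrow> \<Psi> (x \<oplus>\<^bsub>M\<^esub> y) = \<Psi> x \<oplus>\<^bsub>Q\<^esub> \<Psi> y"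
    and smult: "\<And>c x. c \<in> carrier L \<Longrightarrow> x \<in> carrier M \<Longrightarrow> c \<odot>\<^bsub>M\<^esub> x \<in> carrier M \<and> \<Psi> (c \<odot>\<^bsub>M\<^esub> x) = c \<odot>\<^bsub>Q\<^esub> \<Psi> x"
    and N: "N = {x \<in> carrier M. \<Psi> x = \<zero>\<^bsub>Q\<^esub>}"
  shows "\<exists>h. h \<in> module_iso L (quotient_module M N) Q"
proof -
  interpret M: abelian_group M by (rule M)
  interpret Q: abelian_group Q by (rule Q)
  interpret group_hom "add_monoid M" "add_monoid Q" \<Psi>
    using \<Psi> add by (intro group_hom.intro group_hom_axioms.intro M.a_group Q.a_group) (auto simp: hom_def)
  have ker: "kernel (add_monoid M) (add_monoid Q) \<Psi> = N"
    unfolding kernel_def N by simp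
  let ?h = "\<lambda>C. the_elem (\<Psi> ` C)"
  have iso: "?h \<in> iso (add_monoid M Mod N) (add_monoid Q)"
    using FactGroup_iso_set \<Psi> unfolding ker by simp
  have carr: "carrier (quotient_module M N) = carrier (add_monoid M Mod N)"
    by (simp add: quotient_module_def FactGroup_def A_RCOSETS_def)
  have val: "\<Psi> ` C = {\<Psi> x}" "x \<in> carrier M" if xC: "x \<in> C" "C \<in> carrier (quotient_module M N)" for C x
  proof -
    obtain y where y: "y \<in> carrier M" "C = N #>\<^bsub>add_monoid M\<^esub> y"
      using xC(2) unfolding carr carrier_FactGroup by auto
    have *: "z \<in> carrier M \<and> \<Psi> z = \<Psi> y" if "z \<in> C" for z
    proof -
      obtain u where "u \<in> N" "z = u \<oplus>\<^bsub>M\<^esub> y"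
        using \<open>z \<in> C\<close> y by (auto simp: r_coset_def)
      moreover have "\<Psi> y \<in> carrier Q" using y \<Psi> by blast
      ultimately show ?thesis
        using y add by (auto simp: N)
    qed
    then show "\<Psi> ` C = {\<Psi> x}" "x \<in> carrier M"
      using * \<open>x \<in> C\<close> by force+
  qed
  have ne: "\<exists>x. x \<in> C" if C: "C \<in> carrier (quotient_module M N)" for C
  proof -
    obtain y where y: "y \<in> carrier M" "C = N #>\<^bsub>add_monoid M\<^esub> y"
      using C unfolding carr carrier_FactGroup by auto
    have "\<zero>\<^bsub>M\<^esub> \<in> N" using hom_one by (simp add: N)
    then have "\<zero>\<^bsub>M\<^esub> \<oplus>\<^bsub>M\<^esub> y \<in> C" unfolding y r_coset_def by auto
    then show ?thesis by blast
  qed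
  have "?h (c \<odot>\<^bsub>quotient_module M N\<^esub> C) = c \<odot>\<^bsub>Q\<^esub> ?h C"
    if c: "c \<in> carrier L" and C: "C \<in> carrier (quotient_module M N)" for c C
  proof -
    obtain x where x: "x \<in> C" using ne[OF C] by blast
    have y: "\<Psi> y = \<Psi> x \<and> y \<in> carrier M" if "y \<in> C" for y
      using val[OF that C] val[OF x C] by auto
    have T: "c \<odot>\<^bsub>quotient_module M N\<^esub> C = {u \<oplus>\<^bsub>M\<^esub> c \<odot>\<^bsub>M\<^esub> y | u y. u \<in> N \<and> y \<in> C}"
      by (auto simp: quotient_module_def set_add_def set_mult_def)
    have im: "\<Psi> (u \<oplus>\<^bsub>M\<^esub> c \<odot>\<^bsub>M\<^esub> y) = c \<odot>\<^bsub>Q\<^esub> \<Psi> x" if "u \<in> N" "y \<in> C" for u y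
    proof -
      have "c \<odot>\<^bsub>Q\<^esub> \<Psi> x \<in> carrier Q"
        using smult[OF c, of x] y[OF x] \<Psi> by (metis imageI)
      then show ?thesis
        using that y[OF that(2)] smult[OF c, of y] add by (auto simp: N)
    qed
    have "\<zero>\<^bsub>M\<^esub> \<in> N" using hom_one by (simp add: N)
    then have "\<zero>\<^bsub>M\<^esub> \<oplus>\<^bsub>M\<^esub> c \<odot>\<^bsub>M\<^esub> x \<in> c \<odot>\<^bsub>quotient_module M N\<^esub> C"
      unfolding T using x by blast
    moreover have "\<Psi> z = c \<odot>\<^bsub>Q\<^esub> \<Psi> x" if "z \<in> c \<odot>\<^bsub>quotient_module M N\<^esub> C" for z
      using that im unfolding T by blast
    ultimately have "\<Psi> ` (c \<odot>\<^bsub>quotient_module M N\<^esub> C) = {c \<odot>\<^bsub>Q\<^esub> \<Psi> x}"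
      by (intro equalityI subsetI) (auto intro: image_eqI[rotated])
    then show ?thesis
      using val[OF x C] by simp
  qed
  moreover have "bij_betw ?h (carrier (quotient_module M N)) (carrier Q)"
    using iso unfolding carr by (simp add: iso_def)
  moreover have "?h (C \<oplus>\<^bsub>quotient_module M N\<^esub> C') = ?h C \<oplus>\<^bsub>Q\<^esub> ?h C'"
    if "C \<in> carrier (quotient_module M N)" "C' \<in> carrier (quotient_module M N)" for C C'
    using iso that unfolding carr by (simp add: iso_def hom_def quotient_module_def set_add_def)
  ultimately have "?h \<in> module_iso L (quotient_module M N) Q"
    unfolding module_iso_def by blast
  then show ?thesis by blast
qed

text \<open>The first coordinates of \<open>E\<close>, and the second coordinates over first
  coordinate zero, form two ideals. Their generators \<open>d\<close> and \<open>f\<close> yield the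
  triangular basis (d, e), (0, f); the vectors \<open>(p, s)\<close> and \<open>(\<zero>, r)\<close>
  guarantee that neither generator is zero.\<close>

lemma (in principal_domain) submodule_rank_2:
  assumes E: "E \<subseteq> carrier R \<times> carrier R"
    and add: "\<And>x y x' y'. (x, y) \<in> E \<Longrightarrow> (x', y') \<in> E \<Longrightarrow> (x \<oplus> x', y \<oplus> y') \<in> E"
    and smult: "\<And>c x y. c \<in> carrier R \<Longrightarrow> (x, y) \<in> E \<Longrightarrow> (c \<otimes> x, c \<otimes> y) \<in> E"
    and p: "(p, s) \<in> E" "p \<noteq> \<zero>" and r: "(\<zero>, r) \<in> E" "r \<noteq> \<zero>"
  obtains d e f where "d \<in> carrier R" "e \<in> carrier R" "f \<in> carrier R" "d \<noteq> \<zero>" "f \<noteq> \<zero>"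
    "E = (\<lambda>(x, y). (x \<otimes> d, x \<otimes> e \<oplus> y \<otimes> f)) ` (carrier R \<times> carrier R)"
proof -
  have z: "(\<zero>, \<zero>) \<in> E"
    using smult[of \<zero> p s] p E by auto
  have neg: "(\<ominus> x, \<ominus> y) \<in> E" if "(x, y) \<in> E" for x y
    using smult[of "\<ominus> \<one>" x y] that E by (auto simp: l_minus)
  have i1: "ideal {x. \<exists>y. (x, y) \<in> E} R"
  proof (rule idealI[OF ring_axioms])
    show "subgroup {x. \<exists>y. (x, y) \<in> E} (add_monoid R)"
      using E z add neg by (unfold_locales) (auto simp: a_inv_def[symmetric], blast+)
  qed (use E smult m_comm in \<open>auto, (metis mem_Sigma_iff subsetD)+\<close>)
  have i2: "ideal {y. (\<zero>, y) \<in> E} R"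
  proof (rule idealI[OF ring_axioms])
    show "subgroup {y. (\<zero>, y) \<in> E} (add_monoid R)"
    proof
      show "x \<otimes>\<^bsub>add_monoid R\<^esub> y \<in> {y. (\<zero>, y) \<in> E}" if "x \<in> {y. (\<zero>, y) \<in> E}" "y \<in> {y. (\<zero>, y) \<in> E}" for x y
        using add[of \<zero> x \<zero> y] that by simp
      show "inv\<^bsub>add_monoid R\<^esub> x \<in> {y. (\<zero>, y) \<in> E}" if "x \<in> {y. (\<zero>, y) \<in> E}" for x
        using neg[of \<zero> x] that by (simp add: a_inv_def[symmetric])
    qed (use E z in auto)
    show "x \<otimes> a \<in> {y. (\<zero>, y) \<in> E}" "a \<otimes> x \<in> {y. (\<zero>, y) \<in> E}" if "a \<in> {y. (\<zero>, y) \<in> E}" "x \<in> carrier R" for a x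
    proof -
      have "a \<in> carrier R" using that E by auto
      then show "x \<otimes> a \<in> {y. (\<zero>, y) \<in> E}" "a \<otimes> x \<in> {y. (\<zero>, y) \<in> E}"
        using smult[of x \<zero> a] that m_comm[of a x] by simp_all
    qed
  qed
  obtain d where d: "d \<in> carrier R" "{x. \<exists>y. (x, y) \<in> E} = PIdl d"
    using exists_gen[OF i1] by blast
  obtain f where f: "f \<in> carrier R" "{y. (\<zero>, y) \<in> E} = PIdl f"
    using exists_gen[OF i2] by blast
  have "d \<in> {x. \<exists>y. (x, y) \<in> E}"
    unfolding d(2) using cgenideal_self[OF d(1)] .
  then obtain e where e: "(d, e) \<in> E" by blast
  then have eR: "e \<in> carrier R" using E by auto
  have fE: "(\<zero>, f) \<in> E"
    using cgenideal_self[OF f(1)] f(2) by blast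
  have d0: "d \<noteq> \<zero>"
  proof
    assume "d = \<zero>"
    moreover have "p \<in> PIdl d" using p d(2) by blast
    ultimately show False using p(2) by (auto simp: cgenideal_def)
  qed
  have f0: "f \<noteq> \<zero>"
  proof
    assume "f = \<zero>"
    moreover have "r \<in> PIdl f" using r f(2) by blast
    ultimately show False using r(2) by (auto simp: cgenideal_def)
  qed
  have "E = (\<lambda>(x, y). (x \<otimes> d, x \<otimes> e \<oplus> y \<otimes> f)) ` (carrier R \<times> carrier R)"
  proof (intro equalityI subsetI)
    fix z assume z: "z \<in> E"
    obtain u v where uv: "z = (u, v)" by (cases z)
    have c: "u \<in> carrier R" "v \<in> carrier R" using z uv E by auto
    have "u \<in> PIdl d" using d(2) z uv by blast
    then obtain x where x: "x \<in> carrier R" "u = x \<otimes> d" by (auto simp: cgenideal_def)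
    have "(\<ominus> (x \<otimes> d), \<ominus> (x \<otimes> e)) \<in> E" using neg smult[OF x(1) e] by blast
    from add[OF this] z uv have "(\<ominus> (x \<otimes> d) \<oplus> u, \<ominus> (x \<otimes> e) \<oplus> v) \<in> E" by simp
    then have "\<ominus> (x \<otimes> e) \<oplus> v \<in> PIdl f"
      using f(2) x c d by (auto simp: l_neg)
    then obtain y where y: "y \<in> carrier R" "\<ominus> (x \<otimes> e) \<oplus> v = y \<otimes> f" by (auto simp: cgenideal_def)
    then have "v = x \<otimes> e \<oplus> y \<otimes> f"
      using x eR c by (metis a_assoc a_inv_closed l_zero m_closed r_neg)
    then show "z \<in> (\<lambda>(x, y). (x \<otimes> d, x \<otimes> e \<oplus> y \<otimes> f)) ` (carrier R \<times> carrier R)"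
      using uv x y by (intro image_eqI[of _ _ "(x, y)"]) auto
  next
    fix z assume "z \<in> (\<lambda>(x, y). (x \<otimes> d, x \<otimes> e \<oplus> y \<otimes> f)) ` (carrier R \<times> carrier R)"
    then obtain x y where xy: "x \<in> carrier R" "y \<in> carrier R" "z = (x \<otimes> d, x \<otimes> e \<oplus> y \<otimes> f)" by auto
    have "(x \<otimes> d \<oplus> y \<otimes> \<zero>, x \<otimes> e \<oplus> y \<otimes> f) \<in> E"
      by (intro add smult xy e fE)
    then show "z \<in> E" using xy d by simp
  qed
  with d(1) eR f(1) d0 f0 show ?thesis by (rule that)
qed

section \<open>The module of cocycles\<close>

locale linear_action = G: group G + A: module L A
  for G :: "('s, 'b) monoid_scheme" and L :: "('l, 'm) ring_scheme" and A :: "('l, 'a) module" +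
  fixes act :: "'s \<Rightarrow> 'a \<Rightarrow> 'a"
  assumes act_closed: "\<sigma> \<in> carrier G \<Longrightarrow> m \<in> carrier A \<Longrightarrow> act \<sigma> m \<in> carrier A"
    and act_add: "\<sigma> \<in> carrier G \<Longrightarrow> m \<in> carrier A \<Longrightarrow> m' \<in> carrier A \<Longrightarrow> act \<sigma> (m \<oplus>\<^bsub>A\<^esub> m') = act \<sigma> m \<oplus>\<^bsub>A\<^esub> act \<sigma> m'"
    and act_smult: "\<sigma> \<in> carrier G \<Longrightarrow> c \<in> carrier L \<Longrightarrow> m \<in> carrier A \<Longrightarrow> act \<sigma> (c \<odot>\<^bsub>A\<^esub> m) = c \<odot>\<^bsub>A\<^esub> act \<sigma> m"
begin

abbreviation "Z \<equiv> cocycle_module G A act"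

lemma carrier_Z: "f \<in> carrier Z \<longleftrightarrow> f \<in> carrier G \<rightarrow>\<^sub>E carrier A \<and>
    (\<forall>\<sigma>\<in>carrier G. \<forall>\<tau>\<in>carrier G. f (\<sigma> \<otimes>\<^bsub>G\<^esub> \<tau>) = f \<sigma> \<oplus>\<^bsub>A\<^esub> act \<sigma> (f \<tau>))"
  by (simp add: cocycle_module_def cocycles_def)

lemma Z_sel [simp]: "f \<oplus>\<^bsub>Z\<^esub> g = (\<lambda>\<sigma>\<in>carrier G. f \<sigma> \<oplus>\<^bsub>A\<^esub> g \<sigma>)" "c \<odot>\<^bsub>Z\<^esub> f = (\<lambda>\<sigma>\<in>carrier G. c \<odot>\<^bsub>A\<^esub> f \<sigma>)"
    "\<zero>\<^bsub>Z\<^esub> = (\<lambda>\<sigma>\<in>carrier G. \<zero>\<^bsub>A\<^esub>)"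
  by (simp_all add: cocycle_module_def)

lemma act_zero: "\<sigma> \<in> carrier G \<Longrightarrow> act \<sigma> \<zero>\<^bsub>A\<^esub> = \<zero>\<^bsub>A\<^esub>"
  using act_add[of \<sigma> "\<zero>\<^bsub>A\<^esub>" "\<zero>\<^bsub>A\<^esub>"] act_closed[of \<sigma> "\<zero>\<^bsub>A\<^esub>"]
    A.M.add.l_cancel_one'[of "act \<sigma> \<zero>\<^bsub>A\<^esub>" "act \<sigma> \<zero>\<^bsub>A\<^esub>"] by simp

lemma act_uminus: "\<sigma> \<in> carrier G \<Longrightarrow> m \<in> carrier A \<Longrightarrow> act \<sigma> (\<ominus>\<^bsub>A\<^esub> m) = \<ominus>\<^bsub>A\<^esub> act \<sigma> m"
  using act_add[of \<sigma> "\<ominus>\<^bsub>A\<^esub> m" m] A.M.minus_equality[of "act \<sigma> (\<ominus>\<^bsub>A\<^esub> m)" "act \<sigma> m"]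
  by (simp add: act_closed A.M.l_neg act_zero)

lemma Z_closed: "f \<in> carrier Z \<Longrightarrow> \<sigma> \<in> carrier G \<Longrightarrow> f \<sigma> \<in> carrier A"
  by (auto simp: carrier_Z)

lemma Z_add: "f \<in> carrier Z \<Longrightarrow> g \<in> carrier Z \<Longrightarrow> f \<oplus>\<^bsub>Z\<^esub> g \<in> carrier Z"
proof -
  assume f: "f \<in> carrier Z" and g: "g \<in> carrier Z"
  note c = Z_closed[OF f] Z_closed[OF g]
  have "f (\<sigma> \<otimes>\<^bsub>G\<^esub> \<tau>) = f \<sigma> \<oplus>\<^bsub>A\<^esub> act \<sigma> (f \<tau>)" "g (\<sigma> \<otimes>\<^bsub>G\<^esub> \<tau>) = g \<sigma> \<oplus>\<^bsub>A\<^esub> act \<sigma> (g \<tau>)"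
    if "\<sigma> \<in> carrier G" "\<tau> \<in> carrier G" for \<sigma> \<tau>
    using f g that unfolding carrier_Z by blast+
  then show ?thesis
    unfolding carrier_Z using c by (simp add: act_add act_closed A.M.a_ac)
qed

lemma Z_smult: "c \<in> carrier L \<Longrightarrow> f \<in> carrier Z \<Longrightarrow> c \<odot>\<^bsub>Z\<^esub> f \<in> carrier Z"
proof -
  assume r: "c \<in> carrier L" and f: "f \<in> carrier Z"
  note c = Z_closed[OF f]
  have "f (\<sigma> \<otimes>\<^bsub>G\<^esub> \<tau>) = f \<sigma> \<oplus>\<^bsub>A\<^esub> act \<sigma> (f \<tau>)"
    if "\<sigma> \<in> carrier G" "\<tau> \<in> carrier G" for \<sigma> \<tau>
    using f that unfolding carrier_Z by blast
  then show ?thesis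
    unfolding carrier_Z using c r by (simp add: act_smult act_closed A.smult_r_distr)
qed

lemma abelian_group_Z: "abelian_group Z"
proof (rule abelian_groupI)
  show "f \<oplus>\<^bsub>Z\<^esub> g \<in> carrier Z" if "f \<in> carrier Z" "g \<in> carrier Z" for f g
    using that by (rule Z_add)
  show "\<zero>\<^bsub>Z\<^esub> \<in> carrier Z" by (auto simp: carrier_Z act_zero)
  show "f \<oplus>\<^bsub>Z\<^esub> g \<oplus>\<^bsub>Z\<^esub> h = f \<oplus>\<^bsub>Z\<^esub> (g \<oplus>\<^bsub>Z\<^esub> h)" if "f \<in> carrier Z" "g \<in> carrier Z" "h \<in> carrier Z" for f g h
    using that by (auto simp: Z_closed A.M.a_assoc intro!: restrict_ext)
  show "f \<oplus>\<^bsub>Z\<^esub> g = g \<oplus>\<^bsub>Z\<^esub> f" if "f \<in> carrier Z" "g \<in> carrier Z" for f g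
    using that by (auto simp: Z_closed A.M.a_comm intro!: restrict_ext)
  show "\<zero>\<^bsub>Z\<^esub> \<oplus>\<^bsub>Z\<^esub> f = f" if "f \<in> carrier Z" for f
  proof (rule extensionalityI[of _ "carrier G"])
    show "f \<in> extensional (carrier G)" using that by (auto simp: carrier_Z PiE_def)
  qed (use that in \<open>auto simp: Z_closed\<close>)
  show "\<exists>g\<in>carrier Z. g \<oplus>\<^bsub>Z\<^esub> f = \<zero>\<^bsub>Z\<^esub>" if f: "f \<in> carrier Z" for f
  proof (rule bexI[of _ "\<lambda>\<sigma>\<in>carrier G. \<ominus>\<^bsub>A\<^esub> f \<sigma>"])
    show "(\<lambda>\<sigma>\<in>carrier G. \<ominus>\<^bsub>A\<^esub> f \<sigma>) \<in> carrier Z"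
    proof -
      have "f (\<sigma> \<otimes>\<^bsub>G\<^esub> \<tau>) = f \<sigma> \<oplus>\<^bsub>A\<^esub> act \<sigma> (f \<tau>)"
        if "\<sigma> \<in> carrier G" "\<tau> \<in> carrier G" for \<sigma> \<tau>
        using f that unfolding carrier_Z by blast
      then show ?thesis
        unfolding carrier_Z using Z_closed[OF f] by (simp add: act_uminus act_closed A.M.minus_add)
    qed
    show "(\<lambda>\<sigma>\<in>carrier G. \<ominus>\<^bsub>A\<^esub> f \<sigma>) \<oplus>\<^bsub>Z\<^esub> f = \<zero>\<^bsub>Z\<^esub>"
      using f by (auto simp: Z_closed A.M.l_neg intro!: restrict_ext)
  qed
qed

text \<open>The pair \<open>\<psi>\<close>, \<open>\<psi>'\<close> embeds the cohomology into L^2,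
  and \<open>f\<close>, \<open>g\<close> witness that the image has rank two.\<close>

lemma H1_rank_2:
  assumes L: "principal_domain L"
    and \<psi>: "\<And>f. f \<in> carrier Z \<Longrightarrow> \<psi> f \<in> carrier L" "\<And>f. f \<in> carrier Z \<Longrightarrow> \<psi>' f \<in> carrier L"
    and add: "\<And>f g. f \<in> carrier Z \<Longrightarrow> g \<in> carrier Z \<Longrightarrow> \<psi> (f \<oplus>\<^bsub>Z\<^esub> g) = \<psi> f \<oplus>\<^bsub>L\<^esub> \<psi> g"
      "\<And>f g. f \<in> carrier Z \<Longrightarrow> g \<in> carrier Z \<Longrightarrow> \<psi>' (f \<oplus>\<^bsub>Z\<^esub> g) = \<psi>' f \<oplus>\<^bsub>L\<^esub> \<psi>' g"
    and smult: "\<And>c f. c \<in> carrier L \<Longrightarrow> f \<in> carrier Z \<Longrightarrow> \<psi> (c \<odot>\<^bsub>Z\<^esub> f) = c \<otimes>\<^bsub>L\<^esub> \<psi> f"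
      "\<And>c f. c \<in> carrier L \<Longrightarrow> f \<in> carrier Z \<Longrightarrow> \<psi>' (c \<odot>\<^bsub>Z\<^esub> f) = c \<otimes>\<^bsub>L\<^esub> \<psi>' f"
    and kernel: "coboundaries G A act = {f \<in> carrier Z. \<psi> f = \<zero>\<^bsub>L\<^esub> \<and> \<psi>' f = \<zero>\<^bsub>L\<^esub>}"
    and f: "f \<in> carrier Z" "\<psi> f \<noteq> \<zero>\<^bsub>L\<^esub>" and g: "g \<in> carrier Z" "\<psi> g = \<zero>\<^bsub>L\<^esub>" "\<psi>' g \<noteq> \<zero>\<^bsub>L\<^esub>"
  shows "\<exists>h. h \<in> module_iso L (H1 G A act) (square_module L)"
proof -
  interpret L: principal_domain L by (rule L)
  let ?\<Psi> = "\<lambda>f. (\<psi> f, \<psi>' f)"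
  obtain d e k where d: "d \<in> carrier L" "e \<in> carrier L" "k \<in> carrier L" "d \<noteq> \<zero>\<^bsub>L\<^esub>" "k \<noteq> \<zero>\<^bsub>L\<^esub>"
    and E: "?\<Psi> ` carrier Z = (\<lambda>(x, y). (x \<otimes>\<^bsub>L\<^esub> d, x \<otimes>\<^bsub>L\<^esub> e \<oplus>\<^bsub>L\<^esub> y \<otimes>\<^bsub>L\<^esub> k)) ` (carrier L \<times> carrier L)"
  proof (rule L.submodule_rank_2[of "?\<Psi> ` carrier Z" "\<psi> f" "\<psi>' f" "\<psi>' g"])
    show "?\<Psi> ` carrier Z \<subseteq> carrier L \<times> carrier L" using \<psi> by auto
    show "(x \<oplus>\<^bsub>L\<^esub> x', y \<oplus>\<^bsub>L\<^esub> y') \<in> ?\<Psi> ` carrier Z" if xy: "(x, y) \<in> ?\<Psi> ` carrier Z" "(x', y') \<in> ?\<Psi> ` carrier Z" for x y x' y'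
    proof -
      obtain f g where "f \<in> carrier Z" "g \<in> carrier Z" "x = \<psi> f" "y = \<psi>' f" "x' = \<psi> g" "y' = \<psi>' g"
        using xy by auto
      then show ?thesis
        using add[of f g] Z_add[of f g] by (intro image_eqI[of _ _ "f \<oplus>\<^bsub>Z\<^esub> g"]) simp_all
    qed
    show "(c \<otimes>\<^bsub>L\<^esub> x, c \<otimes>\<^bsub>L\<^esub> y) \<in> ?\<Psi> ` carrier Z" if cxy: "c \<in> carrier L" "(x, y) \<in> ?\<Psi> ` carrier Z" for c x y
    proof -
      obtain f where "f \<in> carrier Z" "x = \<psi> f" "y = \<psi>' f" using cxy by blast
      then show ?thesis
        using smult[of c f] Z_smult[of c f] cxy by (intro image_eqI[of _ _ "c \<odot>\<^bsub>Z\<^esub> f"]) simp_all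
    qed
    show "(\<psi> f, \<psi>' f) \<in> ?\<Psi> ` carrier Z" using f by blast
    show "(\<zero>\<^bsub>L\<^esub>, \<psi>' g) \<in> ?\<Psi> ` carrier Z" using g by (metis (no_types, lifting) image_iff)
  qed (use f g that in auto)
  let ?g = "\<lambda>(x, y). (x \<otimes>\<^bsub>L\<^esub> d, x \<otimes>\<^bsub>L\<^esub> e \<oplus>\<^bsub>L\<^esub> y \<otimes>\<^bsub>L\<^esub> k)"
  have inj: "inj_on ?g (carrier L \<times> carrier L)"
  proof (rule inj_onI)
    fix u v assume uv: "u \<in> carrier L \<times> carrier L" "v \<in> carrier L \<times> carrier L" "?g u = ?g v"
    obtain x y x' y' where [simp]: "u = (x, y)" "v = (x', y')" by (cases u, cases v)
    have "x = x'" using uv d L.m_rcancel[of d x x'] by auto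
    moreover have "y = y'" using uv d calculation L.m_rcancel[of k y y'] by auto
    ultimately show "u = v" by simp
  qed
  \<comment> \<open>\<open>P f\<close> is the coordinate vector of \<open>f\<close> in the
    triangular basis of the image, so \<open>P\<close> is onto with the same kernel as the
    pair.\<close>
  define P where "P f = inv_into (carrier L \<times> carrier L) ?g (?\<Psi> f)" for f
  have P: "P f \<in> carrier L \<times> carrier L" "?g (P f) = ?\<Psi> f" if "f \<in> carrier Z" for f
  proof -
    have "?\<Psi> f \<in> ?g ` (carrier L \<times> carrier L)" using E that by blast
    then show "P f \<in> carrier L \<times> carrier L" "?g (P f) = ?\<Psi> f"
      unfolding P_def by (rule inv_into_into, rule f_inv_into_f)
  qed
  have Puniq: "P f = u" if "f \<in> carrier Z" "u \<in> carrier L \<times> carrier L" "?g u = ?\<Psi> f" for f u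
    by (rule inj_onD[OF inj trans[OF P(2)[OF that(1)] that(3)[symmetric]] P(1)[OF that(1)] that(2)])
  show ?thesis
    unfolding H1_def
  proof (rule quotient_module_iso[where \<Psi> = P])
    show "abelian_group Z" by (rule abelian_group_Z)
    show "abelian_group (square_module L)" by (rule abelian_group_square_module[OF domain.axioms(1)[OF principal_domain.axioms(1)[OF L]]])
    show "P ` carrier Z = carrier (square_module L)"
    proof
      have "carrier (square_module L) = carrier L \<times> carrier L" by (simp add: square_module_def)
      then show "P ` carrier Z \<subseteq> carrier (square_module L)" using P(1) by (simp only: image_subset_iff) blast
      show "carrier (square_module L) \<subseteq> P ` carrier Z"
      proof
        fix u assume "u \<in> carrier (square_module L)"
        then have u: "u \<in> carrier L \<times> carrier L" by (simp add: square_module_def)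
        then have "?g u \<in> ?\<Psi> ` carrier Z" unfolding E by (rule imageI)
        then obtain f where f: "?g u = ?\<Psi> f" "f \<in> carrier Z" by (rule imageE)
        show "u \<in> P ` carrier Z"
          using Puniq[OF f(2) u f(1)] f(2) by blast
      qed
    qed
    show "P (f \<oplus>\<^bsub>Z\<^esub> g) = P f \<oplus>\<^bsub>square_module L\<^esub> P g" if fg: "f \<in> carrier Z" "g \<in> carrier Z" for f g
    proof (rule Puniq[OF Z_add[OF fg]])
      obtain x y x' y' where e: "P f = (x, y)" "P g = (x', y')" by (cases "P f", cases "P g")
      have c: "x \<in> carrier L" "y \<in> carrier L" "x' \<in> carrier L" "y' \<in> carrier L"
        using P[OF fg(1)] P[OF fg(2)] e by auto
      show "P f \<oplus>\<^bsub>square_module L\<^esub> P g \<in> carrier L \<times> carrier L"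
        using c by (simp add: e square_module_def)
      show "?g (P f \<oplus>\<^bsub>square_module L\<^esub> P g) = ?\<Psi> (f \<oplus>\<^bsub>Z\<^esub> g)"
      proof -
        have v: "\<psi> f = x \<otimes>\<^bsub>L\<^esub> d" "\<psi>' f = x \<otimes>\<^bsub>L\<^esub> e \<oplus>\<^bsub>L\<^esub> y \<otimes>\<^bsub>L\<^esub> k"
          "\<psi> g = x' \<otimes>\<^bsub>L\<^esub> d" "\<psi>' g = x' \<otimes>\<^bsub>L\<^esub> e \<oplus>\<^bsub>L\<^esub> y' \<otimes>\<^bsub>L\<^esub> k"
          using P(2)[OF fg(1)] P(2)[OF fg(2)] by (simp_all add: e)
        show ?thesis
          unfolding add[OF fg] v using c d by (simp add: e square_module_def A.R.l_distr A.R.a_ac)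
      qed
    qed
    show "c \<odot>\<^bsub>Z\<^esub> f \<in> carrier Z \<and> P (c \<odot>\<^bsub>Z\<^esub> f) = c \<odot>\<^bsub>square_module L\<^esub> P f" if cf: "c \<in> carrier L" "f \<in> carrier Z" for c f
    proof (intro conjI Puniq Z_smult cf)
      obtain x y where e: "P f = (x, y)" by (cases "P f")
      have c: "x \<in> carrier L" "y \<in> carrier L"
        using P[OF cf(2)] e by auto
      show "c \<odot>\<^bsub>square_module L\<^esub> P f \<in> carrier L \<times> carrier L"
        using c cf by (simp add: e square_module_def)
      show "?g (c \<odot>\<^bsub>square_module L\<^esub> P f) = ?\<Psi> (c \<odot>\<^bsub>Z\<^esub> f)"
      proof -
        have v: "\<psi> f = x \<otimes>\<^bsub>L\<^esub> d" "\<psi>' f = x \<otimes>\<^bsub>L\<^esub> e \<oplus>\<^bsub>L\<^esub> y \<otimes>\<^bsub>L\<^esub> k"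
          using P(2)[OF cf(2)] by (simp_all add: e)
        show ?thesis
          unfolding smult[OF cf] v using c d cf by (simp add: e square_module_def A.R.r_distr A.R.m_assoc)
      qed
    qed
    show "coboundaries G A act = {f \<in> carrier Z. P f = \<zero>\<^bsub>square_module L\<^esub>}"
      unfolding kernel
    proof (intro Collect_cong conj_cong refl)
      fix f assume f: "f \<in> carrier Z"
      have "?g (\<zero>\<^bsub>L\<^esub>, \<zero>\<^bsub>L\<^esub>) = (\<zero>\<^bsub>L\<^esub>, \<zero>\<^bsub>L\<^esub>)" using d by simp
      then show "(\<psi> f = \<zero>\<^bsub>L\<^esub> \<and> \<psi>' f = \<zero>\<^bsub>L\<^esub>) = (P f = \<zero>\<^bsub>square_module L\<^esub>)"
        using Puniq[OF f, of "(\<zero>\<^bsub>L\<^esub>, \<zero>\<^bsub>L\<^esub>)"] P(2)[OF f] by (auto simp: square_module_def)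
    qed
  qed
qed

end

section \<open>Coordinates on the coefficient module\<close>

lemma chiV_mult:
  assumes "i < n" "x \<in> carrier (IA_ab n)" "y \<in> carrier (IA_ab n)"
  shows "chiV n i j k (x \<otimes>\<^bsub>IA_ab n\<^esub> y) = chiV n i j k x + chiV n i j k y"
proof -
  obtain s u where "s \<in> Ia n" "u \<in> Ia n" "x = cls n s" "y = cls n u"
    using assms by (auto simp: carrier_IA_ab)
  then show ?thesis
    using assms(1) by (simp add: cls_plus[symmetric] chiV_cls Ia_plus chi_plus)
qed

lemma cls_closed: "s \<in> Ia n \<Longrightarrow> cls n s \<in> carrier (IA_ab n)"
  by (simp add: carrier_IA_ab)

lemma cls_comm: "s \<in> Ia n \<Longrightarrow> u \<in> Ia n \<Longrightarrow> cls n (comm s u) = \<one>\<^bsub>IA_ab n\<^esub>"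
  by (intro cls_Der Der.comm)

lemma cls_uminus:
  assumes "s \<in> Ia n"
  shows "cls n (- s) = inv\<^bsub>IA_ab n\<^esub> (cls n s)"
proof -
  have "cls n (- s) \<otimes>\<^bsub>IA_ab n\<^esub> cls n s = cls n (comm 0 0)"
    using cls_plus[OF Ia_uminus[OF assms] assms] by (simp add: comm_def)
  then show ?thesis
    using assms cls_comm[of 0 n 0] by (intro group.inv_equality[OF group_IA_ab, symmetric]) (auto intro: cls_closed Ia_uminus)
qed

lemma generate_IA_ab: "carrier (IA_ab n) = generate (IA_ab n) ((\<lambda>b. cls n (Kb b)) ` basis n)"
proof
  let ?K = "(\<lambda>b. cls n (Kb b)) ` basis n"
  have K: "?K \<subseteq> carrier (IA_ab n)"
    by (auto intro: cls_closed Kb_Ia)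
  then show "generate (IA_ab n) ?K \<subseteq> carrier (IA_ab n)"
    by (rule group.generate_incl[OF group_IA_ab])
  have "cls n s \<in> generate (IA_ab n) ?K" if "s \<in> Ia n" for s
    using that
  proof (induction rule: Ia_induct)
    case (comm s u)
    then show ?case by (simp add: cls_comm generate.one)
  next
    case (Kb b)
    then show ?case by (intro generate.incl) blast
  next
    case (plus s u)
    then show ?case by (simp add: cls_plus generate.eng)
  next
    case (uminus s)
    then show ?case
      using group.generate_m_inv_closed[OF group_IA_ab K] by (simp add: cls_uminus)
  qed
  then show "carrier (IA_ab n) \<subseteq> generate (IA_ab n) ?K"
    by (auto simp: carrier_IA_ab)
qed

locale IA_coefficients =
  fixes n :: nat and L :: "('l, 'm) ring_scheme"
  assumes n: "5 \<le> n" and L: "principal_domain L"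
    and L2: "\<And>a. a \<in> carrier L \<Longrightarrow> a \<oplus>\<^bsub>L\<^esub> a = \<zero>\<^bsub>L\<^esub> \<Longrightarrow> a = \<zero>\<^bsub>L\<^esub>"

sublocale IA_coefficients \<subseteq> tensor_basis "IA_ab n" L "basis n" "\<lambda>b. cls n (Kb b)" "\<lambda>(i, j, k). chiV n i j k"
proof (intro tensor_basis.intro tensor_setup.intro tensor_basis_axioms.intro)
  show "group (IA_ab n)" by (rule group_IA_ab)
  show "cring L" using L by (simp add: principal_domain_def domain_def)
  show "carrier (IA_ab n) = generate (IA_ab n) ((\<lambda>b. cls n (Kb b)) ` basis n)"
    by (rule generate_IA_ab)
  show "(case b of (i, j, k) \<Rightarrow> chiV n i j k) (cls n (Kb b')) = (if b = b' then 1 else 0)"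
    if "b \<in> basis n" "b' \<in> basis n" for b b'
    using chib_Kb[OF that] that(1) by (cases b) (simp add: basis_def chib_def chiV_cls Kb_Ia[OF that(2)])
  show "(case b of (i, j, k) \<Rightarrow> chiV n i j k) (x \<otimes>\<^bsub>IA_ab n\<^esub> y) =
      (case b of (i, j, k) \<Rightarrow> chiV n i j k) x + (case b of (i, j, k) \<Rightarrow> chiV n i j k) y"
    if "b \<in> basis n" "x \<in> carrier (IA_ab n)" "y \<in> carrier (IA_ab n)" for b x y
    using that chiV_mult[of _ n x y] by (cases b) (simp add: basis_def)
qed (auto intro: cls_closed Kb_Ia)

context IA_coefficients
begin

abbreviation "TH i j k \<equiv> fn (chiV n i j k)"
abbreviation "ag g \<equiv> tensor_action (IA_ab n) L (IA_ab_action n) (Phi n g)"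

lemma ag_alt: "ag g = tm (IA_ab_action n (Phi n g))"
  by (simp add: tensor_action_def tm_def fun_eq_iff)

lemma action_hom:
  assumes "g \<in> An n"
  shows "x \<in> carrier (IA_ab n) \<Longrightarrow> IA_ab_action n (Phi n g) x \<in> carrier (IA_ab n)"
    and "x \<in> carrier (IA_ab n) \<Longrightarrow> y \<in> carrier (IA_ab n) \<Longrightarrow>
      IA_ab_action n (Phi n g) (x \<otimes>\<^bsub>IA_ab n\<^esub> y) = IA_ab_action n (Phi n g) x \<otimes>\<^bsub>IA_ab n\<^esub> IA_ab_action n (Phi n g) y"
proof -
  have c: "cj s (- g) \<in> Ia n" if "s \<in> Ia n" for s
    using that assms by (intro cj_Ia An_uminus)
  show "IA_ab_action n (Phi n g) x \<in> carrier (IA_ab n)" if "x \<in> carrier (IA_ab n)" for x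
    using that assms c by (auto simp: carrier_IA_ab IA_ab_action_cls)
  show "IA_ab_action n (Phi n g) (x \<otimes>\<^bsub>IA_ab n\<^esub> y) = IA_ab_action n (Phi n g) x \<otimes>\<^bsub>IA_ab n\<^esub> IA_ab_action n (Phi n g) y"
    if "x \<in> carrier (IA_ab n)" "y \<in> carrier (IA_ab n)" for x y
  proof -
    obtain s u where "s \<in> Ia n" "u \<in> Ia n" "x = cls n s" "y = cls n u"
      using \<open>x \<in> _\<close> \<open>y \<in> _\<close> by (auto simp: carrier_IA_ab)
    then show ?thesis
      using assms c by (simp add: cls_plus[symmetric] IA_ab_action_cls Ia_plus cj_plus)
  qed
qed

lemma ag_closed: "g \<in> An n \<Longrightarrow> m \<in> carrier A \<Longrightarrow> ag g m \<in> carrier A"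
  unfolding ag_alt by (rule tm_closed) (simp_all add: action_hom)

lemma ag_add: "g \<in> An n \<Longrightarrow> m \<in> carrier A \<Longrightarrow> m' \<in> carrier A \<Longrightarrow> ag g (m \<oplus>\<^bsub>A\<^esub> m') = ag g m \<oplus>\<^bsub>A\<^esub> ag g m'"
  unfolding ag_alt by (rule tm_add) (simp_all add: action_hom)

lemma ag_diff: "g \<in> An n \<Longrightarrow> m \<in> carrier A \<Longrightarrow> m' \<in> carrier A \<Longrightarrow> ag g (m \<ominus>\<^bsub>A\<^esub> m') = ag g m \<ominus>\<^bsub>A\<^esub> ag g m'"
  unfolding ag_alt by (rule tm_diff) (simp_all add: action_hom)

lemma ag_zero: "g \<in> An n \<Longrightarrow> ag g \<zero>\<^bsub>A\<^esub> = \<zero>\<^bsub>A\<^esub>"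
  unfolding ag_alt by (rule tm_zero) (simp_all add: action_hom)

lemma ag_smult: "g \<in> An n \<Longrightarrow> c \<in> carrier L \<Longrightarrow> m \<in> carrier A \<Longrightarrow> ag g (c \<odot>\<^bsub>A\<^esub> m) = c \<odot>\<^bsub>A\<^esub> ag g m"
  unfolding ag_alt by (rule tm_smult) (simp_all add: action_hom)

lemma ag_pt: "g \<in> An n \<Longrightarrow> s \<in> Ia n \<Longrightarrow> a \<in> carrier L \<Longrightarrow> ag g (pt (cls n s) a) = pt (cls n (cj s (- g))) a"
  unfolding ag_alt by (subst tm_pt) (simp_all add: action_hom IA_ab_action_cls cls_closed)

lemma A_induct' [consumes 1, case_names zero pt diff]:
  assumes "m \<in> carrier A" "P \<zero>\<^bsub>A\<^esub>" "\<And>s a. s \<in> Ia n \<Longrightarrow> a \<in> carrier L \<Longrightarrow> P (pt (cls n s) a)"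
    and "\<And>m m'. m \<in> carrier A \<Longrightarrow> m' \<in> carrier A \<Longrightarrow> P m \<Longrightarrow> P m' \<Longrightarrow> P (m \<ominus>\<^bsub>A\<^esub> m')"
  shows "P m"
  using assms(1) by (induction rule: A_induct) (use assms(2-4) in \<open>auto simp: carrier_IA_ab\<close>)

lemma ag_plus:
  assumes "g \<in> An n" "h \<in> An n" "m \<in> carrier A"
  shows "ag (g + h) m = ag g (ag h m)"
  using assms(3)
proof (induction rule: A_induct')
  case zero
  then show ?case using assms by (simp add: ag_zero An_plus)
next
  case (pt s a)
  then show ?case
    using assms by (simp add: ag_pt An_plus cj_Ia An_uminus cj_cj minus_add del: add_uminus_conv_diff)
next
  case (diff m m')
  then show ?case using assms by (simp add: ag_diff An_plus ag_closed)
qed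

text \<open>Conjugation inside IA_n changes an element by a commutator only.\<close>

lemma ag_Ia:
  assumes "s \<in> Ia n" "m \<in> carrier A"
  shows "ag s m = m"
  using assms(2)
proof (induction rule: A_induct')
  case zero
  then show ?case using assms by (simp add: ag_zero Ia_An)
next
  case (pt u a)
  have "cj u (- s) = comm s u + u"
    by (simp add: cj_def comm_def group_normalize del: add_uminus_conv_diff)
  then have "cls n (cj u (- s)) = cls n u"
    using pt assms cls_plus[OF Ia_comm[OF assms(1) pt(1)] pt(1)] cls_closed[OF pt(1)] by (simp add: cls_comm)
  then show ?case using assms pt by (simp add: ag_pt Ia_An)
next
  case (diff m m')
  then show ?case using assms by (simp add: ag_diff Ia_An)
qed

lemma TH_closed: "i < n \<Longrightarrow> m \<in> carrier A \<Longrightarrow> TH i j k m \<in> carrier L"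
  by (rule fn_closed) (simp_all add: chiV_mult)

lemma TH_add: "i < n \<Longrightarrow> m \<in> carrier A \<Longrightarrow> m' \<in> carrier A \<Longrightarrow> TH i j k (m \<oplus>\<^bsub>A\<^esub> m') = TH i j k m \<oplus>\<^bsub>L\<^esub> TH i j k m'"
  by (rule fn_add) (simp_all add: chiV_mult)

lemma TH_diff: "i < n \<Longrightarrow> m \<in> carrier A \<Longrightarrow> m' \<in> carrier A \<Longrightarrow> TH i j k (m \<ominus>\<^bsub>A\<^esub> m') = TH i j k m \<ominus>\<^bsub>L\<^esub> TH i j k m'"
  by (rule fn_diff) (simp_all add: chiV_mult)

lemma TH_zero: "i < n \<Longrightarrow> TH i j k \<zero>\<^bsub>A\<^esub> = \<zero>\<^bsub>L\<^esub>"
  by (rule fn_zero) (simp_all add: chiV_mult)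

lemma TH_uminus: "i < n \<Longrightarrow> m \<in> carrier A \<Longrightarrow> TH i j k (\<ominus>\<^bsub>A\<^esub> m) = \<ominus>\<^bsub>L\<^esub> TH i j k m"
  by (rule fn_uminus) (simp_all add: chiV_mult)

lemma TH_smult: "i < n \<Longrightarrow> m \<in> carrier A \<Longrightarrow> c \<in> carrier L \<Longrightarrow> TH i j k (c \<odot>\<^bsub>A\<^esub> m) = c \<otimes>\<^bsub>L\<^esub> TH i j k m"
  by (rule fn_smult) (simp_all add: chiV_mult)

lemma TH_pt: "i < n \<Longrightarrow> s \<in> Ia n \<Longrightarrow> a \<in> carrier L \<Longrightarrow> TH i j k (pt (cls n s) a) = add_pow L (chi i j k s) a"
  using fn_pt[of "chiV n i j k" "cls n s" a] by (simp add: chiV_mult chiV_cls cls_closed)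

lemma TH_inj:
  assumes "m \<in> carrier A" "m' \<in> carrier A" "\<And>i j k. i < n \<Longrightarrow> j < k \<Longrightarrow> k < n \<Longrightarrow> TH i j k m = TH i j k m'"
  shows "m = m'"
proof (rule fn_inj[OF assms(1,2)])
  fix b assume "b \<in> basis n"
  then show "fn (case b of (i, j, k) \<Rightarrow> chiV n i j k) m = fn (case b of (i, j, k) \<Rightarrow> chiV n i j k) m'"
    using assms(3) by (cases b) (simp add: basis_def)
qed

lemma TH_half:
  assumes "m \<in> carrier A" "\<And>i j k. i < n \<Longrightarrow> j < k \<Longrightarrow> k < n \<Longrightarrow> \<exists>d\<in>carrier L. TH i j k m = d \<oplus>\<^bsub>L\<^esub> d"
  shows "\<exists>m'\<in>carrier A. m = m' \<oplus>\<^bsub>A\<^esub> m'"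
proof (rule half[OF assms(1)])
  fix b assume "b \<in> basis n"
  then show "\<exists>d\<in>carrier L. fn (case b of (i, j, k) \<Rightarrow> chiV n i j k) m = d \<oplus>\<^bsub>L\<^esub> d"
    using assms(2) by (cases b) (simp add: basis_def)
qed

lemma minus_minus_L: "u \<in> carrier L \<Longrightarrow> v \<in> carrier L \<Longrightarrow> (u \<oplus>\<^bsub>L\<^esub> v) \<ominus>\<^bsub>L\<^esub> (u' \<oplus>\<^bsub>L\<^esub> v') = (u \<ominus>\<^bsub>L\<^esub> u') \<oplus>\<^bsub>L\<^esub> (v \<ominus>\<^bsub>L\<^esub> v')"
  if "u' \<in> carrier L" "v' \<in> carrier L" for u v u' v'
  using that by (simp add: a_minus_def L.minus_add L.a_ac)

text \<open>An integral identity for Johnson coordinates passes to the tensor product. Two terms are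
  enough for transvections; signed permutations use one, with the other coefficient zero.\<close>

lemma TH_ag:
  assumes g: "g \<in> An n" and m: "m \<in> carrier A" and "i < n" "i' < n" "i'' < n"
    and rel: "\<And>s. s \<in> Ia n \<Longrightarrow> chi i j k (cj s (- g)) = e * chi i' j' k' s + e' * chi i'' j'' k'' s"
  shows "TH i j k (ag g m) = add_pow L e (TH i' j' k' m) \<oplus>\<^bsub>L\<^esub> add_pow L e' (TH i'' j'' k'' m)"
  using m
proof (induction rule: A_induct')
  case zero
  have "add_pow L e \<zero>\<^bsub>L\<^esub> = \<zero>\<^bsub>L\<^esub>" for e :: int
    using L.add.int_pow_one by simp
  then show ?case using assms by (simp add: ag_zero TH_zero)
next
  case (pt s a)
  have "add_pow L (e * c) a = add_pow L e (add_pow L c a)" for e c :: int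
    using pt L.add.int_pow_pow[of a e c] by (simp only: mult.commute[of e c])
  moreover have "cj s (- g) \<in> Ia n" using pt g by (intro cj_Ia An_uminus)
  ultimately show ?case
    using pt assms by (simp add: ag_pt TH_pt rel L.add.int_pow_mult)
next
  case (diff m m')
  have "add_pow L e (u \<ominus>\<^bsub>L\<^esub> v) = add_pow L e u \<ominus>\<^bsub>L\<^esub> add_pow L e v" if "u \<in> carrier L" "v \<in> carrier L" for e :: int and u v
    using that L.add.int_pow_distrib[of u "\<ominus>\<^bsub>L\<^esub> v" e] L.add.int_pow_inv[of v e] by (simp add: a_minus_def a_inv_def[symmetric])
  then show ?case
    using diff assms(3-5) g by (simp add: ag_diff TH_diff ag_closed TH_closed minus_minus_L addpow_closed)
qed

lemma TH_ag_t:
  assumes "m \<in> carrier A" "k < n" "l < n" "k \<noteq> l" "i < n" "i \<noteq> k" "j < n" "j \<noteq> l"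
  shows "TH i j l (ag (- t k l) m) = TH i j l m \<oplus>\<^bsub>L\<^esub> TH i j k m"
  using TH_ag[of "- t k l" m i i i j l 1 j l 1 j k] assms
  by (simp add: An_uminus t_An chi_cj_t TH_closed)

definition sg :: "bool \<Rightarrow> int"
  where "sg b = (if b then 1 else - 1)"

lemma TH_ag_W:
  assumes "m \<in> carrier A" "\<pi> permutes {0..<n}" "w = spm \<pi> \<epsilon>" "w \<in> W 0 n" "i < n" "j < n" "k < n"
  shows "TH (\<pi> i) (\<pi> j) (\<pi> k) (ag (- w) m) = add_pow L (sg (\<epsilon> i) * sg (\<epsilon> j) * sg (\<epsilon> k)) (TH i j k m)"
proof -
  have "chi (\<pi> i) (\<pi> j) (\<pi> k) (cj s w) = sg (\<epsilon> i) * sg (\<epsilon> j) * sg (\<epsilon> k) * chi i j k s" if "s \<in> Ia n" for s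
    using chi_cj_W[OF that assms(2-7)] by (simp add: sg_def sgn_if_def)
  then show ?thesis
    using TH_ag[of "- w" m "\<pi> i" i i "\<pi> j" "\<pi> k" "sg (\<epsilon> i) * sg (\<epsilon> j) * sg (\<epsilon> k)" j k 0 j k] assms
      perm_lt[OF assms(2), of i] W_An[OF assms(4)]
    by (simp add: An_uminus TH_closed addpow_closed)
qed

lemma ag_carrier: "\<sigma> \<in> carrier (Aut_F n) \<Longrightarrow> \<exists>g\<in>An n. \<sigma> = Phi n g"
  using aut.ex by blast

end

sublocale IA_coefficients \<subseteq> lin: linear_action "Aut_F n" L "tensor (IA_ab n) L" "tensor_action (IA_ab n) L (IA_ab_action n)"
proof (intro linear_action.intro linear_action_axioms.intro)
  show "group (Aut_F n)" by (rule aut.group)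
  show "module L (tensor (IA_ab n) L)" by (rule module_A)
  fix \<sigma> m m' c
  assume "\<sigma> \<in> carrier (Aut_F n)"
  then obtain g where g: "g \<in> An n" "\<sigma> = Phi n g" using ag_carrier by blast
  assume m: "m \<in> carrier A"
  show "tensor_action (IA_ab n) L (IA_ab_action n) \<sigma> m \<in> carrier A"
    unfolding g(2) by (rule ag_closed[OF g(1) m])
  show "c \<in> carrier L \<Longrightarrow> tensor_action (IA_ab n) L (IA_ab_action n) \<sigma> (c \<odot>\<^bsub>A\<^esub> m) =
      c \<odot>\<^bsub>A\<^esub> tensor_action (IA_ab n) L (IA_ab_action n) \<sigma> m"
    unfolding g(2) by (rule ag_smult[OF g(1) _ m])
  show "m' \<in> carrier A \<Longrightarrow> tensor_action (IA_ab n) L (IA_ab_action n) \<sigma> (m \<oplus>\<^bsub>A\<^esub> m') =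
      tensor_action (IA_ab n) L (IA_ab_action n) \<sigma> m \<oplus>\<^bsub>A\<^esub> tensor_action (IA_ab n) L (IA_ab_action n) \<sigma> m'"
    unfolding g(2) by (rule ag_add[OF g(1) m])
qed

section \<open>Crossed homomorphisms with values in the tensor product\<close>

text \<open>The automorphism called \<iota> in the overview.\<close>

definition neg :: "nat \<Rightarrow> faut"
  where "neg n = spm id (\<lambda>m. n \<le> m)"

lemma app_neg: "app (neg n) (gn m) = (if m < n then - gn m else gn m)"
  by (simp add: neg_def app_spm sgn_if_def)

lemma neg_W: "neg n \<in> W 0 n"
  unfolding neg_def by (rule spm_W) (simp_all add: permutes_id)

lemma neg_An: "neg n \<in> An n"
  by (rule W_An[OF neg_W])

lemma uminus_neg: "- neg n = neg n"
  by (rule faut_eqI) (simp add: app_neg app_uminus_eq)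

lemma mu_app_neg:
  assumes "supp w \<subseteq> {..<n}"
  shows "mu j (app (neg n) w) = - mu j w"
  using assms
proof (induction rule: supp_closed_induct)
  case (plus i b w)
  then show ?case by (simp add: app_neg sgn_if_def)
qed simp

text \<open>On H the automorphism \<open>neg n\<close> is multiplication by -1, which commutes with
  every matrix.\<close>

lemma comm_neg_Ia:
  assumes g: "g \<in> An n"
  shows "comm (neg n) g \<in> Ia n"
proof (rule in_IaI)
  show "comm (neg n) g \<in> An n"
    unfolding comm_def using g neg_An by (intro An_diff An_plus)
  fix i j assume "i < n"
  define x where "x = gn i"
  have s: "supp x \<subseteq> {..<n}" using \<open>i < n\<close> by (simp add: x_def)
  define y where "y = app g (app (neg n) x)"
  have y: "supp y \<subseteq> {..<n}"
    unfolding y_def by (intro An_supp[OF g] An_supp[OF neg_An] s)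
  have "mu a (app g (app (neg n) x + x)) = 0" for a
    by (rule mu_app_eq_0) (simp add: mu_app_neg[OF s])
  then have "mu a (app g (app (neg n) x)) = - mu a (app g x)" for a
    by (metis app_plus eq_neg_iff_add_eq_0 mu_simps(2))
  then have "mu a (app (neg n) y - app g x) = 0" for a
    using mu_app_neg[OF y] by (simp add: y_def add_eq_0_iff)
  then have "mu j (app (- g) (app (neg n) y - app g x)) = 0"
    by (rule mu_app_eq_0)
  then show "mu j (app (comm (neg n) g) (gn i)) = mu j (gn i)"
    by (simp add: comm_def y_def x_def uminus_neg)
qed

lemma comm_neg_plus: "comm (neg n) (g + h) = comm (neg n) g + cj (comm (neg n) h) (- g)"
  by (simp add: comm_def cj_def group_normalize del: add_uminus_conv_diff)

lemma comm_neg_eq: "comm (neg n) s = cj s (neg n) - s"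
proof -
  have "comm (neg n) s = cj s (- neg n) - s"
    by (simp add: comm_def cj_def group_normalize del: add_uminus_conv_diff)
  then show ?thesis by (simp add: uminus_neg)
qed

text \<open>The element called K in the overview.\<close>

definition K01 :: faut
  where "K01 = Q 0 (- gn 1) (gn 1)"

lemma cj_K01_W:
  assumes "\<pi> permutes {0..<n}" "\<epsilon> 1"
  shows "cj K01 (spm \<pi> \<epsilon>) = Q (\<pi> 0) (- gn (\<pi> 1)) (gn (\<pi> 1))"
  unfolding K01_def using assms by (subst cj_Q_W[where \<pi> = \<pi> and \<epsilon> = \<epsilon>]) (auto simp: permutes_bij app_spm)

text \<open>The second Magnus family is expressed through the first by a conjugation, so an
  equivariant map on IA_n is determined by its values on the first family.\<close>

lemma Kc_eq:
  assumes "i \<noteq> a" "i \<noteq> b"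
  shows "Q i 0 (comm (gn a) (gn b)) = - Q i (- gn b) (gn b) + cj (Q i (- gn b) (gn b)) (t i a)"
proof -
  have "cj (Q i (- gn b) (gn b)) (t i a) = Q i (- gn b) (gn a + gn b - gn a)"
    unfolding t_def using assms by (intro cj_eqI) (simp add: Q_plus)
  then show ?thesis
    using assms by (simp add: Q_plus Q_uminus comm_def)
qed

context IA_coefficients
begin

lemma TH_alt:
  assumes "m \<in> carrier A" "i < n"
  shows "TH i k j m = \<ominus>\<^bsub>L\<^esub> TH i j k m"
  using assms(1)
proof (induction rule: A_induct')
  case zero
  then show ?case using assms by (simp add: TH_zero)
next
  case (pt s a)
  then show ?case using assms by (simp add: TH_pt chi_alt[of s n i k j] addpow_neg)
next
  case (diff m m')
  then show ?case using assms by (simp add: TH_diff TH_closed a_minus_def[of L] L.minus_add)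
qed

lemma eq_neg_self:
  assumes "x \<in> carrier L" "x = \<ominus>\<^bsub>L\<^esub> x"
  shows "x = \<zero>\<^bsub>L\<^esub>"
  by (rule L2[OF assms(1)]) (metis assms L.r_neg)

lemma double_cancel:
  assumes "x \<in> carrier A" "y \<in> carrier A" "x \<oplus>\<^bsub>A\<^esub> x = y \<oplus>\<^bsub>A\<^esub> y"
  shows "x = y"
proof -
  have "(x \<ominus>\<^bsub>A\<^esub> y) \<oplus>\<^bsub>A\<^esub> (x \<ominus>\<^bsub>A\<^esub> y) = (x \<oplus>\<^bsub>A\<^esub> x) \<ominus>\<^bsub>A\<^esub> (y \<oplus>\<^bsub>A\<^esub> y)"
    using assms(1,2) by (simp add: a_minus_def A.minus_add A.a_ac)
  also have "\<dots> = \<zero>\<^bsub>A\<^esub>" using assms by (simp add: a_minus_def A.r_neg)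
  finally have "(x \<ominus>\<^bsub>A\<^esub> y) \<oplus>\<^bsub>A\<^esub> (x \<ominus>\<^bsub>A\<^esub> y) = \<zero>\<^bsub>A\<^esub>" .
  moreover have "x \<ominus>\<^bsub>A\<^esub> y \<in> carrier A" using assms(1,2) by simp
  ultimately have "x \<ominus>\<^bsub>A\<^esub> y = \<zero>\<^bsub>A\<^esub>"
    using A_no_2_torsion[OF L2] by blast
  then show ?thesis
    using assms(1,2) A.minus_equality[of x "\<ominus>\<^bsub>A\<^esub> y"] by (simp add: a_minus_def)
qed

lemma ag_neg:
  assumes "m \<in> carrier A"
  shows "ag (neg n) m = \<ominus>\<^bsub>A\<^esub> m"
proof (rule TH_inj)
  fix i j k assume ijk: "i < n" "j < k" "k < n"
  have "TH (id i) (id j) (id k) (ag (- neg n) m) = add_pow L (- 1 :: int) (TH i j k m)"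
    using TH_ag_W[OF assms permutes_id neg_def neg_W, of i j k] ijk by (simp add: sg_def)
  then show "TH i j k (ag (neg n) m) = TH i j k (\<ominus>\<^bsub>A\<^esub> m)"
    using ijk assms by (simp add: uminus_neg TH_uminus addpow_neg TH_closed)
qed (use assms in \<open>simp_all add: ag_closed neg_An\<close>)

end

locale crossed_hom = IA_coefficients n L for n :: nat and L :: "('l, 'm) ring_scheme" +
  fixes F :: "faut \<Rightarrow> ((nat word \<Rightarrow> nat word) set \<times> 'l \<Rightarrow>\<^sub>0 int) set"
  assumes F_closed: "g \<in> An n \<Longrightarrow> F g \<in> carrier A"
    and F_plus: "g \<in> An n \<Longrightarrow> h \<in> An n \<Longrightarrow> F (g + h) = F g \<oplus>\<^bsub>A\<^esub> ag g (F h)"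
begin

lemma F_Ia_plus: "s \<in> Ia n \<Longrightarrow> g \<in> An n \<Longrightarrow> F (s + g) = F s \<oplus>\<^bsub>A\<^esub> F g"
  by (simp add: F_plus Ia_An ag_Ia F_closed)

lemma F_zero: "F 0 = \<zero>\<^bsub>A\<^esub>"
  using F_Ia_plus[of 0 0] F_closed[of 0] A.add.l_cancel_one'[of "F 0" "F 0"] by simp

lemma F_uminus:
  assumes "s \<in> Ia n"
  shows "F (- s) = \<ominus>\<^bsub>A\<^esub> F s"
  using F_Ia_plus[of "- s" s] assms A.minus_equality[of "F (- s)" "F s"]
  by (simp add: F_zero F_closed Ia_uminus Ia_An)

lemma F_comm:
  assumes "s \<in> Ia n" "u \<in> Ia n"
  shows "F (comm s u) = \<zero>\<^bsub>A\<^esub>"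
proof -
  have c: "F s \<in> carrier A" "F u \<in> carrier A" "F (comm s u) \<in> carrier A"
    using assms by (simp_all add: F_closed Ia_An Ia_comm)
  have "comm s u + (u + s) = s + u"
    by (simp add: comm_def group_normalize del: add_uminus_conv_diff)
  then have "F (comm s u) \<oplus>\<^bsub>A\<^esub> (F u \<oplus>\<^bsub>A\<^esub> F s) = F s \<oplus>\<^bsub>A\<^esub> F u"
    using F_Ia_plus[of "comm s u" "u + s"] assms by (simp add: F_Ia_plus Ia_comm Ia_plus Ia_An)
  then have "F (comm s u) \<oplus>\<^bsub>A\<^esub> (F s \<oplus>\<^bsub>A\<^esub> F u) = F s \<oplus>\<^bsub>A\<^esub> F u"
    using c by (simp add: A.a_comm[of "F u"])
  then show ?thesis
    using c A.add.r_cancel_one[of "F s \<oplus>\<^bsub>A\<^esub> F u" "F (comm s u)"] by simp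
qed

text \<open>Both sides of \<open>cj s g + - g = - g + s\<close> contribute the term
  \<open>F (- g)\<close>, since the conjugate acts trivially on the coefficients; it
  cancels.\<close>

lemma F_cj:
  assumes "s \<in> Ia n" "g \<in> An n"
  shows "F (cj s g) = ag (- g) (F s)"
proof -
  have c: "F s \<in> carrier A" "F (- g) \<in> carrier A" "F (cj s g) \<in> carrier A" "ag (- g) (F s) \<in> carrier A"
    using assms by (simp_all add: F_closed Ia_An cj_Ia An_uminus ag_closed)
  have "cj s g + - g = - g + s"
    by (simp add: cj_def group_normalize del: add_uminus_conv_diff)
  then have "F (cj s g) \<oplus>\<^bsub>A\<^esub> F (- g) = F (- g) \<oplus>\<^bsub>A\<^esub> ag (- g) (F s)"
    using F_Ia_plus[of "cj s g" "- g"] F_plus[of "- g" s] assms by (simp add: cj_Ia Ia_An An_uminus del: add_uminus_conv_diff)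
  then have "F (cj s g) \<oplus>\<^bsub>A\<^esub> F (- g) = ag (- g) (F s) \<oplus>\<^bsub>A\<^esub> F (- g)"
    using c by (simp add: A.a_comm[of "F (- g)"])
  then show ?thesis using c by simp
qed

lemma K01_Ia: "K01 \<in> Ia n"
  unfolding K01_def using n by (intro Q_in_Ia) auto

lemma F_K01_closed: "F K01 \<in> carrier A"
  by (intro F_closed Ia_An K01_Ia)

lemma cj_K01_flip: "cj K01 (flip l) = (if l = 1 then - K01 else K01)"
proof -
  have "cj K01 (flip l) = (if l = 1 then Q 0 (gn 1) (- gn 1) else K01)"
    unfolding K01_def by (subst cj_Q_W[where \<pi> = id and \<epsilon> = "\<lambda>m. m \<noteq> l"]) (auto simp: flip_def[symmetric] app_flip)
  then show ?thesis by (simp add: K01_def Q_uminus)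
qed

text \<open>The flip of \<open>x\<^sub>l\<close> fixes \<open>K01\<close>, or inverts it when \<open>l = 1\<close>, and multiplies the coordinate
  \<open>(i, j, k)\<close> by \<open>-1\<close> for every occurrence of \<open>l\<close>.\<close>
lemma TH_F_K01:
  assumes ijk: "i < n" "j < k" "k < n" "(i, j, k) \<noteq> (0, 0, 1)" "\<not> (j = 1 \<and> i = k)"
  shows "TH i j k (F K01) = \<zero>\<^bsub>L\<^esub>"
proof -
  let ?s = "\<lambda>l. sg (i \<noteq> l) * sg (j \<noteq> l) * sg (k \<noteq> l)"
  let ?x = "TH i j k (F K01)"
  have x: "?x \<in> carrier L" using ijk F_K01_closed by (intro TH_closed)
  have *: "(if l = 1 then \<ominus>\<^bsub>L\<^esub> ?x else ?x) = add_pow L (?s l) ?x" if l: "l < n" for l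
  proof -
    have fl: "flip l \<in> W 0 n" using l by (intro flip_W) simp_all
    have "TH (id i) (id j) (id k) (ag (- flip l) (F K01)) = add_pow L (?s l) ?x"
      using ijk by (intro TH_ag_W[OF F_K01_closed permutes_id flip_def fl]) simp_all
    moreover have "ag (- flip l) (F K01) = F (cj K01 (flip l))"
      using F_cj[OF K01_Ia W_An[OF fl]] by simp
    ultimately show ?thesis
      using ijk F_K01_closed by (simp add: cj_K01_flip F_uminus K01_Ia TH_uminus split: if_splits)
  qed
  \<comment> \<open>Either the flip of x_1 fixes the coordinate while it inverts \<open>K01\<close>,
    or some other flip negates the coordinate while it fixes \<open>K01\<close>. In both cases the
    coordinate equals its own negative.\<close>
  have "?s 1 = 1 \<or> (\<exists>l\<in>{i, j, k}. l \<noteq> 1 \<and> ?s l = - 1)"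
    using ijk by (auto simp: sg_def)
  then show ?thesis
  proof
    assume "?s 1 = 1"
    then have "\<ominus>\<^bsub>L\<^esub> ?x = ?x" using *[of 1] x n by simp
    then show ?thesis using eq_neg_self[OF x] by simp
  next
    assume "\<exists>l\<in>{i, j, k}. l \<noteq> 1 \<and> ?s l = - 1"
    then obtain l where l: "l \<in> {i, j, k}" "l \<noteq> 1" "?s l = - 1" by blast
    then have "?x = \<ominus>\<^bsub>L\<^esub> ?x" using *[of l] ijk x by (auto simp: addpow_neg)
    then show ?thesis by (rule eq_neg_self[OF x])
  qed
qed

text \<open>Exchanging x_2 and x_m fixes \<open>K01\<close> and permutes these coordinates.\<close>

lemma TH_F_K01_trace:
  assumes "2 \<le> m" "m < n"
  shows "TH m 1 m (F K01) = TH 2 1 2 (F K01)"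
proof -
  let ?\<pi> = "transpose 2 m" and ?w = "spm (transpose 2 m) (\<lambda>_. True)"
  have p: "?\<pi> permutes {0..<n}" using assms by (intro permutes_swap_id) auto
  then have w: "?w \<in> W 0 n" by (rule spm_W) simp
  have "cj K01 ?w = K01"
    using cj_K01_W[OF p, of "\<lambda>_. True"] assms by (simp add: transpose_def K01_def)
  then have "ag (- ?w) (F K01) = F K01"
    using F_cj[OF K01_Ia W_An[OF w]] by simp
  then show ?thesis
    using TH_ag_W[OF F_K01_closed p refl w, of 2 1 2] assms n F_K01_closed
    by (simp add: sg_def transpose_def TH_closed)
qed

lemma F_K01_zero:
  assumes "TH 0 0 1 (F K01) = \<zero>\<^bsub>L\<^esub>" "TH 2 1 2 (F K01) = \<zero>\<^bsub>L\<^esub>"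
  shows "F K01 = \<zero>\<^bsub>A\<^esub>"
proof (rule TH_inj[OF F_K01_closed])
  fix i j k assume ijk: "i < n" "j < k" "k < n"
  show "TH i j k (F K01) = TH i j k \<zero>\<^bsub>A\<^esub>"
  proof (cases "(i, j, k) = (0, 0, 1) \<or> j = 1 \<and> i = k")
    case True
    then show ?thesis
      using TH_F_K01_trace[of k] assms ijk by (auto simp: TH_zero)
  next
    case False
    then show ?thesis
      using TH_F_K01[OF ijk] ijk by (simp add: TH_zero)
  qed
qed simp

lemma F_Ia_zero:
  assumes K: "F K01 = \<zero>\<^bsub>A\<^esub>" and s: "s \<in> Ia n"
  shows "F s = \<zero>\<^bsub>A\<^esub>"
proof -
  have FK: "F (Q i (- gn l) (gn l)) = \<zero>\<^bsub>A\<^esub>" if il: "i < n" "l < n" "i \<noteq> l" for i l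
  proof -
    let ?a = "transpose 0 i"
    \<comment> \<open>A permutation taking 0 to i and 1 to l: the first swap places i, the second
      moves the resulting image of 1 to l without touching i.\<close>
    let ?\<pi> = "transpose (?a 1) l \<circ> ?a"
    have "?a 1 < n" using il n by (auto simp: transpose_def)
    then have "?a permutes {0..<n}" "transpose (?a 1) l permutes {0..<n}"
      using il by (simp_all add: permutes_swap_id)
    then have p: "?\<pi> permutes {0..<n}" by (rule permutes_compose)
    have "?\<pi> 0 = i" "?\<pi> 1 = l"
      using il by (auto simp: transpose_def)
    then have "cj K01 (spm ?\<pi> (\<lambda>_. True)) = Q i (- gn l) (gn l)"
      using cj_K01_W[OF p, of "\<lambda>_. True"] by simp
    moreover have "spm ?\<pi> (\<lambda>_. True) \<in> An n"
      using p by (intro W_An[of _ 0] spm_W) simp_all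
    ultimately show ?thesis
      using F_cj[OF K01_Ia, of "spm ?\<pi> (\<lambda>_. True)"] K by (simp add: ag_zero An_uminus)
  qed
  have "s \<in> Nn n" using s by (simp add: Ia_eq_Nn)
  then show ?thesis
  proof induction
    case (comm s u)
    then show ?case by (rule F_comm)
  next
    case (K i l)
    then show ?case by (rule FK)
  next
    case (Kc i a b)
    have Ki: "Q i (- gn b) (gn b) \<in> Ia n"
      using Kc by (intro Nn_Ia Nn.K) auto
    have t: "t i a \<in> An n" using Kc by (intro t_An)
    show ?case
      using Kc FK[of i b] F_cj[OF Ki t]
      by (simp add: Kc_eq F_Ia_plus F_uminus Ki cj_Ia[OF Ki t] Ia_An Ia_uminus ag_zero An_uminus t del: add_uminus_conv_diff)
  next
    case (plus s u)
    then show ?case by (simp add: F_Ia_plus Nn_Ia Nn_An)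
  next
    case (uminus s)
    then show ?case by (simp add: F_uminus Nn_Ia)
  qed
qed

text \<open>Since \<open>neg n\<close> acts by \<open>-1\<close> and is central modulo \<open>Ia n\<close>, twice a crossed homomorphism that
  vanishes on \<open>Ia n\<close> is principal.\<close>
lemma F_double:
  assumes "F K01 = \<zero>\<^bsub>A\<^esub>" and g: "g \<in> An n"
  shows "F g \<oplus>\<^bsub>A\<^esub> F g = F (neg n) \<ominus>\<^bsub>A\<^esub> ag g (F (neg n))"
proof -
  let ?m = "F (neg n)"
  have c: "?m \<in> carrier A" "F g \<in> carrier A" "ag g ?m \<in> carrier A"
    using g by (simp_all add: F_closed neg_An ag_closed)
  have "comm (neg n) g + (g + neg n) = neg n + g"
    by (simp add: comm_def group_normalize del: add_uminus_conv_diff)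
  then have "F (comm (neg n) g + (g + neg n)) = F (neg n + g)" by simp
  then have e: "F g \<oplus>\<^bsub>A\<^esub> ag g ?m = ?m \<ominus>\<^bsub>A\<^esub> F g"
    using assms c F_Ia_zero[OF assms(1) comm_neg_Ia[OF g]]
    by (simp add: F_Ia_plus comm_neg_Ia F_plus neg_An An_plus ag_neg a_minus_def)
  have "F g \<oplus>\<^bsub>A\<^esub> F g = ((F g \<oplus>\<^bsub>A\<^esub> ag g ?m) \<oplus>\<^bsub>A\<^esub> F g) \<ominus>\<^bsub>A\<^esub> ag g ?m"
    using c by (simp add: a_minus_def A.a_assoc A.a_comm[of "ag g ?m"] A.r_neg1 A.r_neg2 A.a_comm[of "F g" "\<ominus>\<^bsub>A\<^esub> ag g ?m"] A.r_neg)
  also have "\<dots> = ?m \<ominus>\<^bsub>A\<^esub> ag g ?m"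
    unfolding e using c by (simp add: a_minus_def A.a_assoc A.l_neg)
  finally show ?thesis .
qed

text \<open>For an index l outside {i, j, k}, acting by \<open>- t k l\<close> adds coordinate (i,
  j, k) to coordinate (i, j, l). Reading \<open>F_double\<close> for this transvection at (i, j, l)
  therefore isolates coordinate (i, j, k) as a double. If i = k, antisymmetry first exchanges the
  last two indices.\<close>

lemma F_neg_half:
  assumes "F K01 = \<zero>\<^bsub>A\<^esub>"
  shows "\<exists>m\<in>carrier A. F (neg n) = m \<oplus>\<^bsub>A\<^esub> m"
proof (rule TH_half)
  let ?m = "F (neg n)"
  show c: "?m \<in> carrier A" by (simp add: F_closed neg_An)
  have *: "\<exists>d\<in>carrier L. TH i j k ?m = d \<oplus>\<^bsub>L\<^esub> d" if ijk: "i < n" "j < n" "k < n" "i \<noteq> k" for i j k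
  proof -
    have "\<not> {..<n} \<subseteq> {i, j, k}"
    proof
      assume "{..<n} \<subseteq> {i, j, k}"
      then have "n \<le> card {i, j, k}" using card_mono[of "{i, j, k}" "{..<n}"] by simp
      also have "\<dots> \<le> 3" using card_insert_le_m1[of 3 "{j, k}" i] card_insert_le_m1[of 2 "{k}" j] by simp
      finally show False using n by simp
    qed
    then obtain l where l: "l < n" "l \<noteq> i" "l \<noteq> j" "l \<noteq> k" by blast
    let ?g = "- t k l"
    have g: "?g \<in> An n" using ijk l by (intro An_uminus t_An) auto
    let ?d = "TH i j l (F ?g)"
    have d: "?d \<in> carrier L" using ijk g by (intro TH_closed F_closed)
    have T: "TH i j l ?m \<in> carrier L" "TH i j k ?m \<in> carrier L" using ijk c by (simp_all add: TH_closed)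
    have "?d \<oplus>\<^bsub>L\<^esub> ?d = TH i j l (F ?g \<oplus>\<^bsub>A\<^esub> F ?g)"
      using ijk g by (simp add: TH_add F_closed)
    also have "\<dots> = TH i j l ?m \<ominus>\<^bsub>L\<^esub> TH i j l (ag ?g ?m)"
      using ijk c g by (simp only: F_double[OF assms g]) (simp add: TH_diff ag_closed)
    also have "TH i j l (ag ?g ?m) = TH i j l ?m \<oplus>\<^bsub>L\<^esub> TH i j k ?m"
      using ijk l by (intro TH_ag_t[OF c]) auto
    finally have "?d \<oplus>\<^bsub>L\<^esub> ?d = \<ominus>\<^bsub>L\<^esub> TH i j k ?m"
      using T by (simp add: a_minus_def L.minus_add L.r_neg1 L.a_assoc[symmetric] L.r_neg)
    then have "TH i j k ?m = \<ominus>\<^bsub>L\<^esub> ?d \<oplus>\<^bsub>L\<^esub> \<ominus>\<^bsub>L\<^esub> ?d"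
      using T d L.minus_minus[OF T(2)] by (simp add: L.minus_add[symmetric])
    then show ?thesis using d by (intro bexI[of _ "\<ominus>\<^bsub>L\<^esub> ?d"]) auto
  qed
  show "\<exists>d\<in>carrier L. TH i j k ?m = d \<oplus>\<^bsub>L\<^esub> d" if ijk: "i < n" "j < k" "k < n" for i j k
  proof (cases "i = k")
    case False
    then show ?thesis using * ijk by simp
  next
    case True
    then obtain d where d: "d \<in> carrier L" "TH i k j ?m = d \<oplus>\<^bsub>L\<^esub> d"
      using *[of i k j] ijk by auto
    then have "TH i j k ?m = \<ominus>\<^bsub>L\<^esub> d \<oplus>\<^bsub>L\<^esub> \<ominus>\<^bsub>L\<^esub> d"
      using TH_alt[OF c ijk(1), of j k] by (simp add: L.minus_add)
    then show ?thesis using d by (intro bexI[of _ "\<ominus>\<^bsub>L\<^esub> d"]) auto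
  qed
qed

lemma F_principal:
  assumes "F K01 = \<zero>\<^bsub>A\<^esub>"
  shows "\<exists>m\<in>carrier A. \<forall>g\<in>An n. F g = ag g m \<ominus>\<^bsub>A\<^esub> m"
proof -
  obtain m where m: "m \<in> carrier A" "F (neg n) = m \<oplus>\<^bsub>A\<^esub> m"
    using F_neg_half[OF assms] by blast
  \<comment> \<open>\<open>F_double\<close> has the difference in the opposite order, so the
    principal crossed homomorphism comes from minus the half of \<open>F (neg n)\<close>.\<close>
  have "F g = ag g (\<ominus>\<^bsub>A\<^esub> m) \<ominus>\<^bsub>A\<^esub> \<ominus>\<^bsub>A\<^esub> m" if g: "g \<in> An n" for g
  proof (rule double_cancel)
    have c: "ag g m \<in> carrier A" using g m by (simp add: ag_closed)
    have u: "ag g (\<ominus>\<^bsub>A\<^esub> m) = \<ominus>\<^bsub>A\<^esub> ag g m"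
      using ag_diff[OF g, of "\<zero>\<^bsub>A\<^esub>" m] ag_zero[OF g] m c by (simp add: a_minus_def)
    show "F g \<oplus>\<^bsub>A\<^esub> F g = ag g (\<ominus>\<^bsub>A\<^esub> m) \<ominus>\<^bsub>A\<^esub> \<ominus>\<^bsub>A\<^esub> m \<oplus>\<^bsub>A\<^esub> (ag g (\<ominus>\<^bsub>A\<^esub> m) \<ominus>\<^bsub>A\<^esub> \<ominus>\<^bsub>A\<^esub> m)"
      unfolding F_double[OF assms g] m(2) u using g m c
      by (simp add: ag_add a_minus_def A.minus_add A.a_ac)
  qed (use g m in \<open>simp_all add: F_closed ag_closed\<close>)
  then show ?thesis using m by (intro bexI[of _ "\<ominus>\<^bsub>A\<^esub> m"]) auto
qed

end

section \<open>Cocycles\<close>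

lemma chi_diff:
  "s \<in> Ia n \<Longrightarrow> u \<in> Ia n \<Longrightarrow> i < n \<Longrightarrow> chi i j k (s - u) = chi i j k s - chi i j k u"
  using chi_plus[of s n "- u" i j k] by (simp add: chi_uminus Ia_uminus)

lemma chi_K01: "chi i j k K01 = (if i = 0 then (if j = 0 \<and> k = 1 then 1 else 0) - (if j = 1 \<and> k = 0 then 1 else 0) else 0)"
  using chi_Kb[of 0 1 i j k 0] by (simp add: Kb_def K01_def)

lemma ctr_plus: "s \<in> Ia n \<Longrightarrow> u \<in> Ia n \<Longrightarrow> ctr n k (s + u) = ctr n k s + ctr n k u"
  by (simp add: ctr_def chi_plus sum.distrib)

lemma ctr_K01:
  assumes "0 < n"
  shows "ctr n 1 K01 = 1"
proof -
  have "ctr n 1 K01 = (\<Sum>a<n. if a = 0 then 1 else 0)"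
    unfolding ctr_def by (intro sum.cong) (auto simp: chi_K01)
  then show ?thesis using assms by simp
qed

text \<open>The equivariant endomorphism of the abelianization of \<open>Ia n\<close> given by the embedding of \<open>H\<close>
  into \<open>H\<^sup>* \<otimes> \<Lambda>\<^sup>2 H\<close> composed with the contraction.\<close>
definition tel :: "nat \<Rightarrow> faut \<Rightarrow> faut"
  where "tel n s = (SOME u. u \<in> Ia n \<and> (\<forall>b\<in>basis n. chib b u = (case b of (i, j, k) \<Rightarrow> tfam (\<lambda>k. ctr n k s) i j k)))"

lemma tel_Ia: "tel n s \<in> Ia n"
  and chi_tel: "i < n \<Longrightarrow> j < n \<Longrightarrow> k < n \<Longrightarrow> chi i j k (tel n s) = tfam (\<lambda>k. ctr n k s) i j k"
proof -
  have *: "tel n s \<in> Ia n \<and> (\<forall>b\<in>basis n. chib b (tel n s) = (case b of (i, j, k) \<Rightarrow> tfam (\<lambda>k. ctr n k s) i j k))"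
    unfolding tel_def
    by (rule someI_ex) (use chib_surj[of n "\<lambda>b. case b of (i, j, k) \<Rightarrow> tfam (\<lambda>k. ctr n k s) i j k"] in blast)
  then show "tel n s \<in> Ia n" by blast
  show "chi i j k (tel n s) = tfam (\<lambda>k. ctr n k s) i j k" if "i < n" "j < n" "k < n"
    by (rule chi_from_chib[where n = n]) (use * that in \<open>auto simp: tfam_def\<close>)
qed

lemma chi_tel_plus:
  assumes "s \<in> Ia n" "u \<in> Ia n" "i < n" "j < n" "k < n"
  shows "chi i j k (tel n (s + u)) = chi i j k (tel n s) + chi i j k (tel n u)"
  using assms by (simp add: chi_tel ctr_plus tfam_def algebra_simps)

lemma chi_tel_cj:
  assumes "s \<in> Ia n" "g \<in> An n" "i < n" "j < n" "k < n"
  shows "chi i j k (tel n (cj s g)) = chi i j k (cj (tel n s) g)"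
proof -
  have "chi i j k (cj (tel n s) g) = tfam (\<lambda>k. \<Sum>b<n. ctr n b s * mat g b k) i j k"
    using assms by (intro tfam_cj tel_Ia chi_tel)
  moreover have "chi i j k (tel n (cj s g)) = tfam (\<lambda>k. ctr n k (cj s g)) i j k"
    using assms by (intro chi_tel)
  ultimately show ?thesis
    using assms by (simp add: ctr_cj)
qed

context IA_coefficients
begin

lemma crossed_hom_cocycle:
  assumes f: "f \<in> carrier lin.Z"
  shows "crossed_hom n L (\<lambda>g. f (Phi n g))"
proof unfold_locales
  show "f (Phi n g) \<in> carrier A" if "g \<in> An n" for g
    using lin.Z_closed[OF f] that by (simp add: aut.closed)
  show "f (Phi n (g + h)) = f (Phi n g) \<oplus>\<^bsub>A\<^esub> ag g (f (Phi n h))" if gh: "g \<in> An n" "h \<in> An n" for g h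
    using f gh unfolding lin.carrier_Z by (simp add: aut.mult aut.closed)
qed

lemma cocycleI:
  assumes "\<And>g. g \<in> An n \<Longrightarrow> F g \<in> carrier A"
    and "\<And>g h. g \<in> An n \<Longrightarrow> h \<in> An n \<Longrightarrow> F (g + h) = F g \<oplus>\<^bsub>A\<^esub> ag g (F h)"
    and "\<And>g. g \<in> An n \<Longrightarrow> f (Phi n g) = F g" "f \<in> extensional (carrier (Aut_F n))"
  shows "f \<in> carrier lin.Z"
  unfolding lin.carrier_Z
proof (intro conjI ballI PiE_I)
  show "f \<sigma> \<in> carrier A" if "\<sigma> \<in> carrier (Aut_F n)" for \<sigma>
    using ag_carrier[OF that] assms by auto
  show "f \<sigma> = undefined" if "\<sigma> \<notin> carrier (Aut_F n)" for \<sigma>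
    using assms(4) that by (rule extensional_arb)
  fix \<sigma> \<tau> assume "\<sigma> \<in> carrier (Aut_F n)" "\<tau> \<in> carrier (Aut_F n)"
  then obtain g h where g: "g \<in> An n" "\<sigma> = Phi n g" and h: "h \<in> An n" "\<tau> = Phi n h"
    using ag_carrier by metis
  show "f (\<sigma> \<otimes>\<^bsub>Aut_F n\<^esub> \<tau>) = f \<sigma> \<oplus>\<^bsub>A\<^esub> tensor_action (IA_ab n) L (IA_ab_action n) \<sigma> (f \<tau>)"
    unfolding g(2) h(2) using g(1) h(1) by (simp add: aut.mult[symmetric] assms(2,3) An_plus)
qed

text \<open>A principal crossed homomorphism vanishes on IA_n, which acts trivially. Conversely, the
  two coordinates control the value at \<open>K01\<close>, and its vanishing makes the cocycle
  principal.\<close>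

lemma coboundaries_eq:
  "coboundaries (Aut_F n) A (tensor_action (IA_ab n) L (IA_ab_action n)) =
    {f \<in> carrier lin.Z. TH 0 0 1 (f (Phi n K01)) = \<zero>\<^bsub>L\<^esub> \<and> TH 2 1 2 (f (Phi n K01)) = \<zero>\<^bsub>L\<^esub>}"
proof (intro equalityI subsetI CollectI conjI)
  have K: "K01 \<in> Ia n" unfolding K01_def using n by (intro Q_in_Ia) auto
  fix f assume "f \<in> coboundaries (Aut_F n) A (tensor_action (IA_ab n) L (IA_ab_action n))"
  then obtain m where m: "m \<in> carrier A"
    and f: "f = (\<lambda>\<sigma>\<in>carrier (Aut_F n). tensor_action (IA_ab n) L (IA_ab_action n) \<sigma> m \<ominus>\<^bsub>A\<^esub> m)"
    by (auto simp: coboundaries_def)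
  have fP: "f (Phi n g) = ag g m \<ominus>\<^bsub>A\<^esub> m" if "g \<in> An n" for g
    using that by (simp add: f aut.closed)
  show "f \<in> carrier lin.Z"
  proof (rule cocycleI[where F = "\<lambda>g. ag g m \<ominus>\<^bsub>A\<^esub> m"])
    show "ag g m \<ominus>\<^bsub>A\<^esub> m \<in> carrier A" if "g \<in> An n" for g
      using that m by (simp add: ag_closed)
    show "ag (g + h) m \<ominus>\<^bsub>A\<^esub> m = (ag g m \<ominus>\<^bsub>A\<^esub> m) \<oplus>\<^bsub>A\<^esub> ag g (ag h m \<ominus>\<^bsub>A\<^esub> m)"
      if gh: "g \<in> An n" "h \<in> An n" for g h
    proof -
      have c: "ag g m \<in> carrier A" "ag g (ag h m) \<in> carrier A"
        using gh m by (simp_all add: ag_closed)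
      have "ag g (ag h m) \<ominus>\<^bsub>A\<^esub> m = (ag g m \<ominus>\<^bsub>A\<^esub> m) \<oplus>\<^bsub>A\<^esub> (ag g (ag h m) \<ominus>\<^bsub>A\<^esub> ag g m)"
        using c m by (simp add: a_minus_def A.a_ac A.r_neg2 A.r_neg1)
      then show ?thesis using gh m by (simp add: ag_plus ag_diff ag_closed)
    qed
  qed (simp_all add: f aut.closed)
  have "f (Phi n K01) = \<zero>\<^bsub>A\<^esub>"
    using K m by (simp add: fP Ia_An ag_Ia a_minus_def A.r_neg)
  then show "TH 0 0 1 (f (Phi n K01)) = \<zero>\<^bsub>L\<^esub>" "TH 2 1 2 (f (Phi n K01)) = \<zero>\<^bsub>L\<^esub>"
    using n by (simp_all add: TH_zero)
next
  fix f assume "f \<in> {f \<in> carrier lin.Z. TH 0 0 1 (f (Phi n K01)) = \<zero>\<^bsub>L\<^esub> \<and> TH 2 1 2 (f (Phi n K01)) = \<zero>\<^bsub>L\<^esub>}"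
  then have f: "f \<in> carrier lin.Z" and z: "TH 0 0 1 (f (Phi n K01)) = \<zero>\<^bsub>L\<^esub>" "TH 2 1 2 (f (Phi n K01)) = \<zero>\<^bsub>L\<^esub>"
    by simp_all
  interpret F: crossed_hom n L "\<lambda>g. f (Phi n g)"
    by (rule crossed_hom_cocycle[OF f])
  obtain m where m: "m \<in> carrier A" and fP: "\<And>g. g \<in> An n \<Longrightarrow> f (Phi n g) = ag g m \<ominus>\<^bsub>A\<^esub> m"
    using F.F_principal[OF F.F_K01_zero[OF z]] by blast
  have "f = (\<lambda>\<sigma>\<in>carrier (Aut_F n). tensor_action (IA_ab n) L (IA_ab_action n) \<sigma> m \<ominus>\<^bsub>A\<^esub> m)"
  proof (rule extensionalityI[of _ "carrier (Aut_F n)"])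
    show "f \<in> extensional (carrier (Aut_F n))" using f by (simp add: lin.carrier_Z PiE_def)
    fix \<sigma> assume s: "\<sigma> \<in> carrier (Aut_F n)"
    then obtain g where "g \<in> An n" "\<sigma> = Phi n g" using ag_carrier by blast
    then show "f \<sigma> = (\<lambda>\<sigma>\<in>carrier (Aut_F n). tensor_action (IA_ab n) L (IA_ab_action n) \<sigma> m \<ominus>\<^bsub>A\<^esub> m) \<sigma>"
      using s fP by simp
  qed simp
  then show "f \<in> coboundaries (Aut_F n) A (tensor_action (IA_ab n) L (IA_ab_action n))"
    unfolding coboundaries_def using m by blast
qed

text \<open>Any equivariant endomorphism \<open>E\<close> of the abelianization of \<open>Ia n\<close> turns the crossed
  homomorphism \<open>g \<mapsto> [neg n, g]\<close> into a cocycle.\<close>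
lemma exists_cocycle:
  assumes E: "\<And>s. s \<in> Ia n \<Longrightarrow> E s \<in> Ia n"
    and plus: "\<And>s u i j k. s \<in> Ia n \<Longrightarrow> u \<in> Ia n \<Longrightarrow> i < n \<Longrightarrow> j < n \<Longrightarrow> k < n \<Longrightarrow>
      chi i j k (E (s + u)) = chi i j k (E s) + chi i j k (E u)"
    and cj: "\<And>s g i j k. s \<in> Ia n \<Longrightarrow> g \<in> An n \<Longrightarrow> i < n \<Longrightarrow> j < n \<Longrightarrow> k < n \<Longrightarrow>
      chi i j k (E (cj s g)) = chi i j k (cj (E s) g)"
  shows "\<exists>f\<in>carrier lin.Z. \<forall>i j k. i < n \<longrightarrow> j < n \<longrightarrow> k < n \<longrightarrow>
    TH i j k (f (Phi n K01)) = add_pow L (- 2 * chi i j k (E K01)) \<one>\<^bsub>L\<^esub>"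
proof -
  have K: "K01 \<in> Ia n" unfolding K01_def using n by (intro Q_in_Ia) auto
  define F where "F g = pt (cls n (E (comm (neg n) g))) \<one>\<^bsub>L\<^esub>" for g
  define f where "f = (\<lambda>\<sigma>\<in>carrier (Aut_F n). F (inv_into (An n) (Phi n) \<sigma>))"
  have fP: "f (Phi n g) = F g" if "g \<in> An n" for g
  proof -
    have "inj_on (Phi n) (An n)" using aut.inj by (auto intro: inj_onI)
    then show ?thesis using that by (simp add: f_def aut.closed)
  qed
  have Fc: "F g \<in> carrier A" if "g \<in> An n" for g
    unfolding F_def using that by (simp add: pt_closed cls_closed E comm_neg_Ia)
  have TF: "TH i j k (F g) = add_pow L (chi i j k (E (comm (neg n) g))) \<one>\<^bsub>L\<^esub>" if "g \<in> An n" "i < n" for g i j k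
    unfolding F_def using that by (simp add: TH_pt E comm_neg_Ia)
  have "f \<in> carrier lin.Z"
  proof (rule cocycleI[where F = F])
    fix g h assume gh: "g \<in> An n" "h \<in> An n"
    have c: "comm (neg n) g \<in> Ia n" "comm (neg n) h \<in> Ia n" "cj (comm (neg n) h) (- g) \<in> Ia n"
        "cj (E (comm (neg n) h)) (- g) \<in> Ia n"
      using gh by (simp_all add: comm_neg_Ia cj_Ia An_uminus E)
    have agF: "ag g (F h) = pt (cls n (cj (E (comm (neg n) h)) (- g))) \<one>\<^bsub>L\<^esub>"
      unfolding F_def using gh c by (simp add: ag_pt E)
    show "F (g + h) = F g \<oplus>\<^bsub>A\<^esub> ag g (F h)"
    proof (rule TH_inj)
      fix i j k assume ijk: "i < n" "j < k" "k < n"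
      have "chi i j k (E (comm (neg n) (g + h))) =
          chi i j k (E (comm (neg n) g)) + chi i j k (cj (E (comm (neg n) h)) (- g))"
        unfolding comm_neg_plus using gh c ijk by (simp add: plus cj An_uminus)
      then show "TH i j k (F (g + h)) = TH i j k (F g \<oplus>\<^bsub>A\<^esub> ag g (F h))"
        using gh ijk c by (simp add: TH_add Fc ag_closed TF An_plus) (simp add: agF TH_pt L.add.int_pow_mult)
    qed (use gh in \<open>simp_all add: Fc ag_closed An_plus\<close>)
  qed (simp_all add: Fc fP, simp add: f_def)
  moreover have "TH i j k (f (Phi n K01)) = add_pow L (- 2 * chi i j k (E K01)) \<one>\<^bsub>L\<^esub>"
    if ijk: "i < n" "j < n" "k < n" for i j k
  proof -
    have z: "chi i j k (E 0) = 0"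
      using plus[of 0 0 i j k] ijk by simp
    have "chi i j k (E (- K01)) = - chi i j k (E K01)"
      using plus[of K01 "- K01" i j k] z K ijk by (simp add: Ia_uminus)
    moreover have "chi i j k (E (comm (neg n) K01)) = chi i j k (E (cj K01 (neg n))) + chi i j k (E (- K01))"
      using plus[of "cj K01 (neg n)" "- K01" i j k] K ijk by (simp add: comm_neg_eq cj_Ia neg_An Ia_uminus)
    \<comment> \<open>All three indices change sign, so conjugation by \<open>neg n\<close> negates
      every coordinate; subtracting \<open>K01\<close> itself then produces the factor -2.\<close>
    moreover have "chi (id i) (id j) (id k) (cj (E K01) (neg n)) = - chi i j k (E K01)"
      using chi_cj_W[OF E[OF K] permutes_id neg_def neg_W ijk] ijk by (simp add: sgn_if_def)
    ultimately have "chi i j k (E (comm (neg n) K01)) = - 2 * chi i j k (E K01)"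
      using cj[OF K neg_An ijk] by simp
    then show ?thesis
      using ijk K by (simp add: fP Ia_An TF)
  qed
  ultimately show ?thesis by blast
qed

lemma two_neq_0: "add_pow L (2 :: int) \<one>\<^bsub>L\<^esub> \<noteq> \<zero>\<^bsub>L\<^esub>" "add_pow L (- 2 :: int) \<one>\<^bsub>L\<^esub> \<noteq> \<zero>\<^bsub>L\<^esub>"
proof -
  have "\<one>\<^bsub>L\<^esub> \<noteq> \<zero>\<^bsub>L\<^esub>"
    using L by (simp add: principal_domain_def domain_def domain_axioms_def)
  then have "\<one>\<^bsub>L\<^esub> \<oplus>\<^bsub>L\<^esub> \<one>\<^bsub>L\<^esub> \<noteq> \<zero>\<^bsub>L\<^esub>" using L2 by blast
  moreover have "add_pow L (1 + 1 :: int) \<one>\<^bsub>L\<^esub> = \<one>\<^bsub>L\<^esub> \<oplus>\<^bsub>L\<^esub> \<one>\<^bsub>L\<^esub>"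
    by (subst L.add.int_pow_mult) simp_all
  ultimately show 2: "add_pow L (2 :: int) \<one>\<^bsub>L\<^esub> \<noteq> \<zero>\<^bsub>L\<^esub>" by simp
  then show "add_pow L (- 2 :: int) \<one>\<^bsub>L\<^esub> \<noteq> \<zero>\<^bsub>L\<^esub>"
    using addpow_neg[of "\<one>\<^bsub>L\<^esub>" 2] addpow_closed[of "\<one>\<^bsub>L\<^esub>" 2] L.add.inv_eq_1_iff by (simp add: a_inv_def)
qed

lemma H1_iso:
  "\<exists>h. h \<in> module_iso L (H1 (Aut_F n) A (tensor_action (IA_ab n) L (IA_ab_action n))) (square_module L)"
proof -
  have K: "Phi n K01 \<in> carrier (Aut_F n)"
    unfolding K01_def using n by (intro aut.closed Ia_An Q_in_Ia) auto
  obtain f where f: "f \<in> carrier lin.Z" "TH 0 0 1 (f (Phi n K01)) = add_pow L (- 2 :: int) \<one>\<^bsub>L\<^esub>"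
  proof -
    obtain f where f: "f \<in> carrier lin.Z" "\<And>i j k. i < n \<Longrightarrow> j < n \<Longrightarrow> k < n \<Longrightarrow>
        TH i j k (f (Phi n K01)) = add_pow L (- 2 * chi i j k K01) \<one>\<^bsub>L\<^esub>"
      using exists_cocycle[of "\<lambda>s. s"] chi_plus by blast
    show thesis using n f(1) f(2)[of 0 0 1] by (intro that) (simp_all add: chi_K01)
  qed
  obtain g where g: "g \<in> carrier lin.Z" "TH 0 0 1 (g (Phi n K01)) = \<zero>\<^bsub>L\<^esub>"
    "TH 2 1 2 (g (Phi n K01)) = add_pow L (2 :: int) \<one>\<^bsub>L\<^esub>"
  proof -
    \<comment> \<open>On \<open>K01\<close> both \<open>tel n\<close> and the identity have
      coordinate 1 at (0, 0, 1), so their difference vanishes there. At (2, 1, 2) only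
      \<open>tel n\<close> contributes, with value -1.\<close>
    let ?E = "\<lambda>s. tel n s - s"
    have "\<exists>f\<in>carrier lin.Z. \<forall>i j k. i < n \<longrightarrow> j < n \<longrightarrow> k < n \<longrightarrow>
        TH i j k (f (Phi n K01)) = add_pow L (- 2 * chi i j k (?E K01)) \<one>\<^bsub>L\<^esub>"
      by (rule exists_cocycle)
        (simp_all add: Ia_diff tel_Ia chi_diff[of _ n] Ia_plus chi_plus[of _ n] chi_tel_plus cj_Ia cj_diff chi_tel_cj)
    then obtain g where g: "g \<in> carrier lin.Z" "\<And>i j k. i < n \<Longrightarrow> j < n \<Longrightarrow> k < n \<Longrightarrow>
        TH i j k (g (Phi n K01)) = add_pow L (- 2 * chi i j k (?E K01)) \<one>\<^bsub>L\<^esub>"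
      by blast
    have "K01 \<in> Ia n" unfolding K01_def using n by (intro Q_in_Ia) auto
    then have "chi 0 0 1 (?E K01) = 0" "chi 2 1 2 (?E K01) = - 1"
      using n ctr_K01[of n] by (simp_all add: chi_diff[of _ n] tel_Ia chi_tel chi_K01 tfam_def)
    then show thesis using n g(1) g(2)[of 0 0 1] g(2)[of 2 1 2] by (intro that) simp_all
  qed
  show ?thesis
  proof (rule lin.H1_rank_2[OF L, where \<psi> = "\<lambda>f. TH 0 0 1 (f (Phi n K01))" and \<psi>' = "\<lambda>f. TH 2 1 2 (f (Phi n K01))"])
    show "TH 0 0 1 (f (Phi n K01)) \<noteq> \<zero>\<^bsub>L\<^esub>" "TH 2 1 2 (g (Phi n K01)) \<noteq> \<zero>\<^bsub>L\<^esub>"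
      using f g two_neq_0 by simp_all
  qed (use f g n K in \<open>simp_all add: lin.Z_closed TH_closed TH_add TH_smult coboundaries_eq\<close>)
qed

end

theorem theorem1:
  fixes n :: nat and L :: "('l, 'm) ring_scheme"
  assumes "n \<ge> 5"
    and "principal_domain L"
    and "\<And>a. a \<in> carrier L \<Longrightarrow> a \<oplus>\<^bsub>L\<^esub> a = \<zero>\<^bsub>L\<^esub> \<Longrightarrow> a = \<zero>\<^bsub>L\<^esub>"
  shows "\<exists>h. h \<in> module_iso L
    (H1 (Aut_F n) (tensor (IA_ab n) L) (tensor_action (IA_ab n) L (IA_ab_action n)))
    (square_module L)"
proof -
  interpret IA_coefficients n L
    using assms by (rule IA_coefficients.intro)
  show ?thesis by (rule H1_iso)
qed

end
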